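(* Let $k$ be a commutative ring with unit, $H$ a $k$-Hopf algebra, $A$ an $H$-semiprime left $H$-module algebra and let $\widehat{A}$ be the self-injective hull of $A$ as a left $A^e\#_\nu H$-module. Then the following statements hold: (1) $A$ is a polyform $A^e\#_\nu H$-module and a subdirect product of $H$-prime module algebras. Furthermore $Z(A)^H$ is reduced. (2) $\widehat{A}$ is an $H$-semiprime left $H$-module algebra with submodule algebra $A$. $\widehat{A}$ is self-injective as an $\widehat{A}^e\#_\nu H$-module and a non-singular module over the self-injective and von Neumann regular ring $Z(\widehat{A})^H$. (3) If $Z(A)^H$ is large in $A$, then $Z(\widehat{A})^H=Q_{max}(Z(A)^H)$ and $A$ is non-singular as a $Z(A)^H$-module.
   Context: All algebras are associative with unit; $\otimes=\otimes_k$. $A^e=A\otimes A^{op}$. For a left $H$-module algebra $A$, $A^e\#_\nu H$ is the $k$-module $A^e\otimes H$ with multiplication $(\mu_{A^e}\otimes\mu_H)(1\otimes\nu\otimes1)$, where $\nu:H\otimes A^e\to A^e\otimes H$, $\nu(h\otimes a\otimes b)=\sum_{(h)}(h_1\cdot a)\otimes(h_3\cdot b)\otimes h_2$; this is an associative unital $k$-algebra. It acts on $A$ by $((a\otimes b)\#h)\cdot x=a(h\cdot x)b$. Let $M_H(A)\subseteq\mathrm{End}_k(A)$ be the $k$-subalgebra generated by all left multiplications $L_a$, right multiplications $R_a$ ($a\in A$) and all $\lambda_h:x\mapsto h\cdot x$ ($h\in H$); it is the image of $A^e\#_\nu H$ in $\mathrm{End}_k(A)$. The submodules of $A$ are the $H$-stable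 two-sided ideals. $A$ is $H$-prime (resp. $H$-semiprime) if for all $H$-stable ideals $K,L$: $KL=0$ implies $K=0$ or $L=0$ (resp. $K^2=0$ implies $K=0$). $A^H=\{a\in A\mid h\cdot a=\epsilon(h)a\ \forall h\in H\}$ and $Z(A)^H:=Z(A)\cap A^H$ where $Z(A)$ is the centre; likewise for $\widehat{A}$. $Z(A)^H$ is large in $A$ if $Z(A)^H\cap I\ne0$ for every nonzero $H$-stable ideal $I$ of $A$. $Q_{max}$ denotes the maximal quotient ring. The self-injective hull of a module $M$ with injective hull $E(M)$ is $\widehat{M}=\sum_{f\in\mathrm{Hom}(M,E(M))}\mathrm{Im}(f)$. A module $M$ is self-injective if homomorphisms from submodules of $M$ to $M$ extend to endomorphisms of $M$. A submodule $N\subseteq M$ is dense if $\mathrm{Hom}(M/N,\widehat{M})=0$; $M$ is polyform if every essential submodule is dense. Ring structure on $\widehat{A}$: put $B=M_H(A)$ and $\widehat{A}^B=\{m\in\widehat{A}\mid b\cdot m=(b\cdot1_A)m\ \forall b\in B\}$. The map $\mathrm{End}_B(\widehat{A})\to\widehat{A}^B$, $f\mapsto(1_A)f$ (maps written on the right) is bijective, and $\widehat{A}^B$ carries the transported commutative ring structure. For $a\in A$, $s=(1_A)f\in\widehat{A}^B$ write $as=(a)f$. Every element of $\widehat{A}$ is a finite sum of such elements, and $\widehat{A}$ is a ring via $(as)(bt)=(ab)st$, with $A$ as subring; $H$ acts by $h\cdot(as)=(h\cdot a)s$. One has $\widehat{A}^B=Z(\widehat{A})^H$. *)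

theory Defs
  imports "HOL-Algebra.Module" "HOL-Algebra.QuotRing" "HOL-Algebra.Ideal_Product"
begin

section \<open>Left modules over a not necessarily commutative ring\<close>

text \<open>The record of HOL-Algebra modules and its \<^locale>\<open>submodule\<close> are reused; the locale
  \<^locale>\<open>module\<close> itself is restricted to commutative base rings. As there, the fields \<^const>\<open>mult\<close>
  and \<^const>\<open>one\<close> of the record play no role for a mere module.\<close>

locale lmodule = R?: ring R + M?: abelian_group M
  for R :: "('r, 'm) ring_scheme" and M :: "('r, 'a, 'n) module_scheme" +
  assumes lsmult_closed:
      "\<lbrakk>a \<in> carrier R; x \<in> carrier M\<rbrakk> \<Longrightarrow> a \<odot>\<^bsub>M\<^esub> x \<in> carrier M"
    and lsmult_l_distr:
      "\<lbrakk>a \<in> carrier R; b \<in> carrier R; x \<in> carrier M\<rbrakk> \<Longrightarrow>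
        (a \<oplus>\<^bsub>R\<^esub> b) \<odot>\<^bsub>M\<^esub> x = a \<odot>\<^bsub>M\<^esub> x \<oplus>\<^bsub>M\<^esub> b \<odot>\<^bsub>M\<^esub> x"
    and lsmult_r_distr:
      "\<lbrakk>a \<in> carrier R; x \<in> carrier M; y \<in> carrier M\<rbrakk> \<Longrightarrow>
        a \<odot>\<^bsub>M\<^esub> (x \<oplus>\<^bsub>M\<^esub> y) = a \<odot>\<^bsub>M\<^esub> x \<oplus>\<^bsub>M\<^esub> a \<odot>\<^bsub>M\<^esub> y"
    and lsmult_assoc:
      "\<lbrakk>a \<in> carrier R; b \<in> carrier R; x \<in> carrier M\<rbrakk> \<Longrightarrow>
        (a \<otimes>\<^bsub>R\<^esub> b) \<odot>\<^bsub>M\<^esub> x = a \<odot>\<^bsub>M\<^esub> (b \<odot>\<^bsub>M\<^esub> x)"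
    and lsmult_one:
      "x \<in> carrier M \<Longrightarrow> \<one>\<^bsub>R\<^esub> \<odot>\<^bsub>M\<^esub> x = x"

definition mod_hom ::
    "('r, 'm) ring_scheme \<Rightarrow> ('r, 'a, 'n) module_scheme \<Rightarrow> ('r, 'b, 'p) module_scheme \<Rightarrow> ('a \<Rightarrow> 'b) set"
  where "mod_hom R M N = {f \<in> carrier M \<rightarrow> carrier N.
     (\<forall>x\<in>carrier M. \<forall>y\<in>carrier M. f (x \<oplus>\<^bsub>M\<^esub> y) = f x \<oplus>\<^bsub>N\<^esub> f y) \<and>
     (\<forall>r\<in>carrier R. \<forall>x\<in>carrier M. f (r \<odot>\<^bsub>M\<^esub> x) = r \<odot>\<^bsub>N\<^esub> f x)}"

definition regular_module :: "('r, 'm) ring_scheme \<Rightarrow> ('r, 'r) module"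
  where "regular_module R =
    \<lparr>carrier = carrier R, mult = mult R, one = one R,
     zero = zero R, add = add R, smult = mult R\<rparr>"

definition quotient_module :: "('r, 'a, 'n) module_scheme \<Rightarrow> 'a set \<Rightarrow> ('r, 'a set) module"
  where "quotient_module M N =
    \<lparr>carrier = a_rcosets\<^bsub>M\<^esub> N, mult = undefined, one = undefined, zero = N, add = set_add M,
     smult = (\<lambda>r U. \<Union>u\<in>U. N +>\<^bsub>M\<^esub> (r \<odot>\<^bsub>M\<^esub> u))\<rparr>"

definition generated_submodule ::
    "('r, 'm) ring_scheme \<Rightarrow> ('r, 'a, 'n) module_scheme \<Rightarrow> 'a set \<Rightarrow> 'a set"
  where "generated_submodule R M X = \<Inter>{N. submodule N R M \<and> X \<subseteq> N}"

definition essential_submodule ::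
    "('r, 'm) ring_scheme \<Rightarrow> ('r, 'a, 'n) module_scheme \<Rightarrow> 'a set \<Rightarrow> bool"
  where "essential_submodule R M N \<longleftrightarrow> submodule N R M \<and>
    (\<forall>L. submodule L R M \<longrightarrow> L \<inter> N = {\<zero>\<^bsub>M\<^esub>} \<longrightarrow> L = {\<zero>\<^bsub>M\<^esub>})"

definition self_injective ::
    "('r, 'm) ring_scheme \<Rightarrow> ('r, 'a, 'n) module_scheme \<Rightarrow> bool"
  where "self_injective R M \<longleftrightarrow> lmodule R M \<and>
    (\<forall>N f. submodule N R M \<longrightarrow> f \<in> mod_hom R (M\<lparr>carrier := N\<rparr>) M \<longrightarrow>
       (\<exists>g\<in>mod_hom R M M. \<forall>x\<in>N. g x = f x))"

text \<open>HOL cannot quantify over all types inside a formula, so the test modules \<open>Y\<close> have their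
  carrier in the type of the ring. As \<open>R\<close> itself, with all its left ideals \<open>X\<close>, is among
  them, Baer's criterion shows that this is injectivity with respect to modules over any type.\<close>

definition injective_module ::
    "('r, 'm) ring_scheme \<Rightarrow> ('r, 'a, 'n) module_scheme \<Rightarrow> bool"
  where "injective_module R E \<longleftrightarrow> lmodule R E \<and>
    (\<forall>(Y :: ('r, 'r) module) X f.
       lmodule R Y \<longrightarrow> submodule X R Y \<longrightarrow> f \<in> mod_hom R (Y\<lparr>carrier := X\<rparr>) E \<longrightarrow>
       (\<exists>g\<in>mod_hom R Y E. \<forall>x\<in>X. g x = f x))"

text \<open>Injective hulls are only determined up to isomorphism; \<open>\<iota>\<close> is the embedding of \<open>M\<close>.\<close>

definition injective_hull ::
    "('r, 'm) ring_scheme \<Rightarrow> ('r, 'a, 'n) module_scheme \<Rightarrow> ('r, 'e, 'p) module_scheme \<Rightarrow> ('a \<Rightarrow> 'e) \<Rightarrow> bool"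
  where "injective_hull R M E \<iota> \<longleftrightarrow> injective_module R E \<and>
    \<iota> \<in> mod_hom R M E \<and> inj_on \<iota> (carrier M) \<and> essential_submodule R E (\<iota> ` carrier M)"

text \<open>In the next three definitions \<open>E\<close> is an injective hull of \<open>M\<close>.\<close>

definition self_injective_hull ::
    "('r, 'm) ring_scheme \<Rightarrow> ('r, 'a, 'n) module_scheme \<Rightarrow> ('r, 'e) module \<Rightarrow> ('r, 'e) module"
  where "self_injective_hull R M E =
    E\<lparr>carrier := generated_submodule R E (\<Union>f\<in>mod_hom R M E. f ` carrier M)\<rparr>"

definition dense_submodule ::
    "('r, 'm) ring_scheme \<Rightarrow> ('r, 'a, 'n) module_scheme \<Rightarrow> ('r, 'e) module \<Rightarrow> 'a set \<Rightarrow> bool"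
  where "dense_submodule R M E N \<longleftrightarrow> submodule N R M \<and>
    (\<forall>f\<in>mod_hom R (quotient_module M N) (self_injective_hull R M E).
       \<forall>x\<in>carrier (quotient_module M N). f x = \<zero>\<^bsub>E\<^esub>)"

definition polyform ::
    "('r, 'm) ring_scheme \<Rightarrow> ('r, 'a, 'n) module_scheme \<Rightarrow> ('r, 'e) module \<Rightarrow> bool"
  where "polyform R M E \<longleftrightarrow> lmodule R M \<and>
    (\<forall>N. essential_submodule R M N \<longrightarrow> dense_submodule R M E N)"

definition nonsingular_module ::
    "('r, 'm) ring_scheme \<Rightarrow> ('r, 'a, 'n) module_scheme \<Rightarrow> bool"
  where "nonsingular_module R M \<longleftrightarrow> lmodule R M \<and>
    {x \<in> carrier M. essential_submodule R (regular_module R) {r \<in> carrier R. r \<odot>\<^bsub>M\<^esub> x = \<zero>\<^bsub>M\<^esub>}}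
      = {\<zero>\<^bsub>M\<^esub>}"

definition von_neumann_regular :: "('r, 'm) ring_scheme \<Rightarrow> bool"
  where "von_neumann_regular R \<longleftrightarrow> ring R \<and>
    (\<forall>a\<in>carrier R. \<exists>x\<in>carrier R. a \<otimes>\<^bsub>R\<^esub> x \<otimes>\<^bsub>R\<^esub> a = a)"

definition reduced_ring :: "('r, 'm) ring_scheme \<Rightarrow> bool"
  where "reduced_ring R \<longleftrightarrow> ring R \<and>
    (\<forall>a\<in>carrier R. \<forall>n::nat. a [^]\<^bsub>R\<^esub> n = \<zero>\<^bsub>R\<^esub> \<longrightarrow> a = \<zero>\<^bsub>R\<^esub>)"


section \<open>The maximal ring of quotients\<close>

text \<open>The maximal left quotient ring is the direct limit of the groups \<open>Hom(D, R)\<close> over the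
  dense left ideals \<open>D\<close> of \<open>R\<close>. Homomorphisms are to be read as written on the right, so
  that in the product \<open>f \<cdot> g\<close> the map \<open>f\<close> is applied first, and \<open>z \<in> R\<close>
  corresponds to the right multiplication by \<open>z\<close>.\<close>

definition dense_left_ideal :: "('r, 'm) ring_scheme \<Rightarrow> 'r set \<Rightarrow> bool"
  where "dense_left_ideal R D \<longleftrightarrow> submodule D R (regular_module R) \<and>
    (\<forall>x\<in>carrier R. \<forall>y\<in>carrier R. x \<noteq> \<zero>\<^bsub>R\<^esub> \<longrightarrow>
       (\<exists>r\<in>carrier R. r \<otimes>\<^bsub>R\<^esub> y \<in> D \<and> r \<otimes>\<^bsub>R\<^esub> x \<noteq> \<zero>\<^bsub>R\<^esub>))"

type_synonym 'r fraction = "'r set \<times> ('r \<Rightarrow> 'r)"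

definition fractions :: "('r, 'm) ring_scheme \<Rightarrow> 'r fraction set"
  where "fractions R = {(D, f). dense_left_ideal R D \<and> f \<in> extensional D \<and>
    f \<in> mod_hom R ((regular_module R)\<lparr>carrier := D\<rparr>) (regular_module R)}"

definition fraction_rel :: "('r, 'm) ring_scheme \<Rightarrow> ('r fraction \<times> 'r fraction) set"
  where "fraction_rel R = {((D, f), (D', f')). (D, f) \<in> fractions R \<and> (D', f') \<in> fractions R \<and>
    (\<exists>D''. dense_left_ideal R D'' \<and> D'' \<subseteq> D \<inter> D' \<and> (\<forall>x\<in>D''. f x = f' x))}"

definition fraction_add :: "('r, 'm) ring_scheme \<Rightarrow> 'r fraction \<Rightarrow> 'r fraction \<Rightarrow> 'r fraction"
  where "fraction_add R = (\<lambda>(D, f) (D', g). (D \<inter> D', \<lambda>x\<in>D \<inter> D'. f x \<oplus>\<^bsub>R\<^esub> g x))"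

definition fraction_mult :: "'r fraction \<Rightarrow> 'r fraction \<Rightarrow> 'r fraction"
  where "fraction_mult = (\<lambda>(D, f) (D', g). ({x \<in> D. f x \<in> D'}, \<lambda>x\<in>{x \<in> D. f x \<in> D'}. g (f x)))"

definition Qmax_embed :: "('r, 'm) ring_scheme \<Rightarrow> 'r \<Rightarrow> 'r fraction set"
  where "Qmax_embed R z = fraction_rel R `` {(carrier R, \<lambda>x\<in>carrier R. x \<otimes>\<^bsub>R\<^esub> z)}"

definition Qmax :: "('r, 'm) ring_scheme \<Rightarrow> ('r fraction set) ring"
  where "Qmax R =
    \<lparr>carrier = fractions R // fraction_rel R,
     mult = (\<lambda>U V. \<Union>u\<in>U. \<Union>v\<in>V. fraction_rel R `` {fraction_mult u v}),
     one = Qmax_embed R \<one>\<^bsub>R\<^esub>,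
     zero = Qmax_embed R \<zero>\<^bsub>R\<^esub>,
     add = (\<lambda>U V. \<Union>u\<in>U. \<Union>v\<in>V. fraction_rel R `` {fraction_add R u v})\<rparr>"


section \<open>Tensor products over a commutative ring\<close>

definition free_module :: "('k, 'm) ring_scheme \<Rightarrow> 'x set \<Rightarrow> ('k, 'x \<Rightarrow> 'k) module"
  where "free_module K X =
    \<lparr>carrier = {f. (\<forall>x. f x \<in> carrier K) \<and> finite {x. f x \<noteq> \<zero>\<^bsub>K\<^esub>} \<and> {x. f x \<noteq> \<zero>\<^bsub>K\<^esub>} \<subseteq> X},
     mult = undefined, one = undefined,
     zero = (\<lambda>x. \<zero>\<^bsub>K\<^esub>),
     add = (\<lambda>f g x. f x \<oplus>\<^bsub>K\<^esub> g x),
     smult = (\<lambda>c f x. c \<otimes>\<^bsub>K\<^esub> f x)\<rparr>"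

definition unit_vector :: "('k, 'm) ring_scheme \<Rightarrow> 'x \<Rightarrow> 'x \<Rightarrow> 'k"
  where "unit_vector K x = (\<lambda>y. if y = x then \<one>\<^bsub>K\<^esub> else \<zero>\<^bsub>K\<^esub>)"

type_synonym ('k, 'a, 'b) tensor = "('a \<times> 'b \<Rightarrow> 'k) set"

definition bilinear_relators ::
    "('k, 'm) ring_scheme \<Rightarrow> ('k, 'a, 'n) module_scheme \<Rightarrow> ('k, 'b, 'p) module_scheme \<Rightarrow> ('a \<times> 'b \<Rightarrow> 'k) set"
  where "bilinear_relators K M N =
    (let F = free_module K (carrier M \<times> carrier N); e = unit_vector K in
      {e (x \<oplus>\<^bsub>M\<^esub> x', y) \<ominus>\<^bsub>F\<^esub> (e (x, y) \<oplus>\<^bsub>F\<^esub> e (x', y)) | x x' y.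
         x \<in> carrier M \<and> x' \<in> carrier M \<and> y \<in> carrier N} \<union>
      {e (x, y \<oplus>\<^bsub>N\<^esub> y') \<ominus>\<^bsub>F\<^esub> (e (x, y) \<oplus>\<^bsub>F\<^esub> e (x, y')) | x y y'.
         x \<in> carrier M \<and> y \<in> carrier N \<and> y' \<in> carrier N} \<union>
      {e (c \<odot>\<^bsub>M\<^esub> x, y) \<ominus>\<^bsub>F\<^esub> (c \<odot>\<^bsub>F\<^esub> e (x, y)) | c x y.
         c \<in> carrier K \<and> x \<in> carrier M \<and> y \<in> carrier N} \<union>
      {e (x, c \<odot>\<^bsub>N\<^esub> y) \<ominus>\<^bsub>F\<^esub> (c \<odot>\<^bsub>F\<^esub> e (x, y)) | c x y.
         c \<in> carrier K \<and> x \<in> carrier M \<and> y \<in> carrier N})"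

definition tensor_null ::
    "('k, 'm) ring_scheme \<Rightarrow> ('k, 'a, 'n) module_scheme \<Rightarrow> ('k, 'b, 'p) module_scheme \<Rightarrow> ('k, 'a, 'b) tensor"
  where "tensor_null K M N =
    generated_submodule K (free_module K (carrier M \<times> carrier N)) (bilinear_relators K M N)"

definition tensor_module ::
    "('k, 'm) ring_scheme \<Rightarrow> ('k, 'a, 'n) module_scheme \<Rightarrow> ('k, 'b, 'p) module_scheme \<Rightarrow>
      ('k, ('k, 'a, 'b) tensor) module"
  where "tensor_module K M N =
    quotient_module (free_module K (carrier M \<times> carrier N)) (tensor_null K M N)"

definition tensor ::
    "('k, 'm) ring_scheme \<Rightarrow> ('k, 'a, 'n) module_scheme \<Rightarrow> ('k, 'b, 'p) module_scheme \<Rightarrow>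
      'a \<Rightarrow> 'b \<Rightarrow> ('k, 'a, 'b) tensor"
  where "tensor K M N x y =
    tensor_null K M N +>\<^bsub>free_module K (carrier M \<times> carrier N)\<^esub> unit_vector K (x, y)"

text \<open>\<open>tensor_lift K P \<beta> t\<close> is the value at the tensor \<open>t\<close> of the linear map into
  \<open>P\<close> induced by a bilinear map \<open>\<beta>\<close>; for bilinear \<open>\<beta>\<close> the choice of the representative is
  irrelevant. In Sweedler notation it is
  \<open>\<Sum> \<beta> x y\<close> where \<open>t = \<Sum> x \<otimes> y\<close>.\<close>

definition tensor_lift ::
    "('k, 'm) ring_scheme \<Rightarrow> ('k, 'c, 'n) module_scheme \<Rightarrow> ('a \<Rightarrow> 'b \<Rightarrow> 'c) \<Rightarrow> ('k, 'a, 'b) tensor \<Rightarrow> 'c"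
  where "tensor_lift K P \<beta> t =
    (let f = (SOME f. f \<in> t) in
      \<Oplus>\<^bsub>P\<^esub>p\<in>{p. f p \<noteq> \<zero>\<^bsub>K\<^esub>}. f p \<odot>\<^bsub>P\<^esub> \<beta> (fst p) (snd p))"


section \<open>Algebras, Hopf algebras and module algebras\<close>

text \<open>The HOL-Algebra locale \<^locale>\<open>algebra\<close> only covers commutative algebras.\<close>

locale assoc_algebra = module K A + ring A
  for K :: "('k, 'm) ring_scheme" and A :: "('k, 'a, 'n) module_scheme" +
  assumes smult_mult_left:
      "\<lbrakk>c \<in> carrier K; x \<in> carrier A; y \<in> carrier A\<rbrakk> \<Longrightarrow> (c \<odot>\<^bsub>A\<^esub> x) \<otimes>\<^bsub>A\<^esub> y = c \<odot>\<^bsub>A\<^esub> (x \<otimes>\<^bsub>A\<^esub> y)"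
    and smult_mult_right:
      "\<lbrakk>c \<in> carrier K; x \<in> carrier A; y \<in> carrier A\<rbrakk> \<Longrightarrow> x \<otimes>\<^bsub>A\<^esub> (c \<odot>\<^bsub>A\<^esub> y) = c \<odot>\<^bsub>A\<^esub> (x \<otimes>\<^bsub>A\<^esub> y)"

definition opposite :: "('k, 'a) module \<Rightarrow> ('k, 'a) module"
  where "opposite A = A\<lparr>mult := (\<lambda>x y. y \<otimes>\<^bsub>A\<^esub> x)\<rparr>"

definition tensor_algebra ::
    "('k, 'm) ring_scheme \<Rightarrow> ('k, 'a, 'n) module_scheme \<Rightarrow> ('k, 'b, 'p) module_scheme \<Rightarrow>
      ('k, ('k, 'a, 'b) tensor) module"
  where "tensor_algebra K A B = (let T = tensor_module K A B in
    T\<lparr>mult := (\<lambda>t u. tensor_lift K T (\<lambda>a b. tensor_lift K T (\<lambda>c d.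
                 tensor K A B (a \<otimes>\<^bsub>A\<^esub> c) (b \<otimes>\<^bsub>B\<^esub> d)) u) t),
      one := tensor K A B \<one>\<^bsub>A\<^esub> \<one>\<^bsub>B\<^esub>\<rparr>)"

record ('k, 'h) hopf = "('k, 'h) module" +
  comult :: "'h \<Rightarrow> ('k, 'h, 'h) tensor"
  counit :: "'h \<Rightarrow> 'k"
  antipode :: "'h \<Rightarrow> 'h"

locale hopf_algebra = assoc_algebra K H
  for K :: "('k, 'm) ring_scheme" and H :: "('k, 'h, 'n) hopf_scheme" +
  assumes comult_hom: "comult H \<in> ring_hom H (tensor_algebra K H H)"
    and comult_smult:
      "\<lbrakk>c \<in> carrier K; h \<in> carrier H\<rbrakk> \<Longrightarrow>
        comult H (c \<odot>\<^bsub>H\<^esub> h) = c \<odot>\<^bsub>tensor_module K H H\<^esub> comult H h"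
    and counit_hom: "counit H \<in> ring_hom H K"
    and counit_smult:
      "\<lbrakk>c \<in> carrier K; h \<in> carrier H\<rbrakk> \<Longrightarrow> counit H (c \<odot>\<^bsub>H\<^esub> h) = c \<otimes>\<^bsub>K\<^esub> counit H h"
    and coassoc:
      "h \<in> carrier H \<Longrightarrow>
        tensor_lift K (tensor_module K H (tensor_module K H H))
          (\<lambda>u z. tensor_lift K (tensor_module K H (tensor_module K H H))
             (\<lambda>x y. tensor K H (tensor_module K H H) x (tensor K H H y z)) (comult H u))
          (comult H h) =
        tensor_lift K (tensor_module K H (tensor_module K H H))
          (\<lambda>x v. tensor K H (tensor_module K H H) x (comult H v)) (comult H h)"
    and counit_left:
      "h \<in> carrier H \<Longrightarrow> tensor_lift K H (\<lambda>x y. counit H x \<odot>\<^bsub>H\<^esub> y) (comult H h) = h"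
    and counit_right:
      "h \<in> carrier H \<Longrightarrow> tensor_lift K H (\<lambda>x y. counit H y \<odot>\<^bsub>H\<^esub> x) (comult H h) = h"
    and antipode_linear: "antipode H \<in> mod_hom K H H"
    and antipode_left:
      "h \<in> carrier H \<Longrightarrow>
        tensor_lift K H (\<lambda>x y. antipode H x \<otimes>\<^bsub>H\<^esub> y) (comult H h) = counit H h \<odot>\<^bsub>H\<^esub> \<one>\<^bsub>H\<^esub>"
    and antipode_right:
      "h \<in> carrier H \<Longrightarrow>
        tensor_lift K H (\<lambda>x y. x \<otimes>\<^bsub>H\<^esub> antipode H y) (comult H h) = counit H h \<odot>\<^bsub>H\<^esub> \<one>\<^bsub>H\<^esub>"

text \<open>\<open>act h x\<close> is \<open>h \<cdot> x\<close>.\<close>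

locale module_algebra = H: hopf_algebra K H + A: assoc_algebra K A
  for K :: "('k, 'm) ring_scheme" and H :: "('k, 'h, 'n) hopf_scheme"
    and A :: "('k, 'a, 'p) module_scheme" +
  fixes act :: "'h \<Rightarrow> 'a \<Rightarrow> 'a"
  assumes act_closed: "\<lbrakk>h \<in> carrier H; x \<in> carrier A\<rbrakk> \<Longrightarrow> act h x \<in> carrier A"
    and act_add_left:
      "\<lbrakk>g \<in> carrier H; h \<in> carrier H; x \<in> carrier A\<rbrakk> \<Longrightarrow> act (g \<oplus>\<^bsub>H\<^esub> h) x = act g x \<oplus>\<^bsub>A\<^esub> act h x"
    and act_add_right:
      "\<lbrakk>h \<in> carrier H; x \<in> carrier A; y \<in> carrier A\<rbrakk> \<Longrightarrow> act h (x \<oplus>\<^bsub>A\<^esub> y) = act h x \<oplus>\<^bsub>A\<^esub> act h y"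
    and act_smult_left:
      "\<lbrakk>c \<in> carrier K; h \<in> carrier H; x \<in> carrier A\<rbrakk> \<Longrightarrow> act (c \<odot>\<^bsub>H\<^esub> h) x = c \<odot>\<^bsub>A\<^esub> act h x"
    and act_smult_right:
      "\<lbrakk>c \<in> carrier K; h \<in> carrier H; x \<in> carrier A\<rbrakk> \<Longrightarrow> act h (c \<odot>\<^bsub>A\<^esub> x) = c \<odot>\<^bsub>A\<^esub> act h x"
    and act_assoc:
      "\<lbrakk>g \<in> carrier H; h \<in> carrier H; x \<in> carrier A\<rbrakk> \<Longrightarrow> act (g \<otimes>\<^bsub>H\<^esub> h) x = act g (act h x)"
    and act_one: "x \<in> carrier A \<Longrightarrow> act \<one>\<^bsub>H\<^esub> x = x"
    and act_on_mult:
      "\<lbrakk>h \<in> carrier H; x \<in> carrier A; y \<in> carrier A\<rbrakk> \<Longrightarrow>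
        act h (x \<otimes>\<^bsub>A\<^esub> y) = tensor_lift K A (\<lambda>g g'. act g x \<otimes>\<^bsub>A\<^esub> act g' y) (comult H h)"
    and act_on_one: "h \<in> carrier H \<Longrightarrow> act h \<one>\<^bsub>A\<^esub> = counit H h \<odot>\<^bsub>A\<^esub> \<one>\<^bsub>A\<^esub>"

definition module_algebra_hom ::
    "('k, 'm) ring_scheme \<Rightarrow> ('k, 'h) hopf \<Rightarrow> ('k, 'a) module \<Rightarrow> ('h \<Rightarrow> 'a \<Rightarrow> 'a) \<Rightarrow>
      ('k, 'b) module \<Rightarrow> ('h \<Rightarrow> 'b \<Rightarrow> 'b) \<Rightarrow> ('a \<Rightarrow> 'b) set"
  where "module_algebra_hom K H A act B act' = {f \<in> ring_hom A B \<inter> mod_hom K A B.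
    \<forall>h\<in>carrier H. \<forall>x\<in>carrier A. f (act h x) = act' h (f x)}"

definition H_stable_ideal ::
    "('k, 'h) hopf \<Rightarrow> ('k, 'a) module \<Rightarrow> ('h \<Rightarrow> 'a \<Rightarrow> 'a) \<Rightarrow> 'a set \<Rightarrow> bool"
  where "H_stable_ideal H A act I \<longleftrightarrow> ideal I A \<and> (\<forall>h\<in>carrier H. \<forall>x\<in>I. act h x \<in> I)"

definition H_prime :: "('k, 'h) hopf \<Rightarrow> ('k, 'a) module \<Rightarrow> ('h \<Rightarrow> 'a \<Rightarrow> 'a) \<Rightarrow> bool"
  where "H_prime H A act \<longleftrightarrow>
    (\<forall>I J. H_stable_ideal H A act I \<longrightarrow> H_stable_ideal H A act J \<longrightarrow>
       ideal_prod A I J = {\<zero>\<^bsub>A\<^esub>} \<longrightarrow> I = {\<zero>\<^bsub>A\<^esub>} \<or> J = {\<zero>\<^bsub>A\<^esub>})"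

definition H_semiprime :: "('k, 'h) hopf \<Rightarrow> ('k, 'a) module \<Rightarrow> ('h \<Rightarrow> 'a \<Rightarrow> 'a) \<Rightarrow> bool"
  where "H_semiprime H A act \<longleftrightarrow>
    (\<forall>I. H_stable_ideal H A act I \<longrightarrow> ideal_prod A I I = {\<zero>\<^bsub>A\<^esub>} \<longrightarrow> I = {\<zero>\<^bsub>A\<^esub>})"

text \<open>The factors of a subdirect product are isomorphic to quotients of \<open>A\<close> by \<open>H\<close>-stable ideals, so
  nothing is lost by taking subsets of \<open>A\<close> as indices and as elements of the factors.\<close>

definition subdirect_product_of_H_primes ::
    "('k, 'm) ring_scheme \<Rightarrow> ('k, 'h) hopf \<Rightarrow> ('k, 'a) module \<Rightarrow> ('h \<Rightarrow> 'a \<Rightarrow> 'a) \<Rightarrow> bool"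
  where "subdirect_product_of_H_primes K H A act \<longleftrightarrow>
    (\<exists>(I :: 'a set set) (B :: 'a set \<Rightarrow> ('k, 'a set) module) act' \<pi>.
       (\<forall>i\<in>I. module_algebra K H (B i) (act' i) \<and> H_prime H (B i) (act' i) \<and>
          \<pi> i \<in> module_algebra_hom K H A act (B i) (act' i) \<and> \<pi> i ` carrier A = carrier (B i)) \<and>
       inj_on (\<lambda>x. \<lambda>i\<in>I. \<pi> i x) (carrier A))"

text \<open>\<open>Z(A)\<^sup>H\<close>, as a ring\<close>

definition central_invariants ::
    "('k, 'h) hopf \<Rightarrow> ('k, 'a) module \<Rightarrow> ('h \<Rightarrow> 'a \<Rightarrow> 'a) \<Rightarrow> ('k, 'a) module"
  where "central_invariants H A act = A\<lparr>carrier := {z \<in> carrier A.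
    (\<forall>x\<in>carrier A. z \<otimes>\<^bsub>A\<^esub> x = x \<otimes>\<^bsub>A\<^esub> z) \<and>
    (\<forall>h\<in>carrier H. act h z = counit H h \<odot>\<^bsub>A\<^esub> z)}\<rparr>"

definition large_in ::
    "'a set \<Rightarrow> ('k, 'h) hopf \<Rightarrow> ('k, 'a) module \<Rightarrow> ('h \<Rightarrow> 'a \<Rightarrow> 'a) \<Rightarrow> bool"
  where "large_in Z H A act \<longleftrightarrow>
    (\<forall>I. H_stable_ideal H A act I \<longrightarrow> I \<noteq> {\<zero>\<^bsub>A\<^esub>} \<longrightarrow> Z \<inter> I \<noteq> {\<zero>\<^bsub>A\<^esub>})"


section \<open>The algebra \<open>A\<^sup>e #\<^sub>\<nu> H\<close>\<close>

definition enveloping_algebra ::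
    "('k, 'm) ring_scheme \<Rightarrow> ('k, 'a) module \<Rightarrow> ('k, ('k, 'a, 'a) tensor) module"
  where "enveloping_algebra K A = tensor_algebra K A (opposite A)"

type_synonym ('k, 'a, 'h) smash = "('k, ('k, 'a, 'a) tensor, 'h) tensor"

text \<open>\<open>\<nu>(h \<otimes> a \<otimes> b) = \<Sum> (h\<^sub>1\<cdot>a \<otimes> h\<^sub>3\<cdot>b) \<otimes> h\<^sub>2\<close>, where the outer comultiplication yields
  \<open>h \<mapsto> \<Sum> g \<otimes> h\<^sub>3\<close> and the inner one \<open>g \<mapsto> \<Sum> h\<^sub>1 \<otimes> h\<^sub>2\<close>\<close>

definition smash_nu ::
    "('k, 'm) ring_scheme \<Rightarrow> ('k, 'h) hopf \<Rightarrow> ('k, 'a) module \<Rightarrow> ('h \<Rightarrow> 'a \<Rightarrow> 'a) \<Rightarrow>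
      'h \<Rightarrow> ('k, 'a, 'a) tensor \<Rightarrow> ('k, 'a, 'h) smash"
  where "smash_nu K H A act h t =
    (let Ae = enveloping_algebra K A; T = tensor_module K Ae H in
      tensor_lift K T (\<lambda>a b.
        tensor_lift K T (\<lambda>g h3.
          tensor_lift K T (\<lambda>h1 h2.
            tensor K Ae H (tensor K A (opposite A) (act h1 a) (act h3 b)) h2)
          (comult H g))
        (comult H h))
      t)"

definition smash_algebra ::
    "('k, 'm) ring_scheme \<Rightarrow> ('k, 'h) hopf \<Rightarrow> ('k, 'a) module \<Rightarrow> ('h \<Rightarrow> 'a \<Rightarrow> 'a) \<Rightarrow>
      ('k, ('k, 'a, 'h) smash) module"
  where "smash_algebra K H A act =
    (let Ae = enveloping_algebra K A; T = tensor_module K Ae H in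
      T\<lparr>mult := (\<lambda>p q.
          tensor_lift K T (\<lambda>t h.
            tensor_lift K T (\<lambda>u g.
              tensor_lift K T (\<lambda>u' h'. tensor K Ae H (t \<otimes>\<^bsub>Ae\<^esub> u') (h' \<otimes>\<^bsub>H\<^esub> g))
                (smash_nu K H A act h u))
            q)
          p),
        one := tensor K Ae H \<one>\<^bsub>Ae\<^esub> \<one>\<^bsub>H\<^esub>\<rparr>)"

text \<open>\<open>A\<close> as a left module over the above algebra, by \<open>((a \<otimes> b) # h) \<cdot> x = a (h \<cdot> x) b\<close>\<close>

definition smash_module ::
    "('k, 'm) ring_scheme \<Rightarrow> ('k, 'h) hopf \<Rightarrow> ('k, 'a) module \<Rightarrow> ('h \<Rightarrow> 'a \<Rightarrow> 'a) \<Rightarrow>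
      (('k, 'a, 'h) smash, 'a) module"
  where "smash_module K H A act =
    \<lparr>carrier = carrier A, mult = mult A, one = one A,
     zero = zero A, add = add A,
     smult = (\<lambda>p x. tensor_lift K A (\<lambda>t h. tensor_lift K A (\<lambda>a b. a \<otimes>\<^bsub>A\<^esub> act h x \<otimes>\<^bsub>A\<^esub> b) t) p)\<rparr>"


section \<open>The module algebra structure on the self-injective hull\<close>

definition smash_hull ::
    "('k, 'm) ring_scheme \<Rightarrow> ('k, 'h) hopf \<Rightarrow> ('k, 'a) module \<Rightarrow> ('h \<Rightarrow> 'a \<Rightarrow> 'a) \<Rightarrow>
      (('k, 'a, 'h) smash, 'e) module \<Rightarrow> (('k, 'a, 'h) smash, 'e) module"
  where "smash_hull K H A act E =
    self_injective_hull (smash_algebra K H A act) (smash_module K H A act) E"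

text \<open>Let \<open>S\<close> be the above algebra and \<open>M\<close> the self-injective hull of \<open>A\<close>, with \<open>A\<close> embedded by \<open>\<iota>\<close>.
  An element \<open>s = f(1)\<close>, with \<open>f\<close> an \<open>S\<close>-endomorphism of \<open>M\<close>, is represented by \<open>f\<close>, so that
  \<open>a s = f(a)\<close>. The predicate says that \<open>x = \<Sum>\<^sub>i a\<^sub>i s\<^sub>i\<close>, summed over \<open>i < n\<close>.\<close>

definition hull_repr ::
    "('k, 'm) ring_scheme \<Rightarrow> ('k, 'h) hopf \<Rightarrow> ('k, 'a) module \<Rightarrow> ('h \<Rightarrow> 'a \<Rightarrow> 'a) \<Rightarrow>
      (('k, 'a, 'h) smash, 'e) module \<Rightarrow> ('a \<Rightarrow> 'e) \<Rightarrow> 'e \<Rightarrow> nat \<Rightarrow> (nat \<Rightarrow> 'a) \<Rightarrow> (nat \<Rightarrow> 'e \<Rightarrow> 'e) \<Rightarrow> bool"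
  where "hull_repr K H A act E \<iota> x n a f \<longleftrightarrow>
    (let M = smash_hull K H A act E in
      (\<forall>i<n. a i \<in> carrier A \<and> f i \<in> mod_hom (smash_algebra K H A act) M M) \<and>
      x = (\<Oplus>\<^bsub>M\<^esub>i\<in>{..<n}. f i (\<iota> (a i))))"

text \<open>\<open>(\<Sum>\<^sub>i a\<^sub>i s\<^sub>i) (\<Sum>\<^sub>j b\<^sub>j t\<^sub>j) = \<Sum>\<^sub>i \<Sum>\<^sub>j (a\<^sub>i b\<^sub>j) s\<^sub>i t\<^sub>j\<close>, and \<open>s\<^sub>i t\<^sub>j\<close> stands for
  the composition applying \<open>s\<^sub>i\<close> first\<close>

definition hull_mult ::
    "('k, 'm) ring_scheme \<Rightarrow> ('k, 'h) hopf \<Rightarrow> ('k, 'a) module \<Rightarrow> ('h \<Rightarrow> 'a \<Rightarrow> 'a) \<Rightarrow>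
      (('k, 'a, 'h) smash, 'e) module \<Rightarrow> ('a \<Rightarrow> 'e) \<Rightarrow> 'e \<Rightarrow> 'e \<Rightarrow> 'e"
  where "hull_mult K H A act E \<iota> x y =
    (THE z. \<exists>m a f n b g.
       hull_repr K H A act E \<iota> x m a f \<and> hull_repr K H A act E \<iota> y n b g \<and>
       z = (\<Oplus>\<^bsub>E\<^esub>i\<in>{..<m}. \<Oplus>\<^bsub>E\<^esub>j\<in>{..<n}. g j (f i (\<iota> (a i \<otimes>\<^bsub>A\<^esub> b j)))))"

text \<open>\<open>\<Sum>\<^sub>i a\<^sub>i s\<^sub>i \<mapsto> \<Sum>\<^sub>i \<phi>(a\<^sub>i) s\<^sub>i\<close>, to be used for \<open>\<phi>\<close> the action of an element of \<open>k\<close> or \<open>H\<close>\<close>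

definition hull_extend ::
    "('k, 'm) ring_scheme \<Rightarrow> ('k, 'h) hopf \<Rightarrow> ('k, 'a) module \<Rightarrow> ('h \<Rightarrow> 'a \<Rightarrow> 'a) \<Rightarrow>
      (('k, 'a, 'h) smash, 'e) module \<Rightarrow> ('a \<Rightarrow> 'e) \<Rightarrow> ('a \<Rightarrow> 'a) \<Rightarrow> 'e \<Rightarrow> 'e"
  where "hull_extend K H A act E \<iota> \<phi> x =
    (THE z. \<exists>n a f. hull_repr K H A act E \<iota> x n a f \<and>
       z = (\<Oplus>\<^bsub>E\<^esub>i\<in>{..<n}. f i (\<iota> (\<phi> (a i)))))"

definition hull_algebra ::
    "('k, 'm) ring_scheme \<Rightarrow> ('k, 'h) hopf \<Rightarrow> ('k, 'a) module \<Rightarrow> ('h \<Rightarrow> 'a \<Rightarrow> 'a) \<Rightarrow>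
      (('k, 'a, 'h) smash, 'e) module \<Rightarrow> ('a \<Rightarrow> 'e) \<Rightarrow> ('k, 'e) module"
  where "hull_algebra K H A act E \<iota> =
    \<lparr>carrier = carrier (smash_hull K H A act E),
     mult = hull_mult K H A act E \<iota>,
     one = \<iota> \<one>\<^bsub>A\<^esub>,
     zero = zero E,
     add = add E,
     smult = (\<lambda>c. hull_extend K H A act E \<iota> (\<lambda>a. c \<odot>\<^bsub>A\<^esub> a))\<rparr>"

definition hull_act ::
    "('k, 'm) ring_scheme \<Rightarrow> ('k, 'h) hopf \<Rightarrow> ('k, 'a) module \<Rightarrow> ('h \<Rightarrow> 'a \<Rightarrow> 'a) \<Rightarrow>
      (('k, 'a, 'h) smash, 'e) module \<Rightarrow> ('a \<Rightarrow> 'e) \<Rightarrow> 'h \<Rightarrow> 'e \<Rightarrow> 'e"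
  where "hull_act K H A act E \<iota> h = hull_extend K H A act E \<iota> (act h)"

end

theory Submission
  imports Defs
begin

text \<open>The submodules of \<open>A\<close> over \<open>S = A\<^sup>e #\<^sub>\<nu> H\<close> are the \<open>H\<close>-stable ideals, so semiprimeness says that a
  submodule with zero square vanishes. If \<open>g : A \<rightarrow> E\<close> kills an essential \<open>N\<close> and \<open>V\<close> is the part of \<open>A\<close> lying
  in the image of \<open>g\<close>, then \<open>V N = 0\<close>, hence \<open>V \<inter> N\<close> has zero square and \<open>g = 0\<close>: \<open>A\<close> is polyform. Two
  endomorphisms of the hull agree on products \<open>a b\<close> of elements which both of them map into \<open>A\<close>, so they commute; this
  makes the product on the hull well defined. Over a semiprime self-injective algebra an ideal has its annihilator as a
  complement, and extending the projections along such decompositions gives the regularity, self-injectivity and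
  non-singularity statements for the central invariants. If \<open>Z(A)\<^sup>H\<close> is large, a dense ideal of it
  annihilates no nonzero element of the hull, so that elements of \<open>Z(A^)\<^sup>H\<close> and fractions determine each other.\<close>

section \<open>Modules\<close>

text \<open>Module theory turns into ring theory through one fact: an endomorphism of an algebra
  over its smash algebra is multiplication by its value at 1, and that value is a central invariant.
  So every homomorphism extended by injectivity ends up as an element of \<open>Z(A)^H\<close> or of
  its analogue for the hull. Two obstacles shape the rest. Injectivity of \<open>E\<close> is
  assumed only for test modules whose carrier has the type of \<open>S\<close>, whereas
  homomorphisms must be extended from submodules of \<open>A\<close> and of \<open>E\<close>; Baer's
  criterion bridges the types. And \<open>E\<close> carries an action of \<open>S\<close> but no
  product. Every element of the hull is a sum of values f(a) of its endomorphisms at elements of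
  \<open>A\<close>, and the rule f(a) g(b) = g(f(a b)) lets each law be checked on such values and
  extended additively. Endomorphisms of the hull over \<open>S\<close> turn out to be linear over
  the hull's own smash algebra, so self-injectivity survives the change of algebra. The results on
  centres can thus be proved for an abstract semiprime self-injective algebra and then instantiated
  with the hull.\<close>

lemma mod_homI:
  assumes "\<And>x. x \<in> carrier M \<Longrightarrow> f x \<in> carrier N"
    and "\<And>x y. \<lbrakk>x \<in> carrier M; y \<in> carrier M\<rbrakk> \<Longrightarrow> f (x \<oplus>\<^bsub>M\<^esub> y) = f x \<oplus>\<^bsub>N\<^esub> f y"
    and "\<And>r x. \<lbrakk>r \<in> carrier R; x \<in> carrier M\<rbrakk> \<Longrightarrow> f (r \<odot>\<^bsub>M\<^esub> x) = r \<odot>\<^bsub>N\<^esub> f x"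
  shows "f \<in> mod_hom R M N"
  using assms by (auto simp: mod_hom_def)

lemma mod_hom_closed: "\<lbrakk>f \<in> mod_hom R M N; x \<in> carrier M\<rbrakk> \<Longrightarrow> f x \<in> carrier N"
  by (auto simp: mod_hom_def)

lemma mod_hom_add:
  "\<lbrakk>f \<in> mod_hom R M N; x \<in> carrier M; y \<in> carrier M\<rbrakk> \<Longrightarrow> f (x \<oplus>\<^bsub>M\<^esub> y) = f x \<oplus>\<^bsub>N\<^esub> f y"
  by (auto simp: mod_hom_def)

lemma mod_hom_smult:
  "\<lbrakk>f \<in> mod_hom R M N; r \<in> carrier R; x \<in> carrier M\<rbrakk> \<Longrightarrow> f (r \<odot>\<^bsub>M\<^esub> x) = r \<odot>\<^bsub>N\<^esub> f x"
  by (auto simp: mod_hom_def)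

lemma mod_hom_compose:
  assumes "f \<in> mod_hom R M N" "g \<in> mod_hom R N P"
  shows "(\<lambda>x. g (f x)) \<in> mod_hom R M P"
  using assms by (auto simp: mod_hom_def Pi_def)

text \<open>Only additivity is assumed, since the lemma also serves for r \<mapsto> r x from the
  ring to a module and for the action of a fixed element of H on A.\<close>

lemma additive_zero:
  assumes "abelian_group M" "abelian_group N" "f \<in> carrier M \<rightarrow> carrier N"
    and "\<And>x y. \<lbrakk>x \<in> carrier M; y \<in> carrier M\<rbrakk> \<Longrightarrow> f (x \<oplus>\<^bsub>M\<^esub> y) = f x \<oplus>\<^bsub>N\<^esub> f y"
  shows "f \<zero>\<^bsub>M\<^esub> = \<zero>\<^bsub>N\<^esub>"
proof -
  interpret M: abelian_group M by fact
  interpret N: abelian_group N by fact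
  have c: "f \<zero>\<^bsub>M\<^esub> \<in> carrier N" using assms(3) by auto
  have "f \<zero>\<^bsub>M\<^esub> \<oplus>\<^bsub>N\<^esub> f \<zero>\<^bsub>M\<^esub> = f \<zero>\<^bsub>M\<^esub>" using assms(4)[of "\<zero>\<^bsub>M\<^esub>" "\<zero>\<^bsub>M\<^esub>"] by simp
  then show ?thesis using c N.add.r_cancel_one by blast
qed

lemma additive_finsum:
  assumes "abelian_group M" "abelian_group N" "f \<in> carrier M \<rightarrow> carrier N"
    and "\<And>x y. \<lbrakk>x \<in> carrier M; y \<in> carrier M\<rbrakk> \<Longrightarrow> f (x \<oplus>\<^bsub>M\<^esub> y) = f x \<oplus>\<^bsub>N\<^esub> f y"
    and "finite I" "g \<in> I \<rightarrow> carrier M"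
  shows "f (finsum M g I) = finsum N (\<lambda>i. f (g i)) I"
proof -
  interpret M: abelian_group M by fact
  interpret N: abelian_group N by fact
  show ?thesis using assms(5,6)
  proof (induction I rule: finite_induct)
    case empty
    then show ?case using additive_zero[OF assms(1-4)] by simp
  next
    case (insert i I)
    then have "g \<in> I \<rightarrow> carrier M" "g i \<in> carrier M" "(\<lambda>i. f (g i)) \<in> I \<rightarrow> carrier N"
      "f (g i) \<in> carrier N" using assms(3) by auto
    then show ?case using insert assms(4) M.finsum_closed by (simp add: M.finsum_insert N.finsum_insert)
  qed
qed

lemma module_imp_lmodule: "module K M \<Longrightarrow> lmodule K M"
  unfolding module_def lmodule_def lmodule_axioms_def module_axioms_def by (simp add: cring.axioms(1))

context lmodule
begin

lemma smult_zero_right: "a \<in> carrier R \<Longrightarrow> a \<odot>\<^bsub>M\<^esub> \<zero>\<^bsub>M\<^esub> = \<zero>\<^bsub>M\<^esub>"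
  by (rule additive_zero[OF M.abelian_group_axioms M.abelian_group_axioms])
    (auto simp: lsmult_closed lsmult_r_distr)

lemma smult_zero_left: "x \<in> carrier M \<Longrightarrow> \<zero>\<^bsub>R\<^esub> \<odot>\<^bsub>M\<^esub> x = \<zero>\<^bsub>M\<^esub>"
  by (rule additive_zero[OF R.abelian_group_axioms M.abelian_group_axioms])
    (auto simp: lsmult_closed lsmult_l_distr)

text \<open>Negation is multiplication by the scalar -1. This is why submodules need only be closed
  under sums and scalars (\<open>submodule_iff\<close>) and why homomorphisms respect
  differences.\<close>

lemma smult_minus_one: "x \<in> carrier M \<Longrightarrow> (\<ominus>\<^bsub>R\<^esub> \<one>\<^bsub>R\<^esub>) \<odot>\<^bsub>M\<^esub> x = \<ominus>\<^bsub>M\<^esub> x"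
  using lsmult_l_distr[of "\<ominus>\<^bsub>R\<^esub> \<one>\<^bsub>R\<^esub>" "\<one>\<^bsub>R\<^esub>" x] lsmult_closed lsmult_one R.l_neg smult_zero_left
  by (metis M.minus_equality R.a_inv_closed R.one_closed)

lemma smult_diff:
  assumes "a \<in> carrier R" "x \<in> carrier M" "y \<in> carrier M"
  shows "a \<odot>\<^bsub>M\<^esub> (x \<ominus>\<^bsub>M\<^esub> y) = a \<odot>\<^bsub>M\<^esub> x \<ominus>\<^bsub>M\<^esub> a \<odot>\<^bsub>M\<^esub> y"
proof -
  have "a \<odot>\<^bsub>M\<^esub> (\<ominus>\<^bsub>M\<^esub> y) \<oplus>\<^bsub>M\<^esub> a \<odot>\<^bsub>M\<^esub> y = \<zero>\<^bsub>M\<^esub>"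
    using assms lsmult_r_distr[of a "\<ominus>\<^bsub>M\<^esub> y" y] by (simp add: M.l_neg smult_zero_right)
  then have "a \<odot>\<^bsub>M\<^esub> (\<ominus>\<^bsub>M\<^esub> y) = \<ominus>\<^bsub>M\<^esub> (a \<odot>\<^bsub>M\<^esub> y)"
    using assms by (metis M.a_inv_closed M.minus_equality lsmult_closed)
  then show ?thesis using assms by (simp add: a_minus_def lsmult_r_distr)
qed

lemma submodule_iff:
  "submodule N R M \<longleftrightarrow> N \<subseteq> carrier M \<and> \<zero>\<^bsub>M\<^esub> \<in> N \<and>
     (\<forall>x\<in>N. \<forall>y\<in>N. x \<oplus>\<^bsub>M\<^esub> y \<in> N) \<and> (\<forall>r\<in>carrier R. \<forall>x\<in>N. r \<odot>\<^bsub>M\<^esub> x \<in> N)"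
  (is "_ \<longleftrightarrow> ?r")
proof
  assume s: "submodule N R M"
  interpret subgroup N "add_monoid M" using s by (rule submodule.axioms)
  show ?r using subset one_closed m_closed submodule.smult_closed[OF s] by auto
next
  assume r: ?r
  have "\<ominus>\<^bsub>M\<^esub> x \<in> N" if "x \<in> N" for x
    using r that smult_minus_one[of x] R.a_inv_closed[OF R.one_closed] by (metis in_mono)
  then show "submodule N R M" using r
    by (intro submodule.intro subgroup.intro submodule_axioms.intro) (auto simp flip: a_inv_def)
qed

lemma submoduleD:
  assumes "submodule N R M"
  shows "x \<in> N \<Longrightarrow> x \<in> carrier M" "\<zero>\<^bsub>M\<^esub> \<in> N" "\<lbrakk>x \<in> N; y \<in> N\<rbrakk> \<Longrightarrow> x \<oplus>\<^bsub>M\<^esub> y \<in> N"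
    "\<lbrakk>r \<in> carrier R; x \<in> N\<rbrakk> \<Longrightarrow> r \<odot>\<^bsub>M\<^esub> x \<in> N"
  using assms unfolding submodule_iff by auto

lemma submodule_lmodule:
  assumes "submodule N R M"
  shows "lmodule R (M\<lparr>carrier := N\<rparr>)"
proof -
  have N: "N \<subseteq> carrier M" "\<zero>\<^bsub>M\<^esub> \<in> N" "\<And>x y. \<lbrakk>x \<in> N; y \<in> N\<rbrakk> \<Longrightarrow> x \<oplus>\<^bsub>M\<^esub> y \<in> N"
    "\<And>r x. \<lbrakk>r \<in> carrier R; x \<in> N\<rbrakk> \<Longrightarrow> r \<odot>\<^bsub>M\<^esub> x \<in> N"
    using assms by (auto simp: submodule_iff)
  have inv: "\<exists>y\<in>N. y \<oplus>\<^bsub>M\<^esub> x = \<zero>\<^bsub>M\<^esub>" if "x \<in> N" for x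
  proof
    have x: "x \<in> carrier M" using that N by auto
    show "(\<ominus>\<^bsub>R\<^esub> \<one>\<^bsub>R\<^esub>) \<odot>\<^bsub>M\<^esub> x \<in> N" using N(4) that by blast
    show "(\<ominus>\<^bsub>R\<^esub> \<one>\<^bsub>R\<^esub>) \<odot>\<^bsub>M\<^esub> x \<oplus>\<^bsub>M\<^esub> x = \<zero>\<^bsub>M\<^esub>" using x by (simp add: smult_minus_one M.l_neg)
  qed
  have "abelian_group (M\<lparr>carrier := N\<rparr>)"
  proof (rule abelian_groupI, goal_cases)
    case (3 x y z) then show ?case using N(1) by (simp add: subset_iff M.a_assoc)
  next
    case (4 x y) then show ?case using N(1) M.a_comm by (simp add: subset_iff)
  qed (use N inv in auto)
  then show ?thesis
    by (intro lmodule.intro lmodule_axioms.intro R.ring_axioms)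
      (use N in \<open>auto simp: subset_iff lsmult_l_distr lsmult_r_distr lsmult_assoc lsmult_one\<close>)
qed

lemma carrier_submodule: "submodule (carrier M) R M"
  by (auto simp: submodule_iff lsmult_closed)

lemma zero_submodule: "submodule {\<zero>\<^bsub>M\<^esub>} R M"
  by (auto simp: submodule_iff smult_zero_right)

lemma submodule_Int: "\<lbrakk>submodule N R M; submodule L R M\<rbrakk> \<Longrightarrow> submodule (N \<inter> L) R M"
  by (auto simp: submodule_iff)

lemma submodule_diff:
  assumes "submodule N R M" "x \<in> N" "y \<in> N" shows "x \<ominus>\<^bsub>M\<^esub> y \<in> N"
proof -
  have "\<ominus>\<^bsub>M\<^esub> y \<in> N"
    using assms submodule_iff[of N] smult_minus_one[of y] R.a_inv_closed[OF R.one_closed] by (metis in_mono)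
  then show ?thesis using assms by (auto simp: submodule_iff a_minus_def)
qed

lemma submodule_sum:
  assumes "submodule N R M" "submodule L R M"
  shows "submodule {x \<oplus>\<^bsub>M\<^esub> y | x y. x \<in> N \<and> y \<in> L} R M"
proof -
  have N: "N \<subseteq> carrier M" "L \<subseteq> carrier M" using assms by (auto simp: submodule_iff)
  have swap: "a \<oplus>\<^bsub>M\<^esub> b \<oplus>\<^bsub>M\<^esub> (c \<oplus>\<^bsub>M\<^esub> d) = (a \<oplus>\<^bsub>M\<^esub> c) \<oplus>\<^bsub>M\<^esub> (b \<oplus>\<^bsub>M\<^esub> d)"
    if "a \<in> N" "c \<in> N" "b \<in> L" "d \<in> L" for a b c d
    using that N by (simp add: subset_iff M.a_ac)
  have d: "r \<odot>\<^bsub>M\<^esub> (x \<oplus>\<^bsub>M\<^esub> y) = r \<odot>\<^bsub>M\<^esub> x \<oplus>\<^bsub>M\<^esub> r \<odot>\<^bsub>M\<^esub> y" if "x \<in> N" "y \<in> L" "r \<in> carrier R" for r x y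
    using that N by (simp add: subset_iff lsmult_r_distr)
  have z: "\<zero>\<^bsub>M\<^esub> = \<zero>\<^bsub>M\<^esub> \<oplus>\<^bsub>M\<^esub> \<zero>\<^bsub>M\<^esub>" by simp
  show ?thesis
    unfolding submodule_iff
  proof (intro conjI ballI)
    show "{x \<oplus>\<^bsub>M\<^esub> y | x y. x \<in> N \<and> y \<in> L} \<subseteq> carrier M" using N by auto
    show "\<zero>\<^bsub>M\<^esub> \<in> {x \<oplus>\<^bsub>M\<^esub> y | x y. x \<in> N \<and> y \<in> L}" using z assms unfolding submodule_iff by blast
    show "p \<oplus>\<^bsub>M\<^esub> q \<in> {x \<oplus>\<^bsub>M\<^esub> y | x y. x \<in> N \<and> y \<in> L}"
      if "p \<in> {x \<oplus>\<^bsub>M\<^esub> y | x y. x \<in> N \<and> y \<in> L}" "q \<in> {x \<oplus>\<^bsub>M\<^esub> y | x y. x \<in> N \<and> y \<in> L}" for p q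
    proof -
      obtain a b c d where "a \<in> N" "b \<in> L" "c \<in> N" "d \<in> L" "p = a \<oplus>\<^bsub>M\<^esub> b" "q = c \<oplus>\<^bsub>M\<^esub> d"
        using \<open>p \<in> _\<close> \<open>q \<in> _\<close> by blast
      moreover from this have "p \<oplus>\<^bsub>M\<^esub> q = (a \<oplus>\<^bsub>M\<^esub> c) \<oplus>\<^bsub>M\<^esub> (b \<oplus>\<^bsub>M\<^esub> d)" using swap by simp
      ultimately show ?thesis using assms unfolding submodule_iff by blast
    qed
    show "r \<odot>\<^bsub>M\<^esub> p \<in> {x \<oplus>\<^bsub>M\<^esub> y | x y. x \<in> N \<and> y \<in> L}"
      if "r \<in> carrier R" "p \<in> {x \<oplus>\<^bsub>M\<^esub> y | x y. x \<in> N \<and> y \<in> L}" for r p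
      using that d assms unfolding submodule_iff by blast
  qed
qed

end

lemma mod_hom_zero:
  assumes "lmodule R M" "lmodule R N" "f \<in> mod_hom R M N"
  shows "f \<zero>\<^bsub>M\<^esub> = \<zero>\<^bsub>N\<^esub>"
  by (rule additive_zero) (use assms in \<open>auto simp: mod_hom_def lmodule_def\<close>)

lemma mod_hom_minus:
  assumes "lmodule R M" "lmodule R N" "f \<in> mod_hom R M N" "x \<in> carrier M" "y \<in> carrier M"
  shows "f (x \<ominus>\<^bsub>M\<^esub> y) = f x \<ominus>\<^bsub>N\<^esub> f y"
proof -
  interpret M: lmodule R M by fact
  interpret N: lmodule R N by fact
  have "f (\<ominus>\<^bsub>M\<^esub> y) = \<ominus>\<^bsub>N\<^esub> f y"
    using assms mod_hom_smult[OF assms(3), of "\<ominus>\<^bsub>R\<^esub> \<one>\<^bsub>R\<^esub>" y]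
    by (simp add: M.smult_minus_one N.smult_minus_one mod_hom_closed)
  then show ?thesis using assms by (simp add: a_minus_def mod_hom_add)
qed

lemma vimage_submodule:
  assumes "lmodule R M" "lmodule R N" "f \<in> mod_hom R M N" "submodule L R N"
  shows "submodule {x \<in> carrier M. f x \<in> L} R M"
proof -
  interpret M: lmodule R M by fact
  interpret N: lmodule R N by fact
  show ?thesis using assms(4) mod_hom_zero[OF assms(1-3)]
    by (auto simp: M.submodule_iff N.submodule_iff mod_hom_add[OF assms(3)] mod_hom_smult[OF assms(3)]
        M.lsmult_closed)
qed

lemma image_submodule:
  assumes "lmodule R M" "lmodule R N" "f \<in> mod_hom R M N" "submodule L R M"
  shows "submodule (f ` L) R N"
proof -
  interpret M: lmodule R M by fact
  interpret N: lmodule R N by fact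
  have L: "L \<subseteq> carrier M" "\<zero>\<^bsub>M\<^esub> \<in> L" "\<And>x y. \<lbrakk>x \<in> L; y \<in> L\<rbrakk> \<Longrightarrow> x \<oplus>\<^bsub>M\<^esub> y \<in> L"
    "\<And>r x. \<lbrakk>r \<in> carrier R; x \<in> L\<rbrakk> \<Longrightarrow> r \<odot>\<^bsub>M\<^esub> x \<in> L"
    using assms(4) by (auto simp: M.submodule_iff)
  have "\<zero>\<^bsub>N\<^esub> \<in> f ` L" using mod_hom_zero[OF assms(1-3)] L(2) by (metis imageI)
  moreover have "f x \<oplus>\<^bsub>N\<^esub> f y \<in> f ` L" if "x \<in> L" "y \<in> L" for x y
    using that L mod_hom_add[OF assms(3), of x y] by (metis imageI in_mono)
  moreover have "r \<odot>\<^bsub>N\<^esub> f x \<in> f ` L" if "x \<in> L" "r \<in> carrier R" for r x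
    using that L mod_hom_smult[OF assms(3), of r x] by (metis imageI in_mono)
  ultimately show ?thesis using L(1) mod_hom_closed[OF assms(3)] by (auto simp: N.submodule_iff)
qed

lemma submodule_restrict:
  assumes "lmodule R M" "submodule X R M" "N \<subseteq> X"
  shows "submodule N R (M\<lparr>carrier := X\<rparr>) \<longleftrightarrow> submodule N R M"
proof -
  interpret M: lmodule R M by fact
  interpret X: lmodule R "M\<lparr>carrier := X\<rparr>" using assms(2) by (rule M.submodule_lmodule)
  show ?thesis using assms(2,3) by (auto simp: M.submodule_iff X.submodule_iff)
qed

lemma essential_trivial:
  assumes "essential_submodule R M N" "submodule L R M" "L \<noteq> {\<zero>\<^bsub>M\<^esub>}"
  obtains x where "x \<in> L" "x \<in> N" "x \<noteq> \<zero>\<^bsub>M\<^esub>"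
proof -
  have "\<zero>\<^bsub>M\<^esub> \<in> L \<inter> N"
    using assms(1,2) subgroup.one_closed[OF submodule.axioms(1)] by (fastforce simp: essential_submodule_def)
  then show ?thesis using assms that by (auto simp: essential_submodule_def)
qed

lemma essentialI:
  assumes "submodule N R M" "\<And>L. \<lbrakk>submodule L R M; L \<inter> N = {\<zero>\<^bsub>M\<^esub>}\<rbrakk> \<Longrightarrow> L \<subseteq> {\<zero>\<^bsub>M\<^esub>}"
  shows "essential_submodule R M N"
  unfolding essential_submodule_def
proof (intro conjI allI impI assms(1))
  fix L assume "submodule L R M" "L \<inter> N = {\<zero>\<^bsub>M\<^esub>}"
  then show "L = {\<zero>\<^bsub>M\<^esub>}" using assms(2)[of L] by auto
qed

text \<open>For a submodule J there are two cases. If f kills J, then J lies in the preimage;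
  otherwise f(J) is nonzero and meets L in some f(x) \<noteq> 0 with x in J, and x lies in the
  preimage.\<close>

lemma essential_vimage:
  assumes "lmodule R M" "lmodule R N" "f \<in> mod_hom R M N" "essential_submodule R N L"
  shows "essential_submodule R M {x \<in> carrier M. f x \<in> L}"
proof (rule essentialI)
  interpret M: lmodule R M by fact
  interpret N: lmodule R N by fact
  have L: "submodule L R N" using assms(4) by (simp add: essential_submodule_def)
  show "submodule {x \<in> carrier M. f x \<in> L} R M" using vimage_submodule[OF assms(1-3) L] .
  fix J assume J: "submodule J R M" "J \<inter> {x \<in> carrier M. f x \<in> L} = {\<zero>\<^bsub>M\<^esub>}"
  have fJ: "submodule (f ` J) R N" using image_submodule[OF assms(1-3) J(1)] .
  have Jc: "J \<subseteq> carrier M" using J(1) by (simp add: M.submodule_iff)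
  show "J \<subseteq> {\<zero>\<^bsub>M\<^esub>}"
  proof (cases "f ` J = {\<zero>\<^bsub>N\<^esub>}")
    case True
    show ?thesis
    proof
      fix x assume x: "x \<in> J"
      then have "f x \<in> {\<zero>\<^bsub>N\<^esub>}" using imageI[of x J f] unfolding True by simp
      then have "f x \<in> L" using L N.submodule_iff by simp
      then have "x \<in> J \<inter> {x \<in> carrier M. f x \<in> L}" using x Jc by auto
      then show "x \<in> {\<zero>\<^bsub>M\<^esub>}" unfolding J(2) .
    qed
  next
    case False
    obtain z where "z \<in> f ` J" "z \<in> L" "z \<noteq> \<zero>\<^bsub>N\<^esub>" using essential_trivial[OF assms(4) fJ False] .
    then obtain x where "x \<in> J" "f x \<in> L" "f x \<noteq> \<zero>\<^bsub>N\<^esub>" by auto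
    then have "x \<in> J \<inter> {x \<in> carrier M. f x \<in> L}" using Jc by auto
    then have "x = \<zero>\<^bsub>M\<^esub>" using J(2) by simp
    then show ?thesis using \<open>f x \<noteq> _\<close> mod_hom_zero[OF assms(1-3)] by simp
  qed
qed

text \<open>Two stages: J \<inter> N meets L trivially and is therefore zero, and then J itself is
  zero.\<close>

lemma essential_Int:
  assumes "lmodule R M" "essential_submodule R M N" "essential_submodule R M L"
  shows "essential_submodule R M (N \<inter> L)"
proof (rule essentialI)
  interpret M: lmodule R M by fact
  show "submodule (N \<inter> L) R M" using assms M.submodule_Int by (simp add: essential_submodule_def)
  fix J assume J: "submodule J R M" "J \<inter> (N \<inter> L) = {\<zero>\<^bsub>M\<^esub>}"
  have "submodule (J \<inter> N) R M" using J(1) assms(2) M.submodule_Int by (simp add: essential_submodule_def)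
  moreover have "J \<inter> N \<inter> L = {\<zero>\<^bsub>M\<^esub>}" using J by auto
  ultimately have "J \<inter> N = {\<zero>\<^bsub>M\<^esub>}" using assms(3) by (simp add: essential_submodule_def)
  then show "J \<subseteq> {\<zero>\<^bsub>M\<^esub>}" using J(1) assms(2) unfolding essential_submodule_def by (metis order_refl)
qed

lemma regular_module_simps [simp]:
  "carrier (regular_module R) = carrier R" "add (regular_module R) = add R"
  "zero (regular_module R) = zero R" "smult (regular_module R) = mult R"
  by (simp_all add: regular_module_def)

lemma mod_hom_diff:
  assumes "lmodule R M" "lmodule R N" "f \<in> mod_hom R M N" "g \<in> mod_hom R M N"
  shows "(\<lambda>x. f x \<ominus>\<^bsub>N\<^esub> g x) \<in> mod_hom R M N"
proof (rule mod_homI)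
  interpret M: lmodule R M by fact
  interpret N: lmodule R N by fact
  note cl = mod_hom_closed[OF assms(3)] mod_hom_closed[OF assms(4)]
  show "f x \<ominus>\<^bsub>N\<^esub> g x \<in> carrier N" if "x \<in> carrier M" for x using cl that by simp
  show "f (x \<oplus>\<^bsub>M\<^esub> y) \<ominus>\<^bsub>N\<^esub> g (x \<oplus>\<^bsub>M\<^esub> y) = (f x \<ominus>\<^bsub>N\<^esub> g x) \<oplus>\<^bsub>N\<^esub> (f y \<ominus>\<^bsub>N\<^esub> g y)"
    if "x \<in> carrier M" "y \<in> carrier M" for x y
    using cl that by (simp add: mod_hom_add[OF assms(3)] mod_hom_add[OF assms(4)] a_minus_def
        N.M.minus_add N.M.a_ac)
  show "f (r \<odot>\<^bsub>M\<^esub> x) \<ominus>\<^bsub>N\<^esub> g (r \<odot>\<^bsub>M\<^esub> x) = r \<odot>\<^bsub>N\<^esub> (f x \<ominus>\<^bsub>N\<^esub> g x)"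
    if "r \<in> carrier R" "x \<in> carrier M" for r x
    using cl that by (simp add: mod_hom_smult[OF assms(3)] mod_hom_smult[OF assms(4)] N.smult_diff)
qed

lemma (in lmodule) diff_eq_zero:
  "\<lbrakk>x \<in> carrier M; y \<in> carrier M; x \<ominus>\<^bsub>M\<^esub> y = \<zero>\<^bsub>M\<^esub>\<rbrakk> \<Longrightarrow> x = y"
  using M.minus_equality[of x "\<ominus>\<^bsub>M\<^esub> y"] by (simp add: a_minus_def)

lemma (in lmodule) diff_self: "x \<in> carrier M \<Longrightarrow> x \<ominus>\<^bsub>M\<^esub> x = \<zero>\<^bsub>M\<^esub>"
  by (simp add: a_minus_def M.r_neg)

subsection \<open>Transport along surjections\<close>

text \<open>The axioms pass along any surjection compatible with the operations. With a coset map
  this yields quotients; with the identity it moves a structure to another record that has the same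
  carrier, addition and zero.\<close>

lemma abelian_group_surj:
  assumes "abelian_group M" "carrier Q = \<pi> ` carrier M" "zero Q = \<pi> (zero M)"
    and "\<And>x y. \<lbrakk>x \<in> carrier M; y \<in> carrier M\<rbrakk> \<Longrightarrow> \<pi> x \<oplus>\<^bsub>Q\<^esub> \<pi> y = \<pi> (x \<oplus>\<^bsub>M\<^esub> y)"
  shows "abelian_group Q"
proof -
  interpret M: abelian_group M by fact
  show ?thesis
  proof (rule abelian_groupI, goal_cases)
    case (3 x y z) then show ?case by (auto simp: assms(2,4) M.a_assoc)
  next
    case (4 x y) then show ?case using M.a_comm by (auto simp: assms(2,4))
  next
    case (6 x)
    then obtain a where a: "a \<in> carrier M" "x = \<pi> a" by (auto simp: assms(2))
    then have "\<pi> (\<ominus>\<^bsub>M\<^esub> a) \<oplus>\<^bsub>Q\<^esub> x = \<zero>\<^bsub>Q\<^esub>" by (simp add: assms(3,4) M.l_neg)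
    then show ?case using a by (auto simp: assms(2))
  qed (auto simp: assms(2-4))
qed

lemma (in ring) regular_lmodule: "lmodule R (regular_module R)"
proof -
  have "abelian_group (regular_module R)"
    using abelian_group_surj[OF abelian_group_axioms, of "regular_module R" "\<lambda>x. x"] by simp
  then show ?thesis
    by (intro lmodule.intro lmodule_axioms.intro) (auto simp: ring_axioms l_distr r_distr m_assoc)
qed

lemma lmodule_surj:
  assumes "lmodule R M" "carrier Q = \<pi> ` carrier M" "zero Q = \<pi> (zero M)"
    and "\<And>x y. \<lbrakk>x \<in> carrier M; y \<in> carrier M\<rbrakk> \<Longrightarrow> \<pi> x \<oplus>\<^bsub>Q\<^esub> \<pi> y = \<pi> (x \<oplus>\<^bsub>M\<^esub> y)"
    and "\<And>r x. \<lbrakk>r \<in> carrier R; x \<in> carrier M\<rbrakk> \<Longrightarrow> r \<odot>\<^bsub>Q\<^esub> \<pi> x = \<pi> (r \<odot>\<^bsub>M\<^esub> x)"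
  shows "lmodule R Q"
proof -
  interpret M: lmodule R M by fact
  have "abelian_group Q" using abelian_group_surj[OF M.M.abelian_group_axioms assms(2-4)] by simp
  then show ?thesis
    by (intro lmodule.intro lmodule_axioms.intro M.R.ring_axioms)
      (auto simp: assms(2-5) M.lsmult_closed M.lsmult_l_distr M.lsmult_r_distr M.lsmult_assoc M.lsmult_one)
qed

lemma module_surj:
  assumes "module R M" "carrier Q = \<pi> ` carrier M" "zero Q = \<pi> (zero M)"
    and "\<And>x y. \<lbrakk>x \<in> carrier M; y \<in> carrier M\<rbrakk> \<Longrightarrow> \<pi> x \<oplus>\<^bsub>Q\<^esub> \<pi> y = \<pi> (x \<oplus>\<^bsub>M\<^esub> y)"
    and "\<And>r x. \<lbrakk>r \<in> carrier R; x \<in> carrier M\<rbrakk> \<Longrightarrow> r \<odot>\<^bsub>Q\<^esub> \<pi> x = \<pi> (r \<odot>\<^bsub>M\<^esub> x)"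
  shows "module R Q"
proof -
  have "lmodule R Q" using lmodule_surj[OF module_imp_lmodule[OF assms(1)] assms(2-5)] by simp
  then show ?thesis using assms(1)
    by (auto simp: module_def module_axioms_def lmodule_def lmodule_axioms_def)
qed

lemma ring_surj:
  assumes "ring M" "carrier Q = \<pi> ` carrier M" "zero Q = \<pi> (zero M)" "one Q = \<pi> (one M)"
    and "\<And>x y. \<lbrakk>x \<in> carrier M; y \<in> carrier M\<rbrakk> \<Longrightarrow> \<pi> x \<oplus>\<^bsub>Q\<^esub> \<pi> y = \<pi> (x \<oplus>\<^bsub>M\<^esub> y)"
    and "\<And>x y. \<lbrakk>x \<in> carrier M; y \<in> carrier M\<rbrakk> \<Longrightarrow> \<pi> x \<otimes>\<^bsub>Q\<^esub> \<pi> y = \<pi> (x \<otimes>\<^bsub>M\<^esub> y)"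
  shows "ring Q"
proof -
  interpret M: ring M by fact
  have "abelian_group Q" using abelian_group_surj[OF M.abelian_group_axioms assms(2,3,5)] by simp
  then show ?thesis
    by (intro ringI monoidI) (auto simp: assms(2-6) M.l_distr M.r_distr M.m_assoc)
qed

subsection \<open>Quotient modules\<close>

lemma submodule_abelian_subgroup:
  "\<lbrakk>lmodule R M; submodule N R M\<rbrakk> \<Longrightarrow> abelian_subgroup N M"
  by (intro abelian_subgroupI3 additive_subgroup.intro submodule.axioms(1)) (auto simp: lmodule_def)

context lmodule
begin

lemma coset_eq_iff:
  assumes "submodule N R M" "x \<in> carrier M" "y \<in> carrier M"
  shows "N +>\<^bsub>M\<^esub> x = N +>\<^bsub>M\<^esub> y \<longleftrightarrow> x \<ominus>\<^bsub>M\<^esub> y \<in> N"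
proof -
  interpret N: abelian_subgroup N M using submodule_abelian_subgroup[OF lmodule_axioms assms(1)] .
  show ?thesis
    using N.a_rcos_module[OF assms(3,2)] N.a_repr_independence'[of x y] N.a_rcos_self[of x] assms(2,3)
    by (auto simp: a_minus_def)
qed

lemma coset_self: "\<lbrakk>submodule N R M; x \<in> carrier M\<rbrakk> \<Longrightarrow> x \<in> N +>\<^bsub>M\<^esub> x"
  using abelian_subgroup.a_rcos_self[OF submodule_abelian_subgroup[OF lmodule_axioms]] by blast

lemma mem_coset_iff:
  assumes "submodule N R M" "x \<in> carrier M"
  shows "y \<in> N +>\<^bsub>M\<^esub> x \<longleftrightarrow> y \<in> carrier M \<and> N +>\<^bsub>M\<^esub> y = N +>\<^bsub>M\<^esub> x"
  using abelian_subgroup.a_elemrcos_carrier[OF submodule_abelian_subgroup[OF lmodule_axioms assms(1)] assms(2)]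
    abelian_subgroup.a_repr_independence'[OF submodule_abelian_subgroup[OF lmodule_axioms assms(1)] _ assms(2)]
    coset_self[OF assms(1)] by blast

lemma coset_add:
  "\<lbrakk>submodule N R M; x \<in> carrier M; y \<in> carrier M\<rbrakk> \<Longrightarrow>
    (N +>\<^bsub>M\<^esub> x) <+>\<^bsub>M\<^esub> (N +>\<^bsub>M\<^esub> y) = N +>\<^bsub>M\<^esub> (x \<oplus>\<^bsub>M\<^esub> y)"
  using abelian_subgroup.a_rcos_sum[OF submodule_abelian_subgroup[OF lmodule_axioms]] by blast

text \<open>The scalar multiplication of \<open>quotient_module\<close> is a union over all
  representatives of a coset; such a union is the intended coset as soon as its members
  coincide.\<close>

lemma coset_UN_const:
  assumes "submodule N R M" "x \<in> carrier M" "\<And>y. y \<in> N +>\<^bsub>M\<^esub> x \<Longrightarrow> F y = F x"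
  shows "(\<Union>y\<in>N +>\<^bsub>M\<^esub> x. F y) = F x"
proof -
  have "F ` (N +>\<^bsub>M\<^esub> x) \<subseteq> {F x}" using assms(3) by (intro image_subsetI singletonI insertI1) simp
  moreover have "F x \<in> F ` (N +>\<^bsub>M\<^esub> x)" using coset_self[OF assms(1,2)] by (rule imageI)
  ultimately have "F ` (N +>\<^bsub>M\<^esub> x) = {F x}" by blast
  then show ?thesis by simp
qed

lemma coset_smult:
  assumes "submodule N R M" "r \<in> carrier R" "x \<in> carrier M"
  shows "(\<Union>u\<in>N +>\<^bsub>M\<^esub> x. N +>\<^bsub>M\<^esub> (r \<odot>\<^bsub>M\<^esub> u)) = N +>\<^bsub>M\<^esub> (r \<odot>\<^bsub>M\<^esub> x)"
proof (rule coset_UN_const[OF assms(1,3)])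
  fix y assume "y \<in> N +>\<^bsub>M\<^esub> x"
  then have y: "y \<in> carrier M" "y \<ominus>\<^bsub>M\<^esub> x \<in> N"
    using mem_coset_iff[OF assms(1,3)] coset_eq_iff[OF assms(1)] assms(3) by auto
  have "r \<odot>\<^bsub>M\<^esub> (y \<ominus>\<^bsub>M\<^esub> x) \<in> N" using y assms by (auto simp: submodule_iff)
  moreover have "r \<odot>\<^bsub>M\<^esub> (y \<ominus>\<^bsub>M\<^esub> x) = r \<odot>\<^bsub>M\<^esub> y \<ominus>\<^bsub>M\<^esub> r \<odot>\<^bsub>M\<^esub> x"
    using y assms by (simp add: smult_diff)
  ultimately show "N +>\<^bsub>M\<^esub> (r \<odot>\<^bsub>M\<^esub> y) = N +>\<^bsub>M\<^esub> (r \<odot>\<^bsub>M\<^esub> x)"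
    using coset_eq_iff[OF assms(1)] y assms by (simp add: lsmult_closed)
qed

lemma quotient_module_simps:
  assumes "submodule N R M"
  shows "carrier (quotient_module M N) = (\<lambda>x. N +>\<^bsub>M\<^esub> x) ` carrier M"
    and "zero (quotient_module M N) = N +>\<^bsub>M\<^esub> \<zero>\<^bsub>M\<^esub>"
    and "\<lbrakk>x \<in> carrier M; y \<in> carrier M\<rbrakk> \<Longrightarrow>
      (N +>\<^bsub>M\<^esub> x) \<oplus>\<^bsub>quotient_module M N\<^esub> (N +>\<^bsub>M\<^esub> y) = N +>\<^bsub>M\<^esub> (x \<oplus>\<^bsub>M\<^esub> y)"
    and "\<lbrakk>r \<in> carrier R; x \<in> carrier M\<rbrakk> \<Longrightarrow>
      r \<odot>\<^bsub>quotient_module M N\<^esub> (N +>\<^bsub>M\<^esub> x) = N +>\<^bsub>M\<^esub> (r \<odot>\<^bsub>M\<^esub> x)"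
proof -
  have "N +>\<^bsub>M\<^esub> \<zero>\<^bsub>M\<^esub> = N"
    using assms by (intro M.a_coset_add_zero) (auto simp: submodule_iff)
  then show "zero (quotient_module M N) = N +>\<^bsub>M\<^esub> \<zero>\<^bsub>M\<^esub>" by (simp add: quotient_module_def)
qed (use coset_add[OF assms] coset_smult[OF assms] in
    \<open>auto simp: quotient_module_def A_RCOSETS_def'\<close>)

lemma quotient_hom:
  "submodule N R M \<Longrightarrow> (\<lambda>x. N +>\<^bsub>M\<^esub> x) \<in> mod_hom R M (quotient_module M N)"
  by (rule mod_homI) (auto simp: quotient_module_simps)

lemma generated_submodule_submodule:
  assumes "X \<subseteq> carrier M" shows "submodule (generated_submodule R M X) R M"
proof -
  have "generated_submodule R M X \<subseteq> carrier M"
    using carrier_submodule assms by (auto simp: generated_submodule_def)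
  then show ?thesis
    unfolding submodule_iff[of "generated_submodule R M X"] by (auto simp: generated_submodule_def submodule_iff)
qed

lemma generated_submodule_superset: "X \<subseteq> generated_submodule R M X"
  by (auto simp: generated_submodule_def)

lemma generated_submodule_minimal:
  "\<lbrakk>submodule N R M; X \<subseteq> N\<rbrakk> \<Longrightarrow> generated_submodule R M X \<subseteq> N"
  by (auto simp: generated_submodule_def)

end

lemma (in lmodule) cyclic_submodule:
  assumes "x \<in> carrier M"
  shows "submodule ((\<lambda>r. r \<odot>\<^bsub>M\<^esub> x) ` carrier R) R M" "x \<in> (\<lambda>r. r \<odot>\<^bsub>M\<^esub> x) ` carrier R"
proof -
  have "(\<lambda>r. r \<odot>\<^bsub>M\<^esub> x) \<in> mod_hom R (regular_module R) M"
    using assms by (intro mod_homI) (simp_all add: lsmult_closed lsmult_l_distr lsmult_assoc)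
  then show "submodule ((\<lambda>r. r \<odot>\<^bsub>M\<^esub> x) ` carrier R) R M"
    using image_submodule[OF R.regular_lmodule lmodule_axioms _ lmodule.carrier_submodule[OF R.regular_lmodule]]
    by simp
  show "x \<in> (\<lambda>r. r \<odot>\<^bsub>M\<^esub> x) ` carrier R"
    using assms lsmult_one by (intro image_eqI[of _ _ "\<one>\<^bsub>R\<^esub>"]) simp_all
qed

text \<open>Zero always belongs to the singular set: its annihilator is the whole ring, which is
  essential. So one inclusion remains to be checked.\<close>

lemma nonsingular_moduleI:
  assumes "lmodule R M"
    and "\<And>x. \<lbrakk>x \<in> carrier M; essential_submodule R (regular_module R) {r \<in> carrier R. r \<odot>\<^bsub>M\<^esub> x = \<zero>\<^bsub>M\<^esub>}\<rbrakk> \<Longrightarrow>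
      x = \<zero>\<^bsub>M\<^esub>"
  shows "nonsingular_module R M"
proof -
  interpret M: lmodule R M by fact
  interpret Q: lmodule R "regular_module R" by (rule M.R.regular_lmodule)
  have "{r \<in> carrier R. r \<odot>\<^bsub>M\<^esub> \<zero>\<^bsub>M\<^esub> = \<zero>\<^bsub>M\<^esub>} = carrier R" using M.smult_zero_right by blast
  moreover have "essential_submodule R (regular_module R) (carrier R)"
    using Q.carrier_submodule Q.submoduleD(1) by (intro essentialI) auto
  ultimately show ?thesis using assms by (auto simp: nonsingular_module_def)
qed

subsection \<open>Baer's criterion\<close>

text \<open>A partial homomorphism is a submodule of the product which is the graph of a function;
  in a maximal one extending \<open>f\<close>, every \<open>y\<close> lies in the domain, since the homomorphism
  \<open>r \<mapsto> G(r y)\<close> on the left ideal of all \<open>r\<close> with \<open>r y\<close> in the domain extends to the ring.\<close>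

definition partial_hom ::
    "('r, 'm) ring_scheme \<Rightarrow> ('r, 'a, 'n) module_scheme \<Rightarrow> ('r, 'e, 'p) module_scheme \<Rightarrow> ('a \<times> 'e) set \<Rightarrow> bool"
  where "partial_hom R Y E G \<longleftrightarrow> G \<subseteq> carrier Y \<times> carrier E \<and>
    (\<forall>(x, u)\<in>G. \<forall>(y, v)\<in>G. (x \<oplus>\<^bsub>Y\<^esub> y, u \<oplus>\<^bsub>E\<^esub> v) \<in> G) \<and>
    (\<forall>r\<in>carrier R. \<forall>(x, u)\<in>G. (r \<odot>\<^bsub>Y\<^esub> x, r \<odot>\<^bsub>E\<^esub> u) \<in> G) \<and>
    (\<forall>u. (\<zero>\<^bsub>Y\<^esub>, u) \<in> G \<longrightarrow> u = \<zero>\<^bsub>E\<^esub>)"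

text \<open>Single-valuedness at zero suffices: if x is related to u and to v, then closure under
  sums and under multiplication by -1 relates zero to u - v.\<close>

lemma partial_hom_unique:
  assumes "lmodule R Y" "lmodule R E" "partial_hom R Y E G" "(x, u) \<in> G" "(x, v) \<in> G"
  shows "u = v"
proof -
  interpret Y: lmodule R Y by fact
  interpret E: lmodule R E by fact
  have c: "x \<in> carrier Y" "u \<in> carrier E" "v \<in> carrier E" using assms by (auto simp: partial_hom_def)
  have "((\<ominus>\<^bsub>R\<^esub> \<one>\<^bsub>R\<^esub>) \<odot>\<^bsub>Y\<^esub> x, (\<ominus>\<^bsub>R\<^esub> \<one>\<^bsub>R\<^esub>) \<odot>\<^bsub>E\<^esub> v) \<in> G"
    using assms(3,5) Y.R.a_inv_closed[OF Y.R.one_closed] unfolding partial_hom_def by blast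
  then have "(x \<oplus>\<^bsub>Y\<^esub> \<ominus>\<^bsub>Y\<^esub> x, u \<oplus>\<^bsub>E\<^esub> \<ominus>\<^bsub>E\<^esub> v) \<in> G"
    using assms(3,4) c unfolding partial_hom_def Y.smult_minus_one[OF c(1)] E.smult_minus_one[OF c(3)] by blast
  then have "u \<ominus>\<^bsub>E\<^esub> v = \<zero>\<^bsub>E\<^esub>" using assms(3) c by (auto simp: partial_hom_def Y.M.r_neg a_minus_def)
  then have "u = \<ominus>\<^bsub>E\<^esub> (\<ominus>\<^bsub>E\<^esub> v)" using c by (intro E.M.minus_equality[symmetric]) (auto simp: a_minus_def)
  then show ?thesis using c by simp
qed

lemma baer_step:
  assumes inj: "injective_module R E" and Y: "lmodule R Y" and G: "partial_hom R Y E G"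
    and ne: "G \<noteq> {}" and y: "y \<in> carrier Y"
  obtains G' e where "partial_hom R Y E G'" "G \<subseteq> G'" "(y, e) \<in> G'"
proof -
  interpret Y: lmodule R Y by fact
  interpret E: lmodule R E using inj by (simp add: injective_module_def)
  interpret Q: lmodule R "regular_module R" using Y.R.regular_lmodule .
  have Gc: "x \<in> carrier Y" "u \<in> carrier E" if "(x, u) \<in> G" for x u
    using G that by (auto simp: partial_hom_def)
  have Ga: "(x \<oplus>\<^bsub>Y\<^esub> x', u \<oplus>\<^bsub>E\<^esub> u') \<in> G" if "(x, u) \<in> G" "(x', u') \<in> G" for x u x' u'
    using G that unfolding partial_hom_def by fast
  have Gs: "(r \<odot>\<^bsub>Y\<^esub> x, r \<odot>\<^bsub>E\<^esub> u) \<in> G" if "(x, u) \<in> G" "r \<in> carrier R" for x u r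
    using G that unfolding partial_hom_def by fast
  have Gz: "(\<zero>\<^bsub>Y\<^esub>, \<zero>\<^bsub>E\<^esub>) \<in> G"
    using ne Gs[OF _ Y.R.zero_closed] Gc by (auto simp: Y.smult_zero_left E.smult_zero_left)
  define J where "J = {r \<in> carrier R. \<exists>u. (r \<odot>\<^bsub>Y\<^esub> y, u) \<in> G}"
  define k where "k r = (THE u. (r \<odot>\<^bsub>Y\<^esub> y, u) \<in> G)" for r
  have k: "k r = u" if "(r \<odot>\<^bsub>Y\<^esub> y, u) \<in> G" for r u
    unfolding k_def using that partial_hom_unique[OF Y E.lmodule_axioms G] by blast
  have J: "submodule J R (regular_module R)"
    unfolding Q.submodule_iff J_def using Ga Gs Gz y
    by (auto simp: Y.lsmult_l_distr Y.lsmult_assoc Y.smult_zero_left) blast+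
  have "k \<in> mod_hom R ((regular_module R)\<lparr>carrier := J\<rparr>) E"
  proof (rule mod_homI)
    fix r assume "r \<in> carrier ((regular_module R)\<lparr>carrier := J\<rparr>)"
    then obtain u where u: "r \<in> carrier R" "(r \<odot>\<^bsub>Y\<^esub> y, u) \<in> G" by (auto simp: J_def)
    then show "k r \<in> carrier E" using k Gc by auto
    {
      fix s assume "s \<in> carrier ((regular_module R)\<lparr>carrier := J\<rparr>)"
      then obtain v where v: "s \<in> carrier R" "(s \<odot>\<^bsub>Y\<^esub> y, v) \<in> G" by (auto simp: J_def)
      have "((r \<oplus>\<^bsub>R\<^esub> s) \<odot>\<^bsub>Y\<^esub> y, u \<oplus>\<^bsub>E\<^esub> v) \<in> G" using Ga[OF u(2) v(2)] u v y by (simp add: Y.lsmult_l_distr)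
      then show "k (r \<oplus>\<^bsub>(regular_module R)\<lparr>carrier := J\<rparr>\<^esub> s) = k r \<oplus>\<^bsub>E\<^esub> k s"
        using k u v by simp
    }
    fix s assume s: "s \<in> carrier R"
    have "((s \<otimes>\<^bsub>R\<^esub> r) \<odot>\<^bsub>Y\<^esub> y, s \<odot>\<^bsub>E\<^esub> u) \<in> G" using Gs[OF u(2) s] u s y by (simp add: Y.lsmult_assoc)
    then show "k (s \<odot>\<^bsub>(regular_module R)\<lparr>carrier := J\<rparr>\<^esub> r) = s \<odot>\<^bsub>E\<^esub> k r"
      using k u by simp
  qed
  \<comment> \<open>The only appeal to injectivity. The test module is the ring itself with its left
    ideal J, so its carrier has the type that \<open>injective_module\<close> demands.\<close>
  then obtain g where g: "g \<in> mod_hom R (regular_module R) E" "\<And>r. r \<in> J \<Longrightarrow> g r = k r"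
    using inj J Q.lmodule_axioms unfolding injective_module_def by blast
  define e where "e = g \<one>\<^bsub>R\<^esub>"
  have e: "e \<in> carrier E" using g mod_hom_closed[OF g(1), of "\<one>\<^bsub>R\<^esub>"] by (simp add: e_def)
  have ge: "g r = r \<odot>\<^bsub>E\<^esub> e" if "r \<in> carrier R" for r
    using mod_hom_smult[OF g(1), of r "\<one>\<^bsub>R\<^esub>"] that by (simp add: e_def)
  \<comment> \<open>The pair (y, e) is adjoined: e is the value that y must receive, and G' is
    generated by this pair and G.\<close>
  define G' where "G' = {(x \<oplus>\<^bsub>Y\<^esub> r \<odot>\<^bsub>Y\<^esub> y, u \<oplus>\<^bsub>E\<^esub> r \<odot>\<^bsub>E\<^esub> e) | x u r. (x, u) \<in> G \<and> r \<in> carrier R}"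
  have "partial_hom R Y E G'"
    unfolding partial_hom_def
  proof (intro conjI)
    show "G' \<subseteq> carrier Y \<times> carrier E"
      using Gc e y by (auto simp: G'_def Y.lsmult_closed E.lsmult_closed)
    have "(a \<oplus>\<^bsub>Y\<^esub> b, p \<oplus>\<^bsub>E\<^esub> q) \<in> G'" if ab: "(a, p) \<in> G'" "(b, q) \<in> G'" for a b p q
    proof -
      obtain x u r where 1: "(x, u) \<in> G" "r \<in> carrier R" "a = x \<oplus>\<^bsub>Y\<^esub> r \<odot>\<^bsub>Y\<^esub> y" "p = u \<oplus>\<^bsub>E\<^esub> r \<odot>\<^bsub>E\<^esub> e"
        using ab(1) by (auto simp: G'_def)
      obtain x' u' r' where 2: "(x', u') \<in> G" "r' \<in> carrier R" "b = x' \<oplus>\<^bsub>Y\<^esub> r' \<odot>\<^bsub>Y\<^esub> y" "q = u' \<oplus>\<^bsub>E\<^esub> r' \<odot>\<^bsub>E\<^esub> e"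
        using ab(2) by (auto simp: G'_def)
      have "a \<oplus>\<^bsub>Y\<^esub> b = (x \<oplus>\<^bsub>Y\<^esub> x') \<oplus>\<^bsub>Y\<^esub> (r \<oplus>\<^bsub>R\<^esub> r') \<odot>\<^bsub>Y\<^esub> y"
        using 1 2 Gc y by (simp add: Y.lsmult_l_distr Y.lsmult_closed Y.M.a_ac)
      moreover have "p \<oplus>\<^bsub>E\<^esub> q = (u \<oplus>\<^bsub>E\<^esub> u') \<oplus>\<^bsub>E\<^esub> (r \<oplus>\<^bsub>R\<^esub> r') \<odot>\<^bsub>E\<^esub> e"
        using 1 2 Gc e by (simp add: E.lsmult_l_distr E.lsmult_closed E.M.a_ac)
      ultimately show ?thesis using Ga[OF 1(1) 2(1)] 1(2) 2(2) unfolding G'_def by blast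
    qed
    then show "\<forall>(x, u)\<in>G'. \<forall>(x', u')\<in>G'. (x \<oplus>\<^bsub>Y\<^esub> x', u \<oplus>\<^bsub>E\<^esub> u') \<in> G'" by blast
    have "(s \<odot>\<^bsub>Y\<^esub> a, s \<odot>\<^bsub>E\<^esub> p) \<in> G'" if ab: "(a, p) \<in> G'" "s \<in> carrier R" for a p s
    proof -
      obtain x u r where 1: "(x, u) \<in> G" "r \<in> carrier R" "a = x \<oplus>\<^bsub>Y\<^esub> r \<odot>\<^bsub>Y\<^esub> y" "p = u \<oplus>\<^bsub>E\<^esub> r \<odot>\<^bsub>E\<^esub> e"
        using ab(1) by (auto simp: G'_def)
      have "s \<odot>\<^bsub>Y\<^esub> a = s \<odot>\<^bsub>Y\<^esub> x \<oplus>\<^bsub>Y\<^esub> (s \<otimes>\<^bsub>R\<^esub> r) \<odot>\<^bsub>Y\<^esub> y" "s \<odot>\<^bsub>E\<^esub> p = s \<odot>\<^bsub>E\<^esub> u \<oplus>\<^bsub>E\<^esub> (s \<otimes>\<^bsub>R\<^esub> r) \<odot>\<^bsub>E\<^esub> e"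
        using 1 Gc y e ab(2) by (simp_all add: Y.lsmult_r_distr Y.lsmult_closed Y.lsmult_assoc
            E.lsmult_r_distr E.lsmult_closed E.lsmult_assoc)
      then show ?thesis using Gs[OF 1(1) ab(2)] 1(2) ab(2) unfolding G'_def by blast
    qed
    then show "\<forall>s\<in>carrier R. \<forall>(x, u)\<in>G'. (s \<odot>\<^bsub>Y\<^esub> x, s \<odot>\<^bsub>E\<^esub> u) \<in> G'" by blast
    \<comment> \<open>If x + r y = 0, then r y = -x lies in the domain of G and is sent to -u; as r
      is in J, it is also sent to g r = r e. Hence u + r e = 0, and G' remains
      single-valued.\<close>
    have "p = \<zero>\<^bsub>E\<^esub>" if p: "(\<zero>\<^bsub>Y\<^esub>, p) \<in> G'" for p
    proof -
      obtain x u r where 1: "(x, u) \<in> G" "r \<in> carrier R" "\<zero>\<^bsub>Y\<^esub> = x \<oplus>\<^bsub>Y\<^esub> r \<odot>\<^bsub>Y\<^esub> y" "p = u \<oplus>\<^bsub>E\<^esub> r \<odot>\<^bsub>E\<^esub> e"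
        using p by (auto simp: G'_def)
      have "r \<odot>\<^bsub>Y\<^esub> y = \<ominus>\<^bsub>Y\<^esub> x"
        using 1 Gc y Y.M.minus_equality[of "r \<odot>\<^bsub>Y\<^esub> y" x] by (simp add: Y.lsmult_closed Y.M.a_comm)
      then have "(r \<odot>\<^bsub>Y\<^esub> y, \<ominus>\<^bsub>E\<^esub> u) \<in> G"
        using Gs[OF 1(1), of "\<ominus>\<^bsub>R\<^esub> \<one>\<^bsub>R\<^esub>"] Gc[OF 1(1)] by (simp add: Y.smult_minus_one E.smult_minus_one)
      then have "r \<odot>\<^bsub>E\<^esub> e = \<ominus>\<^bsub>E\<^esub> u" using ge[OF 1(2)] g(2)[of r] k 1(2) by (auto simp: J_def)
      then show ?thesis using 1 Gc by (simp add: E.M.r_neg)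
    qed
    then show "\<forall>p. (\<zero>\<^bsub>Y\<^esub>, p) \<in> G' \<longrightarrow> p = \<zero>\<^bsub>E\<^esub>" by blast
  qed
  moreover have "G \<subseteq> G'"
  proof
    fix z assume z: "z \<in> G"
    obtain x u where [simp]: "z = (x, u)" by (cases z)
    have "x = x \<oplus>\<^bsub>Y\<^esub> \<zero>\<^bsub>R\<^esub> \<odot>\<^bsub>Y\<^esub> y" "u = u \<oplus>\<^bsub>E\<^esub> \<zero>\<^bsub>R\<^esub> \<odot>\<^bsub>E\<^esub> e"
      using z Gc y e by (simp_all add: Y.smult_zero_left E.smult_zero_left)
    then show "z \<in> G'" using z Y.R.zero_closed unfolding G'_def by auto
  qed
  moreover have "(y, e) \<in> G'"
  proof -
    have "y = \<zero>\<^bsub>Y\<^esub> \<oplus>\<^bsub>Y\<^esub> \<one>\<^bsub>R\<^esub> \<odot>\<^bsub>Y\<^esub> y" "e = \<zero>\<^bsub>E\<^esub> \<oplus>\<^bsub>E\<^esub> \<one>\<^bsub>R\<^esub> \<odot>\<^bsub>E\<^esub> e"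
      using y e by (simp_all add: Y.lsmult_one E.lsmult_one)
    then show ?thesis using Gz Y.R.one_closed unfolding G'_def by blast
  qed
  ultimately show ?thesis using that by blast
qed

text \<open>Unlike in \<open>injective_module\<close>, the module Y may live over any type. It is
  applied to submodules of E and of A.\<close>

theorem injective_module_extension:
  assumes inj: "injective_module R E" and Y: "lmodule R Y" and X: "submodule X R Y"
    and f: "f \<in> mod_hom R (Y\<lparr>carrier := X\<rparr>) E"
  obtains g where "g \<in> mod_hom R Y E" "\<And>x. x \<in> X \<Longrightarrow> g x = f x"
proof -
  interpret Y: lmodule R Y by fact
  interpret E: lmodule R E using inj by (simp add: injective_module_def)
  interpret X: lmodule R "Y\<lparr>carrier := X\<rparr>" using X by (rule Y.submodule_lmodule)
  define F where "F = (\<lambda>x. (x, f x)) ` X"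
  have XY: "X \<subseteq> carrier Y" "\<zero>\<^bsub>Y\<^esub> \<in> X" using X by (auto simp: Y.submodule_iff)
  have F: "partial_hom R Y E F"
    unfolding partial_hom_def F_def
    using X mod_hom_closed[OF f] mod_hom_add[OF f] mod_hom_smult[OF f]
      mod_hom_zero[OF X.lmodule_axioms E.lmodule_axioms f]
    by (auto simp: Y.submodule_iff image_iff)
  define S where "S = {G. partial_hom R Y E G \<and> F \<subseteq> G}"
  have "\<exists>U\<in>S. \<forall>G\<in>C. G \<subseteq> U" if C: "C \<in> chains S" for C
  proof (cases "C = {}")
    case True
    then show ?thesis using F by (auto simp: S_def)
  next
    case False
    have CS: "C \<subseteq> S" and ch: "\<And>G G'. \<lbrakk>G \<in> C; G' \<in> C\<rbrakk> \<Longrightarrow> G \<subseteq> G' \<or> G' \<subseteq> G"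
      using C by (auto simp: chains_def chain_subset_def)
    have P: "partial_hom R Y E G" if "G \<in> C" for G using that CS by (auto simp: S_def)
    have "partial_hom R Y E (\<Union>C)"
      unfolding partial_hom_def
    proof (intro conjI)
      show "\<Union>C \<subseteq> carrier Y \<times> carrier E" using P by (fastforce simp: partial_hom_def)
      have "(x \<oplus>\<^bsub>Y\<^esub> y, u \<oplus>\<^bsub>E\<^esub> v) \<in> \<Union>C" if "(x, u) \<in> \<Union>C" "(y, v) \<in> \<Union>C" for x y u v
      proof -
        obtain G where G: "G \<in> C" "(x, u) \<in> G" "(y, v) \<in> G"
          using \<open>(x, u) \<in> \<Union>C\<close> \<open>(y, v) \<in> \<Union>C\<close> ch by blast
        then show ?thesis using P[OF G(1)] unfolding partial_hom_def by blast
      qed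
      then show "\<forall>(x, u)\<in>\<Union>C. \<forall>(y, v)\<in>\<Union>C. (x \<oplus>\<^bsub>Y\<^esub> y, u \<oplus>\<^bsub>E\<^esub> v) \<in> \<Union>C" by blast
      have "(r \<odot>\<^bsub>Y\<^esub> x, r \<odot>\<^bsub>E\<^esub> u) \<in> \<Union>C" if "(x, u) \<in> \<Union>C" "r \<in> carrier R" for x u r
        using that P unfolding partial_hom_def by blast
      then show "\<forall>r\<in>carrier R. \<forall>(x, u)\<in>\<Union>C. (r \<odot>\<^bsub>Y\<^esub> x, r \<odot>\<^bsub>E\<^esub> u) \<in> \<Union>C" by blast
      show "\<forall>u. (\<zero>\<^bsub>Y\<^esub>, u) \<in> \<Union>C \<longrightarrow> u = \<zero>\<^bsub>E\<^esub>" using P unfolding partial_hom_def by blast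
    qed
    then show ?thesis using False CS by (intro bexI[of _ "\<Union>C"]) (auto simp: S_def)
  qed
  then obtain G where G: "G \<in> S" "\<And>G'. \<lbrakk>G' \<in> S; G \<subseteq> G'\<rbrakk> \<Longrightarrow> G' = G"
    using Zorn_Lemma2[of S] by meson
  have Gp: "partial_hom R Y E G" and FG: "F \<subseteq> G" using G(1) by (auto simp: S_def)
  have ne: "G \<noteq> {}" using FG XY by (auto simp: F_def)
  have dom: "\<exists>e. (y, e) \<in> G" if y: "y \<in> carrier Y" for y
  proof -
    obtain G' e where "partial_hom R Y E G'" "G \<subseteq> G'" "(y, e) \<in> G'"
      using baer_step[OF inj Y Gp ne y] .
    then show ?thesis using G(2)[of G'] FG by (auto simp: S_def)
  qed
  define g where "g y = (THE e. (y, e) \<in> G)" for y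
  have g: "g y = e" if "(y, e) \<in> G" for y e
    unfolding g_def using that partial_hom_unique[OF Y E.lmodule_axioms Gp] by blast
  have gG: "(y, g y) \<in> G" if "y \<in> carrier Y" for y using dom[OF that] g by auto
  show ?thesis
  proof
    show "g \<in> mod_hom R Y E"
    proof (rule mod_homI)
      show "g y \<in> carrier E" if "y \<in> carrier Y" for y
        using gG[OF that] Gp by (auto simp: partial_hom_def)
      show "g (x \<oplus>\<^bsub>Y\<^esub> y) = g x \<oplus>\<^bsub>E\<^esub> g y" if "x \<in> carrier Y" "y \<in> carrier Y" for x y
        using gG[OF that(1)] gG[OF that(2)] Gp unfolding partial_hom_def by (intro g) blast
      show "g (r \<odot>\<^bsub>Y\<^esub> x) = r \<odot>\<^bsub>E\<^esub> g x" if "r \<in> carrier R" "x \<in> carrier Y" for r x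
        using gG[OF that(2)] that(1) Gp unfolding partial_hom_def by (intro g) blast
    qed
    show "g x = f x" if "x \<in> X" for x using FG that by (intro g) (auto simp: F_def)
  qed
qed

section \<open>Tensor products\<close>

text \<open>The linear extension of \<gamma> from the basis to the free module.
  \<open>tensor_lift\<close> is this map evaluated at a chosen representative of the tensor.\<close>

definition free_lift ::
    "('k, 'm) ring_scheme \<Rightarrow> ('k, 'c, 'n) module_scheme \<Rightarrow> ('x \<Rightarrow> 'c) \<Rightarrow> ('x \<Rightarrow> 'k) \<Rightarrow> 'c"
  where "free_lift K P \<gamma> f = (\<Oplus>\<^bsub>P\<^esub>p\<in>{p. f p \<noteq> \<zero>\<^bsub>K\<^esub>}. f p \<odot>\<^bsub>P\<^esub> \<gamma> p)"

lemma free_module_simps [simp]: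
  "zero (free_module K X) = (\<lambda>x. \<zero>\<^bsub>K\<^esub>)"
  "f \<oplus>\<^bsub>free_module K X\<^esub> g = (\<lambda>x. f x \<oplus>\<^bsub>K\<^esub> g x)"
  "c \<odot>\<^bsub>free_module K X\<^esub> f = (\<lambda>x. c \<otimes>\<^bsub>K\<^esub> f x)"
  by (simp_all add: free_module_def)

lemma free_module_carrier:
  "f \<in> carrier (free_module K X) \<longleftrightarrow>
    (\<forall>x. f x \<in> carrier K) \<and> finite {x. f x \<noteq> \<zero>\<^bsub>K\<^esub>} \<and> {x. f x \<noteq> \<zero>\<^bsub>K\<^esub>} \<subseteq> X"
  by (simp add: free_module_def)

context cring
begin

lemma free_module_module: "module R (free_module R X)"
proof (rule moduleI)
  show "abelian_group (free_module R X)"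
  proof (rule abelian_groupI, goal_cases)
    case (1 f g)
    have "{x. f x \<oplus> g x \<noteq> \<zero>} \<subseteq> {x. f x \<noteq> \<zero>} \<union> {x. g x \<noteq> \<zero>}" by auto
    then show ?case using 1 by (auto simp: free_module_carrier intro: finite_subset)
  next
    case (3 f g h) then show ?case by (simp add: free_module_carrier a_assoc)
  next
    case (4 f g) then show ?case by (simp add: free_module_carrier a_comm)
  next
    case (6 f)
    have "{x. \<ominus> f x \<noteq> \<zero>} \<subseteq> {x. f x \<noteq> \<zero>}" by auto
    then have "(\<lambda>x. \<ominus> f x) \<in> carrier (free_module R X)"
      using 6 by (auto simp: free_module_carrier intro: finite_subset)
    moreover have "(\<lambda>x. \<ominus> f x) \<oplus>\<^bsub>free_module R X\<^esub> f = \<zero>\<^bsub>free_module R X\<^esub>"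
      using 6 by (simp add: free_module_carrier l_neg)
    ultimately show ?case by blast
  qed (auto simp: free_module_carrier)
next
  fix c f assume cf: "c \<in> carrier R" "f \<in> carrier (free_module R X)"
  have "{x. c \<otimes> f x \<noteq> \<zero>} \<subseteq> {x. f x \<noteq> \<zero>}" using cf by auto
  then show "c \<odot>\<^bsub>free_module R X\<^esub> f \<in> carrier (free_module R X)"
    using cf by (auto simp: free_module_carrier intro: finite_subset)
qed (auto simp: free_module_carrier l_distr r_distr m_assoc intro: cring_axioms)

lemma unit_vector_carrier: "x \<in> X \<Longrightarrow> unit_vector R x \<in> carrier (free_module R X)"
  by (auto simp: free_module_carrier unit_vector_def)

lemma free_module_induct [consumes 1, case_names zero add]:
  assumes f: "f \<in> carrier (free_module R X)"
    and zero: "P (\<lambda>x. \<zero>)"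
    and add: "\<And>f c x. \<lbrakk>f \<in> carrier (free_module R X); c \<in> carrier R; x \<in> X; P f\<rbrakk> \<Longrightarrow>
      P (f \<oplus>\<^bsub>free_module R X\<^esub> c \<odot>\<^bsub>free_module R X\<^esub> unit_vector R x)"
  shows "P f"
proof -
  have "finite S \<Longrightarrow> f \<in> carrier (free_module R X) \<Longrightarrow> {x. f x \<noteq> \<zero>} \<subseteq> S \<Longrightarrow> P f" for S f
  proof (induction S arbitrary: f rule: finite_induct)
    case empty
    then have "f = (\<lambda>x. \<zero>)" by auto
    then show ?case using zero by simp
  next
    case (insert x S)
    show ?case
    proof (cases "f x = \<zero>")
      case True
      then show ?thesis using insert by (intro insert.IH) auto
    next
      case False
      let ?g = "f(x := \<zero>)"
      have "{y. ?g y \<noteq> \<zero>} \<subseteq> {y. f y \<noteq> \<zero>}" by auto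
      then have g: "?g \<in> carrier (free_module R X)" "{y. ?g y \<noteq> \<zero>} \<subseteq> S"
        using insert.prems by (auto simp: free_module_carrier intro: finite_subset)
      have "f = ?g \<oplus>\<^bsub>free_module R X\<^esub> f x \<odot>\<^bsub>free_module R X\<^esub> unit_vector R x"
        using insert.prems(1) by (auto simp: free_module_carrier unit_vector_def fun_eq_iff)
      then show ?thesis
        using add[OF g(1) _ _ insert.IH[OF g], of "f x" x] insert.prems(1) False
        by (auto simp: free_module_carrier)
    qed
  qed
  then show ?thesis using f by (auto simp: free_module_carrier)
qed

end

text \<open>Sums and multiples can have smaller supports than their arguments, so values are
  compared over a common finite set, on which the additional summands vanish.\<close>

lemma free_lift_superset:
  assumes "module K P" "f \<in> carrier (free_module K X)" "\<gamma> \<in> X \<rightarrow> carrier P"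
    and "finite S" "S \<subseteq> X" "{x. f x \<noteq> \<zero>\<^bsub>K\<^esub>} \<subseteq> S"
  shows "free_lift K P \<gamma> f = (\<Oplus>\<^bsub>P\<^esub>x\<in>S. f x \<odot>\<^bsub>P\<^esub> \<gamma> x)"
proof -
  interpret P: module K P by fact
  show ?thesis
    unfolding free_lift_def
    by (rule P.M.add.finprod_mono_neutral_cong_left)
      (use assms in \<open>auto simp: free_module_carrier Pi_def subset_iff\<close>)
qed

lemma free_lift_hom:
  assumes "module K P" "\<gamma> \<in> X \<rightarrow> carrier P"
  shows "free_lift K P \<gamma> \<in> mod_hom K (free_module K X) P"
proof -
  interpret P: module K P by fact
  note sup = free_lift_superset[OF assms(1) _ assms(2)]
  have supp: "finite {x. f x \<noteq> \<zero>\<^bsub>K\<^esub>}" "{x. f x \<noteq> \<zero>\<^bsub>K\<^esub>} \<subseteq> X" "\<And>x. f x \<in> carrier K"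
    if "f \<in> carrier (free_module K X)" for f using that by (auto simp: free_module_carrier)
  interpret F: module K "free_module K X" by (rule P.R.free_module_module)
  show ?thesis
  proof (rule mod_homI)
    fix f assume f: "f \<in> carrier (free_module K X)"
    show "free_lift K P \<gamma> f \<in> carrier P"
      unfolding free_lift_def using supp[OF f] assms(2) by (intro P.M.finsum_closed) (auto simp: Pi_def subset_iff)
    {
      fix g assume g: "g \<in> carrier (free_module K X)"
      let ?S = "{x. f x \<noteq> \<zero>\<^bsub>K\<^esub>} \<union> {x. g x \<noteq> \<zero>\<^bsub>K\<^esub>}"
      have S: "finite ?S" "?S \<subseteq> X" using supp[OF f] supp[OF g] by auto
      have \<gamma>: "\<gamma> x \<in> carrier P" if "x \<in> ?S" for x using that S(2) assms(2) by blast
      have fg: "f \<oplus>\<^bsub>free_module K X\<^esub> g \<in> carrier (free_module K X)" using f g by (rule F.M.a_closed)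
      have "free_lift K P \<gamma> (f \<oplus>\<^bsub>free_module K X\<^esub> g) = (\<Oplus>\<^bsub>P\<^esub>x\<in>?S. (f x \<oplus>\<^bsub>K\<^esub> g x) \<odot>\<^bsub>P\<^esub> \<gamma> x)"
      proof -
        have "{x. f x \<oplus>\<^bsub>K\<^esub> g x \<noteq> \<zero>\<^bsub>K\<^esub>} \<subseteq> ?S" by auto
        then show ?thesis using sup[OF fg S] by simp
      qed
      also have "\<dots> = (\<Oplus>\<^bsub>P\<^esub>x\<in>?S. f x \<odot>\<^bsub>P\<^esub> \<gamma> x \<oplus>\<^bsub>P\<^esub> g x \<odot>\<^bsub>P\<^esub> \<gamma> x)"
        using \<gamma> supp(3)[OF f] supp(3)[OF g] by (intro P.M.finsum_cong') (auto simp: P.smult_l_distr)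
      also have "\<dots> = (\<Oplus>\<^bsub>P\<^esub>x\<in>?S. f x \<odot>\<^bsub>P\<^esub> \<gamma> x) \<oplus>\<^bsub>P\<^esub> (\<Oplus>\<^bsub>P\<^esub>x\<in>?S. g x \<odot>\<^bsub>P\<^esub> \<gamma> x)"
        using \<gamma> supp(3)[OF f] supp(3)[OF g] by (intro P.M.finsum_addf) auto
      also have "\<dots> = free_lift K P \<gamma> f \<oplus>\<^bsub>P\<^esub> free_lift K P \<gamma> g" using sup[OF f S] sup[OF g S] by auto
      finally show "free_lift K P \<gamma> (f \<oplus>\<^bsub>free_module K X\<^esub> g) = free_lift K P \<gamma> f \<oplus>\<^bsub>P\<^esub> free_lift K P \<gamma> g" .
    }
    fix c assume c: "c \<in> carrier K"
    let ?S = "{x. f x \<noteq> \<zero>\<^bsub>K\<^esub>}"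
    have S: "finite ?S" "?S \<subseteq> X" using supp[OF f] by auto
    have \<gamma>: "\<gamma> x \<in> carrier P" if "x \<in> ?S" for x using that S(2) assms(2) by blast
    have cf: "c \<odot>\<^bsub>free_module K X\<^esub> f \<in> carrier (free_module K X)" using c f by (rule F.smult_closed)
    have "free_lift K P \<gamma> (c \<odot>\<^bsub>free_module K X\<^esub> f) = (\<Oplus>\<^bsub>P\<^esub>x\<in>?S. (c \<otimes>\<^bsub>K\<^esub> f x) \<odot>\<^bsub>P\<^esub> \<gamma> x)"
    proof -
      have "{x. c \<otimes>\<^bsub>K\<^esub> f x \<noteq> \<zero>\<^bsub>K\<^esub>} \<subseteq> ?S" using c by auto
      then show ?thesis using sup[OF cf S] by simp
    qed
    also have "\<dots> = (\<Oplus>\<^bsub>P\<^esub>x\<in>?S. c \<odot>\<^bsub>P\<^esub> (f x \<odot>\<^bsub>P\<^esub> \<gamma> x))"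
      using \<gamma> supp(3)[OF f] c by (intro P.M.finsum_cong') (auto simp: P.smult_assoc1)
    also have "\<dots> = c \<odot>\<^bsub>P\<^esub> free_lift K P \<gamma> f"
      unfolding free_lift_def using S(1) c \<gamma> supp(3)[OF f]
      by (intro P.finsum_smult_ldistr[symmetric]) auto
    finally show "free_lift K P \<gamma> (c \<odot>\<^bsub>free_module K X\<^esub> f) = c \<odot>\<^bsub>P\<^esub> free_lift K P \<gamma> f" .
  qed
qed

lemma free_lift_unit_vector:
  assumes "module K P" "\<gamma> \<in> X \<rightarrow> carrier P" "x \<in> X"
  shows "free_lift K P \<gamma> (unit_vector K x) = \<gamma> x"
proof -
  interpret P: module K P by fact
  have \<gamma>: "\<gamma> x \<in> carrier P" using assms(2,3) by auto
  have "free_lift K P \<gamma> (unit_vector K x) = (\<Oplus>\<^bsub>P\<^esub>y\<in>{x}. unit_vector K x y \<odot>\<^bsub>P\<^esub> \<gamma> y)"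
    using assms by (intro free_lift_superset[OF _ P.R.unit_vector_carrier]) (auto simp: unit_vector_def)
  also have "\<dots> = \<gamma> x" using \<gamma> by (simp add: P.M.finsum_insert unit_vector_def)
  finally show ?thesis .
qed

text \<open>Linearity in each variable is phrased by \<open>mod_hom\<close>, so that it can be
  derived by composing rules for one variable at a time.\<close>

definition bilinear ::
    "('k, 'm) ring_scheme \<Rightarrow> ('k, 'a, 'n) module_scheme \<Rightarrow> ('k, 'b, 'p) module_scheme \<Rightarrow>
      ('k, 'c, 'q) module_scheme \<Rightarrow> ('a \<Rightarrow> 'b \<Rightarrow> 'c) \<Rightarrow> bool"
  where "bilinear K M N P \<beta> \<longleftrightarrow>
    (\<forall>x\<in>carrier M. (\<lambda>y. \<beta> x y) \<in> mod_hom K N P) \<and> (\<forall>y\<in>carrier N. (\<lambda>x. \<beta> x y) \<in> mod_hom K M P)"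

lemma bilinearI:
  assumes "\<And>x. x \<in> carrier M \<Longrightarrow> (\<lambda>y. \<beta> x y) \<in> mod_hom K N P"
    and "\<And>y. y \<in> carrier N \<Longrightarrow> (\<lambda>x. \<beta> x y) \<in> mod_hom K M P"
  shows "bilinear K M N P \<beta>"
  using assms by (simp add: bilinear_def)

lemma bilinear_closed:
  "\<lbrakk>bilinear K M N P \<beta>; x \<in> carrier M; y \<in> carrier N\<rbrakk> \<Longrightarrow> \<beta> x y \<in> carrier P"
  using mod_hom_closed by (fastforce simp: bilinear_def)

lemma bilinear_left: "\<lbrakk>bilinear K M N P \<beta>; y \<in> carrier N\<rbrakk> \<Longrightarrow> (\<lambda>x. \<beta> x y) \<in> mod_hom K M P"
  by (simp add: bilinear_def)

lemma bilinear_right: "\<lbrakk>bilinear K M N P \<beta>; x \<in> carrier M\<rbrakk> \<Longrightarrow> (\<lambda>y. \<beta> x y) \<in> mod_hom K N P"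
  by (simp add: bilinear_def)

locale tensor_pair = Ms: module K M + Ns: module K N
  for K :: "('k, 'm) ring_scheme" and M :: "('k, 'a, 'n) module_scheme" and N :: "('k, 'b, 'p) module_scheme"
begin

abbreviation F where "F \<equiv> free_module K (carrier M \<times> carrier N)"
abbreviation T where "T \<equiv> tensor_module K M N"
abbreviation null where "null \<equiv> tensor_null K M N"
abbreviation e where "e \<equiv> unit_vector K"

sublocale Fm: module K F
  by (rule Ms.R.free_module_module)

sublocale Fl: lmodule K F
  by (rule module_imp_lmodule) (rule Fm.module_axioms)

lemma e_closed: "\<lbrakk>x \<in> carrier M; y \<in> carrier N\<rbrakk> \<Longrightarrow> e (x, y) \<in> carrier F"
  by (rule Ms.R.unit_vector_carrier) simp

lemma relator_iff:
  "r \<in> bilinear_relators K M N \<longleftrightarrow>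
    (\<exists>x x' y. r = e (x \<oplus>\<^bsub>M\<^esub> x', y) \<ominus>\<^bsub>F\<^esub> (e (x, y) \<oplus>\<^bsub>F\<^esub> e (x', y)) \<and>
      x \<in> carrier M \<and> x' \<in> carrier M \<and> y \<in> carrier N) \<or>
    (\<exists>x y y'. r = e (x, y \<oplus>\<^bsub>N\<^esub> y') \<ominus>\<^bsub>F\<^esub> (e (x, y) \<oplus>\<^bsub>F\<^esub> e (x, y')) \<and>
      x \<in> carrier M \<and> y \<in> carrier N \<and> y' \<in> carrier N) \<or>
    (\<exists>c x y. r = e (c \<odot>\<^bsub>M\<^esub> x, y) \<ominus>\<^bsub>F\<^esub> (c \<odot>\<^bsub>F\<^esub> e (x, y)) \<and>
      c \<in> carrier K \<and> x \<in> carrier M \<and> y \<in> carrier N) \<or>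
    (\<exists>c x y. r = e (x, c \<odot>\<^bsub>N\<^esub> y) \<ominus>\<^bsub>F\<^esub> (c \<odot>\<^bsub>F\<^esub> e (x, y)) \<and>
      c \<in> carrier K \<and> x \<in> carrier M \<and> y \<in> carrier N)"
  by (simp only: bilinear_relators_def Let_def Un_iff mem_Collect_eq disj_assoc)

lemma relatorI:
  "\<lbrakk>x \<in> carrier M; x' \<in> carrier M; y \<in> carrier N\<rbrakk> \<Longrightarrow>
    e (x \<oplus>\<^bsub>M\<^esub> x', y) \<ominus>\<^bsub>F\<^esub> (e (x, y) \<oplus>\<^bsub>F\<^esub> e (x', y)) \<in> bilinear_relators K M N"
  "\<lbrakk>x \<in> carrier M; y \<in> carrier N; y' \<in> carrier N\<rbrakk> \<Longrightarrow>
    e (x, y \<oplus>\<^bsub>N\<^esub> y') \<ominus>\<^bsub>F\<^esub> (e (x, y) \<oplus>\<^bsub>F\<^esub> e (x, y')) \<in> bilinear_relators K M N"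
  "\<lbrakk>c \<in> carrier K; x \<in> carrier M; y \<in> carrier N\<rbrakk> \<Longrightarrow>
    e (c \<odot>\<^bsub>M\<^esub> x, y) \<ominus>\<^bsub>F\<^esub> (c \<odot>\<^bsub>F\<^esub> e (x, y)) \<in> bilinear_relators K M N"
  "\<lbrakk>c \<in> carrier K; x \<in> carrier M; y \<in> carrier N\<rbrakk> \<Longrightarrow>
    e (x, c \<odot>\<^bsub>N\<^esub> y) \<ominus>\<^bsub>F\<^esub> (c \<odot>\<^bsub>F\<^esub> e (x, y)) \<in> bilinear_relators K M N"
  unfolding relator_iff by metis+

lemma relators_closed: "bilinear_relators K M N \<subseteq> carrier F"
proof -
  have 1: "e (x, y) \<ominus>\<^bsub>F\<^esub> g \<in> carrier F" if "x \<in> carrier M" "y \<in> carrier N" "g \<in> carrier F" for x y g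
    using that by (intro Fm.M.minus_closed e_closed)
  show ?thesis
    using 1 Ms.M.a_closed Ns.M.a_closed Ms.smult_closed Ns.smult_closed Fm.M.a_closed Fm.smult_closed e_closed
    by (intro subsetI) (unfold relator_iff, elim disjE exE conjE; metis)
qed

lemma null_submodule: "submodule null K F"
  unfolding tensor_null_def by (rule Fl.generated_submodule_submodule[OF relators_closed])

lemma relators_null: "bilinear_relators K M N \<subseteq> null"
  unfolding tensor_null_def by (rule Fl.generated_submodule_superset)

lemma tensor_module_module: "module K T"
  unfolding tensor_module_def
  by (rule module_surj[OF Fm.module_axioms Fl.quotient_module_simps(1)[OF null_submodule]])
    (simp_all add: Fl.quotient_module_simps[OF null_submodule] del: free_module_simps)

sublocale Tm: module K T
  by (rule tensor_module_module)

lemma coset_hom: "(\<lambda>f. null +>\<^bsub>F\<^esub> f) \<in> mod_hom K F T"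
  unfolding tensor_module_def by (rule Fl.quotient_hom[OF null_submodule])

lemma T_carrier: "carrier T = (\<lambda>f. null +>\<^bsub>F\<^esub> f) ` carrier F"
  unfolding tensor_module_def by (rule Fl.quotient_module_simps(1)[OF null_submodule])

lemma tensor_closed: "\<lbrakk>x \<in> carrier M; y \<in> carrier N\<rbrakk> \<Longrightarrow> tensor K M N x y \<in> carrier T"
  unfolding tensor_def using mod_hom_closed[OF coset_hom e_closed] .

lemma coset_relator:
  assumes "f \<ominus>\<^bsub>F\<^esub> g \<in> bilinear_relators K M N" "f \<in> carrier F" "g \<in> carrier F"
  shows "null +>\<^bsub>F\<^esub> f = null +>\<^bsub>F\<^esub> g"
  using assms relators_null Fl.coset_eq_iff[OF null_submodule] by blast

lemma tensor_bilinear: "bilinear K M N T (tensor K M N)"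
proof (rule bilinearI)
  fix x assume x: "x \<in> carrier M"
  show "(\<lambda>y. tensor K M N x y) \<in> mod_hom K N T"
  proof (rule mod_homI)
    show "tensor K M N x y \<in> carrier T" if "y \<in> carrier N" for y using x that by (rule tensor_closed)
    show "tensor K M N x (y \<oplus>\<^bsub>N\<^esub> y') = tensor K M N x y \<oplus>\<^bsub>T\<^esub> tensor K M N x y'"
      if y: "y \<in> carrier N" "y' \<in> carrier N" for y y'
    proof -
      have "null +>\<^bsub>F\<^esub> e (x, y \<oplus>\<^bsub>N\<^esub> y') = null +>\<^bsub>F\<^esub> (e (x, y) \<oplus>\<^bsub>F\<^esub> e (x, y'))"
        using x y by (intro coset_relator[OF relatorI(2)] e_closed Fm.M.a_closed Ns.M.a_closed)
      also have "\<dots> = (null +>\<^bsub>F\<^esub> e (x, y)) \<oplus>\<^bsub>T\<^esub> (null +>\<^bsub>F\<^esub> e (x, y'))"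
        using x y by (intro mod_hom_add[OF coset_hom] e_closed)
      finally show ?thesis by (simp add: tensor_def)
    qed
    show "tensor K M N x (c \<odot>\<^bsub>N\<^esub> y) = c \<odot>\<^bsub>T\<^esub> tensor K M N x y"
      if y: "c \<in> carrier K" "y \<in> carrier N" for c y
    proof -
      have "null +>\<^bsub>F\<^esub> e (x, c \<odot>\<^bsub>N\<^esub> y) = null +>\<^bsub>F\<^esub> (c \<odot>\<^bsub>F\<^esub> e (x, y))"
        using x y by (intro coset_relator[OF relatorI(4)] e_closed Fm.smult_closed Ns.smult_closed)
      also have "\<dots> = c \<odot>\<^bsub>T\<^esub> (null +>\<^bsub>F\<^esub> e (x, y))"
        using x y by (intro mod_hom_smult[OF coset_hom] e_closed)
      finally show ?thesis by (simp add: tensor_def)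
    qed
  qed
next
  fix y assume y: "y \<in> carrier N"
  show "(\<lambda>x. tensor K M N x y) \<in> mod_hom K M T"
  proof (rule mod_homI)
    show "tensor K M N x y \<in> carrier T" if "x \<in> carrier M" for x using that y by (rule tensor_closed)
    show "tensor K M N (x \<oplus>\<^bsub>M\<^esub> x') y = tensor K M N x y \<oplus>\<^bsub>T\<^esub> tensor K M N x' y"
      if x: "x \<in> carrier M" "x' \<in> carrier M" for x x'
    proof -
      have "null +>\<^bsub>F\<^esub> e (x \<oplus>\<^bsub>M\<^esub> x', y) = null +>\<^bsub>F\<^esub> (e (x, y) \<oplus>\<^bsub>F\<^esub> e (x', y))"
        using x y by (intro coset_relator[OF relatorI(1)] e_closed Fm.M.a_closed Ms.M.a_closed)
      also have "\<dots> = (null +>\<^bsub>F\<^esub> e (x, y)) \<oplus>\<^bsub>T\<^esub> (null +>\<^bsub>F\<^esub> e (x', y))"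
        using x y by (intro mod_hom_add[OF coset_hom] e_closed)
      finally show ?thesis by (simp add: tensor_def)
    qed
    show "tensor K M N (c \<odot>\<^bsub>M\<^esub> x) y = c \<odot>\<^bsub>T\<^esub> tensor K M N x y"
      if x: "c \<in> carrier K" "x \<in> carrier M" for c x
    proof -
      have "null +>\<^bsub>F\<^esub> e (c \<odot>\<^bsub>M\<^esub> x, y) = null +>\<^bsub>F\<^esub> (c \<odot>\<^bsub>F\<^esub> e (x, y))"
        using x y by (intro coset_relator[OF relatorI(3)] e_closed Fm.smult_closed Ms.smult_closed)
      also have "\<dots> = c \<odot>\<^bsub>T\<^esub> (null +>\<^bsub>F\<^esub> e (x, y))"
        using x y by (intro mod_hom_smult[OF coset_hom] e_closed)
      finally show ?thesis by (simp add: tensor_def)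
    qed
  qed
qed

text \<open>A scalar multiple of a pure tensor is again pure, because the scalar moves into the
  first factor; hence closure under sums is enough.\<close>

lemma tensor_induct [consumes 1, case_names tensor add]:
  assumes t: "t \<in> carrier T"
    and tensor: "\<And>x y. \<lbrakk>x \<in> carrier M; y \<in> carrier N\<rbrakk> \<Longrightarrow> P (tensor K M N x y)"
    and add: "\<And>t u. \<lbrakk>t \<in> carrier T; u \<in> carrier T; P t; P u\<rbrakk> \<Longrightarrow> P (t \<oplus>\<^bsub>T\<^esub> u)"
  shows "P t"
proof -
  obtain f where f: "f \<in> carrier F" "t = null +>\<^bsub>F\<^esub> f" using t unfolding T_carrier by blast
  from f(1) have "P (null +>\<^bsub>F\<^esub> f)"
  proof (induction rule: Ms.R.free_module_induct)
    case zero
    have "tensor K M N \<zero>\<^bsub>M\<^esub> \<zero>\<^bsub>N\<^esub> = \<zero>\<^bsub>T\<^esub>"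
      by (rule mod_hom_zero[OF module_imp_lmodule[OF Ms.module_axioms] module_imp_lmodule[OF Tm.module_axioms]
          bilinear_left[OF tensor_bilinear Ns.M.zero_closed]])
    moreover have "null +>\<^bsub>F\<^esub> \<zero>\<^bsub>F\<^esub> = \<zero>\<^bsub>T\<^esub>"
      by (rule mod_hom_zero[OF Fl.lmodule_axioms module_imp_lmodule[OF Tm.module_axioms] coset_hom])
    ultimately show ?case using tensor[of "\<zero>\<^bsub>M\<^esub>" "\<zero>\<^bsub>N\<^esub>"] by simp
  next
    case (add f c z)
    obtain x y where z: "z = (x, y)" "x \<in> carrier M" "y \<in> carrier N" using add(3) by auto
    have "null +>\<^bsub>F\<^esub> (f \<oplus>\<^bsub>F\<^esub> c \<odot>\<^bsub>F\<^esub> e z) = (null +>\<^bsub>F\<^esub> f) \<oplus>\<^bsub>T\<^esub> c \<odot>\<^bsub>T\<^esub> tensor K M N x y"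
      using add(1,2) z mod_hom_add[OF coset_hom] mod_hom_smult[OF coset_hom]
      by (simp add: tensor_def e_closed del: free_module_simps)
    also have "\<dots> = (null +>\<^bsub>F\<^esub> f) \<oplus>\<^bsub>T\<^esub> tensor K M N (c \<odot>\<^bsub>M\<^esub> x) y"
      using add(2) z mod_hom_smult[OF bilinear_left[OF tensor_bilinear]] by simp
    finally show ?case
      using add(1,2,4) z assms(3)[of "null +>\<^bsub>F\<^esub> f" "tensor K M N (c \<odot>\<^bsub>M\<^esub> x) y"] tensor
        mod_hom_closed[OF coset_hom] by (simp add: tensor_closed del: free_module_simps)
  qed
  then show ?thesis by (simp add: f)
qed

context
  fixes P :: "('k, 'c, 'q) module_scheme" and \<beta>
  assumes P: "module K P" and \<beta>: "bilinear K M N P \<beta>"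
begin

text \<open>The kernel of the linear extension is a submodule, and bilinearity says precisely that
  it contains the four families of relators.\<close>

lemma free_lift_null:
  assumes "f \<in> null" shows "free_lift K P (\<lambda>p. \<beta> (fst p) (snd p)) f = \<zero>\<^bsub>P\<^esub>"
proof -
  interpret P: module K P by fact
  interpret Pl: lmodule K P by (rule module_imp_lmodule[OF P])
  let ?\<gamma> = "\<lambda>p. \<beta> (fst p) (snd p)" and ?L = "free_lift K P (\<lambda>p. \<beta> (fst p) (snd p))"
  have \<gamma>: "?\<gamma> \<in> carrier M \<times> carrier N \<rightarrow> carrier P" using bilinear_closed[OF \<beta>] by auto
  have L: "?L \<in> mod_hom K F P" by (rule free_lift_hom[OF P \<gamma>])
  have Le: "?L (e (x, y)) = \<beta> x y" if "x \<in> carrier M" "y \<in> carrier N" for x y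
    using free_lift_unit_vector[OF P \<gamma>, of "(x, y)"] that by simp
  note minus = mod_hom_minus[OF Fl.lmodule_axioms Pl.lmodule_axioms L]
  have diff: "z \<ominus>\<^bsub>P\<^esub> z = \<zero>\<^bsub>P\<^esub>" if "z \<in> carrier P" for z using that by (simp add: a_minus_def P.M.r_neg)
  have "?L r = \<zero>\<^bsub>P\<^esub>" if r: "r \<in> bilinear_relators K M N" for r
  proof -
    consider (1) x x' y where "x \<in> carrier M" "x' \<in> carrier M" "y \<in> carrier N"
        "r = e (x \<oplus>\<^bsub>M\<^esub> x', y) \<ominus>\<^bsub>F\<^esub> (e (x, y) \<oplus>\<^bsub>F\<^esub> e (x', y))"
      | (2) x y y' where "x \<in> carrier M" "y' \<in> carrier N" "y \<in> carrier N"
        "r = e (x, y \<oplus>\<^bsub>N\<^esub> y') \<ominus>\<^bsub>F\<^esub> (e (x, y) \<oplus>\<^bsub>F\<^esub> e (x, y'))"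
      | (3) x c y where "x \<in> carrier M" "c \<in> carrier K" "y \<in> carrier N"
        "r = e (c \<odot>\<^bsub>M\<^esub> x, y) \<ominus>\<^bsub>F\<^esub> (c \<odot>\<^bsub>F\<^esub> e (x, y))"
      | (4) x c y where "x \<in> carrier M" "c \<in> carrier K" "y \<in> carrier N"
        "r = e (x, c \<odot>\<^bsub>N\<^esub> y) \<ominus>\<^bsub>F\<^esub> (c \<odot>\<^bsub>F\<^esub> e (x, y))"
      using r[unfolded relator_iff] by (elim disjE exE conjE) (erule that; assumption)+
    then show ?thesis
    proof cases
      case 1
      then show ?thesis
        using mod_hom_add[OF bilinear_left[OF \<beta>]] bilinear_closed[OF \<beta>]
        by (simp add: minus e_closed mod_hom_add[OF L] Le diff del: free_module_simps)
    next
      case 2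
      then show ?thesis
        using mod_hom_add[OF bilinear_right[OF \<beta>]] bilinear_closed[OF \<beta>]
        by (simp add: minus e_closed mod_hom_add[OF L] Le diff del: free_module_simps)
    next
      case 3
      then show ?thesis
        using mod_hom_smult[OF bilinear_left[OF \<beta>]] bilinear_closed[OF \<beta>]
        by (simp add: minus e_closed mod_hom_smult[OF L] Le diff del: free_module_simps)
    next
      case 4
      then show ?thesis
        using mod_hom_smult[OF bilinear_right[OF \<beta>]] bilinear_closed[OF \<beta>]
        by (simp add: minus e_closed mod_hom_smult[OF L] Le diff del: free_module_simps)
    qed
  qed
  then have "null \<subseteq> {f \<in> carrier F. ?L f \<in> {\<zero>\<^bsub>P\<^esub>}}"
    unfolding tensor_null_def using relators_closed
    by (intro Fl.generated_submodule_minimal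
        vimage_submodule[OF Fl.lmodule_axioms Pl.lmodule_axioms L Pl.zero_submodule]) auto
  then show ?thesis using assms by auto
qed

text \<open>The representative chosen by \<open>tensor_lift\<close> differs from f by an element of
  \<open>null\<close>, on which the linear extension vanishes.\<close>

lemma tensor_lift_coset:
  assumes "f \<in> carrier F"
  shows "tensor_lift K P \<beta> (null +>\<^bsub>F\<^esub> f) = free_lift K P (\<lambda>p. \<beta> (fst p) (snd p)) f"
proof -
  interpret P: module K P by fact
  let ?L = "free_lift K P (\<lambda>p. \<beta> (fst p) (snd p))"
  define g where "g = (SOME g. g \<in> null +>\<^bsub>F\<^esub> f)"
  have g: "g \<in> null +>\<^bsub>F\<^esub> f"
    unfolding g_def using Fl.coset_self[OF null_submodule assms]
    by (rule someI[where P = "\<lambda>g. g \<in> null +>\<^bsub>F\<^esub> f"])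
  have gc: "g \<in> carrier F" "null +>\<^bsub>F\<^esub> g = null +>\<^bsub>F\<^esub> f"
    using g Fl.mem_coset_iff[OF null_submodule assms] by blast+
  have n: "g \<ominus>\<^bsub>F\<^esub> f \<in> null" using gc Fl.coset_eq_iff[OF null_submodule gc(1) assms] by blast
  have L: "?L \<in> mod_hom K F P"
    using bilinear_closed[OF \<beta>] by (intro free_lift_hom[OF P]) auto
  have "?L g \<ominus>\<^bsub>P\<^esub> ?L f = \<zero>\<^bsub>P\<^esub>"
    using free_lift_null[OF n] mod_hom_minus[OF Fl.lmodule_axioms module_imp_lmodule[OF P] L gc(1) assms] by simp
  then have "?L g = \<ominus>\<^bsub>P\<^esub> (\<ominus>\<^bsub>P\<^esub> ?L f)"
    using mod_hom_closed[OF L] gc(1) assms by (intro P.M.minus_equality[symmetric]) (auto simp: a_minus_def)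
  then have "?L g = ?L f" using mod_hom_closed[OF L assms] by simp
  then show ?thesis by (simp add: tensor_lift_def free_lift_def g_def Let_def)
qed

lemma tensor_lift_hom: "tensor_lift K P \<beta> \<in> mod_hom K T P"
proof (rule mod_homI)
  have L: "free_lift K P (\<lambda>p. \<beta> (fst p) (snd p)) \<in> mod_hom K F P"
    using bilinear_closed[OF \<beta>] by (intro free_lift_hom[OF P]) auto
  fix t assume "t \<in> carrier T"
  then obtain f where f: "f \<in> carrier F" "t = null +>\<^bsub>F\<^esub> f" unfolding T_carrier by blast
  show "tensor_lift K P \<beta> t \<in> carrier P"
    using f mod_hom_closed[OF L] by (simp add: tensor_lift_coset)
  show "tensor_lift K P \<beta> (c \<odot>\<^bsub>T\<^esub> t) = c \<odot>\<^bsub>P\<^esub> tensor_lift K P \<beta> t" if "c \<in> carrier K" for c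
    using f that mod_hom_smult[OF coset_hom, of c f, symmetric] mod_hom_smult[OF L, of c f]
    by (simp add: tensor_lift_coset Fm.smult_closed del: free_module_simps)
  fix u assume "u \<in> carrier T"
  then obtain g where g: "g \<in> carrier F" "u = null +>\<^bsub>F\<^esub> g" unfolding T_carrier by blast
  show "tensor_lift K P \<beta> (t \<oplus>\<^bsub>T\<^esub> u) = tensor_lift K P \<beta> t \<oplus>\<^bsub>P\<^esub> tensor_lift K P \<beta> u"
    using f g mod_hom_add[OF coset_hom, of f g, symmetric] mod_hom_add[OF L, of f g]
    by (simp add: tensor_lift_coset Fm.M.a_closed del: free_module_simps)
qed

lemma tensor_lift_tensor:
  assumes "x \<in> carrier M" "y \<in> carrier N"
  shows "tensor_lift K P \<beta> (tensor K M N x y) = \<beta> x y"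
  unfolding tensor_def
  using assms tensor_lift_coset[OF e_closed[OF assms]]
    free_lift_unit_vector[OF P, of "\<lambda>p. \<beta> (fst p) (snd p)" "carrier M \<times> carrier N" "(x, y)"]
    bilinear_closed[OF \<beta>] by (simp add: Pi_def)

end

definition repr :: "('k, 'a, 'b) tensor \<Rightarrow> 'a \<times> 'b \<Rightarrow> 'k"
  where "repr t = (SOME f. f \<in> t)"

definition supp :: "('k, 'a, 'b) tensor \<Rightarrow> ('a \<times> 'b) set"
  where "supp t = {p. repr t p \<noteq> \<zero>\<^bsub>K\<^esub>}"

lemma tensor_lift_finsum:
  "tensor_lift K P \<beta> t = (\<Oplus>\<^bsub>P\<^esub>p\<in>supp t. repr t p \<odot>\<^bsub>P\<^esub> \<beta> (fst p) (snd p))"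
  by (simp add: tensor_lift_def Let_def supp_def repr_def)

lemma repr_closed:
  assumes "t \<in> carrier T"
  shows "finite (supp t)" "repr t p \<in> carrier K" "p \<in> supp t \<Longrightarrow> fst p \<in> carrier M"
    "p \<in> supp t \<Longrightarrow> snd p \<in> carrier N"
proof -
  obtain f where f: "f \<in> carrier F" "t = null +>\<^bsub>F\<^esub> f" using assms unfolding T_carrier by blast
  have "repr t \<in> t"
    unfolding repr_def f(2) using Fl.coset_self[OF null_submodule f(1)]
    by (rule someI[where P = "\<lambda>g. g \<in> null +>\<^bsub>F\<^esub> f"])
  then have r: "repr t \<in> carrier F" using Fl.mem_coset_iff[OF null_submodule f(1)] f(2) by blast
  then show "finite (supp t)" "repr t p \<in> carrier K" unfolding free_module_carrier supp_def by blast+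
  have "supp t \<subseteq> carrier M \<times> carrier N" using r by (simp add: free_module_carrier supp_def)
  then show "p \<in> supp t \<Longrightarrow> fst p \<in> carrier M" "p \<in> supp t \<Longrightarrow> snd p \<in> carrier N" by auto
qed

text \<open>Unlike the universal property, the following facts need no bilinearity, since
  \<^const>\<open>tensor_lift\<close> always uses the same representative of a tensor.\<close>

lemma tensor_lift_closed:
  assumes "module K P" "\<And>x y. \<lbrakk>x \<in> carrier M; y \<in> carrier N\<rbrakk> \<Longrightarrow> \<beta> x y \<in> carrier P" "t \<in> carrier T"
  shows "tensor_lift K P \<beta> t \<in> carrier P"
proof -
  interpret P: module K P by fact
  show ?thesis
    unfolding tensor_lift_finsum using repr_closed[OF assms(3)] assms(2)
    by (intro P.M.finsum_closed) auto
qed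

lemma tensor_lift_cong:
  assumes "module K P" "\<And>x y. \<lbrakk>x \<in> carrier M; y \<in> carrier N\<rbrakk> \<Longrightarrow> \<beta>' x y \<in> carrier P"
    and "\<And>x y. \<lbrakk>x \<in> carrier M; y \<in> carrier N\<rbrakk> \<Longrightarrow> \<beta> x y = \<beta>' x y" and "t \<in> carrier T"
  shows "tensor_lift K P \<beta> t = tensor_lift K P \<beta>' t"
proof -
  interpret P: module K P by fact
  show ?thesis
    unfolding tensor_lift_finsum using repr_closed[OF assms(4)] assms(2,3)
    by (intro P.M.finsum_cong') auto
qed

lemma additive_tensor_lift:
  assumes P: "module K P" and Q: "abelian_group Q"
    and \<beta>: "\<And>x y. \<lbrakk>x \<in> carrier M; y \<in> carrier N\<rbrakk> \<Longrightarrow> \<beta> x y \<in> carrier P"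
    and g: "g \<in> carrier P \<rightarrow> carrier Q"
      "\<And>x y. \<lbrakk>x \<in> carrier P; y \<in> carrier P\<rbrakk> \<Longrightarrow> g (x \<oplus>\<^bsub>P\<^esub> y) = g x \<oplus>\<^bsub>Q\<^esub> g y"
      "\<And>c x. \<lbrakk>c \<in> carrier K; x \<in> carrier P\<rbrakk> \<Longrightarrow> g (c \<odot>\<^bsub>P\<^esub> x) = c \<odot>\<^bsub>Q\<^esub> g x"
    and t: "t \<in> carrier T"
  shows "g (tensor_lift K P \<beta> t) = tensor_lift K Q (\<lambda>x y. g (\<beta> x y)) t"
proof -
  interpret P: module K P by fact
  interpret Q: abelian_group Q by fact
  have c: "repr t p \<odot>\<^bsub>P\<^esub> \<beta> (fst p) (snd p) \<in> carrier P" if "p \<in> supp t" for p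
    using repr_closed[OF t] that \<beta> by auto
  have "g (tensor_lift K P \<beta> t) = (\<Oplus>\<^bsub>Q\<^esub>p\<in>supp t. g (repr t p \<odot>\<^bsub>P\<^esub> \<beta> (fst p) (snd p)))"
    unfolding tensor_lift_finsum using repr_closed[OF t] c
    by (intro additive_finsum[OF P.M.abelian_group_axioms Q g(1,2)]) auto
  also have "\<dots> = tensor_lift K Q (\<lambda>x y. g (\<beta> x y)) t"
    unfolding tensor_lift_finsum
  proof (rule Q.finsum_cong')
    show eq: "g (repr t p \<odot>\<^bsub>P\<^esub> \<beta> (fst p) (snd p)) = repr t p \<odot>\<^bsub>Q\<^esub> g (\<beta> (fst p) (snd p))"
      if "p \<in> supp t" for p using repr_closed[OF t] that \<beta> by (intro g(3)) auto
    show "(\<lambda>p. repr t p \<odot>\<^bsub>Q\<^esub> g (\<beta> (fst p) (snd p))) \<in> supp t \<rightarrow> carrier Q"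
      using c g(1) by (intro Pi_I) (metis eq funcset_mem)
  qed simp
  finally show ?thesis .
qed

lemma hom_tensor_lift:
  assumes P: "module K P" and Q: "module K Q"
    and \<beta>: "\<And>x y. \<lbrakk>x \<in> carrier M; y \<in> carrier N\<rbrakk> \<Longrightarrow> \<beta> x y \<in> carrier P"
    and g: "g \<in> mod_hom K P Q" and t: "t \<in> carrier T"
  shows "g (tensor_lift K P \<beta> t) = tensor_lift K Q (\<lambda>x y. g (\<beta> x y)) t"
  using g by (intro additive_tensor_lift P \<beta> t) (use Q in \<open>auto simp: mod_hom_def module_def\<close>)

lemma mod_hom_tensor_lift_arg:
  "\<lbrakk>module K P; bilinear K M N P \<beta>; f \<in> mod_hom K Q T\<rbrakk> \<Longrightarrow> (\<lambda>x. tensor_lift K P \<beta> (f x)) \<in> mod_hom K Q P"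
  by (rule mod_hom_compose[OF _ tensor_lift_hom])

lemma mod_hom_tensor_lift_fun:
  assumes P: "module K P" and t: "t \<in> carrier T"
    and lin: "\<And>a b. \<lbrakk>a \<in> carrier M; b \<in> carrier N\<rbrakk> \<Longrightarrow> (\<lambda>x. \<beta> x a b) \<in> mod_hom K Q P"
  shows "(\<lambda>x. tensor_lift K P (\<beta> x) t) \<in> mod_hom K Q P"
proof (rule mod_homI)
  interpret P: module K P by fact
  note r = repr_closed[OF t]
  fix x assume x: "x \<in> carrier Q"
  have \<beta>: "\<beta> x (fst p) (snd p) \<in> carrier P" if "p \<in> supp t" "x \<in> carrier Q" for p x
    using mod_hom_closed[OF lin] r that by blast
  show "tensor_lift K P (\<beta> x) t \<in> carrier P"
    by (rule tensor_lift_closed[OF P mod_hom_closed[OF lin x] t])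
  show "tensor_lift K P (\<beta> (x \<oplus>\<^bsub>Q\<^esub> y)) t = tensor_lift K P (\<beta> x) t \<oplus>\<^bsub>P\<^esub> tensor_lift K P (\<beta> y) t"
    if y: "y \<in> carrier Q" for y
  proof -
    have eq: "repr t p \<odot>\<^bsub>P\<^esub> \<beta> (x \<oplus>\<^bsub>Q\<^esub> y) (fst p) (snd p) =
      repr t p \<odot>\<^bsub>P\<^esub> \<beta> x (fst p) (snd p) \<oplus>\<^bsub>P\<^esub> repr t p \<odot>\<^bsub>P\<^esub> \<beta> y (fst p) (snd p)" if "p \<in> supp t" for p
      using mod_hom_add[OF lin x y] r that \<beta> x y by (simp add: P.smult_r_distr)
    have "tensor_lift K P (\<beta> (x \<oplus>\<^bsub>Q\<^esub> y)) t =
      (\<Oplus>\<^bsub>P\<^esub>p\<in>supp t. repr t p \<odot>\<^bsub>P\<^esub> \<beta> x (fst p) (snd p) \<oplus>\<^bsub>P\<^esub> repr t p \<odot>\<^bsub>P\<^esub> \<beta> y (fst p) (snd p))"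
      unfolding tensor_lift_finsum by (rule P.M.finsum_cong'[OF refl _ eq]) (use r \<beta> x y in auto)
    also have "\<dots> = tensor_lift K P (\<beta> x) t \<oplus>\<^bsub>P\<^esub> tensor_lift K P (\<beta> y) t"
      unfolding tensor_lift_finsum using r \<beta> x y by (intro P.M.finsum_addf) auto
    finally show ?thesis .
  qed
  show "tensor_lift K P (\<beta> (c \<odot>\<^bsub>Q\<^esub> x)) t = c \<odot>\<^bsub>P\<^esub> tensor_lift K P (\<beta> x) t"
    if c: "c \<in> carrier K" for c
  proof -
    have eq: "repr t p \<odot>\<^bsub>P\<^esub> \<beta> (c \<odot>\<^bsub>Q\<^esub> x) (fst p) (snd p) =
      c \<odot>\<^bsub>P\<^esub> (repr t p \<odot>\<^bsub>P\<^esub> \<beta> x (fst p) (snd p))" if "p \<in> supp t" for p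
      using mod_hom_smult[OF lin c x] r that \<beta> x c
      by (simp add: P.smult_assoc1[symmetric] Ms.R.m_comm)
    have "tensor_lift K P (\<beta> (c \<odot>\<^bsub>Q\<^esub> x)) t =
      (\<Oplus>\<^bsub>P\<^esub>p\<in>supp t. c \<odot>\<^bsub>P\<^esub> (repr t p \<odot>\<^bsub>P\<^esub> \<beta> x (fst p) (snd p)))"
      unfolding tensor_lift_finsum by (rule P.M.finsum_cong'[OF refl _ eq]) (use r \<beta> x c in auto)
    also have "\<dots> = c \<odot>\<^bsub>P\<^esub> tensor_lift K P (\<beta> x) t"
      unfolding tensor_lift_finsum using r \<beta> x c by (intro P.finsum_smult_ldistr[symmetric]) auto
    finally show ?thesis .
  qed
qed

lemma mod_hom_tensor_left:
  "\<lbrakk>f \<in> mod_hom K Q M; y \<in> carrier N\<rbrakk> \<Longrightarrow> (\<lambda>x. tensor K M N (f x) y) \<in> mod_hom K Q T"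
  by (rule mod_hom_compose[OF _ bilinear_left[OF tensor_bilinear]])

lemma mod_hom_tensor_right:
  "\<lbrakk>f \<in> mod_hom K Q N; x \<in> carrier M\<rbrakk> \<Longrightarrow> (\<lambda>y. tensor K M N x (f y)) \<in> mod_hom K Q T"
  by (rule mod_hom_compose[OF _ bilinear_right[OF tensor_bilinear]])

text \<open>Both sides are finite double sums over the fixed representatives of t and u; the two
  orders of summation agree because addition and the scalars of K commute.\<close>

lemma tensor_lift_swap:
  assumes MN': "tensor_pair K M' N'" and P: "module K P"
    and t: "t \<in> carrier T" and u: "u \<in> carrier (tensor_module K M' N')"
    and \<gamma>: "\<And>a b c d. \<lbrakk>a \<in> carrier M; b \<in> carrier N; c \<in> carrier M'; d \<in> carrier N'\<rbrakk> \<Longrightarrow>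
      \<gamma> a b c d \<in> carrier P"
  shows "tensor_lift K P (\<lambda>a b. tensor_lift K P (\<gamma> a b) u) t =
    tensor_lift K P (\<lambda>c d. tensor_lift K P (\<lambda>a b. \<gamma> a b c d) t) u"
proof -
  interpret MN': tensor_pair K M' N' by fact
  interpret P: module K P by fact
  note r = repr_closed[OF t] and r' = MN'.repr_closed[OF u]
  let ?g = "\<lambda>p q. repr t p \<odot>\<^bsub>P\<^esub> (MN'.repr u q \<odot>\<^bsub>P\<^esub> \<gamma> (fst p) (snd p) (fst q) (snd q))"
  have swap: "(\<Oplus>\<^bsub>P\<^esub>p\<in>I. \<Oplus>\<^bsub>P\<^esub>q\<in>J. f p q) = (\<Oplus>\<^bsub>P\<^esub>q\<in>J. \<Oplus>\<^bsub>P\<^esub>p\<in>I. f p q)"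
    if "finite I" "finite J" "\<And>p q. \<lbrakk>p \<in> I; q \<in> J\<rbrakk> \<Longrightarrow> f p q \<in> carrier P"
    for I J and f :: "'a \<times> 'b \<Rightarrow> _ \<Rightarrow> _"
    using that(1,3)
  proof (induction I rule: finite_induct)
    case empty
    then show ?case using that(2) by simp
  next
    case (insert i I)
    have "(\<Oplus>\<^bsub>P\<^esub>p\<in>insert i I. \<Oplus>\<^bsub>P\<^esub>q\<in>J. f p q) = (\<Oplus>\<^bsub>P\<^esub>q\<in>J. f i q) \<oplus>\<^bsub>P\<^esub> (\<Oplus>\<^bsub>P\<^esub>q\<in>J. \<Oplus>\<^bsub>P\<^esub>p\<in>I. f p q)"
      using insert by (subst P.M.finsum_insert) (auto intro!: P.M.finsum_closed)
    also have "\<dots> = (\<Oplus>\<^bsub>P\<^esub>q\<in>J. f i q \<oplus>\<^bsub>P\<^esub> (\<Oplus>\<^bsub>P\<^esub>p\<in>I. f p q))"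
      using insert by (intro P.M.finsum_addf[symmetric]) (auto intro!: P.M.finsum_closed)
    also have "\<dots> = (\<Oplus>\<^bsub>P\<^esub>q\<in>J. \<Oplus>\<^bsub>P\<^esub>p\<in>insert i I. f p q)"
    proof (rule P.M.finsum_cong'[OF refl], goal_cases)
      case 1 show ?case using insert by (auto intro!: P.M.finsum_closed)
    next
      case (2 q) then show ?case using insert by (subst P.M.finsum_insert) (auto intro!: P.M.finsum_closed)
    qed
    finally show ?case .
  qed
  have "tensor_lift K P (\<lambda>a b. tensor_lift K P (\<gamma> a b) u) t = (\<Oplus>\<^bsub>P\<^esub>p\<in>supp t. \<Oplus>\<^bsub>P\<^esub>q\<in>MN'.supp u. ?g p q)"
    unfolding tensor_lift_finsum MN'.tensor_lift_finsum
    using r r' \<gamma> by (intro P.M.finsum_cong' P.finsum_smult_ldistr) (auto intro!: P.M.finsum_closed)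
  also have "\<dots> = (\<Oplus>\<^bsub>P\<^esub>q\<in>MN'.supp u. \<Oplus>\<^bsub>P\<^esub>p\<in>supp t. ?g p q)"
    using r r' \<gamma> by (intro swap) auto
  also have "\<dots> = (\<Oplus>\<^bsub>P\<^esub>q\<in>MN'.supp u. \<Oplus>\<^bsub>P\<^esub>p\<in>supp t.
      MN'.repr u q \<odot>\<^bsub>P\<^esub> (repr t p \<odot>\<^bsub>P\<^esub> \<gamma> (fst p) (snd p) (fst q) (snd q)))"
    using r r' \<gamma>
    by (intro P.M.finsum_cong' refl) (auto intro!: P.M.finsum_closed simp: P.smult_assoc1[symmetric] Ms.R.m_comm)
  also have "\<dots> = tensor_lift K P (\<lambda>c d. tensor_lift K P (\<lambda>a b. \<gamma> a b c d) t) u"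
    unfolding tensor_lift_finsum MN'.tensor_lift_finsum
    using r r' \<gamma> by (intro P.M.finsum_cong' P.finsum_smult_ldistr[symmetric]) (auto intro!: P.M.finsum_closed)
  finally show ?thesis .
qed

lemma tensor_pair: "tensor_pair K M N" ..

end

section \<open>Hopf algebras and the smash algebra\<close>

named_theorems multilinear \<open>closure and linearity in one variable\<close>

lemma mod_hom_ident [multilinear]: "(\<lambda>x. x) \<in> mod_hom K M M"
  by (auto simp: mod_hom_def)

declare bilinearI [multilinear]

lemma tensor_algebra_simps [simp]:
  "carrier (tensor_algebra K A B) = carrier (tensor_module K A B)"
  "add (tensor_algebra K A B) = add (tensor_module K A B)"
  "zero (tensor_algebra K A B) = zero (tensor_module K A B)"
  "smult (tensor_algebra K A B) = smult (tensor_module K A B)"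
  "one (tensor_algebra K A B) = tensor K A B \<one>\<^bsub>A\<^esub> \<one>\<^bsub>B\<^esub>"
  by (simp_all add: tensor_algebra_def Let_def)

lemma opposite_simps [simp]:
  "carrier (opposite A) = carrier A" "add (opposite A) = add A" "zero (opposite A) = zero A"
  "smult (opposite A) = smult A" "one (opposite A) = one A" "x \<otimes>\<^bsub>opposite A\<^esub> y = y \<otimes>\<^bsub>A\<^esub> x"
  by (simp_all add: opposite_def)

lemma module_record_cong:
  assumes "module K M" "carrier M = carrier M'" "add M = add M'" "smult M = smult M'" "zero M = zero M'"
  shows "module K M'"
  by (rule module_surj[OF assms(1), where \<pi> = "\<lambda>x. x"]) (simp_all add: assms)

context assoc_algebra
begin

lemma mod_hom_mult_left [multilinear]:
  "\<lbrakk>f \<in> mod_hom K Q A; y \<in> carrier A\<rbrakk> \<Longrightarrow> (\<lambda>x. f x \<otimes>\<^bsub>A\<^esub> y) \<in> mod_hom K Q A"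
  by (auto simp: mod_hom_def Pi_def l_distr smult_mult_left)

lemma mod_hom_mult_right [multilinear]:
  "\<lbrakk>f \<in> mod_hom K Q A; x \<in> carrier A\<rbrakk> \<Longrightarrow> (\<lambda>y. x \<otimes>\<^bsub>A\<^esub> f y) \<in> mod_hom K Q A"
  by (auto simp: mod_hom_def Pi_def r_distr smult_mult_right)

lemma mult_closed [multilinear]: "\<lbrakk>x \<in> carrier A; y \<in> carrier A\<rbrakk> \<Longrightarrow> x \<otimes>\<^bsub>A\<^esub> y \<in> carrier A"
  by simp

lemma scalar_closed [multilinear]: "\<lbrakk>c \<in> carrier K; y \<in> carrier A\<rbrakk> \<Longrightarrow> c \<odot>\<^bsub>A\<^esub> y \<in> carrier A"
  by simp

lemma is_module [multilinear]: "module K A" ..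

end

lemma assoc_algebra_opposite:
  fixes A :: "('k, 'a) module"
  assumes "assoc_algebra K A"
  shows "assoc_algebra K (opposite A)"
proof -
  interpret A: assoc_algebra K A by fact
  have m: "module K (opposite A)" by (rule module_record_cong[OF A.is_module]) simp_all
  then interpret O: module K "opposite A" .
  have "ring (opposite A)"
    by (intro ringI monoidI O.M.abelian_group_axioms) (auto simp: A.m_assoc A.l_distr A.r_distr)
  then show ?thesis
    by (intro assoc_algebra.intro m assoc_algebra_axioms.intro)
      (auto simp: A.smult_mult_left A.smult_mult_right)
qed

locale tensor_algebras = A: assoc_algebra K A + B: assoc_algebra K B
  for K :: "('k, 'm) ring_scheme" and A :: "('k, 'a, 'n) module_scheme" and B :: "('k, 'b, 'p) module_scheme"
begin

sublocale tensor_pair K A B ..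

abbreviation TA where "TA \<equiv> tensor_algebra K A B"

lemma TA_module: "module K TA"
  by (rule module_record_cong[OF tensor_module_module]) simp_all

lemma mod_hom_TA: "mod_hom K TA P = mod_hom K T P" "mod_hom K P TA = mod_hom K P T"
  by (simp_all add: mod_hom_def)

lemma TA_mult_aux: "\<lbrakk>a \<in> carrier A; b \<in> carrier B\<rbrakk> \<Longrightarrow>
    bilinear K A B T (\<lambda>c d. tensor K A B (a \<otimes>\<^bsub>A\<^esub> c) (b \<otimes>\<^bsub>B\<^esub> d))"
  by (rule mod_hom_tensor_left mod_hom_tensor_right multilinear | assumption)+

lemma TA_mult_bilinear: "bilinear K T T T (mult TA)"
proof (rule bilinearI)
  have lin: "bilinear K A B T (\<lambda>a b. tensor_lift K T (\<lambda>c d. tensor K A B (a \<otimes>\<^bsub>A\<^esub> c) (b \<otimes>\<^bsub>B\<^esub> d)) u)"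
    if "u \<in> carrier T" for u
    by (rule mod_hom_tensor_lift_fun mod_hom_tensor_left mod_hom_tensor_right tensor_module_module multilinear that | assumption)+
  show "(\<lambda>u. t \<otimes>\<^bsub>TA\<^esub> u) \<in> mod_hom K T T" if "t \<in> carrier T" for t
    unfolding tensor_algebra_def Let_def
    by simp (rule mod_hom_tensor_lift_fun tensor_lift_hom tensor_module_module TA_mult_aux that | assumption)+
  show "(\<lambda>t. t \<otimes>\<^bsub>TA\<^esub> u) \<in> mod_hom K T T" if "u \<in> carrier T" for u
    unfolding tensor_algebra_def Let_def
    by simp (rule tensor_lift_hom tensor_module_module lin that | assumption)+
qed

text \<open>This formula and bilinearity are all that is used of the enveloping algebra. Ring axioms
  are verified only for the smash algebra, directly on its generators.\<close>

lemma TA_mult_tensor: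
  assumes "a \<in> carrier A" "b \<in> carrier B" "c \<in> carrier A" "d \<in> carrier B"
  shows "tensor K A B a b \<otimes>\<^bsub>TA\<^esub> tensor K A B c d = tensor K A B (a \<otimes>\<^bsub>A\<^esub> c) (b \<otimes>\<^bsub>B\<^esub> d)"
proof -
  have lin: "bilinear K A B T (\<lambda>a b. tensor_lift K T (\<lambda>c d. tensor K A B (a \<otimes>\<^bsub>A\<^esub> c) (b \<otimes>\<^bsub>B\<^esub> d)) (tensor K A B c d))"
    by (rule mod_hom_tensor_lift_fun mod_hom_tensor_left mod_hom_tensor_right tensor_module_module
        multilinear tensor_closed assms | assumption)+
  show ?thesis
    unfolding tensor_algebra_def Let_def
    using assms by (simp add: tensor_lift_tensor[OF tensor_module_module lin]
        tensor_lift_tensor[OF tensor_module_module TA_mult_aux])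
qed

end

context hopf_algebra
begin

sublocale HH: tensor_algebras K H H ..

text \<open>The Sweedler sum of \<beta> h1 h2 over the comultiplication of h. Nesting
  \<open>Sw\<close> in the first or in the second leg yields the iterated comultiplications.\<close>

abbreviation Sw :: "('k, 'c, 'q) module_scheme \<Rightarrow> ('h \<Rightarrow> 'h \<Rightarrow> 'c) \<Rightarrow> 'h \<Rightarrow> 'c"
  where "Sw P \<beta> h \<equiv> tensor_lift K P \<beta> (comult H h)"

lemma comult_linear: "comult H \<in> mod_hom K H HH.T"
  using comult_hom comult_smult by (auto simp: mod_hom_def ring_hom_def)

lemma comult_closed: "h \<in> carrier H \<Longrightarrow> comult H h \<in> carrier HH.T"
  by (rule mod_hom_closed[OF comult_linear])

lemma counit_closed [multilinear]: "h \<in> carrier H \<Longrightarrow> counit H h \<in> carrier K"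
  using counit_hom by (auto simp: ring_hom_def)

lemma mod_hom_counit [multilinear]:
  "\<lbrakk>module K P; f \<in> mod_hom K Q H; x \<in> carrier P\<rbrakk> \<Longrightarrow> (\<lambda>h. counit H (f h) \<odot>\<^bsub>P\<^esub> x) \<in> mod_hom K Q P"
  using counit_hom counit_smult
  by (auto simp: mod_hom_def ring_hom_def Pi_def module.smult_closed module.smult_l_distr module.smult_assoc1)

lemma mod_hom_scalar [multilinear]:
  "\<lbrakk>module K P; f \<in> mod_hom K Q P; c \<in> carrier K\<rbrakk> \<Longrightarrow> (\<lambda>h. c \<odot>\<^bsub>P\<^esub> f h) \<in> mod_hom K Q P"
proof (rule mod_homI)
  assume P: "module K P" and f: "f \<in> mod_hom K Q P" and c: "c \<in> carrier K"
  interpret P: module K P by fact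
  fix x assume x: "x \<in> carrier Q"
  show "c \<odot>\<^bsub>P\<^esub> f x \<in> carrier P" using mod_hom_closed[OF f x] c by simp
  show "c \<odot>\<^bsub>P\<^esub> f (r \<odot>\<^bsub>Q\<^esub> x) = r \<odot>\<^bsub>P\<^esub> (c \<odot>\<^bsub>P\<^esub> f x)" if "r \<in> carrier K" for r
    using that c mod_hom_closed[OF f x] mod_hom_smult[OF f _ x]
    by (simp add: P.smult_assoc1[symmetric] R.m_comm)
  show "c \<odot>\<^bsub>P\<^esub> f (x \<oplus>\<^bsub>Q\<^esub> y) = c \<odot>\<^bsub>P\<^esub> f x \<oplus>\<^bsub>P\<^esub> c \<odot>\<^bsub>P\<^esub> f y" if "y \<in> carrier Q" for y
    using that c x mod_hom_closed[OF f] mod_hom_add[OF f x that] by (simp add: P.smult_r_distr)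
qed

lemma Sw_closed [multilinear]:
  "\<lbrakk>module K P; \<And>x y. \<lbrakk>x \<in> carrier H; y \<in> carrier H\<rbrakk> \<Longrightarrow> \<beta> x y \<in> carrier P; h \<in> carrier H\<rbrakk> \<Longrightarrow>
    Sw P \<beta> h \<in> carrier P"
  by (rule HH.tensor_lift_closed[OF _ _ comult_closed])

lemma Sw_cong:
  "\<lbrakk>module K P; h \<in> carrier H; \<And>x y. \<lbrakk>x \<in> carrier H; y \<in> carrier H\<rbrakk> \<Longrightarrow> \<beta> x y = \<beta>' x y;
    \<And>x y. \<lbrakk>x \<in> carrier H; y \<in> carrier H\<rbrakk> \<Longrightarrow> \<beta>' x y \<in> carrier P\<rbrakk> \<Longrightarrow>
    Sw P \<beta> h = Sw P \<beta>' h"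
  by (rule HH.tensor_lift_cong[OF _ _ _ comult_closed])

lemma mod_hom_Sw_arg [multilinear]:
  "\<lbrakk>module K P; bilinear K H H P \<beta>; f \<in> mod_hom K Q H\<rbrakk> \<Longrightarrow> (\<lambda>x. Sw P \<beta> (f x)) \<in> mod_hom K Q P"
  by (rule HH.mod_hom_tensor_lift_arg[OF _ _ mod_hom_compose[OF _ comult_linear]])

lemma mod_hom_Sw_fun [multilinear]:
  "\<lbrakk>module K P; h \<in> carrier H;
    \<And>a b. \<lbrakk>a \<in> carrier H; b \<in> carrier H\<rbrakk> \<Longrightarrow> (\<lambda>x. \<beta> x a b) \<in> mod_hom K Q P\<rbrakk> \<Longrightarrow>
    (\<lambda>x. Sw P (\<beta> x) h) \<in> mod_hom K Q P"
  by (rule HH.mod_hom_tensor_lift_fun[OF _ comult_closed])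

lemma hom_Sw:
  "\<lbrakk>module K P; module K Q; g \<in> mod_hom K P Q; h \<in> carrier H;
    \<And>x y. \<lbrakk>x \<in> carrier H; y \<in> carrier H\<rbrakk> \<Longrightarrow> \<beta> x y \<in> carrier P\<rbrakk> \<Longrightarrow>
    g (Sw P \<beta> h) = Sw Q (\<lambda>x y. g (\<beta> x y)) h"
  by (rule HH.hom_tensor_lift[OF _ _ _ _ comult_closed])

lemma Sw_swap:
  assumes "module K P" "h \<in> carrier H" "g \<in> carrier H"
    and "\<And>a b c d. \<lbrakk>a \<in> carrier H; b \<in> carrier H; c \<in> carrier H; d \<in> carrier H\<rbrakk> \<Longrightarrow> \<gamma> a b c d \<in> carrier P"
  shows "Sw P (\<lambda>a b. Sw P (\<lambda>c d. \<gamma> a b c d) g) h = Sw P (\<lambda>c d. Sw P (\<lambda>a b. \<gamma> a b c d) h) g"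
  by (rule HH.tensor_lift_swap[OF HH.tensor_pair assms(1) comult_closed[OF assms(2)] comult_closed[OF assms(3)] assms(4)])

lemma Sw_one: "\<lbrakk>module K P; bilinear K H H P \<beta>\<rbrakk> \<Longrightarrow> Sw P \<beta> \<one>\<^bsub>H\<^esub> = \<beta> \<one>\<^bsub>H\<^esub> \<one>\<^bsub>H\<^esub>"
  using comult_hom HH.tensor_lift_tensor[of P \<beta> "\<one>\<^bsub>H\<^esub>" "\<one>\<^bsub>H\<^esub>"] by (simp add: ring_hom_def)

text \<open>The comultiplication is multiplicative, and the product of two elements of H \<otimes> H
  is a double lift; the linear map induced by \<beta> passes through both lifts.\<close>

lemma Sw_mult:
  assumes P: "module K P" and \<beta>: "bilinear K H H P \<beta>" and gh: "g \<in> carrier H" "h \<in> carrier H"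
  shows "Sw P \<beta> (g \<otimes>\<^bsub>H\<^esub> h) = Sw P (\<lambda>g1 g2. Sw P (\<lambda>h1 h2. \<beta> (g1 \<otimes>\<^bsub>H\<^esub> h1) (g2 \<otimes>\<^bsub>H\<^esub> h2)) h) g"
proof -
  note T = HH.tensor_module_module
  let ?t = "\<lambda>g1 g2 h1 h2. tensor K H H (g1 \<otimes>\<^bsub>H\<^esub> h1) (g2 \<otimes>\<^bsub>H\<^esub> h2)"
  have c: "?t a b c d \<in> carrier HH.T" if "a \<in> carrier H" "b \<in> carrier H" "c \<in> carrier H" "d \<in> carrier H" for a b c d
    using that by (simp add: HH.tensor_closed)
  note hom = hom_Sw[OF T P HH.tensor_lift_hom[OF P \<beta>]]
  have "Sw P \<beta> (g \<otimes>\<^bsub>H\<^esub> h) = tensor_lift K P \<beta> (Sw HH.T (\<lambda>g1 g2. Sw HH.T (?t g1 g2) h) g)"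
    using comult_hom gh by (simp add: ring_hom_def) (simp add: tensor_algebra_def Let_def)
  also have "\<dots> = Sw P (\<lambda>g1 g2. tensor_lift K P \<beta> (Sw HH.T (?t g1 g2) h)) g"
    by (rule hom) (rule Sw_closed T c gh | assumption)+
  also have "\<dots> = Sw P (\<lambda>g1 g2. Sw P (\<lambda>h1 h2. \<beta> (g1 \<otimes>\<^bsub>H\<^esub> h1) (g2 \<otimes>\<^bsub>H\<^esub> h2)) h) g"
  proof (rule Sw_cong[OF P gh(1)])
    fix x y assume xy: "x \<in> carrier H" "y \<in> carrier H"
    have "tensor_lift K P \<beta> (Sw HH.T (?t x y) h) = Sw P (\<lambda>h1 h2. tensor_lift K P \<beta> (?t x y h1 h2)) h"
      by (rule hom) (rule c gh xy | assumption)+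
    also have "\<dots> = Sw P (\<lambda>h1 h2. \<beta> (x \<otimes>\<^bsub>H\<^esub> h1) (y \<otimes>\<^bsub>H\<^esub> h2)) h"
      using xy bilinear_closed[OF \<beta>] by (intro Sw_cong[OF P gh(2)]) (simp_all add: HH.tensor_lift_tensor[OF P \<beta>])
    finally show "tensor_lift K P \<beta> (Sw HH.T (?t x y) h) = Sw P (\<lambda>h1 h2. \<beta> (x \<otimes>\<^bsub>H\<^esub> h1) (y \<otimes>\<^bsub>H\<^esub> h2)) h" .
    show "Sw P (\<lambda>h1 h2. \<beta> (x \<otimes>\<^bsub>H\<^esub> h1) (y \<otimes>\<^bsub>H\<^esub> h2)) h \<in> carrier P"
      using xy by (intro Sw_closed P gh bilinear_closed[OF \<beta>]) auto
  qed
  finally show ?thesis .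
qed

sublocale HHH: tensor_pair K H "tensor_module K H H" ..

text \<open>The lift G of the trilinear \<tau> to H \<otimes> (H \<otimes> H) maps the two sides of
  \<open>coassoc\<close> to the two sides of this equation.\<close>

lemma Sw_coassoc:
  assumes P: "module K P" and h: "h \<in> carrier H"
    and 1: "\<And>y z. \<lbrakk>y \<in> carrier H; z \<in> carrier H\<rbrakk> \<Longrightarrow> (\<lambda>x. \<tau> x y z) \<in> mod_hom K H P"
    and 2: "\<And>x z. \<lbrakk>x \<in> carrier H; z \<in> carrier H\<rbrakk> \<Longrightarrow> (\<lambda>y. \<tau> x y z) \<in> mod_hom K H P"
    and 3: "\<And>x y. \<lbrakk>x \<in> carrier H; y \<in> carrier H\<rbrakk> \<Longrightarrow> (\<lambda>z. \<tau> x y z) \<in> mod_hom K H P"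
  shows "Sw P (\<lambda>u z. Sw P (\<lambda>x y. \<tau> x y z) u) h = Sw P (\<lambda>x v. Sw P (\<lambda>y z. \<tau> x y z) v) h"
proof -
  let ?TT = "tensor_module K H HH.T" and ?t = "tensor K H HH.T" and ?s = "tensor K H H"
  note T = HHH.tensor_module_module
  have b: "bilinear K H H P (\<tau> x)" if "x \<in> carrier H" for x
    using that 2 3 by (intro bilinearI)
  have B: "bilinear K H HH.T P (\<lambda>x. tensor_lift K P (\<tau> x))"
    by (rule bilinearI HH.tensor_lift_hom HH.mod_hom_tensor_lift_fun P b 1 | assumption)+
  define G where "G = tensor_lift K P (\<lambda>x. tensor_lift K P (\<tau> x))"
  have G: "G \<in> mod_hom K ?TT P" unfolding G_def by (rule HHH.tensor_lift_hom[OF P B])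
  have Gt: "G (?t x w) = tensor_lift K P (\<tau> x) w" if "x \<in> carrier H" "w \<in> carrier HH.T" for x w
    unfolding G_def using that by (rule HHH.tensor_lift_tensor[OF P B])
  have Gts: "G (?t x (?s y z)) = \<tau> x y z" if "x \<in> carrier H" "y \<in> carrier H" "z \<in> carrier H" for x y z
    using that by (simp add: Gt HH.tensor_closed HH.tensor_lift_tensor[OF P b])
  note cl = HHH.tensor_closed HH.tensor_closed comult_closed h T
  have \<tau>c: "\<tau> x y z \<in> carrier P" if "x \<in> carrier H" "y \<in> carrier H" "z \<in> carrier H" for x y z
    using mod_hom_closed[OF 1] that by blast
  have "G (Sw ?TT (\<lambda>u z. Sw ?TT (\<lambda>x y. ?t x (?s y z)) u) h) = Sw P (\<lambda>u z. G (Sw ?TT (\<lambda>x y. ?t x (?s y z)) u)) h"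
    by (rule hom_Sw[OF T P G]) (rule Sw_closed cl | assumption)+
  also have "\<dots> = Sw P (\<lambda>u z. Sw P (\<lambda>x y. \<tau> x y z) u) h"
  proof (rule Sw_cong[OF P h])
    fix u z assume uz: "u \<in> carrier H" "z \<in> carrier H"
    have "G (Sw ?TT (\<lambda>x y. ?t x (?s y z)) u) = Sw P (\<lambda>x y. G (?t x (?s y z))) u"
      by (rule hom_Sw[OF T P G]) (rule cl uz | assumption)+
    also have "\<dots> = Sw P (\<lambda>x y. \<tau> x y z) u"
      by (rule Sw_cong[OF P]) (rule Gts \<tau>c uz | assumption)+
    finally show "G (Sw ?TT (\<lambda>x y. ?t x (?s y z)) u) = Sw P (\<lambda>x y. \<tau> x y z) u" .
    show "Sw P (\<lambda>x y. \<tau> x y z) u \<in> carrier P" by (rule Sw_closed P \<tau>c uz | assumption)+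
  qed
  finally have L: "G (Sw ?TT (\<lambda>u z. Sw ?TT (\<lambda>x y. ?t x (?s y z)) u) h) = Sw P (\<lambda>u z. Sw P (\<lambda>x y. \<tau> x y z) u) h" .
  have "G (Sw ?TT (\<lambda>x v. ?t x (comult H v)) h) = Sw P (\<lambda>x v. G (?t x (comult H v))) h"
    by (rule hom_Sw[OF T P G]) (rule cl | assumption)+
  also have "\<dots> = Sw P (\<lambda>x v. Sw P (\<tau> x) v) h"
    by (rule Sw_cong[OF P]) (rule Gt Sw_closed P \<tau>c cl | assumption)+
  finally show ?thesis using L coassoc[OF h] by simp
qed

text \<open>The counit law for h itself, with a linear map f applied to it and pulled inside the
  sum, so that one leg may occur in any linear expression.\<close>

lemma Sw_counit_left:
  assumes P: "module K P" and h: "h \<in> carrier H" and f: "f \<in> mod_hom K H P"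
  shows "Sw P (\<lambda>x y. counit H x \<odot>\<^bsub>P\<^esub> f y) h = f h"
proof -
  have "f h = f (Sw H (\<lambda>x y. counit H x \<odot>\<^bsub>H\<^esub> y) h)" using counit_left[OF h] by simp
  also have "\<dots> = Sw P (\<lambda>x y. f (counit H x \<odot>\<^bsub>H\<^esub> y)) h"
    by (rule hom_Sw[OF is_module P f h]) (rule multilinear | assumption)+
  also have "\<dots> = Sw P (\<lambda>x y. counit H x \<odot>\<^bsub>P\<^esub> f y) h"
    using counit_closed mod_hom_closed[OF f]
    by (intro Sw_cong[OF P h] mod_hom_smult[OF f]) (auto intro: module.smult_closed[OF P])
  finally show ?thesis by simp
qed

lemma Sw_counit_right:
  assumes P: "module K P" and h: "h \<in> carrier H" and f: "f \<in> mod_hom K H P"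
  shows "Sw P (\<lambda>x y. counit H y \<odot>\<^bsub>P\<^esub> f x) h = f h"
proof -
  have "f h = f (Sw H (\<lambda>x y. counit H y \<odot>\<^bsub>H\<^esub> x) h)" using counit_right[OF h] by simp
  also have "\<dots> = Sw P (\<lambda>x y. f (counit H y \<odot>\<^bsub>H\<^esub> x)) h"
    by (rule hom_Sw[OF is_module P f h]) (rule multilinear | assumption)+
  also have "\<dots> = Sw P (\<lambda>x y. counit H y \<odot>\<^bsub>P\<^esub> f x) h"
    using counit_closed mod_hom_closed[OF f]
    by (intro Sw_cong[OF P h] mod_hom_smult[OF f]) (auto intro: module.smult_closed[OF P])
  finally show ?thesis by simp
qed

end

section \<open>Iterated Sweedler sums: products and re-bracketing\<close>

context hopf_algebra
begin

text \<open>Using multiplicativity twice interleaves the legs of g and h; a final exchange collects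
  all sums over g on the outside.\<close>

lemma Sw3_mult:
  assumes P: "module K P" and gh: "g \<in> carrier H" "h \<in> carrier H"
    and 1: "\<And>y z. \<lbrakk>y \<in> carrier H; z \<in> carrier H\<rbrakk> \<Longrightarrow> (\<lambda>x. \<tau> x y z) \<in> mod_hom K H P"
    and 2: "\<And>x z. \<lbrakk>x \<in> carrier H; z \<in> carrier H\<rbrakk> \<Longrightarrow> (\<lambda>y. \<tau> x y z) \<in> mod_hom K H P"
    and 3: "\<And>x y. \<lbrakk>x \<in> carrier H; y \<in> carrier H\<rbrakk> \<Longrightarrow> (\<lambda>z. \<tau> x y z) \<in> mod_hom K H P"
  shows "Sw P (\<lambda>k z. Sw P (\<lambda>x y. \<tau> x y z) k) (g \<otimes>\<^bsub>H\<^esub> h) =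
    Sw P (\<lambda>k g3. Sw P (\<lambda>g1 g2. Sw P (\<lambda>l h3. Sw P (\<lambda>h1 h2.
      \<tau> (g1 \<otimes>\<^bsub>H\<^esub> h1) (g2 \<otimes>\<^bsub>H\<^esub> h2) (g3 \<otimes>\<^bsub>H\<^esub> h3)) l) h) k) g"
proof -
  have \<tau>c: "\<tau> x y z \<in> carrier P" if "x \<in> carrier H" "y \<in> carrier H" "z \<in> carrier H" for x y z
    using mod_hom_closed[OF 1] that by blast
  have b: "bilinear K H H P (\<lambda>x y. \<tau> x y z)" if "z \<in> carrier H" for z
    using that 1 2 by (intro bilinearI)
  have "Sw P (\<lambda>k z. Sw P (\<lambda>x y. \<tau> x y z) k) (g \<otimes>\<^bsub>H\<^esub> h) =
      Sw P (\<lambda>k g3. Sw P (\<lambda>l h3. Sw P (\<lambda>x y. \<tau> x y (g3 \<otimes>\<^bsub>H\<^esub> h3)) (k \<otimes>\<^bsub>H\<^esub> l)) h) g"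
    by (rule Sw_mult[OF P _ gh]) (rule multilinear P b 3 | assumption)+
  also have "\<dots> = Sw P (\<lambda>k g3. Sw P (\<lambda>l h3. Sw P (\<lambda>g1 g2. Sw P (\<lambda>h1 h2.
      \<tau> (g1 \<otimes>\<^bsub>H\<^esub> h1) (g2 \<otimes>\<^bsub>H\<^esub> h2) (g3 \<otimes>\<^bsub>H\<^esub> h3)) l) k) h) g"
    by (rule Sw_cong[OF P] Sw_mult[OF P] gh b | rule multilinear P \<tau>c gh | assumption)+
  also have "\<dots> = Sw P (\<lambda>k g3. Sw P (\<lambda>g1 g2. Sw P (\<lambda>l h3. Sw P (\<lambda>h1 h2.
      \<tau> (g1 \<otimes>\<^bsub>H\<^esub> h1) (g2 \<otimes>\<^bsub>H\<^esub> h2) (g3 \<otimes>\<^bsub>H\<^esub> h3)) l) h) k) g"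
    by (rule Sw_cong[OF P gh(1)], rule Sw_swap) (rule multilinear P \<tau>c gh | assumption)+
  finally show ?thesis .
qed

context
  fixes P :: "('k, 'c, 'q) module_scheme" and \<psi>
  assumes P: "module K P"
    and 1: "\<And>b c d e. \<lbrakk>b \<in> carrier H; c \<in> carrier H; d \<in> carrier H; e \<in> carrier H\<rbrakk> \<Longrightarrow> (\<lambda>a. \<psi> a b c d e) \<in> mod_hom K H P"
    and 2: "\<And>a c d e. \<lbrakk>a \<in> carrier H; c \<in> carrier H; d \<in> carrier H; e \<in> carrier H\<rbrakk> \<Longrightarrow> (\<lambda>b. \<psi> a b c d e) \<in> mod_hom K H P"
    and 3: "\<And>a b d e. \<lbrakk>a \<in> carrier H; b \<in> carrier H; d \<in> carrier H; e \<in> carrier H\<rbrakk> \<Longrightarrow> (\<lambda>c. \<psi> a b c d e) \<in> mod_hom K H P"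
    and 4: "\<And>a b c e. \<lbrakk>a \<in> carrier H; b \<in> carrier H; c \<in> carrier H; e \<in> carrier H\<rbrakk> \<Longrightarrow> (\<lambda>d. \<psi> a b c d e) \<in> mod_hom K H P"
    and 5: "\<And>a b c d. \<lbrakk>a \<in> carrier H; b \<in> carrier H; c \<in> carrier H; d \<in> carrier H\<rbrakk> \<Longrightarrow> (\<lambda>e. \<psi> a b c d e) \<in> mod_hom K H P"
begin

text \<open>Both sides sum \<psi> over the five legs of h, bracketed as ((a, ((b, c), d)), e) and as
  (((a, b), c), (d, e)). The first bracketing arises from (x y) z in the smash algebra, the second
  from x (y z).\<close>

lemma Sw_coassoc5:
  assumes h: "h \<in> carrier H"
  shows "Sw P (\<lambda>k e. Sw P (\<lambda>a l. Sw P (\<lambda>n d. Sw P (\<lambda>b c. \<psi> a b c d e) n) l) k) h =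
    Sw P (\<lambda>k v. Sw P (\<lambda>u c. Sw P (\<lambda>a b. Sw P (\<lambda>d e. \<psi> a b c d e) v) u) k) h"
proof -
  have \<psi>c: "\<psi> a b c d e \<in> carrier P"
    if "a \<in> carrier H" "b \<in> carrier H" "c \<in> carrier H" "d \<in> carrier H" "e \<in> carrier H" for a b c d e
    using mod_hom_closed[OF 1] that by blast
  note rules = multilinear P 1 2 3 4 5 \<psi>c h
  have "Sw P (\<lambda>k e. Sw P (\<lambda>a l. Sw P (\<lambda>n d. Sw P (\<lambda>b c. \<psi> a b c d e) n) l) k) h =
      Sw P (\<lambda>a w. Sw P (\<lambda>l e. Sw P (\<lambda>n d. Sw P (\<lambda>b c. \<psi> a b c d e) n) l) w) h"
    by (rule Sw_coassoc[OF P h]) (rule rules | assumption)+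
  also have "\<dots> = Sw P (\<lambda>a w. Sw P (\<lambda>n w'. Sw P (\<lambda>d e. Sw P (\<lambda>b c. \<psi> a b c d e) n) w') w) h"
    by (rule Sw_cong[OF P h], rule Sw_coassoc[OF P]) (rule rules | assumption)+
  also have "\<dots> = Sw P (\<lambda>k v. Sw P (\<lambda>a n. Sw P (\<lambda>d e. Sw P (\<lambda>b c. \<psi> a b c d e) n) v) k) h"
    by (rule Sw_coassoc[OF P h, symmetric]) (rule rules | assumption)+
  \<comment> \<open>Splitting v and splitting n concern different legs, so the two sums may be
    exchanged.\<close>
  also have "\<dots> = Sw P (\<lambda>k v. Sw P (\<lambda>a n. Sw P (\<lambda>b c. Sw P (\<lambda>d e. \<psi> a b c d e) v) n) k) h"
    by (rule Sw_cong[OF P h], rule Sw_cong[OF P], assumption, rule Sw_swap) (rule rules | assumption)+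
  also have "\<dots> = Sw P (\<lambda>k v. Sw P (\<lambda>u c. Sw P (\<lambda>a b. Sw P (\<lambda>d e. \<psi> a b c d e) v) u) k) h"
    by (rule Sw_cong[OF P h], rule Sw_coassoc[OF P, symmetric]) (rule rules | assumption)+
  finally show ?thesis .
qed

end

text \<open>Four exchanges carry the sum over g outwards past the nested sums over h.\<close>

lemma Sw5_swap:
  assumes P: "module K P" and h: "h \<in> carrier H" and g: "g \<in> carrier H"
    and \<gamma>c: "\<And>a b c d e x y. \<lbrakk>a \<in> carrier H; b \<in> carrier H; c \<in> carrier H; d \<in> carrier H; e \<in> carrier H;
      x \<in> carrier H; y \<in> carrier H\<rbrakk> \<Longrightarrow> \<gamma> a b c d e x y \<in> carrier P"
  shows "Sw P (\<lambda>k v. Sw P (\<lambda>u c. Sw P (\<lambda>a b. Sw P (\<lambda>d e. Sw P (\<lambda>x y. \<gamma> a b c d e x y) g) v) u) k) h =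
    Sw P (\<lambda>x y. Sw P (\<lambda>k v. Sw P (\<lambda>u c. Sw P (\<lambda>a b. Sw P (\<lambda>d e. \<gamma> a b c d e x y) v) u) k) h) g"
proof -
  note rules = multilinear P \<gamma>c h g
  have "Sw P (\<lambda>k v. Sw P (\<lambda>u c. Sw P (\<lambda>a b. Sw P (\<lambda>d e. Sw P (\<lambda>x y. \<gamma> a b c d e x y) g) v) u) k) h =
    Sw P (\<lambda>k v. Sw P (\<lambda>u c. Sw P (\<lambda>a b. Sw P (\<lambda>x y. Sw P (\<lambda>d e. \<gamma> a b c d e x y) v) g) u) k) h"
    by (rule Sw_cong[OF P h], rule Sw_cong[OF P], assumption, rule Sw_cong[OF P], assumption, rule Sw_swap)
      (rule rules | assumption)+
  also have "\<dots> = Sw P (\<lambda>k v. Sw P (\<lambda>u c. Sw P (\<lambda>x y. Sw P (\<lambda>a b. Sw P (\<lambda>d e. \<gamma> a b c d e x y) v) u) g) k) h"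
    by (rule Sw_cong[OF P h], rule Sw_cong[OF P], assumption, rule Sw_swap) (rule rules | assumption)+
  also have "\<dots> = Sw P (\<lambda>k v. Sw P (\<lambda>x y. Sw P (\<lambda>u c. Sw P (\<lambda>a b. Sw P (\<lambda>d e. \<gamma> a b c d e x y) v) u) k) g) h"
    by (rule Sw_cong[OF P h], rule Sw_swap) (rule rules | assumption)+
  also have "\<dots> = Sw P (\<lambda>x y. Sw P (\<lambda>k v. Sw P (\<lambda>u c. Sw P (\<lambda>a b. Sw P (\<lambda>d e. \<gamma> a b c d e x y) v) u) k) h) g"
    by (rule Sw_swap) (rule rules | assumption)+
  finally show ?thesis .
qed

end

section \<open>The smash algebra and the products of its pure elements\<close>

locale hmodule_algebra = module_algebra K H A act
  for K :: "('k, 'm) ring_scheme" and H :: "('k, 'h) hopf" and A :: "('k, 'a) module"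
    and act :: "'h \<Rightarrow> 'a \<Rightarrow> 'a"
begin

sublocale AA: tensor_algebras K A "opposite A"
  by (intro tensor_algebras.intro A.assoc_algebra_axioms assoc_algebra_opposite)

abbreviation Ae where "Ae \<equiv> tensor_algebra K A (opposite A)"

sublocale AH: tensor_pair K Ae H
  by (intro tensor_pair.intro AA.TA_module H.is_module)

abbreviation S where "S \<equiv> smash_algebra K H A act"
abbreviation Am where "Am \<equiv> smash_module K H A act"
abbreviation TS where "TS \<equiv> tensor_module K Ae H"

text \<open>The element (a \<otimes> b) # h. By \<open>S_induct\<close> these elements generate S
  additively.\<close>

definition pure :: "'a \<Rightarrow> 'a \<Rightarrow> 'h \<Rightarrow> ('k, 'a, 'h) smash"
  where "pure a b h = tensor K Ae H (tensor K A (opposite A) a b) h"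

lemma S_simps [simp]: "carrier S = carrier TS" "add S = add TS" "zero S = zero TS"
  "one S = pure \<one>\<^bsub>A\<^esub> \<one>\<^bsub>A\<^esub> \<one>\<^bsub>H\<^esub>"
  by (simp_all add: smash_algebra_def Let_def enveloping_algebra_def pure_def)

lemma Am_simps [simp]: "carrier Am = carrier A" "add Am = add A" "zero Am = zero A"
  by (simp_all add: smash_module_def)

lemma TS_module [multilinear]: "module K TS"
  by (rule AH.tensor_module_module)

lemma pure_closed [multilinear]:
  "\<lbrakk>a \<in> carrier A; b \<in> carrier A; h \<in> carrier H\<rbrakk> \<Longrightarrow> pure a b h \<in> carrier TS"
  using AA.tensor_closed[of a b] by (simp add: pure_def AH.tensor_closed)

lemma mod_hom_pure [multilinear]:
  "\<lbrakk>f \<in> mod_hom K Q A; b \<in> carrier A; h \<in> carrier H\<rbrakk> \<Longrightarrow> (\<lambda>x. pure (f x) b h) \<in> mod_hom K Q TS"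
  "\<lbrakk>f \<in> mod_hom K Q A; a \<in> carrier A; h \<in> carrier H\<rbrakk> \<Longrightarrow> (\<lambda>x. pure a (f x) h) \<in> mod_hom K Q TS"
  "\<lbrakk>g \<in> mod_hom K Q H; a \<in> carrier A; b \<in> carrier A\<rbrakk> \<Longrightarrow> (\<lambda>x. pure a b (g x)) \<in> mod_hom K Q TS"
proof -
  have o: "mod_hom K Q (opposite A) = mod_hom K Q A" by (simp add: mod_hom_def)
  show "(\<lambda>x. pure (f x) b h) \<in> mod_hom K Q TS"
    if "f \<in> mod_hom K Q A" "b \<in> carrier A" "h \<in> carrier H"
    unfolding pure_def using that AA.mod_hom_tensor_left[OF that(1), of b]
    by (intro AH.mod_hom_tensor_left) (simp_all add: AA.mod_hom_TA)
  show "(\<lambda>x. pure a (f x) h) \<in> mod_hom K Q TS"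
    if "f \<in> mod_hom K Q A" "a \<in> carrier A" "h \<in> carrier H"
    unfolding pure_def using that AA.mod_hom_tensor_right[of f Q a]
    by (intro AH.mod_hom_tensor_left) (simp_all add: AA.mod_hom_TA o)
  show "(\<lambda>x. pure a b (g x)) \<in> mod_hom K Q TS"
    if "g \<in> mod_hom K Q H" "a \<in> carrier A" "b \<in> carrier A"
    unfolding pure_def using that AA.tensor_closed[of a b]
    by (intro AH.mod_hom_tensor_right) simp_all
qed

lemma mod_hom_act [multilinear]:
  "\<lbrakk>f \<in> mod_hom K Q A; h \<in> carrier H\<rbrakk> \<Longrightarrow> (\<lambda>x. act h (f x)) \<in> mod_hom K Q A"
  "\<lbrakk>g \<in> mod_hom K Q H; y \<in> carrier A\<rbrakk> \<Longrightarrow> (\<lambda>x. act (g x) y) \<in> mod_hom K Q A"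
  by (auto simp: mod_hom_def Pi_def act_closed act_add_left act_add_right act_smult_left act_smult_right)

declare act_closed [multilinear]

lemma S_induct [consumes 1, case_names pure add]:
  assumes p: "p \<in> carrier S"
    and pure: "\<And>a b h. \<lbrakk>a \<in> carrier A; b \<in> carrier A; h \<in> carrier H\<rbrakk> \<Longrightarrow> P (pure a b h)"
    and add: "\<And>p q. \<lbrakk>p \<in> carrier S; q \<in> carrier S; P p; P q\<rbrakk> \<Longrightarrow> P (p \<oplus>\<^bsub>S\<^esub> q)"
  shows "P p"
  using p unfolding S_simps
proof (induction rule: AH.tensor_induct)
  case (tensor t h)
  from tensor(1) show ?case unfolding tensor_algebra_simps
  proof (induction rule: AA.tensor_induct)
    case (tensor a b)
    then show ?case using pure \<open>h \<in> carrier H\<close> by (simp add: pure_def)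
  next
    case (add t u)
    then show ?case
      using assms(3)[of "tensor K Ae H t h" "tensor K Ae H u h"] \<open>h \<in> carrier H\<close>
        mod_hom_add[OF bilinear_left[OF AH.tensor_bilinear], of h t u] by (simp add: AH.tensor_closed)
  qed
qed (use add in simp)

lemma nu_tensor_aux:
  assumes "h \<in> carrier H"
  shows "bilinear K A (opposite A) TS
    (\<lambda>a b. H.Sw TS (\<lambda>g h3. H.Sw TS (\<lambda>h1 h2. pure (act h1 a) (act h3 b) h2) g) h)"
proof -
  \<comment> \<open>The opposite algebra differs from A in its multiplication alone, so linear maps
    out of the two are the same.\<close>
  have o: "mod_hom K (opposite A) P = mod_hom K A P" for P :: "('k, 'x, 'y) module_scheme"
    by (simp add: mod_hom_def)
  show ?thesis
    by (rule bilinearI; (unfold o opposite_simps)?) (rule multilinear assms | assumption)+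
qed

lemma smash_nu_eq:
  "smash_nu K H A act h t = tensor_lift K TS
    (\<lambda>a b. H.Sw TS (\<lambda>g h3. H.Sw TS (\<lambda>h1 h2. pure (act h1 a) (act h3 b) h2) g) h) t"
  by (simp add: smash_nu_def Let_def enveloping_algebra_def pure_def)

lemma smash_nu_tensor:
  assumes "h \<in> carrier H" "a \<in> carrier A" "b \<in> carrier A"
  shows "smash_nu K H A act h (tensor K A (opposite A) a b) =
    H.Sw TS (\<lambda>g h3. H.Sw TS (\<lambda>h1 h2. pure (act h1 a) (act h3 b) h2) g) h"
  unfolding smash_nu_eq using assms
  by (simp add: AA.tensor_lift_tensor[OF TS_module nu_tensor_aux])

lemma smash_nu_linear:
  "h \<in> carrier H \<Longrightarrow> smash_nu K H A act h \<in> mod_hom K AA.T TS"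
  "t \<in> carrier AA.T \<Longrightarrow> (\<lambda>h. smash_nu K H A act h t) \<in> mod_hom K H TS"
proof -
  show "smash_nu K H A act h \<in> mod_hom K AA.T TS" if "h \<in> carrier H"
    unfolding smash_nu_eq[abs_def] using AA.tensor_lift_hom[OF TS_module nu_tensor_aux[OF that]] .
  show "(\<lambda>h. smash_nu K H A act h t) \<in> mod_hom K H TS" if "t \<in> carrier AA.T"
    unfolding smash_nu_eq
    by (rule AA.mod_hom_tensor_lift_fun[OF TS_module that]; (unfold opposite_simps)?) (rule multilinear | assumption)+
qed

text \<open>The second half of the multiplication of S: once \<open>smash_nu\<close> has turned h
  and u into w, the outer factors t and g are multiplied onto w, in the enveloping algebra and in H
  respectively.\<close>

definition mult_aux :: "('k, 'a, 'a) tensor \<Rightarrow> 'h \<Rightarrow> ('k, 'a, 'h) smash \<Rightarrow> ('k, 'a, 'h) smash"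
  where "mult_aux t g w = tensor_lift K TS (\<lambda>u' h'. tensor K Ae H (t \<otimes>\<^bsub>Ae\<^esub> u') (h' \<otimes>\<^bsub>H\<^esub> g)) w"

lemma mult_aux_bilinear:
  assumes "t \<in> carrier AA.T" "g \<in> carrier H"
  shows "bilinear K Ae H TS (\<lambda>u' h'. tensor K Ae H (t \<otimes>\<^bsub>Ae\<^esub> u') (h' \<otimes>\<^bsub>H\<^esub> g))"
  using assms bilinear_right[OF AA.TA_mult_bilinear, of t] bilinear_closed[OF AA.TA_mult_bilinear, of t]
  by (intro bilinearI AH.mod_hom_tensor_left AH.mod_hom_tensor_right multilinear) (simp_all add: AA.mod_hom_TA)

lemma mult_aux_linear:
  "\<lbrakk>t \<in> carrier AA.T; g \<in> carrier H\<rbrakk> \<Longrightarrow> mult_aux t g \<in> mod_hom K TS TS"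
  "\<lbrakk>t \<in> carrier AA.T; w \<in> carrier TS\<rbrakk> \<Longrightarrow> (\<lambda>g. mult_aux t g w) \<in> mod_hom K H TS"
  "\<lbrakk>w \<in> carrier TS; g \<in> carrier H\<rbrakk> \<Longrightarrow> (\<lambda>t. mult_aux t g w) \<in> mod_hom K AA.T TS"
proof -
  show "mult_aux t g \<in> mod_hom K TS TS" if "t \<in> carrier AA.T" "g \<in> carrier H"
    unfolding mult_aux_def[abs_def] by (rule AH.tensor_lift_hom[OF TS_module mult_aux_bilinear[OF that]])
  show "(\<lambda>g. mult_aux t g w) \<in> mod_hom K H TS" if "t \<in> carrier AA.T" "w \<in> carrier TS"
    unfolding mult_aux_def using that bilinear_closed[OF AA.TA_mult_bilinear, of t]
    by (intro AH.mod_hom_tensor_lift_fun TS_module AH.mod_hom_tensor_right multilinear) simp_all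
  show "(\<lambda>t. mult_aux t g w) \<in> mod_hom K AA.T TS" if "w \<in> carrier TS" "g \<in> carrier H"
    unfolding mult_aux_def using that bilinear_left[OF AA.TA_mult_bilinear]
    by (intro AH.mod_hom_tensor_lift_fun TS_module AH.mod_hom_tensor_left multilinear) (simp_all add: AA.mod_hom_TA)
qed

lemma S_mult_eq:
  "p \<otimes>\<^bsub>S\<^esub> q = tensor_lift K TS (\<lambda>t h. tensor_lift K TS (\<lambda>u g. mult_aux t g (smash_nu K H A act h u)) q) p"
  by (simp add: smash_algebra_def Let_def enveloping_algebra_def mult_aux_def)

lemma S_mult_aux_bilinear:
  assumes "t \<in> carrier AA.T" "h \<in> carrier H"
  shows "bilinear K Ae H TS (\<lambda>u g. mult_aux t g (smash_nu K H A act h u))"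
  unfolding AA.mod_hom_TA
proof (rule bilinearI)
  show "(\<lambda>g. mult_aux t g (smash_nu K H A act h u)) \<in> mod_hom K H TS" if "u \<in> carrier Ae" for u
    using assms that mod_hom_closed[OF smash_nu_linear(1)] by (intro mult_aux_linear) simp_all
  show "(\<lambda>u. mult_aux t g (smash_nu K H A act h u)) \<in> mod_hom K Ae TS" if "g \<in> carrier H" for g
    unfolding AA.mod_hom_TA using assms that
    by (intro mod_hom_compose[OF smash_nu_linear(1) mult_aux_linear(1)])
qed

lemma S_mult_outer_bilinear:
  assumes q: "q \<in> carrier TS"
  shows "bilinear K Ae H TS (\<lambda>t h. tensor_lift K TS (\<lambda>u g. mult_aux t g (smash_nu K H A act h u)) q)"
proof (rule bilinearI)
  show "(\<lambda>h. tensor_lift K TS (\<lambda>u g. mult_aux t g (smash_nu K H A act h u)) q) \<in> mod_hom K H TS"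
    if "t \<in> carrier Ae" for t
    using that by (intro AH.mod_hom_tensor_lift_fun TS_module q mod_hom_compose[OF smash_nu_linear(2) mult_aux_linear(1)]) simp_all
  show "(\<lambda>t. tensor_lift K TS (\<lambda>u g. mult_aux t g (smash_nu K H A act h u)) q) \<in> mod_hom K Ae TS"
    if "h \<in> carrier H" for h
    unfolding AA.mod_hom_TA using that mod_hom_closed[OF smash_nu_linear(1)]
    by (intro AH.mod_hom_tensor_lift_fun TS_module q mult_aux_linear(3)) simp_all
qed

lemma S_mult_bilinear: "bilinear K TS TS TS (mult S)"
proof (rule bilinearI)
  show "(\<lambda>q. p \<otimes>\<^bsub>S\<^esub> q) \<in> mod_hom K TS TS" if "p \<in> carrier TS" for p
    unfolding S_mult_eq using that
    by (intro AH.mod_hom_tensor_lift_fun TS_module AH.tensor_lift_hom S_mult_aux_bilinear) simp_all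
  show "(\<lambda>p. p \<otimes>\<^bsub>S\<^esub> q) \<in> mod_hom K TS TS" if "q \<in> carrier TS" for q
    unfolding S_mult_eq by (rule AH.tensor_lift_hom[OF TS_module S_mult_outer_bilinear[OF that]])
qed

lemma S_mult_closed: "\<lbrakk>p \<in> carrier TS; q \<in> carrier TS\<rbrakk> \<Longrightarrow> p \<otimes>\<^bsub>S\<^esub> q \<in> carrier TS"
  by (rule bilinear_closed[OF S_mult_bilinear])

text \<open>The sum of (a (h1 a') \<otimes> (h3 b') b) # h2 g. The factor b stands on the right
  because the second tensor factor multiplies in the opposite algebra.\<close>

lemma pure_mult:
  assumes "a \<in> carrier A" "b \<in> carrier A" "h \<in> carrier H" "a' \<in> carrier A" "b' \<in> carrier A" "g \<in> carrier H"
  shows "pure a b h \<otimes>\<^bsub>S\<^esub> pure a' b' g = H.Sw TS (\<lambda>k h3. H.Sw TS (\<lambda>h1 h2.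
    pure (a \<otimes>\<^bsub>A\<^esub> act h1 a') (act h3 b' \<otimes>\<^bsub>A\<^esub> b) (h2 \<otimes>\<^bsub>H\<^esub> g)) k) h"
proof -
  let ?ab = "tensor K A (opposite A) a b" and ?ab' = "tensor K A (opposite A) a' b'"
  have ab: "?ab \<in> carrier AA.T" "?ab' \<in> carrier AA.T" using assms by (simp_all add: AA.tensor_closed)
  have m: "mult_aux ?ab g (pure x y k) = pure (a \<otimes>\<^bsub>A\<^esub> x) (y \<otimes>\<^bsub>A\<^esub> b) (k \<otimes>\<^bsub>H\<^esub> g)"
    if "x \<in> carrier A" "y \<in> carrier A" "k \<in> carrier H" for x y k
    unfolding mult_aux_def pure_def
    using that assms ab AA.tensor_closed[of x y] AA.TA_mult_tensor[of a b x y]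
    by (simp add: AH.tensor_lift_tensor[OF TS_module mult_aux_bilinear])
  have "pure a b h \<otimes>\<^bsub>S\<^esub> pure a' b' g = mult_aux ?ab g (smash_nu K H A act h ?ab')"
    unfolding pure_def[of a b] pure_def[of a' b'] S_mult_eq using assms ab
    by (simp add: AH.tensor_lift_tensor[OF TS_module S_mult_outer_bilinear] AH.tensor_closed
        AH.tensor_lift_tensor[OF TS_module S_mult_aux_bilinear])
  also have "\<dots> = mult_aux ?ab g (H.Sw TS (\<lambda>k h3. H.Sw TS (\<lambda>h1 h2. pure (act h1 a') (act h3 b') h2) k) h)"
    using assms by (simp add: smash_nu_tensor)
  also have "\<dots> = H.Sw TS (\<lambda>k h3. mult_aux ?ab g (H.Sw TS (\<lambda>h1 h2. pure (act h1 a') (act h3 b') h2) k)) h"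
    by (rule H.hom_Sw[OF TS_module TS_module mult_aux_linear(1)[OF ab(1) assms(6)]])
      (rule multilinear assms | assumption)+
  also have "\<dots> = H.Sw TS (\<lambda>k h3. H.Sw TS (\<lambda>h1 h2. mult_aux ?ab g (pure (act h1 a') (act h3 b') h2)) k) h"
    by (rule H.Sw_cong[OF TS_module assms(3)], rule H.hom_Sw[OF TS_module TS_module mult_aux_linear(1)[OF ab(1) assms(6)]])
      (rule multilinear assms mod_hom_closed[OF mult_aux_linear(1)[OF ab(1) assms(6)]] | assumption)+
  also have "\<dots> = H.Sw TS (\<lambda>k h3. H.Sw TS (\<lambda>h1 h2.
    pure (a \<otimes>\<^bsub>A\<^esub> act h1 a') (act h3 b' \<otimes>\<^bsub>A\<^esub> b) (h2 \<otimes>\<^bsub>H\<^esub> g)) k) h"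
    by (rule H.Sw_cong[OF TS_module assms(3)], rule H.Sw_cong[OF TS_module], assumption, rule m)
      (rule multilinear assms | assumption)+
  finally show ?thesis .
qed

end

section \<open>The smash algebra is a ring acting on A\<close>

context hmodule_algebra
begin

lemma act_mult:
  "\<lbrakk>h \<in> carrier H; x \<in> carrier A; y \<in> carrier A\<rbrakk> \<Longrightarrow>
    act h (x \<otimes>\<^bsub>A\<^esub> y) = H.Sw A (\<lambda>g g'. act g x \<otimes>\<^bsub>A\<^esub> act g' y) h"
  by (rule act_on_mult)

text \<open>Both bracketings expand to the sum of \<open>\<Phi>\<close> (h1, h2 g1, h3 g2, h4 g3,
  h5) over five legs of h and three of g. They reach it through different iterated comultiplications
  of h, which \<open>Sw_coassoc5\<close> identifies.\<close>

lemma pure_mult_assoc: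
  assumes x: "a \<in> carrier A" "b \<in> carrier A" "h \<in> carrier H"
    and y: "a' \<in> carrier A" "b' \<in> carrier A" "g \<in> carrier H"
    and z: "a'' \<in> carrier A" "b'' \<in> carrier A" "l \<in> carrier H"
  shows "(pure a b h \<otimes>\<^bsub>S\<^esub> pure a' b' g) \<otimes>\<^bsub>S\<^esub> pure a'' b'' l =
    pure a b h \<otimes>\<^bsub>S\<^esub> (pure a' b' g \<otimes>\<^bsub>S\<^esub> pure a'' b'' l)"
proof -
  note T = TS_module
  define \<Phi> where "\<Phi> h1 m1 m2 m3 h3 =
    pure (a \<otimes>\<^bsub>A\<^esub> act h1 a' \<otimes>\<^bsub>A\<^esub> act m1 a'') (act m3 b'' \<otimes>\<^bsub>A\<^esub> (act h3 b' \<otimes>\<^bsub>A\<^esub> b)) (m2 \<otimes>\<^bsub>H\<^esub> l)"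
    for h1 m1 m2 m3 h3
  have \<Phi>1: "(\<lambda>i. \<Phi> (f i) m1 m2 m3 h3) \<in> mod_hom K Q TS"
    if "f \<in> mod_hom K Q H" "m1 \<in> carrier H" "m2 \<in> carrier H" "m3 \<in> carrier H" "h3 \<in> carrier H"
    for f m1 m2 m3 h3 and Q :: "('k, 'x, 'y) module_scheme"
    unfolding \<Phi>_def by (rule multilinear x y z that | assumption)+
  have \<Phi>2: "(\<lambda>i. \<Phi> h1 (f i) m2 m3 h3) \<in> mod_hom K Q TS"
    if "f \<in> mod_hom K Q H" "h1 \<in> carrier H" "m2 \<in> carrier H" "m3 \<in> carrier H" "h3 \<in> carrier H"
    for f h1 m2 m3 h3 and Q :: "('k, 'x, 'y) module_scheme"
    unfolding \<Phi>_def by (rule multilinear x y z that | assumption)+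
  have \<Phi>3: "(\<lambda>i. \<Phi> h1 m1 (f i) m3 h3) \<in> mod_hom K Q TS"
    if "f \<in> mod_hom K Q H" "h1 \<in> carrier H" "m1 \<in> carrier H" "m3 \<in> carrier H" "h3 \<in> carrier H"
    for f h1 m1 m3 h3 and Q :: "('k, 'x, 'y) module_scheme"
    unfolding \<Phi>_def by (rule multilinear x y z that | assumption)+
  have \<Phi>4: "(\<lambda>i. \<Phi> h1 m1 m2 (f i) h3) \<in> mod_hom K Q TS"
    if "f \<in> mod_hom K Q H" "h1 \<in> carrier H" "m1 \<in> carrier H" "m2 \<in> carrier H" "h3 \<in> carrier H"
    for f h1 m1 m2 h3 and Q :: "('k, 'x, 'y) module_scheme"
    unfolding \<Phi>_def by (rule multilinear x y z that | assumption)+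
  have \<Phi>5: "(\<lambda>i. \<Phi> h1 m1 m2 m3 (f i)) \<in> mod_hom K Q TS"
    if "f \<in> mod_hom K Q H" "h1 \<in> carrier H" "m1 \<in> carrier H" "m2 \<in> carrier H" "m3 \<in> carrier H"
    for f h1 m1 m2 m3 and Q :: "('k, 'x, 'y) module_scheme"
    unfolding \<Phi>_def by (rule multilinear x y z that | assumption)+
  have \<Phi>c: "\<Phi> h1 m1 m2 m3 h3 \<in> carrier TS"
    if "h1 \<in> carrier H" "m1 \<in> carrier H" "m2 \<in> carrier H" "m3 \<in> carrier H" "h3 \<in> carrier H" for h1 m1 m2 m3 h3
    unfolding \<Phi>_def by (rule multilinear x y z that | assumption)+
  \<comment> \<open>The legs of g are summed away first, which leaves a function linear in each of
    the five legs of h; coassociativity is applied to this function.\<close>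
  define \<psi> where "\<psi> h1 m1 m2 m3 h3 = H.Sw TS (\<lambda>n g3. H.Sw TS (\<lambda>g1 g2.
    \<Phi> h1 (m1 \<otimes>\<^bsub>H\<^esub> g1) (m2 \<otimes>\<^bsub>H\<^esub> g2) (m3 \<otimes>\<^bsub>H\<^esub> g3) h3) n) g" for h1 m1 m2 m3 h3
  note \<Phi>rules = multilinear \<Phi>1 \<Phi>2 \<Phi>3 \<Phi>4 \<Phi>5 \<Phi>c x y z
  have \<psi>c: "\<psi> h1 m1 m2 m3 h3 \<in> carrier TS"
    if "h1 \<in> carrier H" "m1 \<in> carrier H" "m2 \<in> carrier H" "m3 \<in> carrier H" "h3 \<in> carrier H" for h1 m1 m2 m3 h3
    unfolding \<psi>_def by (rule \<Phi>rules that | assumption)+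
  have \<psi>1: "(\<lambda>i. \<psi> i m1 m2 m3 h3) \<in> mod_hom K H TS"
    if "m1 \<in> carrier H" "m2 \<in> carrier H" "m3 \<in> carrier H" "h3 \<in> carrier H" for m1 m2 m3 h3
    unfolding \<psi>_def by (rule \<Phi>rules that | assumption)+
  have \<psi>2: "(\<lambda>i. \<psi> h1 i m2 m3 h3) \<in> mod_hom K H TS"
    if "h1 \<in> carrier H" "m2 \<in> carrier H" "m3 \<in> carrier H" "h3 \<in> carrier H" for h1 m2 m3 h3
    unfolding \<psi>_def by (rule \<Phi>rules that | assumption)+
  have \<psi>3: "(\<lambda>i. \<psi> h1 m1 i m3 h3) \<in> mod_hom K H TS"
    if "h1 \<in> carrier H" "m1 \<in> carrier H" "m3 \<in> carrier H" "h3 \<in> carrier H" for h1 m1 m3 h3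
    unfolding \<psi>_def by (rule \<Phi>rules that | assumption)+
  have \<psi>4: "(\<lambda>i. \<psi> h1 m1 m2 i h3) \<in> mod_hom K H TS"
    if "h1 \<in> carrier H" "m1 \<in> carrier H" "m2 \<in> carrier H" "h3 \<in> carrier H" for h1 m1 m2 h3
    unfolding \<psi>_def by (rule \<Phi>rules that | assumption)+
  have \<psi>5: "(\<lambda>i. \<psi> h1 m1 m2 m3 i) \<in> mod_hom K H TS"
    if "h1 \<in> carrier H" "m1 \<in> carrier H" "m2 \<in> carrier H" "m3 \<in> carrier H" for h1 m1 m2 m3
    unfolding \<psi>_def by (rule \<Phi>rules that | assumption)+
  have mz: "(\<lambda>w. w \<otimes>\<^bsub>S\<^esub> pure a'' b'' l) \<in> mod_hom K TS TS"
    by (rule bilinear_left[OF S_mult_bilinear]) (rule multilinear z)+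
  have mx: "(\<lambda>w. pure a b h \<otimes>\<^bsub>S\<^esub> w) \<in> mod_hom K TS TS"
    by (rule bilinear_right[OF S_mult_bilinear]) (rule multilinear x)+
  note rules = multilinear x y z \<Phi>c \<psi>c S_mult_closed
  \<comment> \<open>In the left bracketing the element comultiplied next is the product h2 g, and
    its comultiplication is that of h2 times that of g.\<close>
  have inner: "pure (a \<otimes>\<^bsub>A\<^esub> act h1 a') (act h3 b' \<otimes>\<^bsub>A\<^esub> b) (h2 \<otimes>\<^bsub>H\<^esub> g) \<otimes>\<^bsub>S\<^esub> pure a'' b'' l =
      H.Sw TS (\<lambda>n m3. H.Sw TS (\<lambda>m1 m2. \<psi> h1 m1 m2 m3 h3) n) h2"
    if h: "h1 \<in> carrier H" "h2 \<in> carrier H" "h3 \<in> carrier H" for h1 h2 h3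
  proof -
    have "pure (a \<otimes>\<^bsub>A\<^esub> act h1 a') (act h3 b' \<otimes>\<^bsub>A\<^esub> b) (h2 \<otimes>\<^bsub>H\<^esub> g) \<otimes>\<^bsub>S\<^esub> pure a'' b'' l =
        H.Sw TS (\<lambda>n m3. H.Sw TS (\<lambda>m1 m2. \<Phi> h1 m1 m2 m3 h3) n) (h2 \<otimes>\<^bsub>H\<^esub> g)"
      unfolding \<Phi>_def by (rule pure_mult) (rule multilinear x y z h)+
    also have "\<dots> = H.Sw TS (\<lambda>n m3. H.Sw TS (\<lambda>m1 m2. \<psi> h1 m1 m2 m3 h3) n) h2"
      unfolding \<psi>_def by (rule H.Sw3_mult[OF T]) (rule \<Phi>rules h | assumption)+
    finally show ?thesis .
  qed
  have "(pure a b h \<otimes>\<^bsub>S\<^esub> pure a' b' g) \<otimes>\<^bsub>S\<^esub> pure a'' b'' l =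
    H.Sw TS (\<lambda>k h3. H.Sw TS (\<lambda>h1 h2.
      pure (a \<otimes>\<^bsub>A\<^esub> act h1 a') (act h3 b' \<otimes>\<^bsub>A\<^esub> b) (h2 \<otimes>\<^bsub>H\<^esub> g)) k) h \<otimes>\<^bsub>S\<^esub> pure a'' b'' l"
    using pure_mult[OF x y] by simp
  also have "\<dots> = H.Sw TS (\<lambda>k h3. H.Sw TS (\<lambda>h1 h2.
      pure (a \<otimes>\<^bsub>A\<^esub> act h1 a') (act h3 b' \<otimes>\<^bsub>A\<^esub> b) (h2 \<otimes>\<^bsub>H\<^esub> g)) k \<otimes>\<^bsub>S\<^esub> pure a'' b'' l) h"
    by (rule H.hom_Sw[OF T T mz]) (rule rules | assumption)+
  also have "\<dots> = H.Sw TS (\<lambda>k h3. H.Sw TS (\<lambda>h1 h2.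
      pure (a \<otimes>\<^bsub>A\<^esub> act h1 a') (act h3 b' \<otimes>\<^bsub>A\<^esub> b) (h2 \<otimes>\<^bsub>H\<^esub> g) \<otimes>\<^bsub>S\<^esub> pure a'' b'' l) k) h"
    by (rule H.Sw_cong[OF T x(3)], rule H.hom_Sw[OF T T mz]) (rule rules | assumption)+
  also have "\<dots> = H.Sw TS (\<lambda>k h3. H.Sw TS (\<lambda>h1 h2.
      H.Sw TS (\<lambda>n m3. H.Sw TS (\<lambda>m1 m2. \<psi> h1 m1 m2 m3 h3) n) h2) k) h"
    by (rule H.Sw_cong[OF T x(3)], rule H.Sw_cong[OF T], assumption, rule inner) (rule rules | assumption)+
  also have "\<dots> = H.Sw TS (\<lambda>k v. H.Sw TS (\<lambda>u m2. H.Sw TS (\<lambda>h1 m1. H.Sw TS (\<lambda>m3 h3.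
      \<psi> h1 m1 m2 m3 h3) v) u) k) h"
    by (rule H.Sw_coassoc5[OF T \<psi>1 \<psi>2 \<psi>3 \<psi>4 \<psi>5 x(3)])
  finally have L: "(pure a b h \<otimes>\<^bsub>S\<^esub> pure a' b' g) \<otimes>\<^bsub>S\<^esub> pure a'' b'' l = \<dots>" .
  \<comment> \<open>In the right bracketing the outer legs u and v act on products, and the module
    algebra axiom splits each of them once more.\<close>
  have inner': "pure (a \<otimes>\<^bsub>A\<^esub> act u (a' \<otimes>\<^bsub>A\<^esub> act g1 a'')) (act v (act g3 b'' \<otimes>\<^bsub>A\<^esub> b') \<otimes>\<^bsub>A\<^esub> b) (m2 \<otimes>\<^bsub>H\<^esub> (g2 \<otimes>\<^bsub>H\<^esub> l)) =
      H.Sw TS (\<lambda>h1 m1. H.Sw TS (\<lambda>m3 h3. \<Phi> h1 (m1 \<otimes>\<^bsub>H\<^esub> g1) (m2 \<otimes>\<^bsub>H\<^esub> g2) (m3 \<otimes>\<^bsub>H\<^esub> g3) h3) v) u"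
    if h: "u \<in> carrier H" "v \<in> carrier H" "m2 \<in> carrier H" "g1 \<in> carrier H" "g2 \<in> carrier H" "g3 \<in> carrier H"
    for u v m2 g1 g2 g3
  proof -
    let ?m = "m2 \<otimes>\<^bsub>H\<^esub> (g2 \<otimes>\<^bsub>H\<^esub> l)"
    let ?c = "act v (act g3 b'' \<otimes>\<^bsub>A\<^esub> b') \<otimes>\<^bsub>A\<^esub> b"
    have hc: "(\<lambda>w. pure (a \<otimes>\<^bsub>A\<^esub> w) ?c ?m) \<in> mod_hom K A TS" by (rule rules h | assumption)+
    have "pure (a \<otimes>\<^bsub>A\<^esub> act u (a' \<otimes>\<^bsub>A\<^esub> act g1 a'')) ?c ?m =
        pure (a \<otimes>\<^bsub>A\<^esub> H.Sw A (\<lambda>h1 m1. act h1 a' \<otimes>\<^bsub>A\<^esub> act m1 (act g1 a'')) u) ?c ?m"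
      using h y z by (subst act_mult) (simp_all add: act_closed)
    also have "\<dots> = H.Sw TS (\<lambda>h1 m1. pure (a \<otimes>\<^bsub>A\<^esub> (act h1 a' \<otimes>\<^bsub>A\<^esub> act m1 (act g1 a''))) ?c ?m) u"
      by (rule H.hom_Sw[OF A.is_module T hc]) (rule rules h | assumption)+
    also have "\<dots> = H.Sw TS (\<lambda>h1 m1. H.Sw TS (\<lambda>m3 h3. \<Phi> h1 (m1 \<otimes>\<^bsub>H\<^esub> g1) (m2 \<otimes>\<^bsub>H\<^esub> g2) (m3 \<otimes>\<^bsub>H\<^esub> g3) h3) v) u"
    proof (rule H.Sw_cong[OF T h(1)])
      fix h1 m1 assume hm: "h1 \<in> carrier H" "m1 \<in> carrier H"
      let ?d = "a \<otimes>\<^bsub>A\<^esub> (act h1 a' \<otimes>\<^bsub>A\<^esub> act m1 (act g1 a''))"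
      have hd: "(\<lambda>w. pure ?d (w \<otimes>\<^bsub>A\<^esub> b) ?m) \<in> mod_hom K A TS" by (rule rules h hm | assumption)+
      have "pure ?d ?c ?m = pure ?d (H.Sw A (\<lambda>m3 h3. act m3 (act g3 b'') \<otimes>\<^bsub>A\<^esub> act h3 b') v \<otimes>\<^bsub>A\<^esub> b) ?m"
        using h y z by (subst act_mult) (simp_all add: act_closed)
      also have "\<dots> = H.Sw TS (\<lambda>m3 h3. pure ?d ((act m3 (act g3 b'') \<otimes>\<^bsub>A\<^esub> act h3 b') \<otimes>\<^bsub>A\<^esub> b) ?m) v"
        by (rule H.hom_Sw[OF A.is_module T hd]) (rule rules h | assumption)+
      also have "\<dots> = H.Sw TS (\<lambda>m3 h3. \<Phi> h1 (m1 \<otimes>\<^bsub>H\<^esub> g1) (m2 \<otimes>\<^bsub>H\<^esub> g2) (m3 \<otimes>\<^bsub>H\<^esub> g3) h3) v"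
      proof (rule H.Sw_cong[OF T h(2)])
        fix m3 h3 assume hm': "m3 \<in> carrier H" "h3 \<in> carrier H"
        show "pure ?d ((act m3 (act g3 b'') \<otimes>\<^bsub>A\<^esub> act h3 b') \<otimes>\<^bsub>A\<^esub> b) ?m =
          \<Phi> h1 (m1 \<otimes>\<^bsub>H\<^esub> g1) (m2 \<otimes>\<^bsub>H\<^esub> g2) (m3 \<otimes>\<^bsub>H\<^esub> g3) h3"
          unfolding \<Phi>_def using x y z h hm hm'
          by (simp add: act_assoc act_closed A.m_assoc H.m_assoc)
      qed (rule rules h hm | assumption)+
      finally show "pure ?d ?c ?m = H.Sw TS (\<lambda>m3 h3. \<Phi> h1 (m1 \<otimes>\<^bsub>H\<^esub> g1) (m2 \<otimes>\<^bsub>H\<^esub> g2) (m3 \<otimes>\<^bsub>H\<^esub> g3) h3) v" .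
    qed (rule rules h | assumption)+
    finally show ?thesis .
  qed
  have "pure a b h \<otimes>\<^bsub>S\<^esub> (pure a' b' g \<otimes>\<^bsub>S\<^esub> pure a'' b'' l) =
    pure a b h \<otimes>\<^bsub>S\<^esub> H.Sw TS (\<lambda>n g3. H.Sw TS (\<lambda>g1 g2.
      pure (a' \<otimes>\<^bsub>A\<^esub> act g1 a'') (act g3 b'' \<otimes>\<^bsub>A\<^esub> b') (g2 \<otimes>\<^bsub>H\<^esub> l)) n) g"
    using pure_mult[OF y z] by simp
  also have "\<dots> = H.Sw TS (\<lambda>n g3. pure a b h \<otimes>\<^bsub>S\<^esub> H.Sw TS (\<lambda>g1 g2.
      pure (a' \<otimes>\<^bsub>A\<^esub> act g1 a'') (act g3 b'' \<otimes>\<^bsub>A\<^esub> b') (g2 \<otimes>\<^bsub>H\<^esub> l)) n) g"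
    by (rule H.hom_Sw[OF T T mx]) (rule rules | assumption)+
  also have "\<dots> = H.Sw TS (\<lambda>n g3. H.Sw TS (\<lambda>g1 g2. pure a b h \<otimes>\<^bsub>S\<^esub>
      pure (a' \<otimes>\<^bsub>A\<^esub> act g1 a'') (act g3 b'' \<otimes>\<^bsub>A\<^esub> b') (g2 \<otimes>\<^bsub>H\<^esub> l)) n) g"
    by (rule H.Sw_cong[OF T y(3)], rule H.hom_Sw[OF T T mx]) (rule rules | assumption)+
  also have "\<dots> = H.Sw TS (\<lambda>n g3. H.Sw TS (\<lambda>g1 g2. H.Sw TS (\<lambda>k v. H.Sw TS (\<lambda>u m2.
      pure (a \<otimes>\<^bsub>A\<^esub> act u (a' \<otimes>\<^bsub>A\<^esub> act g1 a'')) (act v (act g3 b'' \<otimes>\<^bsub>A\<^esub> b') \<otimes>\<^bsub>A\<^esub> b) (m2 \<otimes>\<^bsub>H\<^esub> (g2 \<otimes>\<^bsub>H\<^esub> l))) k) h) n) g"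
    by (rule H.Sw_cong[OF T y(3)], rule H.Sw_cong[OF T], assumption, rule pure_mult) (rule rules | assumption)+
  also have "\<dots> = H.Sw TS (\<lambda>n g3. H.Sw TS (\<lambda>g1 g2. H.Sw TS (\<lambda>k v. H.Sw TS (\<lambda>u m2.
      H.Sw TS (\<lambda>h1 m1. H.Sw TS (\<lambda>m3 h3. \<Phi> h1 (m1 \<otimes>\<^bsub>H\<^esub> g1) (m2 \<otimes>\<^bsub>H\<^esub> g2) (m3 \<otimes>\<^bsub>H\<^esub> g3) h3) v) u) k) h) n) g"
    by (rule H.Sw_cong[OF T y(3)], rule H.Sw_cong[OF T], assumption, rule H.Sw_cong[OF T x(3)],
        rule H.Sw_cong[OF T], assumption, rule inner') (rule rules | assumption)+
  also have "\<dots> = H.Sw TS (\<lambda>n g3. H.Sw TS (\<lambda>k v. H.Sw TS (\<lambda>u m2. H.Sw TS (\<lambda>h1 m1. H.Sw TS (\<lambda>m3 h3.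
      H.Sw TS (\<lambda>g1 g2. \<Phi> h1 (m1 \<otimes>\<^bsub>H\<^esub> g1) (m2 \<otimes>\<^bsub>H\<^esub> g2) (m3 \<otimes>\<^bsub>H\<^esub> g3) h3) n) v) u) k) h) g"
    by (rule H.Sw_cong[OF T y(3)], rule H.Sw5_swap[OF T, symmetric]) (rule rules | assumption)+
  also have "\<dots> = H.Sw TS (\<lambda>k v. H.Sw TS (\<lambda>u m2. H.Sw TS (\<lambda>h1 m1. H.Sw TS (\<lambda>m3 h3.
      \<psi> h1 m1 m2 m3 h3) v) u) k) h"
    unfolding \<psi>_def by (rule H.Sw5_swap[OF T, symmetric]) (rule rules | assumption)+
  finally show ?thesis using L by simp
qed

lemma S_abelian_group: "abelian_group S"
proof -
  show ?thesis
    by (rule abelian_group_surj[OF module.axioms(2)[OF TS_module], where \<pi> = "\<lambda>x. x"]) simp_all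
qed

lemma act_one_right: "h \<in> carrier H \<Longrightarrow> act h \<one>\<^bsub>A\<^esub> = counit H h \<odot>\<^bsub>A\<^esub> \<one>\<^bsub>A\<^esub>"
  by (rule act_on_one)

lemma pure_smult:
  assumes "a \<in> carrier A" "b \<in> carrier A" "h \<in> carrier H" "c \<in> carrier K"
  shows "pure (c \<odot>\<^bsub>A\<^esub> a) b h = c \<odot>\<^bsub>TS\<^esub> pure a b h" "pure a (c \<odot>\<^bsub>A\<^esub> b) h = c \<odot>\<^bsub>TS\<^esub> pure a b h"
    "pure a b (c \<odot>\<^bsub>H\<^esub> h) = c \<odot>\<^bsub>TS\<^esub> pure a b h"
  using assms mod_hom_smult[OF mod_hom_pure(1)[OF mod_hom_ident]] mod_hom_smult[OF mod_hom_pure(2)[OF mod_hom_ident]]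
    mod_hom_smult[OF mod_hom_pure(3)[OF mod_hom_ident]] by simp_all

text \<open>H acts on 1 through the counit, so the two outer legs of the comultiplication contribute
  scalars and disappear by the counit laws.\<close>

lemma pure_one_right:
  assumes x: "a \<in> carrier A" "b \<in> carrier A" "h \<in> carrier H"
  shows "pure a b h \<otimes>\<^bsub>S\<^esub> pure \<one>\<^bsub>A\<^esub> \<one>\<^bsub>A\<^esub> \<one>\<^bsub>H\<^esub> = pure a b h"
proof -
  note T = TS_module and rules = multilinear x A.one_closed H.one_closed
  have "pure a b h \<otimes>\<^bsub>S\<^esub> pure \<one>\<^bsub>A\<^esub> \<one>\<^bsub>A\<^esub> \<one>\<^bsub>H\<^esub> = H.Sw TS (\<lambda>k h3. H.Sw TS (\<lambda>h1 h2.
    pure (a \<otimes>\<^bsub>A\<^esub> act h1 \<one>\<^bsub>A\<^esub>) (act h3 \<one>\<^bsub>A\<^esub> \<otimes>\<^bsub>A\<^esub> b) (h2 \<otimes>\<^bsub>H\<^esub> \<one>\<^bsub>H\<^esub>)) k) h"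
    using x by (intro pure_mult) auto
  also have "\<dots> = H.Sw TS (\<lambda>k h3. H.Sw TS (\<lambda>h1 h2. counit H h1 \<odot>\<^bsub>TS\<^esub> (counit H h3 \<odot>\<^bsub>TS\<^esub> pure a b h2)) k) h"
  proof (rule H.Sw_cong[OF T x(3)], rule H.Sw_cong[OF T], assumption)
    fix k h3 h1 h2 assume "h3 \<in> carrier H" "h1 \<in> carrier H" "h2 \<in> carrier H"
    then show "pure (a \<otimes>\<^bsub>A\<^esub> act h1 \<one>\<^bsub>A\<^esub>) (act h3 \<one>\<^bsub>A\<^esub> \<otimes>\<^bsub>A\<^esub> b) (h2 \<otimes>\<^bsub>H\<^esub> \<one>\<^bsub>H\<^esub>) =
      counit H h1 \<odot>\<^bsub>TS\<^esub> (counit H h3 \<odot>\<^bsub>TS\<^esub> pure a b h2)"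
      using x by (simp add: act_one_right A.smult_mult_left A.smult_mult_right H.counit_closed pure_smult
          pure_closed H.R.m_comm flip: AH.Tm.smult_assoc1)
  qed (rule rules AH.Tm.smult_closed | assumption)+
  also have "\<dots> = H.Sw TS (\<lambda>k h3. counit H h3 \<odot>\<^bsub>TS\<^esub> pure a b k) h"
    by (rule H.Sw_cong[OF T x(3)], rule H.Sw_counit_left[OF T]) (rule rules AH.Tm.smult_closed | assumption)+
  also have "\<dots> = pure a b h"
    by (rule H.Sw_counit_right[OF T x(3)]) (rule rules | assumption)+
  finally show ?thesis .
qed

text \<open>The comultiplication of 1 is 1 \<otimes> 1, so no sum remains. Hence left and right
  multiplications by A commute inside S, and \<open>pure_factor\<close> can split a
  generator.\<close>

lemma pure_mult_special:
  assumes x: "a \<in> carrier A" "b \<in> carrier A" and y: "a' \<in> carrier A" "b' \<in> carrier A" "g \<in> carrier H"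
  shows "pure a b \<one>\<^bsub>H\<^esub> \<otimes>\<^bsub>S\<^esub> pure a' b' g = pure (a \<otimes>\<^bsub>A\<^esub> a') (b' \<otimes>\<^bsub>A\<^esub> b) g"
proof -
  note T = TS_module and rules = multilinear x y A.one_closed H.one_closed
  have "pure a b \<one>\<^bsub>H\<^esub> \<otimes>\<^bsub>S\<^esub> pure a' b' g = H.Sw TS (\<lambda>k h3. H.Sw TS (\<lambda>h1 h2.
    pure (a \<otimes>\<^bsub>A\<^esub> act h1 a') (act h3 b' \<otimes>\<^bsub>A\<^esub> b) (h2 \<otimes>\<^bsub>H\<^esub> g)) k) \<one>\<^bsub>H\<^esub>"
    using x y by (intro pure_mult) auto
  also have "\<dots> = H.Sw TS (\<lambda>h1 h2.
    pure (a \<otimes>\<^bsub>A\<^esub> act h1 a') (act \<one>\<^bsub>H\<^esub> b' \<otimes>\<^bsub>A\<^esub> b) (h2 \<otimes>\<^bsub>H\<^esub> g)) \<one>\<^bsub>H\<^esub>"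
    by (rule H.Sw_one[OF T]) (rule rules | assumption)+
  also have "\<dots> = pure (a \<otimes>\<^bsub>A\<^esub> act \<one>\<^bsub>H\<^esub> a') (act \<one>\<^bsub>H\<^esub> b' \<otimes>\<^bsub>A\<^esub> b) (\<one>\<^bsub>H\<^esub> \<otimes>\<^bsub>H\<^esub> g)"
    by (rule H.Sw_one[OF T]) (rule rules | assumption)+
  also have "\<dots> = pure (a \<otimes>\<^bsub>A\<^esub> a') (b' \<otimes>\<^bsub>A\<^esub> b) g"
    using x y by (simp add: act_one)
  finally show ?thesis .
qed

lemma S_one_closed: "one S \<in> carrier TS"
  using pure_closed by simp

lemma S_add: "\<lbrakk>p \<in> carrier TS; q \<in> carrier TS; r \<in> carrier TS\<rbrakk> \<Longrightarrow>
    (p \<oplus>\<^bsub>TS\<^esub> q) \<otimes>\<^bsub>S\<^esub> r = p \<otimes>\<^bsub>S\<^esub> r \<oplus>\<^bsub>TS\<^esub> q \<otimes>\<^bsub>S\<^esub> r"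
  "\<lbrakk>p \<in> carrier TS; q \<in> carrier TS; r \<in> carrier TS\<rbrakk> \<Longrightarrow>
    r \<otimes>\<^bsub>S\<^esub> (p \<oplus>\<^bsub>TS\<^esub> q) = r \<otimes>\<^bsub>S\<^esub> p \<oplus>\<^bsub>TS\<^esub> r \<otimes>\<^bsub>S\<^esub> q"
  by (rule mod_hom_add[OF bilinear_left[OF S_mult_bilinear]]; assumption)
    (rule mod_hom_add[OF bilinear_right[OF S_mult_bilinear]]; assumption)

text \<open>Multiplication is additive in each argument, so associativity and the unit laws pass
  from pure elements to all of S by one induction per argument.\<close>

lemma S_ring: "ring S"
proof (rule ringI[OF S_abelian_group])
  have assoc3: "p \<otimes>\<^bsub>S\<^esub> q \<otimes>\<^bsub>S\<^esub> r = p \<otimes>\<^bsub>S\<^esub> (q \<otimes>\<^bsub>S\<^esub> r)"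
    if pqr: "p \<in> carrier S" "q \<in> carrier S" "r \<in> carrier S" for p q r
    using pqr(1)
  proof (induction rule: S_induct)
    case p: (pure a b h)
    show ?case using pqr(2)
    proof (induction rule: S_induct)
      case q: (pure a' b' g)
      show ?case using pqr(3)
      proof (induction rule: S_induct)
        case (pure a'' b'' l)
        then show ?case using p q by (intro pure_mult_assoc)
      next
        case (add r r')
        then show ?case using p q by (simp add: S_add S_mult_closed pure_closed)
      qed
    next
      case (add q q')
      then show ?case using p pqr(3) by (simp add: S_add S_mult_closed pure_closed)
    qed
  next
    case (add p p')
    then show ?case using pqr by (simp add: S_add S_mult_closed)
  qed
  show "Group.monoid S"
  proof (rule monoidI)
    show "\<one>\<^bsub>S\<^esub> \<otimes>\<^bsub>S\<^esub> p = p" if "p \<in> carrier S" for p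
      using that
    proof (induction rule: S_induct)
      case (pure a b h)
      then show ?case by (simp add: pure_mult_special)
    next
      case (add p q)
      then show ?case using S_one_closed by (simp add: S_add)
    qed
    show "p \<otimes>\<^bsub>S\<^esub> \<one>\<^bsub>S\<^esub> = p" if "p \<in> carrier S" for p
      using that
    proof (induction rule: S_induct)
      case (pure a b h)
      then show ?case by (simp add: pure_one_right)
    next
      case (add p q)
      then show ?case using S_one_closed by (simp add: S_add)
    qed
  qed (use assoc3 S_one_closed S_mult_closed in simp_all)
qed (simp_all add: S_add)

lemma Am_smult_eq:
  "p \<odot>\<^bsub>Am\<^esub> x = tensor_lift K A (\<lambda>t h. tensor_lift K A (\<lambda>a b. a \<otimes>\<^bsub>A\<^esub> act h x \<otimes>\<^bsub>A\<^esub> b) t) p"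
  by (simp add: smash_module_def)

lemma Am_smult_aux:
  assumes "x \<in> carrier A"
  shows "h \<in> carrier H \<Longrightarrow> bilinear K A (opposite A) A (\<lambda>a b. a \<otimes>\<^bsub>A\<^esub> act h x \<otimes>\<^bsub>A\<^esub> b)"
    and "bilinear K Ae H A (\<lambda>t h. tensor_lift K A (\<lambda>a b. a \<otimes>\<^bsub>A\<^esub> act h x \<otimes>\<^bsub>A\<^esub> b) t)"
proof -
  have o: "mod_hom K (opposite A) P = mod_hom K A P" for P :: "('k, 'x, 'y) module_scheme"
    by (simp add: mod_hom_def)
  show 1: "bilinear K A (opposite A) A (\<lambda>a b. a \<otimes>\<^bsub>A\<^esub> act h x \<otimes>\<^bsub>A\<^esub> b)" if "h \<in> carrier H" for h
    by (rule bilinearI; (unfold o opposite_simps)?) (rule multilinear assms that | assumption)+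
  show "bilinear K Ae H A (\<lambda>t h. tensor_lift K A (\<lambda>a b. a \<otimes>\<^bsub>A\<^esub> act h x \<otimes>\<^bsub>A\<^esub> b) t)"
  proof (rule bilinearI)
    show "(\<lambda>h. tensor_lift K A (\<lambda>a b. a \<otimes>\<^bsub>A\<^esub> act h x \<otimes>\<^bsub>A\<^esub> b) t) \<in> mod_hom K H A" if "t \<in> carrier Ae" for t
      using that assms by (intro AA.mod_hom_tensor_lift_fun multilinear) simp_all
    show "(\<lambda>t. tensor_lift K A (\<lambda>a b. a \<otimes>\<^bsub>A\<^esub> act h x \<otimes>\<^bsub>A\<^esub> b) t) \<in> mod_hom K Ae A" if "h \<in> carrier H" for h
      unfolding AA.mod_hom_TA by (rule AA.tensor_lift_hom[OF A.is_module 1[OF that]])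
  qed
qed

lemma pure_smult_Am:
  assumes "a \<in> carrier A" "b \<in> carrier A" "h \<in> carrier H" "x \<in> carrier A"
  shows "pure a b h \<odot>\<^bsub>Am\<^esub> x = a \<otimes>\<^bsub>A\<^esub> act h x \<otimes>\<^bsub>A\<^esub> b"
  unfolding Am_smult_eq pure_def using assms AA.tensor_closed[of a b]
  by (simp add: AH.tensor_lift_tensor[OF A.is_module Am_smult_aux(2)]
      AA.tensor_lift_tensor[OF A.is_module Am_smult_aux(1)])

lemma Am_smult_linear:
  "x \<in> carrier A \<Longrightarrow> (\<lambda>p. p \<odot>\<^bsub>Am\<^esub> x) \<in> mod_hom K TS A"
  "p \<in> carrier TS \<Longrightarrow> (\<lambda>x. p \<odot>\<^bsub>Am\<^esub> x) \<in> mod_hom K A A"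
  unfolding Am_smult_eq
  by (rule AH.tensor_lift_hom[OF A.is_module Am_smult_aux(2)], assumption)
    (intro AH.mod_hom_tensor_lift_fun AA.mod_hom_tensor_lift_fun multilinear; simp)

text \<open>The three legs of h act on a', on g z and on b'; two uses of the module algebra axiom
  gather them into the action of h on a' (g z) b'.\<close>

lemma pure_mult_smult_Am:
  assumes x: "a \<in> carrier A" "b \<in> carrier A" "h \<in> carrier H"
    and y: "a' \<in> carrier A" "b' \<in> carrier A" "g \<in> carrier H" and z: "z \<in> carrier A"
  shows "(pure a b h \<otimes>\<^bsub>S\<^esub> pure a' b' g) \<odot>\<^bsub>Am\<^esub> z = pure a b h \<odot>\<^bsub>Am\<^esub> (pure a' b' g \<odot>\<^bsub>Am\<^esub> z)"
proof -
  note rules = multilinear x y z mod_hom_closed[OF Am_smult_linear(1)]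
  let ?z = "act g z"
  note T = TS_module and M = A.is_module
  have "(pure a b h \<otimes>\<^bsub>S\<^esub> pure a' b' g) \<odot>\<^bsub>Am\<^esub> z = H.Sw TS (\<lambda>k h3. H.Sw TS (\<lambda>h1 h2.
    pure (a \<otimes>\<^bsub>A\<^esub> act h1 a') (act h3 b' \<otimes>\<^bsub>A\<^esub> b) (h2 \<otimes>\<^bsub>H\<^esub> g)) k) h \<odot>\<^bsub>Am\<^esub> z"
    by (simp add: pure_mult[OF x y])
  also have "\<dots> = H.Sw A (\<lambda>k h3. H.Sw TS (\<lambda>h1 h2.
    pure (a \<otimes>\<^bsub>A\<^esub> act h1 a') (act h3 b' \<otimes>\<^bsub>A\<^esub> b) (h2 \<otimes>\<^bsub>H\<^esub> g)) k \<odot>\<^bsub>Am\<^esub> z) h"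
    by (rule H.hom_Sw[OF T M Am_smult_linear(1)[OF z]]) (rule rules | assumption)+
  also have "\<dots> = H.Sw A (\<lambda>k h3. H.Sw A (\<lambda>h1 h2.
    pure (a \<otimes>\<^bsub>A\<^esub> act h1 a') (act h3 b' \<otimes>\<^bsub>A\<^esub> b) (h2 \<otimes>\<^bsub>H\<^esub> g) \<odot>\<^bsub>Am\<^esub> z) k) h"
    by (rule H.Sw_cong[OF M x(3)], rule H.hom_Sw[OF T M Am_smult_linear(1)[OF z]]) (rule rules | assumption)+
  also have "\<dots> = H.Sw A (\<lambda>k h3. H.Sw A (\<lambda>h1 h2.
    a \<otimes>\<^bsub>A\<^esub> ((act h1 a' \<otimes>\<^bsub>A\<^esub> act h2 ?z) \<otimes>\<^bsub>A\<^esub> act h3 b') \<otimes>\<^bsub>A\<^esub> b) k) h"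
    by (rule H.Sw_cong[OF M x(3)], rule H.Sw_cong[OF M], assumption)
      (use x y z in \<open>simp add: pure_smult_Am act_closed A.m_assoc act_assoc\<close>, (rule rules | assumption)+)
  also have "\<dots> = H.Sw A (\<lambda>k h3. a \<otimes>\<^bsub>A\<^esub> (H.Sw A (\<lambda>h1 h2. act h1 a' \<otimes>\<^bsub>A\<^esub> act h2 ?z) k \<otimes>\<^bsub>A\<^esub> act h3 b') \<otimes>\<^bsub>A\<^esub> b) h"
    by (rule H.Sw_cong[OF M x(3)], rule H.hom_Sw[OF M M, symmetric]) (rule rules | assumption)+
  also have "\<dots> = H.Sw A (\<lambda>k h3. a \<otimes>\<^bsub>A\<^esub> (act k (a' \<otimes>\<^bsub>A\<^esub> ?z) \<otimes>\<^bsub>A\<^esub> act h3 b') \<otimes>\<^bsub>A\<^esub> b) h"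
    by (rule H.Sw_cong[OF M x(3)]) (use x y z in \<open>simp add: act_mult act_closed\<close>, (rule rules | assumption)+)
  also have "\<dots> = a \<otimes>\<^bsub>A\<^esub> H.Sw A (\<lambda>k h3. act k (a' \<otimes>\<^bsub>A\<^esub> ?z) \<otimes>\<^bsub>A\<^esub> act h3 b') h \<otimes>\<^bsub>A\<^esub> b"
    by (rule H.hom_Sw[OF M M, symmetric]) (rule rules | assumption)+
  also have "\<dots> = pure a b h \<odot>\<^bsub>Am\<^esub> (pure a' b' g \<odot>\<^bsub>Am\<^esub> z)"
    using x y z act_mult[of h "a' \<otimes>\<^bsub>A\<^esub> ?z" b'] by (simp add: pure_smult_Am act_closed)
  finally show ?thesis .
qed

theorem Am_lmodule: "lmodule S Am"
proof (intro lmodule.intro lmodule_axioms.intro S_ring)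
  show "abelian_group Am"
    by (rule abelian_group_surj[OF A.abelian_group_axioms, where \<pi> = "\<lambda>x. x"]) simp_all
  have cl: "p \<odot>\<^bsub>Am\<^esub> x \<in> carrier A" if "p \<in> carrier TS" "x \<in> carrier A" for p x
    using mod_hom_closed[OF Am_smult_linear(1)] that by blast
  then show "\<And>p x. \<lbrakk>p \<in> carrier S; x \<in> carrier Am\<rbrakk> \<Longrightarrow> p \<odot>\<^bsub>Am\<^esub> x \<in> carrier Am" by simp
  have l: "(p \<oplus>\<^bsub>TS\<^esub> q) \<odot>\<^bsub>Am\<^esub> x = p \<odot>\<^bsub>Am\<^esub> x \<oplus>\<^bsub>A\<^esub> q \<odot>\<^bsub>Am\<^esub> x"
    if "p \<in> carrier TS" "q \<in> carrier TS" "x \<in> carrier A" for p q x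
    using mod_hom_add[OF Am_smult_linear(1)] that by blast
  then show "\<And>p q x. \<lbrakk>p \<in> carrier S; q \<in> carrier S; x \<in> carrier Am\<rbrakk> \<Longrightarrow>
    (p \<oplus>\<^bsub>S\<^esub> q) \<odot>\<^bsub>Am\<^esub> x = p \<odot>\<^bsub>Am\<^esub> x \<oplus>\<^bsub>Am\<^esub> q \<odot>\<^bsub>Am\<^esub> x" by simp
  have r: "p \<odot>\<^bsub>Am\<^esub> (x \<oplus>\<^bsub>A\<^esub> y) = p \<odot>\<^bsub>Am\<^esub> x \<oplus>\<^bsub>A\<^esub> p \<odot>\<^bsub>Am\<^esub> y"
    if "p \<in> carrier TS" "x \<in> carrier A" "y \<in> carrier A" for p x y
    using mod_hom_add[OF Am_smult_linear(2)] that by blast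
  then show "\<And>p x y. \<lbrakk>p \<in> carrier S; x \<in> carrier Am; y \<in> carrier Am\<rbrakk> \<Longrightarrow>
    p \<odot>\<^bsub>Am\<^esub> (x \<oplus>\<^bsub>Am\<^esub> y) = p \<odot>\<^bsub>Am\<^esub> x \<oplus>\<^bsub>Am\<^esub> p \<odot>\<^bsub>Am\<^esub> y" by simp
  show "\<And>x. x \<in> carrier Am \<Longrightarrow> \<one>\<^bsub>S\<^esub> \<odot>\<^bsub>Am\<^esub> x = x"
    by (simp add: pure_smult_Am act_one)
  fix p q x assume pq: "p \<in> carrier S" "q \<in> carrier S" "x \<in> carrier Am"
  from pq(1) show "(p \<otimes>\<^bsub>S\<^esub> q) \<odot>\<^bsub>Am\<^esub> x = p \<odot>\<^bsub>Am\<^esub> (q \<odot>\<^bsub>Am\<^esub> x)"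
  proof (induction rule: S_induct)
    case p: (pure a b h)
    show ?case using pq(2)
    proof (induction rule: S_induct)
      case (pure a' b' g)
      then show ?case using p pq(3) by (simp add: pure_mult_smult_Am)
    next
      case (add q q')
      then show ?case using p pq(3) by (simp add: S_add S_mult_closed pure_closed l r cl)
    qed
  next
    case (add p p')
    then show ?case using pq by (simp add: S_add S_mult_closed l cl)
  qed
qed

end

section \<open>The self-injective hull\<close>

context hmodule_algebra
begin

lemma pure_factor:
  assumes "a \<in> carrier A" "b \<in> carrier A" "h \<in> carrier H"
  shows "pure a b h = pure a \<one>\<^bsub>A\<^esub> \<one>\<^bsub>H\<^esub> \<otimes>\<^bsub>S\<^esub> (pure \<one>\<^bsub>A\<^esub> b \<one>\<^bsub>H\<^esub> \<otimes>\<^bsub>S\<^esub> pure \<one>\<^bsub>A\<^esub> \<one>\<^bsub>A\<^esub> h)"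
  using assms by (simp add: pure_mult_special)

lemma pure_closed_S: "\<lbrakk>a \<in> carrier A; b \<in> carrier A; h \<in> carrier H\<rbrakk> \<Longrightarrow> pure a b h \<in> carrier S"
  by (simp add: pure_closed)

text \<open>Pure elements with two trivial entries act as left multiplications, right
  multiplications and the action of H. Conversely, stability under these three gives stability under
  every pure element and, by additivity, under S.\<close>

lemma submodule_iff_H_stable_ideal: "submodule N S Am \<longleftrightarrow> H_stable_ideal H A act N"
proof
  interpret M: lmodule S Am by (rule Am_lmodule)
  assume N: "submodule N S Am"
  then have sub: "N \<subseteq> carrier A"
    and cl: "\<And>p x. \<lbrakk>p \<in> carrier S; x \<in> N\<rbrakk> \<Longrightarrow> p \<odot>\<^bsub>Am\<^esub> x \<in> N"
    unfolding M.submodule_iff by simp_all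
  have "subgroup N (add_monoid Am)" using N by (rule submodule.axioms)
  then have sg: "subgroup N (add_monoid A)"
    by (simp add: subgroup_def m_inv_def)
  have "y \<otimes>\<^bsub>A\<^esub> x \<in> N" "x \<otimes>\<^bsub>A\<^esub> y \<in> N" if "x \<in> N" "y \<in> carrier A" for x y
    using cl[OF pure_closed_S[of y "\<one>\<^bsub>A\<^esub>" "\<one>\<^bsub>H\<^esub>"] that(1)] cl[OF pure_closed_S[of "\<one>\<^bsub>A\<^esub>" y "\<one>\<^bsub>H\<^esub>"] that(1)]
      that sub by (simp_all add: pure_smult_Am subset_iff act_one)
  then have "ideal N A" by (intro idealI A.ring_axioms sg)
  moreover have "act h x \<in> N" if "x \<in> N" "h \<in> carrier H" for x h
    using cl[OF pure_closed_S[of "\<one>\<^bsub>A\<^esub>" "\<one>\<^bsub>A\<^esub>" h] that(1)] that sub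
    by (simp add: pure_smult_Am subset_iff act_closed)
  ultimately show "H_stable_ideal H A act N" by (simp add: H_stable_ideal_def)
next
  interpret M: lmodule S Am by (rule Am_lmodule)
  assume N: "H_stable_ideal H A act N"
  then interpret I: ideal N A by (simp add: H_stable_ideal_def)
  have st: "\<And>h x. \<lbrakk>h \<in> carrier H; x \<in> N\<rbrakk> \<Longrightarrow> act h x \<in> N" using N by (simp add: H_stable_ideal_def)
  have "p \<odot>\<^bsub>Am\<^esub> x \<in> N" if "p \<in> carrier S" "x \<in> N" for p x
    using that(1)
  proof (induction rule: S_induct)
    case (pure a b h)
    then show ?case using that(2) st by (simp add: pure_smult_Am I.I_l_closed I.I_r_closed)
  next
    case (add p q)
    then show ?case using M.lsmult_l_distr[of p q x] that(2) I.a_closed by simp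
  qed
  then show "submodule N S Am" using I.a_subset by (auto simp: M.submodule_iff)
qed

text \<open>\<open>ideal_prod\<close> is an additive closure of products, so it vanishes as soon as
  all products do. In this elementwise form semiprimeness of A is applied below.\<close>

lemma square_zero_submodule:
  assumes "H_semiprime H A act" "submodule W S Am"
    and "\<And>v w. \<lbrakk>v \<in> W; w \<in> W\<rbrakk> \<Longrightarrow> v \<otimes>\<^bsub>A\<^esub> w = \<zero>\<^bsub>A\<^esub>"
  shows "W = {\<zero>\<^bsub>A\<^esub>}"
proof -
  have W: "H_stable_ideal H A act W" using assms(2) by (simp add: submodule_iff_H_stable_ideal)
  then interpret I: ideal W A by (simp add: H_stable_ideal_def)
  have "x = \<zero>\<^bsub>A\<^esub>" if "x \<in> ideal_prod A W W" for x
    using that by (induction rule: ideal_prod.induct) (use assms(3) in auto)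
  moreover have "\<zero>\<^bsub>A\<^esub> \<in> ideal_prod A W W"
    using ideal_prod.prod[of "\<zero>\<^bsub>A\<^esub>" W "\<zero>\<^bsub>A\<^esub>" W A] I.zero_closed by simp
  ultimately have "ideal_prod A W W = {\<zero>\<^bsub>A\<^esub>}" by (metis (no_types, lifting) is_singletonI' is_singleton_the_elem singletonD empty_iff)
  then show ?thesis using assms(1) W by (simp add: H_semiprime_def)
qed

end

locale semiprime_hull = hmodule_algebra K H A act
  for K :: "('k, 'm) ring_scheme" and H :: "('k, 'h) hopf" and A :: "('k, 'a) module"
    and act :: "'h \<Rightarrow> 'a \<Rightarrow> 'a" +
  fixes E :: "(('k, 'a, 'h) smash, 'e) module" and \<iota> :: "'a \<Rightarrow> 'e"
  assumes semiprime: "H_semiprime H A act"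
    and hull: "injective_hull (smash_algebra K H A act) (smash_module K H A act) E \<iota>"
begin

abbreviation X where "X \<equiv> carrier (smash_hull K H A act E)"
abbreviation Xm where "Xm \<equiv> smash_hull K H A act E"
abbreviation \<T> where "\<T> \<equiv> mod_hom S Xm Xm"

lemma E_injective: "injective_module S E"
  using hull by (simp add: injective_hull_def)

sublocale E: lmodule S E
  using E_injective by (simp add: injective_module_def)

sublocale Am: lmodule S Am
  by (rule Am_lmodule)

lemma \<iota>_hom: "\<iota> \<in> mod_hom S Am E"
  using hull by (simp add: injective_hull_def)

lemma \<iota>_inj: "inj_on \<iota> (carrier A)"
  using hull by (simp add: injective_hull_def)

lemma \<iota>_essential: "essential_submodule S E (\<iota> ` carrier A)"
  using hull by (simp add: injective_hull_def)

lemma \<iota>_submodule: "submodule (\<iota> ` carrier A) S E"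
  using \<iota>_essential by (simp add: essential_submodule_def)

lemma \<iota>_zero [simp]: "\<iota> \<zero>\<^bsub>A\<^esub> = \<zero>\<^bsub>E\<^esub>"
  using mod_hom_zero[OF Am_lmodule E.lmodule_axioms \<iota>_hom] by simp

lemma \<iota>_closed: "a \<in> carrier A \<Longrightarrow> \<iota> a \<in> carrier E"
  using mod_hom_closed[OF \<iota>_hom] by simp

lemma \<iota>_add: "\<lbrakk>a \<in> carrier A; b \<in> carrier A\<rbrakk> \<Longrightarrow> \<iota> (a \<oplus>\<^bsub>A\<^esub> b) = \<iota> a \<oplus>\<^bsub>E\<^esub> \<iota> b"
  using mod_hom_add[OF \<iota>_hom] by simp

lemma \<iota>_smult: "\<lbrakk>p \<in> carrier S; a \<in> carrier A\<rbrakk> \<Longrightarrow> \<iota> (p \<odot>\<^bsub>Am\<^esub> a) = p \<odot>\<^bsub>E\<^esub> \<iota> a"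
  using mod_hom_smult[OF \<iota>_hom, of p a] by (simp del: S_simps)

lemma \<iota>_eq_zero: "\<lbrakk>a \<in> carrier A; \<iota> a = \<zero>\<^bsub>E\<^esub>\<rbrakk> \<Longrightarrow> a = \<zero>\<^bsub>A\<^esub>"
  using \<iota>_inj \<iota>_zero by (metis A.zero_closed inj_onD)

lemma hull_eq: "Xm = E\<lparr>carrier := generated_submodule S E (\<Union>f\<in>mod_hom S Am E. f ` carrier A)\<rparr>"
  by (simp add: smash_hull_def self_injective_hull_def)

lemma X_eq: "X = generated_submodule S E (\<Union>f\<in>mod_hom S Am E. f ` carrier A)"
  by (simp add: hull_eq)

lemma Xm_simps [simp]: "add Xm = add E" "zero Xm = zero E" "smult Xm = smult E"
  by (simp_all add: hull_eq)

lemma Xm_eq: "E\<lparr>carrier := X\<rparr> = Xm"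
  by (simp add: hull_eq)

lemma hom_image_E: "(\<Union>f\<in>mod_hom S Am E. f ` carrier A) \<subseteq> carrier E"
  using mod_hom_closed[of _ S Am E] by auto

lemma X_submodule: "submodule X S E"
  unfolding X_eq by (rule E.generated_submodule_submodule[OF hom_image_E])

lemma hom_in_X: "\<lbrakk>f \<in> mod_hom S Am E; a \<in> carrier A\<rbrakk> \<Longrightarrow> f a \<in> X"
  unfolding X_eq by (rule subsetD[OF E.generated_submodule_superset]) (rule UN_I, assumption, rule imageI)

lemma X_E: "x \<in> X \<Longrightarrow> x \<in> carrier E"
  by (rule E.submoduleD(1)[OF X_submodule])

sublocale Xm: lmodule S Xm
  using E.submodule_lmodule[OF X_submodule] by (simp add: Xm_eq)

lemma \<iota>_X: "a \<in> carrier A \<Longrightarrow> \<iota> a \<in> X"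
  by (rule hom_in_X[OF \<iota>_hom])

lemma \<iota>_hom_X: "\<iota> \<in> mod_hom S Am Xm"
  using \<iota>_hom \<iota>_X by (auto simp: mod_hom_def)

text \<open>The hull is fully invariant in E: a homomorphism from A to E followed by F is again one,
  so the preimage of X under F is a submodule containing all generators of X.\<close>

lemma E_endo_X:
  assumes F: "F \<in> mod_hom S E E" and x: "x \<in> X"
  shows "F x \<in> X"
proof -
  have "X \<subseteq> {x \<in> carrier E. F x \<in> X}"
  proof (subst X_eq, rule E.generated_submodule_minimal)
    show "submodule {x \<in> carrier E. F x \<in> X} S E"
      by (rule vimage_submodule[OF E.lmodule_axioms E.lmodule_axioms F X_submodule])
    show "(\<Union>f\<in>mod_hom S Am E. f ` carrier A) \<subseteq> {x \<in> carrier E. F x \<in> X}"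
      using hom_image_E by (intro UN_least image_subsetI CollectI conjI hom_in_X[OF mod_hom_compose[OF _ F]]) auto
  qed
  then show ?thesis using x by blast
qed

lemma E_endo_\<T>: "F \<in> mod_hom S E E \<Longrightarrow> F \<in> \<T>"
  by (rule mod_homI) (simp_all add: E_endo_X X_E mod_hom_add mod_hom_smult del: S_simps)

text \<open>Injectivity extends f to all of E, and full invariance lets the extension restrict to
  the hull.\<close>

lemma hom_extend:
  assumes N: "submodule N S E" and f: "f \<in> mod_hom S (E\<lparr>carrier := N\<rparr>) E"
  obtains F where "F \<in> mod_hom S E E" "F \<in> \<T>" "\<And>x. x \<in> N \<Longrightarrow> F x = f x"
proof -
  obtain F where F: "F \<in> mod_hom S E E" "\<And>x. x \<in> N \<Longrightarrow> F x = f x"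
    using injective_module_extension[OF E_injective E.lmodule_axioms N f] by blast
  then show ?thesis using that E_endo_\<T> by blast
qed

text \<open>Transported along \<iota>, a homomorphism from A becomes one from a submodule of E.
  Hence the generators of the hull are values of its own endomorphisms at elements of A.\<close>

lemma hom_from_A_extend:
  assumes f: "f \<in> mod_hom S Am E"
  obtains F where "F \<in> \<T>" "\<And>a. a \<in> carrier A \<Longrightarrow> F (\<iota> a) = f a"
proof -
  define k where "k = the_inv_into (carrier A) \<iota>"
  have k: "k (\<iota> a) = a" if "a \<in> carrier A" for a
    unfolding k_def using \<iota>_inj that by (rule the_inv_into_f_f)
  have "(\<lambda>x. f (k x)) \<in> mod_hom S (E\<lparr>carrier := \<iota> ` carrier A\<rparr>) E"
  proof (rule mod_homI)
    fix x assume "x \<in> carrier (E\<lparr>carrier := \<iota> ` carrier A\<rparr>)"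
    then obtain a where a: "a \<in> carrier A" "x = \<iota> a" by auto
    show "f (k x) \<in> carrier E" using a k mod_hom_closed[OF f] by simp
    show "f (k (p \<odot>\<^bsub>E\<lparr>carrier := \<iota> ` carrier A\<rparr>\<^esub> x)) = p \<odot>\<^bsub>E\<^esub> f (k x)" if "p \<in> carrier S" for p
      using a that k[of "p \<odot>\<^bsub>Am\<^esub> a"] k[of a] \<iota>_smult[OF that a(1)] mod_hom_smult[OF f that, of a]
        Am.lsmult_closed[OF that, of a] by (simp del: S_simps)
    fix y assume "y \<in> carrier (E\<lparr>carrier := \<iota> ` carrier A\<rparr>)"
    then obtain b where b: "b \<in> carrier A" "y = \<iota> b" by auto
    show "f (k (x \<oplus>\<^bsub>E\<lparr>carrier := \<iota> ` carrier A\<rparr>\<^esub> y)) = f (k x) \<oplus>\<^bsub>E\<^esub> f (k y)"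
      using a b k[of "a \<oplus>\<^bsub>A\<^esub> b"] k mod_hom_add[OF f, of a b] by (simp add: \<iota>_add)
  qed
  then obtain F where "F \<in> \<T>" "\<And>x. x \<in> \<iota> ` carrier A \<Longrightarrow> F x = f (k x)"
    using hom_extend[OF \<iota>_submodule] by blast
  then show ?thesis using that k by auto
qed

text \<open>The set of all x with P x need not be closed under scalars, so it need not be a
  submodule. Instead N collects the x that satisfy every predicate with the two closure properties;
  with Q also x \<mapsto> Q (p x) is such a predicate, and this makes N a submodule.\<close>

lemma X_induct [consumes 1, case_names hom add]:
  assumes x: "x \<in> X"
    and hom: "\<And>f a. \<lbrakk>f \<in> \<T>; a \<in> carrier A\<rbrakk> \<Longrightarrow> P (f (\<iota> a))"
    and add: "\<And>x y. \<lbrakk>x \<in> X; y \<in> X; P x; P y\<rbrakk> \<Longrightarrow> P (x \<oplus>\<^bsub>E\<^esub> y)"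
  shows "P x"
proof -
  define good where "good Q \<longleftrightarrow> (\<forall>f\<in>\<T>. \<forall>a\<in>carrier A. Q (f (\<iota> a))) \<and>
    (\<forall>x\<in>X. \<forall>y\<in>X. Q x \<longrightarrow> Q y \<longrightarrow> Q (x \<oplus>\<^bsub>E\<^esub> y))" for Q :: "'e \<Rightarrow> bool"
  define N where "N = {x \<in> X. \<forall>Q. good Q \<longrightarrow> Q x}"
  have NX: "N \<subseteq> X" by (auto simp: N_def)
  have XE: "X \<subseteq> carrier E" using X_E by blast
  note Xadd = E.submoduleD(3)[OF X_submodule] and Xsm = E.submoduleD(4)[OF X_submodule]
  have im: "f a \<in> N" if f: "f \<in> mod_hom S Am E" "a \<in> carrier A" for f a
  proof -
    obtain F where F: "F \<in> \<T>" "F (\<iota> a) = f a" using hom_from_A_extend[OF f(1)] f(2) by metis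
    then have "Q (f a)" if "good Q" for Q using that f(2) unfolding good_def by metis
    then show ?thesis using hom_in_X[OF f] unfolding N_def by blast
  qed
  have "submodule N S E"
    unfolding E.submodule_iff
  proof (intro conjI ballI)
    show "N \<subseteq> carrier E" using NX XE by blast
    show "\<zero>\<^bsub>E\<^esub> \<in> N" using im[OF \<iota>_hom, of "\<zero>\<^bsub>A\<^esub>"] by simp
    show "x \<oplus>\<^bsub>E\<^esub> y \<in> N" if "x \<in> N" "y \<in> N" for x y
    proof -
      have xy: "x \<in> X" "y \<in> X" "\<And>Q. good Q \<Longrightarrow> Q x" "\<And>Q. good Q \<Longrightarrow> Q y" using that unfolding N_def by blast+
      have "Q (x \<oplus>\<^bsub>E\<^esub> y)" if Q: "good Q" for Q
        using xy(1,2) xy(3,4)[OF Q] Q unfolding good_def by blast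
      then show ?thesis using Xadd[OF xy(1,2)] unfolding N_def by blast
    qed
    show "p \<odot>\<^bsub>E\<^esub> x \<in> N" if p: "p \<in> carrier S" and x: "x \<in> N" for p x
    proof -
      have "Q (p \<odot>\<^bsub>E\<^esub> x)" if Q: "good Q" for Q
      proof -
        have "good (\<lambda>x. Q (p \<odot>\<^bsub>E\<^esub> x))"
          unfolding good_def
        proof (intro conjI ballI impI)
          fix f a assume fa: "f \<in> \<T>" "a \<in> carrier A"
          have "p \<odot>\<^bsub>E\<^esub> f (\<iota> a) = f (\<iota> (p \<odot>\<^bsub>Am\<^esub> a))"
            using mod_hom_smult[OF fa(1) p \<iota>_X[OF fa(2)]] \<iota>_smult[OF p fa(2)] by simp
          moreover have "p \<odot>\<^bsub>Am\<^esub> a \<in> carrier A" using Am.lsmult_closed[OF p, of a] fa(2) by simp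
          ultimately show "Q (p \<odot>\<^bsub>E\<^esub> f (\<iota> a))" using Q fa(1) unfolding good_def by metis
        next
          fix x y assume xy: "x \<in> X" "y \<in> X" "Q (p \<odot>\<^bsub>E\<^esub> x)" "Q (p \<odot>\<^bsub>E\<^esub> y)"
          then show "Q (p \<odot>\<^bsub>E\<^esub> (x \<oplus>\<^bsub>E\<^esub> y))"
            using Q Xsm[OF p] E.lsmult_r_distr[OF p X_E X_E] unfolding good_def by metis
        qed
        then show ?thesis using x unfolding N_def by blast
      qed
      moreover have "p \<odot>\<^bsub>E\<^esub> x \<in> X" using x by (intro Xsm p) (simp add: N_def)
      ultimately show ?thesis unfolding N_def by blast
    qed
  qed
  moreover have "(\<Union>f\<in>mod_hom S Am E. f ` carrier A) \<subseteq> N" by (intro UN_least image_subsetI im)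
  ultimately have "X \<subseteq> N" unfolding X_eq by (rule E.generated_submodule_minimal)
  moreover have "good P" using hom add by (simp add: good_def)
  ultimately show ?thesis using x unfolding N_def by blast
qed

section \<open>Polyformity and commutation of endomorphisms\<close>

lemma hom_vanish:
  assumes g: "g \<in> mod_hom S Am E" and N: "essential_submodule S Am N"
    and z: "\<And>a. a \<in> N \<Longrightarrow> g a = \<zero>\<^bsub>E\<^esub>" and a: "a \<in> carrier A"
  shows "g a = \<zero>\<^bsub>E\<^esub>"
proof -
  have N': "submodule N S Am" using N by (simp add: essential_submodule_def)
  interpret NI: ideal N A using N' by (simp add: submodule_iff_H_stable_ideal H_stable_ideal_def)
  have gA: "submodule (g ` carrier A) S E"
    using image_submodule[OF Am_lmodule E.lmodule_axioms g Am.carrier_submodule] by simp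
  define V where "V = {v \<in> carrier A. \<iota> v \<in> g ` carrier A}"
  have V: "submodule V S Am"
    using vimage_submodule[OF Am_lmodule E.lmodule_axioms \<iota>_hom gA] by (simp add: V_def)
  have VN: "submodule (V \<inter> N) S Am" by (rule Am.submodule_Int[OF V N'])
  have "v \<otimes>\<^bsub>A\<^esub> w = \<zero>\<^bsub>A\<^esub>" if v: "v \<in> V \<inter> N" and w: "w \<in> V \<inter> N" for v w
  proof -
    have c: "v \<in> carrier A" "w \<in> carrier A" using v w by (auto simp: V_def)
    obtain u where u: "u \<in> carrier A" "\<iota> v = g u" using v by (auto simp: V_def)
    \<comment> \<open>Right multiplication by w is the action of an element of S, so v = g(u) gives
      v w = g(u w), and u w lies in the ideal N.\<close>
    let ?r = "pure \<one>\<^bsub>A\<^esub> w \<one>\<^bsub>H\<^esub>"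
    have r: "?r \<in> carrier S" using c by (simp add: pure_closed)
    have rx: "?r \<odot>\<^bsub>Am\<^esub> x = x \<otimes>\<^bsub>A\<^esub> w" if "x \<in> carrier A" for x using that c by (simp add: pure_smult_Am act_one)
    have "\<iota> (v \<otimes>\<^bsub>A\<^esub> w) = ?r \<odot>\<^bsub>E\<^esub> \<iota> v" using \<iota>_smult[OF r c(1)] rx c by simp
    also have "\<dots> = g (u \<otimes>\<^bsub>A\<^esub> w)" using mod_hom_smult[OF g r, of u] u rx by simp
    also have "\<dots> = \<zero>\<^bsub>E\<^esub>" using w u by (intro z) (simp add: NI.I_l_closed)
    finally show ?thesis using \<iota>_eq_zero c by simp
  qed
  then have "V \<inter> N = {\<zero>\<^bsub>A\<^esub>}" by (rule square_zero_submodule[OF semiprime VN])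
  then have "V = {\<zero>\<^bsub>A\<^esub>}" using N V by (simp add: essential_submodule_def)
  have "g ` carrier A \<inter> \<iota> ` carrier A \<subseteq> {\<zero>\<^bsub>E\<^esub>}"
  proof
    fix y assume y: "y \<in> g ` carrier A \<inter> \<iota> ` carrier A"
    then obtain v where v: "v \<in> carrier A" "y = \<iota> v" by blast
    then have "v \<in> V" using y by (simp add: V_def)
    then show "y \<in> {\<zero>\<^bsub>E\<^esub>}" using v(2) unfolding \<open>V = {\<zero>\<^bsub>A\<^esub>}\<close> by simp
  qed
  moreover have "\<zero>\<^bsub>E\<^esub> \<in> g ` carrier A" "\<zero>\<^bsub>E\<^esub> \<in> \<iota> ` carrier A"
    using gA \<iota>_submodule by (simp_all add: E.submodule_iff)
  ultimately have "g ` carrier A \<inter> \<iota> ` carrier A = {\<zero>\<^bsub>E\<^esub>}" by auto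
  then have "g ` carrier A = {\<zero>\<^bsub>E\<^esub>}" using \<iota>_essential gA by (simp add: essential_submodule_def)
  then show ?thesis using imageI[OF a, of g] by simp
qed

text \<open>A homomorphism from A/N to the hull amounts to a homomorphism from A to E that kills
  N.\<close>

lemma polyform: "polyform S Am E"
  unfolding polyform_def
proof (intro conjI allI impI Am_lmodule)
  fix N assume N: "essential_submodule S Am N"
  then have N': "submodule N S Am" by (simp add: essential_submodule_def)
  show "dense_submodule S Am E N"
    unfolding dense_submodule_def
  proof (intro conjI ballI N')
    fix f x assume f: "f \<in> mod_hom S (quotient_module Am N) (self_injective_hull S Am E)"
      and x: "x \<in> carrier (quotient_module Am N)"
    obtain a where a: "a \<in> carrier A" "x = N +>\<^bsub>Am\<^esub> a"
      using x unfolding Am.quotient_module_simps(1)[OF N'] by auto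
    have f': "f \<in> mod_hom S (quotient_module Am N) Xm" using f by (simp add: smash_hull_def)
    have g: "(\<lambda>a. f (N +>\<^bsub>Am\<^esub> a)) \<in> mod_hom S Am Xm"
      by (rule mod_hom_compose[OF Am.quotient_hom[OF N'] f'])
    have "(\<lambda>a. f (N +>\<^bsub>Am\<^esub> a)) \<in> mod_hom S Am E"
      using g X_E by (auto simp: mod_hom_def)
    moreover have "f (N +>\<^bsub>Am\<^esub> b) = \<zero>\<^bsub>E\<^esub>" if "b \<in> N" for b
    proof -
      have b: "b \<in> carrier Am" using that by (rule Am.submoduleD(1)[OF N'])
      have "N +>\<^bsub>Am\<^esub> b = N +>\<^bsub>Am\<^esub> \<zero>\<^bsub>Am\<^esub>"
        using Am.coset_eq_iff[OF N' b Am.M.zero_closed] Am.submodule_diff[OF N' that Am.submoduleD(2)[OF N']] by simp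
      then show ?thesis using mod_hom_zero[OF Am_lmodule Xm.lmodule_axioms g] by simp
    qed
    ultimately show "f x = \<zero>\<^bsub>E\<^esub>" unfolding a(2) by (rule hom_vanish[OF _ N]) (use a in auto)
  qed
qed

lemma \<T>_closed: "\<lbrakk>f \<in> \<T>; x \<in> X\<rbrakk> \<Longrightarrow> f x \<in> X"
  by (rule mod_hom_closed)

lemma \<T>_add: "\<lbrakk>f \<in> \<T>; x \<in> X; y \<in> X\<rbrakk> \<Longrightarrow> f (x \<oplus>\<^bsub>E\<^esub> y) = f x \<oplus>\<^bsub>E\<^esub> f y"
  using mod_hom_add[of f S Xm Xm x y] by simp

lemma \<T>_smult: "\<lbrakk>f \<in> \<T>; p \<in> carrier S; x \<in> X\<rbrakk> \<Longrightarrow> f (p \<odot>\<^bsub>E\<^esub> x) = p \<odot>\<^bsub>E\<^esub> f x"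
  using mod_hom_smult[of f S Xm Xm p x] by simp

lemma \<T>_compose: "\<lbrakk>f \<in> \<T>; g \<in> \<T>\<rbrakk> \<Longrightarrow> (\<lambda>x. g (f x)) \<in> \<T>"
  by (rule mod_hom_compose)

lemma X_add: "\<lbrakk>x \<in> X; y \<in> X\<rbrakk> \<Longrightarrow> x \<oplus>\<^bsub>E\<^esub> y \<in> X"
  using Xm.M.a_closed[of x y] by simp

lemma X_smult: "\<lbrakk>p \<in> carrier S; x \<in> X\<rbrakk> \<Longrightarrow> p \<odot>\<^bsub>E\<^esub> x \<in> X"
  using Xm.lsmult_closed[of p x] by simp

lemma \<T>_zero: "f \<in> \<T> \<Longrightarrow> f \<zero>\<^bsub>E\<^esub> = \<zero>\<^bsub>E\<^esub>"
  using mod_hom_zero[OF Xm.lmodule_axioms Xm.lmodule_axioms] by simp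

lemma \<T>_\<iota>_hom: "f \<in> \<T> \<Longrightarrow> (\<lambda>a. f (\<iota> a)) \<in> mod_hom S Am E"
  using mod_hom_compose[OF \<iota>_hom_X, of f Xm] X_E by (auto simp: mod_hom_def)

lemma \<iota>_vimage_essential: "f \<in> \<T> \<Longrightarrow> essential_submodule S Am {a \<in> carrier A. f (\<iota> a) \<in> \<iota> ` carrier A}"
  using essential_vimage[OF Am_lmodule E.lmodule_axioms \<T>_\<iota>_hom \<iota>_essential] by simp

text \<open>First f vanishes on A by \<open>hom_vanish\<close>. For a value g(a), the composite of g
  and f vanishes on the essential submodule that g maps into A, and therefore on all of A.\<close>

lemma \<T>_vanish:
  assumes f: "f \<in> \<T>" and N: "essential_submodule S Am N" and z: "\<And>a. a \<in> N \<Longrightarrow> f (\<iota> a) = \<zero>\<^bsub>E\<^esub>"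
    and x: "x \<in> X"
  shows "f x = \<zero>\<^bsub>E\<^esub>"
proof -
  have A: "f (\<iota> a) = \<zero>\<^bsub>E\<^esub>" if "a \<in> carrier A" for a
    by (rule hom_vanish[OF \<T>_\<iota>_hom[OF f] N z that])
  show ?thesis using x
  proof (induction rule: X_induct)
    case (hom g a)
    show ?case
    proof (rule hom_vanish[OF \<T>_\<iota>_hom[OF \<T>_compose[OF hom(1) f]] \<iota>_vimage_essential[OF hom(1)]])
      fix b assume "b \<in> {a \<in> carrier A. g (\<iota> a) \<in> \<iota> ` carrier A}"
      then show "f (g (\<iota> b)) = \<zero>\<^bsub>E\<^esub>" using A by auto
    qed (rule hom(2))
  next
    case (add x y)
    then show ?case by (simp add: \<T>_add[OF f])
  qed
qed

lemma \<T>_eqI: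
  assumes f: "f \<in> \<T>" and g: "g \<in> \<T>" and N: "essential_submodule S Am N"
    and eq: "\<And>a. a \<in> N \<Longrightarrow> f (\<iota> a) = g (\<iota> a)" and x: "x \<in> X"
  shows "f x = g x"
proof (rule Xm.diff_eq_zero)
  have d: "(\<lambda>x. f x \<ominus>\<^bsub>Xm\<^esub> g x) \<in> \<T>" by (rule mod_hom_diff[OF Xm.lmodule_axioms Xm.lmodule_axioms f g])
  have NA: "N \<subseteq> carrier A" using N by (simp add: essential_submodule_def Am.submodule_iff)
  have "f x \<ominus>\<^bsub>Xm\<^esub> g x = \<zero>\<^bsub>E\<^esub>"
    by (rule \<T>_vanish[OF d N _ x])
      (use eq NA Xm.diff_self \<T>_closed[OF g] \<iota>_X in \<open>auto simp: subset_iff\<close>)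
  then show "f x \<ominus>\<^bsub>Xm\<^esub> g x = \<zero>\<^bsub>Xm\<^esub>" by simp
qed (use f g x in \<open>simp_all add: \<T>_closed\<close>)

lemma pure_smult_simps:
  assumes "a \<in> carrier A" "b \<in> carrier A"
  shows "pure a \<one>\<^bsub>A\<^esub> \<one>\<^bsub>H\<^esub> \<odot>\<^bsub>E\<^esub> \<iota> b = \<iota> (a \<otimes>\<^bsub>A\<^esub> b)" "pure \<one>\<^bsub>A\<^esub> a \<one>\<^bsub>H\<^esub> \<odot>\<^bsub>E\<^esub> \<iota> b = \<iota> (b \<otimes>\<^bsub>A\<^esub> a)"
    "h \<in> carrier H \<Longrightarrow> pure \<one>\<^bsub>A\<^esub> \<one>\<^bsub>A\<^esub> h \<odot>\<^bsub>E\<^esub> \<iota> b = \<iota> (act h b)"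
  using assms \<iota>_smult[OF pure_closed_S, of a "\<one>\<^bsub>A\<^esub>" "\<one>\<^bsub>H\<^esub>" b] \<iota>_smult[OF pure_closed_S, of "\<one>\<^bsub>A\<^esub>" a "\<one>\<^bsub>H\<^esub>" b]
    \<iota>_smult[OF pure_closed_S, of "\<one>\<^bsub>A\<^esub>" "\<one>\<^bsub>A\<^esub>" h b]
  by (simp_all add: pure_smult_Am act_one act_closed)

lemma \<T>_commute:
  assumes f: "f \<in> \<T>" and g: "g \<in> \<T>" and x: "x \<in> X"
  shows "f (g x) = g (f x)"
proof -
  define N where "N = {a \<in> carrier A. f (\<iota> a) \<in> \<iota> ` carrier A} \<inter> {a \<in> carrier A. g (\<iota> a) \<in> \<iota> ` carrier A}"
  have N: "essential_submodule S Am N"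
    unfolding N_def by (intro essential_Int Am_lmodule \<iota>_vimage_essential f g)
  then have Ns: "submodule N S Am" by (simp add: essential_submodule_def)
  have fg: "(\<lambda>x. f (g x)) \<in> \<T>" "(\<lambda>x. g (f x)) \<in> \<T>" using f g by (auto intro: \<T>_compose)
  define k where "k a = f (g (\<iota> a)) \<ominus>\<^bsub>Xm\<^esub> g (f (\<iota> a))" for a
  have k: "k \<in> mod_hom S Am Xm"
    using mod_hom_compose[OF \<iota>_hom_X mod_hom_diff[OF Xm.lmodule_axioms Xm.lmodule_axioms fg]]
    by (simp add: k_def[abs_def])
  define D where "D = {a \<in> carrier A. k a = \<zero>\<^bsub>E\<^esub>}"
  have D: "submodule D S Am"
    using vimage_submodule[OF Am_lmodule Xm.lmodule_axioms k Xm.zero_submodule] by (simp add: D_def)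
  have prod: "a \<otimes>\<^bsub>A\<^esub> b \<in> D" if a: "a \<in> N" and b: "b \<in> N" for a b
  proof -
    obtain a' where a': "a \<in> carrier A" "a' \<in> carrier A" "f (\<iota> a) = \<iota> a'" using a by (auto simp: N_def)
    obtain b' where b': "b \<in> carrier A" "b' \<in> carrier A" "g (\<iota> b) = \<iota> b'" using b by (auto simp: N_def)
    have lm: "u (\<iota> (c \<otimes>\<^bsub>A\<^esub> d)) = pure c \<one>\<^bsub>A\<^esub> \<one>\<^bsub>H\<^esub> \<odot>\<^bsub>E\<^esub> u (\<iota> d)"
      if "u \<in> \<T>" "c \<in> carrier A" "d \<in> carrier A" for u c d
      using that \<T>_smult[OF that(1) pure_closed_S \<iota>_X, of c "\<one>\<^bsub>A\<^esub>" "\<one>\<^bsub>H\<^esub>" d] by (simp add: pure_smult_simps)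
    have rm: "u (\<iota> (c \<otimes>\<^bsub>A\<^esub> d)) = pure \<one>\<^bsub>A\<^esub> d \<one>\<^bsub>H\<^esub> \<odot>\<^bsub>E\<^esub> u (\<iota> c)"
      if "u \<in> \<T>" "c \<in> carrier A" "d \<in> carrier A" for u c d
      using that \<T>_smult[OF that(1) pure_closed_S \<iota>_X, of "\<one>\<^bsub>A\<^esub>" d "\<one>\<^bsub>H\<^esub>" c] by (simp add: pure_smult_simps)
    \<comment> \<open>Here g passes the left factor a, giving a b', and then f passes the right
      factor b', giving a' b'. In the other order f passes b and then g passes a', with the same
      result.\<close>
    have "f (g (\<iota> (a \<otimes>\<^bsub>A\<^esub> b))) = \<iota> (a' \<otimes>\<^bsub>A\<^esub> b')"
      using a' b' by (simp add: lm[OF g] rm[OF f] pure_smult_simps)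
    moreover have "g (f (\<iota> (a \<otimes>\<^bsub>A\<^esub> b))) = \<iota> (a' \<otimes>\<^bsub>A\<^esub> b')"
      using a' b' by (simp add: rm[OF f] lm[OF g] pure_smult_simps)
    ultimately show ?thesis using a' b' Xm.diff_self[of "\<iota> (a' \<otimes>\<^bsub>A\<^esub> b')"] \<iota>_X by (simp add: D_def k_def)
  qed
  \<comment> \<open>D contains all products of two elements of N. So if L meets D trivially, then L
    \<inter> N has zero square and vanishes.\<close>
  have "essential_submodule S Am D"
  proof (rule essentialI[OF D])
    fix L assume L: "submodule L S Am" "L \<inter> D = {\<zero>\<^bsub>Am\<^esub>}"
    interpret LI: ideal L A using L(1) by (simp add: submodule_iff_H_stable_ideal H_stable_ideal_def)
    have "v \<otimes>\<^bsub>A\<^esub> w = \<zero>\<^bsub>A\<^esub>" if "v \<in> L \<inter> N" "w \<in> L \<inter> N" for v w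
    proof -
      have "v \<otimes>\<^bsub>A\<^esub> w \<in> L" using that LI.Icarr by (intro LI.I_l_closed) auto
      moreover have "v \<otimes>\<^bsub>A\<^esub> w \<in> D" using that prod by simp
      ultimately have "v \<otimes>\<^bsub>A\<^esub> w \<in> L \<inter> D" by simp
      then show ?thesis unfolding L(2) by simp
    qed
    then have "L \<inter> N = {\<zero>\<^bsub>A\<^esub>}" by (rule square_zero_submodule[OF semiprime Am.submodule_Int[OF L(1) Ns]])
    then have "L = {\<zero>\<^bsub>Am\<^esub>}" using N L(1) by (simp add: essential_submodule_def)
    then show "L \<subseteq> {\<zero>\<^bsub>Am\<^esub>}" by simp
  qed
  moreover have "f (g (\<iota> a)) = g (f (\<iota> a))" if "a \<in> D" for a
    using that Xm.diff_eq_zero[of "f (g (\<iota> a))" "g (f (\<iota> a))"] f g \<iota>_X by (simp add: D_def k_def \<T>_closed)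
  ultimately show ?thesis using \<T>_eqI[OF fg _ _ x] by blast
qed

end

context semiprime_hull
begin

subsection \<open>Multiplication on the hull\<close>

lemma finsum_Xm:
  assumes "finite I" "g \<in> I \<rightarrow> X"
  shows "finsum Xm g I = finsum E g I"
  using additive_finsum[OF Xm.M.abelian_group_axioms E.M.abelian_group_axioms, of "\<lambda>x. x" I g] assms X_E by auto

lemma finsum_X:
  assumes "finite I" "g \<in> I \<rightarrow> X"
  shows "finsum E g I \<in> X"
  using finsum_Xm[OF assms] Xm.M.finsum_closed[of g I] assms(2) by simp

lemma additive_finsum_X:
  assumes "finite I" "g \<in> I \<rightarrow> X" "\<And>x. x \<in> X \<Longrightarrow> u x \<in> X"
    "\<And>x y. \<lbrakk>x \<in> X; y \<in> X\<rbrakk> \<Longrightarrow> u (x \<oplus>\<^bsub>E\<^esub> y) = u x \<oplus>\<^bsub>E\<^esub> u y"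
  shows "u (finsum E g I) = finsum E (\<lambda>i. u (g i)) I"
  using additive_finsum[OF Xm.M.abelian_group_axioms E.M.abelian_group_axioms, of u I g] assms X_E
    finsum_Xm[OF assms(1,2)] by auto

text \<open>Left and right multiplication by elements of A exist on the hull before any product
  does, namely as the actions of (a \<otimes> 1) # 1 and (1 \<otimes> a) # 1.\<close>

definition lm :: "'a \<Rightarrow> 'e \<Rightarrow> 'e"
  where "lm a x = pure a \<one>\<^bsub>A\<^esub> \<one>\<^bsub>H\<^esub> \<odot>\<^bsub>E\<^esub> x"

definition rm :: "'a \<Rightarrow> 'e \<Rightarrow> 'e"
  where "rm a x = pure \<one>\<^bsub>A\<^esub> a \<one>\<^bsub>H\<^esub> \<odot>\<^bsub>E\<^esub> x"

lemma lm_closed: "\<lbrakk>a \<in> carrier A; x \<in> X\<rbrakk> \<Longrightarrow> lm a x \<in> X"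
  unfolding lm_def by (rule X_smult[OF pure_closed_S]) simp_all

lemma rm_closed: "\<lbrakk>a \<in> carrier A; x \<in> X\<rbrakk> \<Longrightarrow> rm a x \<in> X"
  unfolding rm_def by (rule X_smult[OF pure_closed_S]) simp_all

lemma lm_add: "\<lbrakk>a \<in> carrier A; x \<in> X; y \<in> X\<rbrakk> \<Longrightarrow> lm a (x \<oplus>\<^bsub>E\<^esub> y) = lm a x \<oplus>\<^bsub>E\<^esub> lm a y"
  unfolding lm_def by (rule E.lsmult_r_distr[OF pure_closed_S X_E X_E]) simp_all

lemma rm_add: "\<lbrakk>a \<in> carrier A; x \<in> X; y \<in> X\<rbrakk> \<Longrightarrow> rm a (x \<oplus>\<^bsub>E\<^esub> y) = rm a x \<oplus>\<^bsub>E\<^esub> rm a y"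
  unfolding rm_def by (rule E.lsmult_r_distr[OF pure_closed_S X_E X_E]) simp_all

lemma \<T>_lm: "\<lbrakk>f \<in> \<T>; a \<in> carrier A; x \<in> X\<rbrakk> \<Longrightarrow> f (lm a x) = lm a (f x)"
  unfolding lm_def by (rule \<T>_smult[OF _ pure_closed_S]) simp_all

lemma \<T>_rm: "\<lbrakk>f \<in> \<T>; a \<in> carrier A; x \<in> X\<rbrakk> \<Longrightarrow> f (rm a x) = rm a (f x)"
  unfolding rm_def by (rule \<T>_smult[OF _ pure_closed_S]) simp_all

lemma lm_\<iota>: "\<lbrakk>a \<in> carrier A; b \<in> carrier A\<rbrakk> \<Longrightarrow> lm a (\<iota> b) = \<iota> (a \<otimes>\<^bsub>A\<^esub> b)"
  by (simp add: lm_def pure_smult_simps)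

lemma rm_\<iota>: "\<lbrakk>a \<in> carrier A; b \<in> carrier A\<rbrakk> \<Longrightarrow> rm a (\<iota> b) = \<iota> (b \<otimes>\<^bsub>A\<^esub> a)"
  by (simp add: rm_def pure_smult_simps)

abbreviation repr where "repr \<equiv> hull_repr K H A act E \<iota>"
abbreviation hmult (infixl \<open>\<star>\<close> 70) where "hmult \<equiv> hull_mult K H A act E \<iota>"

lemma repr_iff: "repr x n a f \<longleftrightarrow>
    (\<forall>i<n. a i \<in> carrier A \<and> f i \<in> \<T>) \<and> x = (\<Oplus>\<^bsub>E\<^esub>i\<in>{..<n}. f i (\<iota> (a i)))"
proof -
  have "(\<Oplus>\<^bsub>Xm\<^esub>i\<in>{..<n}. f i (\<iota> (a i))) = (\<Oplus>\<^bsub>E\<^esub>i\<in>{..<n}. f i (\<iota> (a i)))"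
    if "\<forall>i<n. a i \<in> carrier A \<and> f i \<in> \<T>"
    using that by (intro finsum_Xm) (auto simp: \<T>_closed \<iota>_X)
  then show ?thesis by (auto simp: hull_repr_def Let_def)
qed

lemma repr_single: "\<lbrakk>f \<in> \<T>; a \<in> carrier A\<rbrakk> \<Longrightarrow> repr (f (\<iota> a)) 1 (\<lambda>_. a) (\<lambda>_. f)"
  using \<T>_closed[of f "\<iota> a"] \<iota>_X X_E by (simp add: repr_iff E.M.finsum_insert lessThan_Suc)

lemma repr_closed:
  assumes "repr x n a f" "i < n"
  shows "a i \<in> carrier A" "f i \<in> \<T>" "f i (\<iota> (a i)) \<in> X"
  using assms \<T>_closed \<iota>_X by (auto simp: repr_iff)

lemma ex_repr:
  assumes "x \<in> X" shows "\<exists>n a f. repr x n a f"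
proof -
  \<comment> \<open>Strengthened by a summand y that is already represented, so that each generator
    occurring in x merely appends one term.\<close>
  have "(\<exists>n a f. repr y n a f) \<Longrightarrow> y \<in> X \<Longrightarrow> \<exists>n a f. repr (y \<oplus>\<^bsub>E\<^esub> x) n a f" for y
    using assms
  proof (induction arbitrary: y rule: X_induct)
    case (hom g b)
    then obtain n a f where r: "repr y n a f" by blast
    let ?a = "a(n := b)" and ?f = "f(n := g)"
    have c: "(\<lambda>i. f i (\<iota> (a i))) \<in> {..<n} \<rightarrow> carrier E" using repr_closed(3)[OF r] X_E by auto
    have "(\<Oplus>\<^bsub>E\<^esub>i\<in>{..<Suc n}. ?f i (\<iota> (?a i))) = g (\<iota> b) \<oplus>\<^bsub>E\<^esub> (\<Oplus>\<^bsub>E\<^esub>i\<in>{..<n}. ?f i (\<iota> (?a i)))"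
      unfolding lessThan_Suc using c hom \<T>_closed \<iota>_X X_E by (subst E.M.finsum_insert) auto
    also have "(\<Oplus>\<^bsub>E\<^esub>i\<in>{..<n}. ?f i (\<iota> (?a i))) = (\<Oplus>\<^bsub>E\<^esub>i\<in>{..<n}. f i (\<iota> (a i)))"
      using c by (intro E.M.finsum_cong') auto
    also have "\<dots> = y" using r by (simp add: repr_iff)
    also have "g (\<iota> b) \<oplus>\<^bsub>E\<^esub> y = y \<oplus>\<^bsub>E\<^esub> g (\<iota> b)" using hom \<T>_closed \<iota>_X X_E by (intro E.M.a_comm) auto
    finally have "repr (y \<oplus>\<^bsub>E\<^esub> g (\<iota> b)) (Suc n) ?a ?f"
      using r hom by (auto simp: repr_iff less_Suc_eq)
    then show ?case by blast
  next
    case (add x x')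
    have "\<exists>n a f. repr (y \<oplus>\<^bsub>E\<^esub> x \<oplus>\<^bsub>E\<^esub> x') n a f"
      using add.IH(2)[OF add.IH(1)[OF add.prems]] add.hyps add.prems X_add by blast
    then show ?case using add.hyps add.prems X_E by (simp add: E.M.a_assoc)
  qed
  moreover have "repr \<zero>\<^bsub>E\<^esub> 0 (\<lambda>_. \<zero>\<^bsub>A\<^esub>) (\<lambda>_. \<lambda>x. x)" by (simp add: repr_iff)
  moreover have "\<zero>\<^bsub>E\<^esub> \<in> X" using E.submoduleD(2)[OF X_submodule] .
  ultimately show ?thesis using X_E[OF assms] by (metis E.M.l_zero)
qed

text \<open>For x = \<Sum> a_i s_i this is the product x y with y left unexpanded.
  \<open>hull_mult\<close> expands both factors; isolating the first one reduces independence of the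
  representations to one factor at a time.\<close>

definition rmult :: "nat \<Rightarrow> (nat \<Rightarrow> 'a) \<Rightarrow> (nat \<Rightarrow> 'e \<Rightarrow> 'e) \<Rightarrow> 'e \<Rightarrow> 'e"
  where "rmult n a f y = (\<Oplus>\<^bsub>E\<^esub>i\<in>{..<n}. f i (lm (a i) y))"

lemma rmult_closed: "\<lbrakk>repr x n a f; y \<in> X\<rbrakk> \<Longrightarrow> rmult n a f y \<in> X"
  unfolding rmult_def using repr_closed[of x n a f] by (intro finsum_X) (auto simp: \<T>_closed lm_closed)

lemma rmult_add:
  assumes r: "repr x n a f" and yz: "y \<in> X" "z \<in> X"
  shows "rmult n a f (y \<oplus>\<^bsub>E\<^esub> z) = rmult n a f y \<oplus>\<^bsub>E\<^esub> rmult n a f z"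
proof -
  note c = repr_closed[OF r]
  have cl: "f i (lm (a i) y) \<in> carrier E" if "i < n" "y \<in> X" for i y
    using c that by (simp add: X_E \<T>_closed lm_closed)
  have "rmult n a f (y \<oplus>\<^bsub>E\<^esub> z) = (\<Oplus>\<^bsub>E\<^esub>i\<in>{..<n}. f i (lm (a i) y) \<oplus>\<^bsub>E\<^esub> f i (lm (a i) z))"
    unfolding rmult_def using c yz cl
    by (intro E.M.finsum_cong') (auto simp: lm_add \<T>_add lm_closed)
  also have "\<dots> = rmult n a f y \<oplus>\<^bsub>E\<^esub> rmult n a f z"
    unfolding rmult_def using cl yz by (intro E.M.finsum_addf) auto
  finally show ?thesis .
qed

text \<open>The representation of x is absent from the right-hand side: the endomorphisms commute,
  so g moves in front of every f i and what remains sums to x. As values g(b) generate the hull, the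
  product depends on x alone.\<close>

lemma rmult_hom:
  assumes r: "repr x n a f" and g: "g \<in> \<T>" and b: "b \<in> carrier A"
  shows "rmult n a f (g (\<iota> b)) = g (rm b x)"
proof -
  note c = repr_closed[OF r]
  have s: "(\<lambda>i. f i (\<iota> (a i))) \<in> {..<n} \<rightarrow> X" using c by auto
  have eq: "f i (lm (a i) (g (\<iota> b))) = g (rm b (f i (\<iota> (a i))))" if "i < n" for i
  proof -
    have "f i (lm (a i) (g (\<iota> b))) = f i (g (\<iota> (a i \<otimes>\<^bsub>A\<^esub> b)))"
      using c that g b by (simp add: \<T>_lm[symmetric] lm_\<iota> \<iota>_X)
    also have "\<dots> = g (f i (rm b (\<iota> (a i))))"
      using c that g b by (simp add: \<T>_commute[of g] \<iota>_X rm_\<iota>)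
    also have "\<dots> = g (rm b (f i (\<iota> (a i))))" using c that b by (simp add: \<T>_rm \<iota>_X)
    finally show ?thesis .
  qed
  have gx: "g (rm b (f i (\<iota> (a i)))) \<in> carrier E" if "i < n" for i
    using c that b g by (simp add: X_E \<T>_closed rm_closed)
  have "rmult n a f (g (\<iota> b)) = (\<Oplus>\<^bsub>E\<^esub>i\<in>{..<n}. g (rm b (f i (\<iota> (a i)))))"
    unfolding rmult_def using eq gx by (intro E.M.finsum_cong') auto
  also have "\<dots> = g (rm b (\<Oplus>\<^bsub>E\<^esub>i\<in>{..<n}. f i (\<iota> (a i))))"
    using s b g by (intro additive_finsum_X[where u = "\<lambda>x. g (rm b x)", symmetric])
      (auto simp: rm_add \<T>_add rm_closed \<T>_closed)
  also have "\<dots> = g (rm b x)" using r by (simp add: repr_iff)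
  finally show ?thesis .
qed

lemma rmult_unique:
  assumes "repr x n a f" "repr x n' a' f'" "y \<in> X"
  shows "rmult n a f y = rmult n' a' f' y"
  using assms(3)
  by (induction rule: X_induct) (simp_all add: rmult_hom[OF assms(1)] rmult_hom[OF assms(2)]
      rmult_add[OF assms(1)] rmult_add[OF assms(2)])

text \<open>Moving g j past f i turns the inner sum over j into f i (a i y), so that the
  representation of y disappears as well.\<close>

lemma hmult_eq:
  assumes r: "repr x m a f" and y: "y \<in> X"
  shows "x \<star> y = rmult m a f y"
proof -
  have eq: "(\<Oplus>\<^bsub>E\<^esub>i\<in>{..<m}. \<Oplus>\<^bsub>E\<^esub>j\<in>{..<n}. g j (f i (\<iota> (a i \<otimes>\<^bsub>A\<^esub> b j)))) = rmult m a f y"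
    if r: "repr x m a f" and r': "repr y n b g" for m a f n b g
    unfolding rmult_def
  proof (rule E.M.finsum_cong')
    note c = repr_closed[OF r] and c' = repr_closed[OF r']
    show "(\<lambda>i. f i (lm (a i) y)) \<in> {..<m} \<rightarrow> carrier E" using c y by (auto simp: X_E \<T>_closed lm_closed)
    fix i assume "i \<in> {..<m}"
    then have i: "a i \<in> carrier A" "f i \<in> \<T>" using c by auto
    have gx: "f i (lm (a i) (g j (\<iota> (b j)))) \<in> carrier E" if "j < n" for j
      using c' that i by (simp add: X_E \<T>_closed lm_closed)
    have e: "g j (f i (\<iota> (a i \<otimes>\<^bsub>A\<^esub> b j))) = f i (lm (a i) (g j (\<iota> (b j))))" if "j < n" for j
      using c'[OF that] i by (simp add: \<T>_commute[of "g j"] \<iota>_X \<T>_lm[symmetric] lm_\<iota>)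
    have "(\<Oplus>\<^bsub>E\<^esub>j\<in>{..<n}. g j (f i (\<iota> (a i \<otimes>\<^bsub>A\<^esub> b j)))) = (\<Oplus>\<^bsub>E\<^esub>j\<in>{..<n}. f i (lm (a i) (g j (\<iota> (b j)))))"
      using e gx by (intro E.M.finsum_cong') auto
    also have "\<dots> = f i (lm (a i) (\<Oplus>\<^bsub>E\<^esub>j\<in>{..<n}. g j (\<iota> (b j))))"
      using c' i by (intro additive_finsum_X[where u = "\<lambda>x. f i (lm (a i) x)", symmetric])
        (auto simp: lm_add \<T>_add lm_closed \<T>_closed)
    also have "\<dots> = f i (lm (a i) y)" using r' by (simp add: repr_iff)
    finally show "(\<Oplus>\<^bsub>E\<^esub>j\<in>{..<n}. g j (f i (\<iota> (a i \<otimes>\<^bsub>A\<^esub> b j)))) = f i (lm (a i) y)" .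
  qed simp
  obtain n b g where r': "repr y n b g" using ex_repr[OF y] by blast
  show ?thesis
    unfolding hull_mult_def
  proof (rule the_equality)
    show "\<exists>m' a' f' n b g. repr x m' a' f' \<and> repr y n b g \<and>
      rmult m a f y = (\<Oplus>\<^bsub>E\<^esub>i\<in>{..<m'}. \<Oplus>\<^bsub>E\<^esub>j\<in>{..<n}. g j (f' i (\<iota> (a' i \<otimes>\<^bsub>A\<^esub> b j))))"
      using r r' eq[OF r r', symmetric] by blast
    show "z = rmult m a f y" if z: "\<exists>m a f n b g. repr x m a f \<and> repr y n b g \<and>
      z = (\<Oplus>\<^bsub>E\<^esub>i\<in>{..<m}. \<Oplus>\<^bsub>E\<^esub>j\<in>{..<n}. g j (f i (\<iota> (a i \<otimes>\<^bsub>A\<^esub> b j))))" for z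
    proof -
      obtain m' a' f' n' b' g' where 1: "repr x m' a' f'" "repr y n' b' g'"
        "z = (\<Oplus>\<^bsub>E\<^esub>i\<in>{..<m'}. \<Oplus>\<^bsub>E\<^esub>j\<in>{..<n'}. g' j (f' i (\<iota> (a' i \<otimes>\<^bsub>A\<^esub> b' j))))"
        using z by blast
      then show ?thesis using eq[OF 1(1,2)] rmult_unique[OF 1(1) r y] by simp
    qed
  qed
qed

lemma hmult_closed: "\<lbrakk>x \<in> X; y \<in> X\<rbrakk> \<Longrightarrow> x \<star> y \<in> X"
  using ex_repr[of x] hmult_eq rmult_closed by metis

lemma hmult_r_distr: "\<lbrakk>x \<in> X; y \<in> X; z \<in> X\<rbrakk> \<Longrightarrow> x \<star> (y \<oplus>\<^bsub>E\<^esub> z) = x \<star> y \<oplus>\<^bsub>E\<^esub> x \<star> z"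
  using ex_repr[of x] hmult_eq rmult_add X_add by metis

lemma hmult_hom_right: "\<lbrakk>x \<in> X; g \<in> \<T>; b \<in> carrier A\<rbrakk> \<Longrightarrow> x \<star> g (\<iota> b) = g (rm b x)"
  using ex_repr[of x] hmult_eq[of x _ _ _ "g (\<iota> b)"] rmult_hom \<T>_closed \<iota>_X by metis

text \<open>The induction runs over the right factor, where x g(b) = g(x b) is visibly additive in
  x; this avoids building a representation of x + y from those of x and y.\<close>

lemma hmult_l_distr:
  assumes "x \<in> X" "y \<in> X" "z \<in> X"
  shows "(x \<oplus>\<^bsub>E\<^esub> y) \<star> z = x \<star> z \<oplus>\<^bsub>E\<^esub> y \<star> z"
  using assms(3)
proof (induction rule: X_induct)
  case (hom f a)
  then show ?case using assms by (simp add: hmult_hom_right X_add rm_add \<T>_add rm_closed)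
next
  case (add z w)
  have "(x \<oplus>\<^bsub>E\<^esub> y) \<star> (z \<oplus>\<^bsub>E\<^esub> w) = (x \<star> z \<oplus>\<^bsub>E\<^esub> y \<star> z) \<oplus>\<^bsub>E\<^esub> (x \<star> w \<oplus>\<^bsub>E\<^esub> y \<star> w)"
    using add assms by (simp add: hmult_r_distr X_add)
  also have "\<dots> = (x \<star> z \<oplus>\<^bsub>E\<^esub> x \<star> w) \<oplus>\<^bsub>E\<^esub> (y \<star> z \<oplus>\<^bsub>E\<^esub> y \<star> w)"
    using add assms hmult_closed X_E by (simp add: E.M.a_ac)
  finally show ?case using add assms by (simp add: hmult_r_distr)
qed

lemma hmult_hom_hom:
  "\<lbrakk>f \<in> \<T>; a \<in> carrier A; g \<in> \<T>; b \<in> carrier A\<rbrakk> \<Longrightarrow> f (\<iota> a) \<star> g (\<iota> b) = g (f (\<iota> (a \<otimes>\<^bsub>A\<^esub> b)))"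
  using \<T>_rm[of f b "\<iota> a"] by (simp add: hmult_hom_right \<T>_closed \<iota>_X rm_\<iota>)

lemma \<T>_ident: "(\<lambda>x. x) \<in> \<T>"
  by (rule mod_hom_ident)

lemma hmult_\<iota>: "\<lbrakk>a \<in> carrier A; b \<in> carrier A\<rbrakk> \<Longrightarrow> \<iota> a \<star> \<iota> b = \<iota> (a \<otimes>\<^bsub>A\<^esub> b)"
  using hmult_hom_hom[OF \<T>_ident _ \<T>_ident] by simp

lemma hmult_hom_left: "\<lbrakk>f \<in> \<T>; a \<in> carrier A; y \<in> X\<rbrakk> \<Longrightarrow> f (\<iota> a) \<star> y = f (lm a y)"
  using hmult_eq[OF repr_single, of f a y] \<T>_closed[of f "lm a y"] lm_closed X_E
  by (simp add: rmult_def lessThan_Suc E.M.finsum_insert)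

text \<open>Endomorphisms over S are linear over the hull on both sides. Each half is checked on
  values g(b), where f and g commute.\<close>

lemma \<T>_hmult: "\<lbrakk>f \<in> \<T>; x \<in> X; y \<in> X\<rbrakk> \<Longrightarrow> f (x \<star> y) = f x \<star> y" "\<lbrakk>f \<in> \<T>; x \<in> X; y \<in> X\<rbrakk> \<Longrightarrow> f (x \<star> y) = x \<star> f y"
proof -
  show "f (x \<star> y) = f x \<star> y" if "f \<in> \<T>" "x \<in> X" "y \<in> X"
    using that(3)
  proof (induction rule: X_induct)
    case (hom g b)
    then show ?case using that by (simp add: hmult_hom_right \<T>_closed \<T>_commute[of f g] rm_closed \<T>_rm)
  next
    case (add y z)
    then show ?case using that by (simp add: hmult_r_distr \<T>_add hmult_closed \<T>_closed)
  qed
  show "f (x \<star> y) = x \<star> f y" if "f \<in> \<T>" "x \<in> X" "y \<in> X"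
    using that(2)
  proof (induction rule: X_induct)
    case (hom g b)
    then show ?case using that by (simp add: hmult_hom_left \<T>_closed \<T>_commute[of f g] lm_closed \<T>_lm)
  next
    case (add x z)
    then show ?case using that by (simp add: hmult_l_distr \<T>_add hmult_closed \<T>_closed)
  qed
qed

text \<open>By additivity x = f(a), and f passes through products. What remains is that left
  multiplication by a commutes with right multiplication by b, which holds already in S.\<close>

lemma hmult_assoc:
  assumes "x \<in> X" "y \<in> X" "z \<in> X"
  shows "x \<star> y \<star> z = x \<star> (y \<star> z)"
  using assms(1)
proof (induction rule: X_induct)
  case (hom f a)
  have lm: "lm a (y \<star> z) = lm a y \<star> z"
    using assms(3)
  proof (induction rule: X_induct)
    case (hom g b)
    have "lm a (rm b y) = rm b (lm a y)"
      using hom assms(2) \<open>a \<in> carrier A\<close> X_E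
      by (simp add: lm_def rm_def pure_closed pure_mult_special flip: E.lsmult_assoc)
    then show ?case using hom assms(2) \<open>a \<in> carrier A\<close>
      by (simp add: hmult_hom_right lm_closed rm_closed \<T>_lm[symmetric])
  next
    case (add z w)
    then show ?case using assms(2) \<open>a \<in> carrier A\<close> by (simp add: hmult_r_distr lm_add hmult_closed lm_closed)
  qed
  show ?case using hom assms by (simp add: hmult_hom_left lm hmult_closed lm_closed \<T>_hmult(1))
next
  case (add x w)
  then show ?case using assms by (simp add: hmult_l_distr hmult_closed)
qed

lemma hmult_one:
  assumes "x \<in> X" shows "\<iota> \<one>\<^bsub>A\<^esub> \<star> x = x" "x \<star> \<iota> \<one>\<^bsub>A\<^esub> = x"
proof -
  have 1: "pure \<one>\<^bsub>A\<^esub> \<one>\<^bsub>A\<^esub> \<one>\<^bsub>H\<^esub> \<odot>\<^bsub>E\<^esub> x = x" using E.lsmult_one[OF X_E[OF assms]] by simp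
  then show "\<iota> \<one>\<^bsub>A\<^esub> \<star> x = x" using hmult_hom_left[OF \<T>_ident A.one_closed assms] by (simp add: lm_def)
  show "x \<star> \<iota> \<one>\<^bsub>A\<^esub> = x" using 1 hmult_hom_right[OF assms \<T>_ident A.one_closed] by (simp add: rm_def)
qed

text \<open>When \<phi> is the action of some p in S, every endomorphism f i commutes with it, so
  the sum is p x whatever the representation.\<close>

lemma hull_extend_eq:
  assumes p: "p \<in> carrier S" and \<phi>: "\<And>a. a \<in> carrier A \<Longrightarrow> \<phi> a \<in> carrier A \<and> \<iota> (\<phi> a) = p \<odot>\<^bsub>E\<^esub> \<iota> a"
    and x: "x \<in> X"
  shows "hull_extend K H A act E \<iota> \<phi> x = p \<odot>\<^bsub>E\<^esub> x"
proof -
  have eq: "(\<Oplus>\<^bsub>E\<^esub>i\<in>{..<n}. f i (\<iota> (\<phi> (a i)))) = p \<odot>\<^bsub>E\<^esub> x" if r: "repr x n a f" for n a f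
  proof -
    note c = repr_closed[OF r]
    have gx: "p \<odot>\<^bsub>E\<^esub> f i (\<iota> (a i)) \<in> carrier E" if "i < n" for i using c that by (intro X_E X_smult p)
    have e: "f i (\<iota> (\<phi> (a i))) = p \<odot>\<^bsub>E\<^esub> f i (\<iota> (a i))" if "i < n" for i
      using c[OF that] \<phi> \<T>_smult[OF c(2)[OF that] p] \<iota>_X by simp
    have "(\<Oplus>\<^bsub>E\<^esub>i\<in>{..<n}. f i (\<iota> (\<phi> (a i)))) = (\<Oplus>\<^bsub>E\<^esub>i\<in>{..<n}. p \<odot>\<^bsub>E\<^esub> f i (\<iota> (a i)))"
      using e gx by (intro E.M.finsum_cong') auto
    also have "\<dots> = p \<odot>\<^bsub>E\<^esub> (\<Oplus>\<^bsub>E\<^esub>i\<in>{..<n}. f i (\<iota> (a i)))"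
      using c E.lsmult_r_distr[OF p X_E X_E] X_smult[OF p]
      by (intro additive_finsum_X[symmetric]) auto
    finally show ?thesis using r by (simp add: repr_iff)
  qed
  obtain n a f where r: "repr x n a f" using ex_repr[OF x] by blast
  show ?thesis
    unfolding hull_extend_def
  proof (rule the_equality)
    show "\<exists>n a f. repr x n a f \<and> p \<odot>\<^bsub>E\<^esub> x = (\<Oplus>\<^bsub>E\<^esub>i\<in>{..<n}. f i (\<iota> (\<phi> (a i))))"
      using r eq[OF r, symmetric] by blast
    show "z = p \<odot>\<^bsub>E\<^esub> x" if "\<exists>n a f. repr x n a f \<and> z = (\<Oplus>\<^bsub>E\<^esub>i\<in>{..<n}. f i (\<iota> (\<phi> (a i))))" for z
      using that eq by blast
  qed
qed

abbreviation Ahat where "Ahat \<equiv> hull_algebra K H A act E \<iota>"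
abbreviation hact where "hact \<equiv> hull_act K H A act E \<iota>"

lemma Ahat_simps [simp]: "carrier Ahat = X" "mult Ahat = hmult" "one Ahat = \<iota> \<one>\<^bsub>A\<^esub>"
  "zero Ahat = \<zero>\<^bsub>E\<^esub>" "add Ahat = add E"
  by (simp_all add: hull_algebra_def)

lemma Ahat_smult:
  assumes "c \<in> carrier K" "x \<in> X"
  shows "c \<odot>\<^bsub>Ahat\<^esub> x = pure (c \<odot>\<^bsub>A\<^esub> \<one>\<^bsub>A\<^esub>) \<one>\<^bsub>A\<^esub> \<one>\<^bsub>H\<^esub> \<odot>\<^bsub>E\<^esub> x"
  unfolding hull_algebra_def module.simps
  using assms by (intro hull_extend_eq) (simp_all add: pure_closed pure_smult_simps A.smult_mult_left)

lemma hact_eq: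
  assumes "h \<in> carrier H" "x \<in> X"
  shows "hact h x = pure \<one>\<^bsub>A\<^esub> \<one>\<^bsub>A\<^esub> h \<odot>\<^bsub>E\<^esub> x"
  unfolding hull_act_def
  using assms by (intro hull_extend_eq) (simp_all add: pure_closed pure_smult_simps act_closed)

lemma Ahat_smult_hom:
  assumes "c \<in> carrier K" "f \<in> \<T>" "a \<in> carrier A"
  shows "c \<odot>\<^bsub>Ahat\<^esub> f (\<iota> a) = f (\<iota> (c \<odot>\<^bsub>A\<^esub> a))"
  using assms \<T>_smult[OF assms(2) pure_closed_S \<iota>_X, of "c \<odot>\<^bsub>A\<^esub> \<one>\<^bsub>A\<^esub>" "\<one>\<^bsub>A\<^esub>" "\<one>\<^bsub>H\<^esub>" a]
  by (simp add: Ahat_smult \<T>_closed \<iota>_X pure_smult_simps A.smult_mult_left)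

lemma hact_hom:
  assumes "h \<in> carrier H" "f \<in> \<T>" "a \<in> carrier A"
  shows "hact h (f (\<iota> a)) = f (\<iota> (act h a))"
  using assms \<T>_smult[OF assms(2) pure_closed_S \<iota>_X, of "\<one>\<^bsub>A\<^esub>" "\<one>\<^bsub>A\<^esub>" h a]
  by (simp add: hact_eq \<T>_closed \<iota>_X pure_smult_simps)

lemma Ahat_smult_closed: "\<lbrakk>c \<in> carrier K; x \<in> X\<rbrakk> \<Longrightarrow> c \<odot>\<^bsub>Ahat\<^esub> x \<in> X"
  by (simp add: Ahat_smult del: S_simps) (rule X_smult[OF pure_closed_S]; simp)

lemma hact_closed: "\<lbrakk>h \<in> carrier H; x \<in> X\<rbrakk> \<Longrightarrow> hact h x \<in> X"
  by (simp add: hact_eq del: S_simps) (rule X_smult[OF pure_closed_S]; simp)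

lemma Ahat_smult_add: "\<lbrakk>c \<in> carrier K; x \<in> X; y \<in> X\<rbrakk> \<Longrightarrow>
    c \<odot>\<^bsub>Ahat\<^esub> (x \<oplus>\<^bsub>E\<^esub> y) = c \<odot>\<^bsub>Ahat\<^esub> x \<oplus>\<^bsub>E\<^esub> c \<odot>\<^bsub>Ahat\<^esub> y"
  by (simp add: Ahat_smult X_add) (rule E.lsmult_r_distr[OF pure_closed_S X_E X_E]; simp)

lemma hact_add: "\<lbrakk>h \<in> carrier H; x \<in> X; y \<in> X\<rbrakk> \<Longrightarrow> hact h (x \<oplus>\<^bsub>E\<^esub> y) = hact h x \<oplus>\<^bsub>E\<^esub> hact h y"
  by (simp add: hact_eq X_add) (rule E.lsmult_r_distr[OF pure_closed_S X_E X_E]; simp)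

lemma \<T>_\<iota>_add: "\<lbrakk>f \<in> \<T>; a \<in> carrier A; b \<in> carrier A\<rbrakk> \<Longrightarrow> f (\<iota> (a \<oplus>\<^bsub>A\<^esub> b)) = f (\<iota> a) \<oplus>\<^bsub>E\<^esub> f (\<iota> b)"
  by (simp add: \<iota>_add \<T>_add \<iota>_X)

lemma swap4: "\<lbrakk>x \<in> X; y \<in> X; z \<in> X; w \<in> X\<rbrakk> \<Longrightarrow>
    (x \<oplus>\<^bsub>E\<^esub> y) \<oplus>\<^bsub>E\<^esub> (z \<oplus>\<^bsub>E\<^esub> w) = (x \<oplus>\<^bsub>E\<^esub> z) \<oplus>\<^bsub>E\<^esub> (y \<oplus>\<^bsub>E\<^esub> w)"
  using X_E by (simp add: E.M.a_ac)

lemma Ahat_abelian_group: "abelian_group Ahat"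
  by (rule abelian_group_surj[OF Xm.M.abelian_group_axioms, where \<pi> = "\<lambda>x. x"]) simp_all

lemma Ahat_module: "module K Ahat"
proof (rule moduleI)
  show "cring K" by (rule H.R.cring_axioms)
  show "abelian_group Ahat" by (rule Ahat_abelian_group)
  fix c d x assume cd: "c \<in> carrier K" "d \<in> carrier K" and "x \<in> carrier Ahat"
  then have x: "x \<in> X" by simp
  show "(c \<oplus>\<^bsub>K\<^esub> d) \<odot>\<^bsub>Ahat\<^esub> x = c \<odot>\<^bsub>Ahat\<^esub> x \<oplus>\<^bsub>Ahat\<^esub> d \<odot>\<^bsub>Ahat\<^esub> x"
    using x
  proof (induction rule: X_induct)
    case (add x y)
    then show ?case using cd swap4 by (simp add: Ahat_smult_add Ahat_smult_closed)
  qed (use cd in \<open>simp add: Ahat_smult_hom A.smult_l_distr \<T>_\<iota>_add\<close>)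
  show "(c \<otimes>\<^bsub>K\<^esub> d) \<odot>\<^bsub>Ahat\<^esub> x = c \<odot>\<^bsub>Ahat\<^esub> (d \<odot>\<^bsub>Ahat\<^esub> x)"
    using x
  proof (induction rule: X_induct)
    case (add x y)
    then show ?case using cd by (simp add: Ahat_smult_add Ahat_smult_closed)
  qed (use cd in \<open>simp add: Ahat_smult_hom A.smult_assoc1\<close>)
next
  fix x assume "x \<in> carrier Ahat"
  then have x: "x \<in> X" by simp
  then show "\<one>\<^bsub>K\<^esub> \<odot>\<^bsub>Ahat\<^esub> x = x"
  proof (induction rule: X_induct)
    case (add x y)
    then show ?case by (simp add: Ahat_smult_add)
  qed (simp add: Ahat_smult_hom)
qed (simp_all add: Ahat_smult_closed Ahat_smult_add)

lemma Ahat_ring: "ring Ahat"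
  by (intro ringI monoidI Ahat_abelian_group)
    (simp_all add: hmult_closed \<iota>_X hmult_assoc hmult_one hmult_l_distr hmult_r_distr)

text \<open>A scalar c acts both as left and as right multiplication by the image of c 1, so
  compatibility with products reduces to associativity.\<close>

lemma Ahat_assoc_algebra: "assoc_algebra K Ahat"
proof (intro assoc_algebra.intro Ahat_module Ahat_ring assoc_algebra_axioms.intro)
  have s: "c \<odot>\<^bsub>Ahat\<^esub> z = lm (c \<odot>\<^bsub>A\<^esub> \<one>\<^bsub>A\<^esub>) z" if "c \<in> carrier K" "z \<in> X" for c z
    using that by (simp add: Ahat_smult lm_def)
  have s': "c \<odot>\<^bsub>Ahat\<^esub> z = \<iota> (c \<odot>\<^bsub>A\<^esub> \<one>\<^bsub>A\<^esub>) \<star> z" "c \<odot>\<^bsub>Ahat\<^esub> z = z \<star> \<iota> (c \<odot>\<^bsub>A\<^esub> \<one>\<^bsub>A\<^esub>)"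
    if c: "c \<in> carrier K" and z: "z \<in> X" for c z
  proof -
    show "c \<odot>\<^bsub>Ahat\<^esub> z = \<iota> (c \<odot>\<^bsub>A\<^esub> \<one>\<^bsub>A\<^esub>) \<star> z"
      using that hmult_hom_left[OF \<T>_ident, of "c \<odot>\<^bsub>A\<^esub> \<one>\<^bsub>A\<^esub>" z] by (simp add: s)
    show "c \<odot>\<^bsub>Ahat\<^esub> z = z \<star> \<iota> (c \<odot>\<^bsub>A\<^esub> \<one>\<^bsub>A\<^esub>)"
      using z
    proof (induction rule: X_induct)
      case (hom f a)
      then show ?case using c hmult_hom_hom[OF hom \<T>_ident, of "c \<odot>\<^bsub>A\<^esub> \<one>\<^bsub>A\<^esub>"]
        by (simp add: Ahat_smult_hom A.smult_mult_right)
    next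
      case (add x y)
      then show ?case using c by (simp add: Ahat_smult_add hmult_l_distr \<iota>_X)
    qed
  qed
  fix c x y assume "c \<in> carrier K" "x \<in> carrier Ahat" "y \<in> carrier Ahat"
  then have *: "c \<in> carrier K" "x \<in> X" "y \<in> X" by simp_all
  then show "(c \<odot>\<^bsub>Ahat\<^esub> x) \<otimes>\<^bsub>Ahat\<^esub> y = c \<odot>\<^bsub>Ahat\<^esub> (x \<otimes>\<^bsub>Ahat\<^esub> y)"
    by (simp add: s'(1) hmult_closed hmult_assoc \<iota>_X)
  show "x \<otimes>\<^bsub>Ahat\<^esub> (c \<odot>\<^bsub>Ahat\<^esub> y) = c \<odot>\<^bsub>Ahat\<^esub> (x \<otimes>\<^bsub>Ahat\<^esub> y)"
    using * by (simp add: s'(2) hmult_closed hmult_assoc \<iota>_X)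
qed

lemma \<T>_\<iota>_linear: "f \<in> \<T> \<Longrightarrow> (\<lambda>a. f (\<iota> a)) \<in> mod_hom K A Ahat"
  by (rule mod_homI) (simp_all add: \<T>_closed \<iota>_X \<T>_\<iota>_add Ahat_smult_hom)

lemma hact_smult_right:
  assumes "c \<in> carrier K" "h \<in> carrier H" "x \<in> X"
  shows "hact h (c \<odot>\<^bsub>Ahat\<^esub> x) = c \<odot>\<^bsub>Ahat\<^esub> hact h x"
  using assms(3)
  by (induction rule: X_induct) (use assms in \<open>simp_all add: Ahat_smult_hom hact_hom act_closed
    act_smult_right Ahat_smult_add hact_add Ahat_smult_closed hact_closed\<close>)

lemma hact_smult_left:
  assumes "c \<in> carrier K" "h \<in> carrier H" "x \<in> X"
  shows "hact (c \<odot>\<^bsub>H\<^esub> h) x = c \<odot>\<^bsub>Ahat\<^esub> hact h x"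
  using assms(3)
  by (induction rule: X_induct) (use assms in \<open>simp_all add: Ahat_smult_hom hact_hom act_closed
    act_smult_left Ahat_smult_add hact_add Ahat_smult_closed hact_closed\<close>)

lemma hact_add_left:
  assumes "g \<in> carrier H" "h \<in> carrier H" "x \<in> X"
  shows "hact (g \<oplus>\<^bsub>H\<^esub> h) x = hact g x \<oplus>\<^bsub>E\<^esub> hact h x"
  using assms(3)
proof (induction rule: X_induct)
  case (add x y)
  then show ?case using assms swap4 by (simp add: hact_add hact_closed)
qed (use assms in \<open>simp add: hact_hom act_add_left act_closed \<T>_\<iota>_add\<close>)

text \<open>Both sides are additive in x and in y. On values f(a) and g(b) the product is g(f(a b)),
  and the action of h passes through g and f to a b, where the axiom for A applies.\<close>

lemma hact_mult:
  assumes h: "h \<in> carrier H" and xy: "x \<in> X" "y \<in> X"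
  shows "hact h (x \<star> y) = H.Sw Ahat (\<lambda>g g'. hact g x \<star> hact g' y) h"
proof -
  interpret Q: assoc_algebra K Ahat by (rule Ahat_assoc_algebra)
  have l: "(\<lambda>x. hact g x) \<in> mod_hom K Ahat Ahat" if "g \<in> carrier H" for g
    using that by (intro mod_homI) (simp_all add: hact_closed hact_add hact_smult_right)
  have lin1: "(\<lambda>x. H.Sw Ahat (\<lambda>g g'. hact g x \<star> hact g' y) h) \<in> mod_hom K Ahat Ahat" if "y \<in> X" for y
    by (rule H.mod_hom_Sw_fun[OF Ahat_module h])
      (use Q.mod_hom_mult_left[OF l] that in \<open>simp add: hact_closed\<close>)
  have lin2: "(\<lambda>y. H.Sw Ahat (\<lambda>g g'. hact g x \<star> hact g' y) h) \<in> mod_hom K Ahat Ahat" if "x \<in> X" for x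
    by (rule H.mod_hom_Sw_fun[OF Ahat_module h])
      (use Q.mod_hom_mult_right[OF l] that in \<open>simp add: hact_closed\<close>)
  show ?thesis using xy(1)
  proof (induction rule: X_induct)
    case f: (hom f a)
    show ?case using xy(2)
    proof (induction rule: X_induct)
      case (hom g b)
      have gf: "(\<lambda>x. g (f x)) \<in> \<T>" by (rule \<T>_compose[OF f(1) hom(1)])
      have "hact h (f (\<iota> a) \<star> g (\<iota> b)) = g (f (\<iota> (act h (a \<otimes>\<^bsub>A\<^esub> b))))"
        using f hom h hact_hom[OF h gf, of "a \<otimes>\<^bsub>A\<^esub> b"] by (simp add: hmult_hom_hom)
      also have "\<dots> = g (f (\<iota> (H.Sw A (\<lambda>k k'. act k a \<otimes>\<^bsub>A\<^esub> act k' b) h)))"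
        using f hom h by (simp add: act_mult)
      also have "\<dots> = H.Sw Ahat (\<lambda>k k'. g (f (\<iota> (act k a \<otimes>\<^bsub>A\<^esub> act k' b)))) h"
        using f hom h by (intro H.hom_Sw[OF A.is_module Ahat_module \<T>_\<iota>_linear[OF gf]]) (simp_all add: act_closed)
      also have "\<dots> = H.Sw Ahat (\<lambda>k k'. hact k (f (\<iota> a)) \<star> hact k' (g (\<iota> b))) h"
        using f hom h by (intro H.Sw_cong[OF Ahat_module])
          (simp_all add: hact_hom hmult_hom_hom act_closed hmult_closed \<T>_closed \<iota>_X)
      finally show ?case .
    next
      case (add y z)
      then show ?case using f h mod_hom_add[OF lin2, of "f (\<iota> a)" y z]
        by (simp add: hmult_r_distr hact_add hmult_closed \<T>_closed \<iota>_X)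
    qed
  next
    case (add x z)
    then show ?case using xy(2) h mod_hom_add[OF lin1, of y x z]
      by (simp add: hmult_l_distr hact_add hmult_closed)
  qed
qed

theorem Ahat_module_algebra: "module_algebra K H Ahat hact"
proof (intro module_algebra.intro H.hopf_algebra_axioms Ahat_assoc_algebra module_algebra_axioms.intro)
  show "hact (g \<otimes>\<^bsub>H\<^esub> h) x = hact g (hact h x)"
    if gh: "g \<in> carrier H" "h \<in> carrier H" and "x \<in> carrier Ahat" for g h x
  proof -
    have "x \<in> X" using that by simp
    then show ?thesis
      by (induction rule: X_induct) (use gh in \<open>simp_all add: hact_hom act_assoc act_closed hact_add hact_closed\<close>)
  qed
  show "hact \<one>\<^bsub>H\<^esub> x = x" if "x \<in> carrier Ahat" for x
  proof -
    have "x \<in> X" using that by simp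
    then show ?thesis
      by (induction rule: X_induct) (simp_all add: hact_hom act_one hact_add)
  qed
  show "hact h \<one>\<^bsub>Ahat\<^esub> = counit H h \<odot>\<^bsub>Ahat\<^esub> \<one>\<^bsub>Ahat\<^esub>" if "h \<in> carrier H" for h
    using hact_hom[OF that \<T>_ident A.one_closed] Ahat_smult_hom[OF _ \<T>_ident A.one_closed, of "counit H h"] that
    by (simp add: act_one_right H.counit_closed)
qed (simp_all add: hact_closed hact_add hact_add_left hact_smult_left hact_smult_right hact_mult)

end

section \<open>Central invariants\<close>

lemma central_invariants_simps [simp]:
  "mult (central_invariants H A act) = mult A" "add (central_invariants H A act) = add A"
  "one (central_invariants H A act) = one A" "zero (central_invariants H A act) = zero A"
  by (simp_all add: central_invariants_def)

context hmodule_algebra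
begin

abbreviation C where "C \<equiv> central_invariants H A act"

lemma C_carrier: "z \<in> carrier C \<longleftrightarrow> z \<in> carrier A \<and> (\<forall>x\<in>carrier A. z \<otimes>\<^bsub>A\<^esub> x = x \<otimes>\<^bsub>A\<^esub> z) \<and>
    (\<forall>h\<in>carrier H. act h z = counit H h \<odot>\<^bsub>A\<^esub> z)"
  by (simp add: central_invariants_def)

lemma C_A: "z \<in> carrier C \<Longrightarrow> z \<in> carrier A"
  by (simp add: C_carrier)

lemma C_comm: "\<lbrakk>z \<in> carrier C; x \<in> carrier A\<rbrakk> \<Longrightarrow> z \<otimes>\<^bsub>A\<^esub> x = x \<otimes>\<^bsub>A\<^esub> z"
  by (simp add: C_carrier)

lemma C_act: "\<lbrakk>z \<in> carrier C; h \<in> carrier H\<rbrakk> \<Longrightarrow> act h z = counit H h \<odot>\<^bsub>A\<^esub> z"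
  by (simp add: C_carrier)

text \<open>As z is invariant, the first leg of h acts on it by the counit and the sum
  collapses.\<close>

lemma act_C_mult:
  assumes z: "z \<in> carrier C" and x: "x \<in> carrier A" and h: "h \<in> carrier H"
  shows "act h (z \<otimes>\<^bsub>A\<^esub> x) = z \<otimes>\<^bsub>A\<^esub> act h x"
proof -
  note rules = multilinear x C_A[OF z]
  have "act h (z \<otimes>\<^bsub>A\<^esub> x) = H.Sw A (\<lambda>g g'. act g z \<otimes>\<^bsub>A\<^esub> act g' x) h"
    using h C_A[OF z] x by (rule act_mult)
  also have "\<dots> = H.Sw A (\<lambda>g g'. counit H g \<odot>\<^bsub>A\<^esub> (z \<otimes>\<^bsub>A\<^esub> act g' x)) h"
  proof (rule H.Sw_cong[OF A.is_module h])
    fix g g' assume g: "g \<in> carrier H" "g' \<in> carrier H"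
    then have "act g z = counit H g \<odot>\<^bsub>A\<^esub> z" using C_act[OF z] by simp
    then show "act g z \<otimes>\<^bsub>A\<^esub> act g' x = counit H g \<odot>\<^bsub>A\<^esub> (z \<otimes>\<^bsub>A\<^esub> act g' x)"
      using g C_A[OF z] x by (simp add: A.smult_mult_left act_closed H.counit_closed)
  qed (rule rules | assumption)+
  also have "\<dots> = z \<otimes>\<^bsub>A\<^esub> act h x"
    by (rule H.Sw_counit_left[OF A.is_module h]) (rule rules | assumption)+
  finally show ?thesis .
qed

lemma C_mult_closed: "\<lbrakk>z \<in> carrier C; w \<in> carrier C\<rbrakk> \<Longrightarrow> z \<otimes>\<^bsub>A\<^esub> w \<in> carrier C"
proof -
  assume zw: "z \<in> carrier C" "w \<in> carrier C"
  have "z \<otimes>\<^bsub>A\<^esub> w \<otimes>\<^bsub>A\<^esub> x = x \<otimes>\<^bsub>A\<^esub> (z \<otimes>\<^bsub>A\<^esub> w)" if "x \<in> carrier A" for x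
  proof -
    have "z \<otimes>\<^bsub>A\<^esub> w \<otimes>\<^bsub>A\<^esub> x = z \<otimes>\<^bsub>A\<^esub> (x \<otimes>\<^bsub>A\<^esub> w)"
      using that zw C_A C_comm[OF zw(2) that] by (simp add: A.m_assoc)
    also have "\<dots> = x \<otimes>\<^bsub>A\<^esub> z \<otimes>\<^bsub>A\<^esub> w" using that zw C_A C_comm[OF zw(1) that] by (simp flip: A.m_assoc)
    finally show ?thesis using that zw C_A by (simp add: A.m_assoc)
  qed
  moreover have "act h (z \<otimes>\<^bsub>A\<^esub> w) = counit H h \<odot>\<^bsub>A\<^esub> (z \<otimes>\<^bsub>A\<^esub> w)" if "h \<in> carrier H" for h
    using zw C_A act_C_mult[OF zw(1) C_A[OF zw(2)] that] C_act[OF zw(2) that] that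
    by (simp add: A.smult_mult_right H.counit_closed)
  ultimately show ?thesis using zw C_A unfolding C_carrier by blast
qed

lemma act_zero: "h \<in> carrier H \<Longrightarrow> act h \<zero>\<^bsub>A\<^esub> = \<zero>\<^bsub>A\<^esub>"
  by (rule additive_zero[OF A.abelian_group_axioms A.abelian_group_axioms])
    (auto simp: act_closed act_add_right)

lemma C_add_closed: "\<lbrakk>z \<in> carrier C; w \<in> carrier C\<rbrakk> \<Longrightarrow> z \<oplus>\<^bsub>A\<^esub> w \<in> carrier C"
  by (simp add: C_carrier A.l_distr A.r_distr act_add_right A.smult_r_distr H.counit_closed)

lemma C_smult_closed:
  assumes c: "c \<in> carrier K" and z: "z \<in> carrier C"
  shows "c \<odot>\<^bsub>A\<^esub> z \<in> carrier C"
  using assms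
  by (simp add: C_carrier A.smult_mult_left A.smult_mult_right act_smult_right H.counit_closed
      H.R.m_comm flip: A.smult_assoc1)

lemma C_one: "\<one>\<^bsub>A\<^esub> \<in> carrier C"
  by (simp add: C_carrier act_one_right)

lemma C_zero: "\<zero>\<^bsub>A\<^esub> \<in> carrier C"
  by (simp add: C_carrier act_zero H.counit_closed)

lemma C_cring: "cring C"
proof -
  have "abelian_group C"
  proof (rule abelian_groupI, goal_cases)
    case (3 x y z) then show ?case using C_A by (simp add: A.a_assoc)
  next
    case (4 x y) then show ?case using C_A A.a_comm by simp
  next
    case (5 x) then show ?case using C_A by simp
  next
    case (6 x)
    then have x: "x \<in> carrier C" "x \<in> carrier A" using C_A by auto
    have "(\<ominus>\<^bsub>K\<^esub> \<one>\<^bsub>K\<^esub>) \<odot>\<^bsub>A\<^esub> x \<in> carrier C" using x by (intro C_smult_closed) simp_all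
    moreover have "(\<ominus>\<^bsub>K\<^esub> \<one>\<^bsub>K\<^esub>) \<odot>\<^bsub>A\<^esub> x \<oplus>\<^bsub>A\<^esub> x = \<zero>\<^bsub>A\<^esub>"
      using x by (simp add: A.smult_l_minus A.l_neg)
    ultimately show ?case by auto
  qed (simp_all add: C_add_closed C_zero)
  moreover have "comm_monoid C"
  proof (rule comm_monoidI, goal_cases)
    case (3 x y z) then show ?case using C_A by (simp add: A.m_assoc)
  next
    case (5 x y) then show ?case using C_A C_comm by simp
  qed (use C_A in \<open>simp_all add: C_mult_closed C_one\<close>)
  ultimately show ?thesis by (rule cringI) (use C_A in \<open>simp add: A.l_distr\<close>)
qed

lemma C_ring: "ring C"
  using C_cring by (rule cring.axioms)

text \<open>Together with \<open>endo_C\<close> this identifies the S-endomorphisms of A with the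
  multiplications by central invariants.\<close>

lemma C_mult_hom:
  assumes z: "z \<in> carrier C" shows "(\<lambda>x. z \<otimes>\<^bsub>A\<^esub> x) \<in> mod_hom S Am Am"
proof (rule mod_homI)
  interpret M: lmodule S Am by (rule Am_lmodule)
  show "z \<otimes>\<^bsub>A\<^esub> x \<in> carrier Am" if "x \<in> carrier Am" for x using that C_A[OF z] by simp
  show "z \<otimes>\<^bsub>A\<^esub> (x \<oplus>\<^bsub>Am\<^esub> y) = z \<otimes>\<^bsub>A\<^esub> x \<oplus>\<^bsub>Am\<^esub> z \<otimes>\<^bsub>A\<^esub> y" if "x \<in> carrier Am" "y \<in> carrier Am" for x y
    using that C_A[OF z] by (simp add: A.r_distr)
  show "z \<otimes>\<^bsub>A\<^esub> (p \<odot>\<^bsub>Am\<^esub> x) = p \<odot>\<^bsub>Am\<^esub> (z \<otimes>\<^bsub>A\<^esub> x)" if p: "p \<in> carrier S" and "x \<in> carrier Am" for p x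
    using p
  proof (induction rule: S_induct)
    case (pure a b h)
    have x: "x \<in> carrier A" using that by simp
    have "z \<otimes>\<^bsub>A\<^esub> (a \<otimes>\<^bsub>A\<^esub> act h x \<otimes>\<^bsub>A\<^esub> b) = (z \<otimes>\<^bsub>A\<^esub> a) \<otimes>\<^bsub>A\<^esub> (act h x \<otimes>\<^bsub>A\<^esub> b)"
      using pure x C_A[OF z] by (simp add: A.m_assoc act_closed)
    also have "\<dots> = a \<otimes>\<^bsub>A\<^esub> (z \<otimes>\<^bsub>A\<^esub> act h x) \<otimes>\<^bsub>A\<^esub> b"
      using pure x C_A[OF z] C_comm[OF z, of a] by (simp add: A.m_assoc act_closed)
    finally show ?case using pure x z C_A[OF z] by (simp add: pure_smult_Am act_C_mult)
  next
    case (add p q)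
    have x: "x \<in> carrier A" using that by simp
    have "p \<odot>\<^bsub>Am\<^esub> x \<in> carrier A" "q \<odot>\<^bsub>Am\<^esub> x \<in> carrier A"
      using M.lsmult_closed[OF add.hyps(1), of x] M.lsmult_closed[OF add.hyps(2), of x] x by simp_all
    then show ?case
      using add M.lsmult_l_distr[OF add.hyps, of x] M.lsmult_l_distr[OF add.hyps, of "z \<otimes>\<^bsub>A\<^esub> x"] x C_A[OF z]
      by (simp add: A.r_distr del: S_simps)
  qed
qed

text \<open>Linearity for left and for right multiplications gives x f(1) = f(x) = f(1) x. Linearity
  for H together with h 1 = \<epsilon>(h) 1 gives invariance of f(1).\<close>

lemma endo_C:
  assumes f: "f \<in> mod_hom S Am Am"
  shows "f \<one>\<^bsub>A\<^esub> \<in> carrier C" "x \<in> carrier A \<Longrightarrow> f x = f \<one>\<^bsub>A\<^esub> \<otimes>\<^bsub>A\<^esub> x"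
proof -
  have cl: "f x \<in> carrier A" if "x \<in> carrier A" for x using mod_hom_closed[OF f] that by simp
  have l: "f (a \<otimes>\<^bsub>A\<^esub> x) = a \<otimes>\<^bsub>A\<^esub> f x" if "a \<in> carrier A" "x \<in> carrier A" for a x
    using mod_hom_smult[OF f pure_closed_S, of a "\<one>\<^bsub>A\<^esub>" "\<one>\<^bsub>H\<^esub>" x] that cl by (simp add: pure_smult_Am act_one)
  have r: "f (x \<otimes>\<^bsub>A\<^esub> a) = f x \<otimes>\<^bsub>A\<^esub> a" if "a \<in> carrier A" "x \<in> carrier A" for a x
    using mod_hom_smult[OF f pure_closed_S, of "\<one>\<^bsub>A\<^esub>" a "\<one>\<^bsub>H\<^esub>" x] that cl by (simp add: pure_smult_Am act_one)
  have h: "f (act h x) = act h (f x)" if "h \<in> carrier H" "x \<in> carrier A" for h x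
    using mod_hom_smult[OF f pure_closed_S, of "\<one>\<^bsub>A\<^esub>" "\<one>\<^bsub>A\<^esub>" h x] that cl by (simp add: pure_smult_Am act_closed)
  show 1: "f x = f \<one>\<^bsub>A\<^esub> \<otimes>\<^bsub>A\<^esub> x" if "x \<in> carrier A" for x using r[of x "\<one>\<^bsub>A\<^esub>"] that by simp
  have "f \<one>\<^bsub>A\<^esub> \<otimes>\<^bsub>A\<^esub> x = x \<otimes>\<^bsub>A\<^esub> f \<one>\<^bsub>A\<^esub>" if "x \<in> carrier A" for x
    using l[OF that A.one_closed] 1[OF that] that by simp
  moreover have "act g (f \<one>\<^bsub>A\<^esub>) = counit H g \<odot>\<^bsub>A\<^esub> f \<one>\<^bsub>A\<^esub>" if "g \<in> carrier H" for g
  proof -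
    let ?e = "counit H g \<odot>\<^bsub>A\<^esub> \<one>\<^bsub>A\<^esub>"
    have e: "counit H g \<in> carrier K" "?e \<in> carrier A" using that by (simp_all add: H.counit_closed)
    have "act g (f \<one>\<^bsub>A\<^esub>) = f ?e" using h[OF that A.one_closed] act_one_right[OF that] by simp
    also have "\<dots> = f (?e \<otimes>\<^bsub>A\<^esub> \<one>\<^bsub>A\<^esub>)" using e by simp
    also have "\<dots> = ?e \<otimes>\<^bsub>A\<^esub> f \<one>\<^bsub>A\<^esub>" by (rule l[OF e(2) A.one_closed])
    also have "\<dots> = counit H g \<odot>\<^bsub>A\<^esub> f \<one>\<^bsub>A\<^esub>" using e cl[OF A.one_closed] by (simp add: A.smult_mult_left)
    finally show ?thesis .
  qed
  ultimately show "f \<one>\<^bsub>A\<^esub> \<in> carrier C" using cl by (simp add: C_carrier)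
qed

lemma regular_module_C_lmodule: "lmodule C (regular_module A)"
proof -
  have "abelian_group (regular_module A)"
    by (rule abelian_group_surj[OF A.abelian_group_axioms, where \<pi> = "\<lambda>x. x"]) simp_all
  then show ?thesis
    by (intro lmodule.intro C_ring lmodule_axioms.intro)
      (use C_A in \<open>simp_all add: A.l_distr A.r_distr A.m_assoc\<close>)
qed

section \<open>Semiprime algebras: reducedness and complements\<close>

context
  assumes sp: "H_semiprime H A act"
begin

text \<open>z A is a stable ideal, and centrality of z gives (z x) (z y) = z^2 x y = 0.\<close>

lemma C_square_zero:
  assumes z: "z \<in> carrier C" and zz: "z \<otimes>\<^bsub>A\<^esub> z = \<zero>\<^bsub>A\<^esub>"
  shows "z = \<zero>\<^bsub>A\<^esub>"
proof -
  interpret M: lmodule S Am by (rule Am_lmodule)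
  have sub: "submodule ((\<lambda>x. z \<otimes>\<^bsub>A\<^esub> x) ` carrier A) S Am"
    using image_submodule[OF Am_lmodule Am_lmodule C_mult_hom[OF z] M.carrier_submodule] by simp
  have "(\<lambda>x. z \<otimes>\<^bsub>A\<^esub> x) ` carrier A = {\<zero>\<^bsub>A\<^esub>}"
  proof (rule square_zero_submodule[OF sp sub])
    fix v w assume "v \<in> (\<lambda>x. z \<otimes>\<^bsub>A\<^esub> x) ` carrier A" "w \<in> (\<lambda>x. z \<otimes>\<^bsub>A\<^esub> x) ` carrier A"
    then obtain x y where xy: "x \<in> carrier A" "y \<in> carrier A" "v = z \<otimes>\<^bsub>A\<^esub> x" "w = z \<otimes>\<^bsub>A\<^esub> y" by auto
    have "v \<otimes>\<^bsub>A\<^esub> w = (z \<otimes>\<^bsub>A\<^esub> (x \<otimes>\<^bsub>A\<^esub> z)) \<otimes>\<^bsub>A\<^esub> y" using xy C_A[OF z] by (simp add: A.m_assoc)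
    also have "\<dots> = (z \<otimes>\<^bsub>A\<^esub> z) \<otimes>\<^bsub>A\<^esub> (x \<otimes>\<^bsub>A\<^esub> y)"
      using xy C_A[OF z] by (simp add: C_comm[OF z xy(1), symmetric] A.m_assoc)
    finally show "v \<otimes>\<^bsub>A\<^esub> w = \<zero>\<^bsub>A\<^esub>" using zz xy by simp
  qed
  then show ?thesis using imageI[OF A.one_closed, of "\<lambda>x. z \<otimes>\<^bsub>A\<^esub> x"] C_A[OF z] by simp
qed

lemma C_reduced: "reduced_ring C"
proof -
  interpret C: cring C by (rule C_cring)
  have "a = \<zero>\<^bsub>A\<^esub>" if a: "a \<in> carrier C" "a [^]\<^bsub>C\<^esub> n = \<zero>\<^bsub>A\<^esub>" for a and n :: nat
    using a(2)
  proof (induction n)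
    case 0
    \<comment> \<open>Exponent 0 means 1 = 0, so the ring is trivial.\<close>
    then have "\<one>\<^bsub>A\<^esub> = \<zero>\<^bsub>A\<^esub>" by simp
    then have "a \<otimes>\<^bsub>A\<^esub> \<one>\<^bsub>A\<^esub> = a \<otimes>\<^bsub>A\<^esub> \<zero>\<^bsub>A\<^esub>" by simp
    then show ?case using C_A[OF a(1)] by simp
  next
    case (Suc n)
    show ?case
    proof (cases n)
      case 0
      then show ?thesis using Suc.prems C_A[OF a(1)] by simp
    next
      case (Suc m)
      have p: "a [^]\<^bsub>C\<^esub> n \<in> carrier C" using a(1) by simp
      \<comment> \<open>For n = m + 1 one has 2 n = (n + 1) + m, so vanishing of the power n + 1
        makes the square of the power n vanish.\<close>
      have "n + n = Suc n + m" using Suc by simp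
      then have "a [^]\<^bsub>C\<^esub> n \<otimes>\<^bsub>C\<^esub> a [^]\<^bsub>C\<^esub> n = a [^]\<^bsub>C\<^esub> Suc n \<otimes>\<^bsub>C\<^esub> a [^]\<^bsub>C\<^esub> m"
        using C.nat_pow_mult[OF a(1)] by metis
      also have "\<dots> = \<zero>\<^bsub>A\<^esub>"
        using Suc.prems C.l_null[OF C.nat_pow_closed[OF a(1), of m]] by simp
      finally have "a [^]\<^bsub>C\<^esub> n = \<zero>\<^bsub>A\<^esub>" using C_square_zero[OF p] by simp
      then show ?thesis by (rule Suc.IH)
    qed
  qed
  then show ?thesis by (simp add: reduced_ring_def C_ring)
qed

text \<open>A product of two elements of z A \<inter> N has the form z x b with x b in N, hence is
  zero. So z A \<inter> N has zero square and vanishes, and essentiality of N gives z A = 0.\<close>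

lemma C_vanish_essential:
  assumes z: "z \<in> carrier C" and N: "essential_submodule S Am N"
    and v: "\<And>x. x \<in> N \<Longrightarrow> z \<otimes>\<^bsub>A\<^esub> x = \<zero>\<^bsub>A\<^esub>"
  shows "z = \<zero>\<^bsub>A\<^esub>"
proof -
  interpret M: lmodule S Am by (rule Am_lmodule)
  have N': "submodule N S Am" using N by (simp add: essential_submodule_def)
  interpret NI: ideal N A using N' by (simp add: submodule_iff_H_stable_ideal H_stable_ideal_def)
  let ?V = "(\<lambda>x. z \<otimes>\<^bsub>A\<^esub> x) ` carrier A"
  have V: "submodule ?V S Am"
    using image_submodule[OF Am_lmodule Am_lmodule C_mult_hom[OF z] M.carrier_submodule] by simp
  have "?V \<inter> N = {\<zero>\<^bsub>A\<^esub>}"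
  proof (rule square_zero_submodule[OF sp M.submodule_Int[OF V N']])
    fix a b assume "a \<in> ?V \<inter> N" "b \<in> ?V \<inter> N"
    then obtain x where x: "x \<in> carrier A" "a = z \<otimes>\<^bsub>A\<^esub> x" "b \<in> N" by auto
    then have "a \<otimes>\<^bsub>A\<^esub> b = z \<otimes>\<^bsub>A\<^esub> (x \<otimes>\<^bsub>A\<^esub> b)" using C_A[OF z] by (simp add: A.m_assoc)
    then show "a \<otimes>\<^bsub>A\<^esub> b = \<zero>\<^bsub>A\<^esub>" using v[OF NI.I_l_closed[OF x(3,1)]] by simp
  qed
  then have "?V = {\<zero>\<^bsub>A\<^esub>}" using N V by (simp add: essential_submodule_def)
  then show ?thesis using imageI[OF A.one_closed, of "\<lambda>x. z \<otimes>\<^bsub>A\<^esub> x"] C_A[OF z] by simp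
qed

text \<open>In a semiprime algebra an annihilator is a complement, so no maximality argument is needed.\<close>

lemma ex_complement:
  assumes N: "submodule N S Am"
  obtains W where "submodule W S Am" "N \<inter> W = {\<zero>\<^bsub>A\<^esub>}"
    "essential_submodule S Am {x \<oplus>\<^bsub>A\<^esub> y | x y. x \<in> N \<and> y \<in> W}"
proof
  interpret M: lmodule S Am by (rule Am_lmodule)
  interpret NI: ideal N A using N by (simp add: submodule_iff_H_stable_ideal H_stable_ideal_def)
  \<comment> \<open>Quantifying over p makes W a submodule: it is the largest one whose elements
    annihilate N from the left.\<close>
  define W where "W = {w \<in> carrier A. \<forall>p\<in>carrier S. \<forall>u\<in>N. (p \<odot>\<^bsub>Am\<^esub> w) \<otimes>\<^bsub>A\<^esub> u = \<zero>\<^bsub>A\<^esub>}"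
  have cl: "p \<odot>\<^bsub>Am\<^esub> x \<in> carrier A" if "p \<in> carrier S" "x \<in> carrier A" for p x
    using M.lsmult_closed[OF that(1), of x] that(2) by simp
  have NA: "u \<in> carrier A" if "u \<in> N" for u using NI.Icarr that .
  show W: "submodule W S Am"
    unfolding M.submodule_iff
  proof (intro conjI ballI)
    show "W \<subseteq> carrier Am" by (auto simp: W_def)
    show "\<zero>\<^bsub>Am\<^esub> \<in> W" using M.smult_zero_right NA by (simp add: W_def del: S_simps)
    show "x \<oplus>\<^bsub>Am\<^esub> y \<in> W" if "x \<in> W" "y \<in> W" for x y
      using that M.lsmult_r_distr[of _ x y] NA cl by (simp add: W_def A.l_distr del: S_simps)
    show "q \<odot>\<^bsub>Am\<^esub> x \<in> W" if "q \<in> carrier S" "x \<in> W" for q x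
      using that M.lsmult_assoc[of _ q x, symmetric] M.R.m_closed cl by (simp add: W_def del: S_simps)
  qed
  have WN: "w \<otimes>\<^bsub>A\<^esub> u = \<zero>\<^bsub>A\<^esub>" if "w \<in> W" "u \<in> N" for w u
  proof -
    have "(\<one>\<^bsub>S\<^esub> \<odot>\<^bsub>Am\<^esub> w) \<otimes>\<^bsub>A\<^esub> u = \<zero>\<^bsub>A\<^esub>" using that M.R.one_closed unfolding W_def by blast
    moreover have "\<one>\<^bsub>S\<^esub> \<odot>\<^bsub>Am\<^esub> w = w" using that by (intro M.lsmult_one) (simp add: W_def)
    ultimately show ?thesis by simp
  qed
  show "N \<inter> W = {\<zero>\<^bsub>A\<^esub>}"
    by (rule square_zero_submodule[OF sp M.submodule_Int[OF N W]]) (use WN in auto)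
  show "essential_submodule S Am {x \<oplus>\<^bsub>A\<^esub> y | x y. x \<in> N \<and> y \<in> W}"
  proof (rule essentialI)
    show "submodule {x \<oplus>\<^bsub>A\<^esub> y | x y. x \<in> N \<and> y \<in> W} S Am" using M.submodule_sum[OF N W] by simp
    fix L assume L: "submodule L S Am" "L \<inter> {x \<oplus>\<^bsub>A\<^esub> y | x y. x \<in> N \<and> y \<in> W} = {\<zero>\<^bsub>Am\<^esub>}"
    interpret LI: ideal L A using L(1) by (simp add: submodule_iff_H_stable_ideal H_stable_ideal_def)
    have zW: "\<zero>\<^bsub>A\<^esub> \<in> W" using M.submoduleD(2)[OF W] by simp
    have NW: "u \<in> {x \<oplus>\<^bsub>A\<^esub> y | x y. x \<in> N \<and> y \<in> W}" if "u \<in> N" for u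
      using that zW NA[OF that] by (intro CollectI exI[of _ u] exI[of _ "\<zero>\<^bsub>A\<^esub>"]) simp
    have WW: "w \<in> {x \<oplus>\<^bsub>A\<^esub> y | x y. x \<in> N \<and> y \<in> W}" if "w \<in> W" for w
      using that by (intro CollectI exI[of _ "\<zero>\<^bsub>A\<^esub>"] exI[of _ w]) (simp add: W_def)
    \<comment> \<open>If L meets N + W trivially, then products of elements of L with elements of N
      lie in L \<inter> N and vanish. Hence L lies in W, and thus in the sum.\<close>
    have LW: "l \<in> W" if l: "l \<in> L" for l
    proof -
      have "(p \<odot>\<^bsub>Am\<^esub> l) \<otimes>\<^bsub>A\<^esub> u = \<zero>\<^bsub>A\<^esub>" if p: "p \<in> carrier S" and u: "u \<in> N" for p u
      proof -
        have pl: "p \<odot>\<^bsub>Am\<^esub> l \<in> L" by (rule M.submoduleD(4)[OF L(1) p l])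
        then have "(p \<odot>\<^bsub>Am\<^esub> l) \<otimes>\<^bsub>A\<^esub> u \<in> L" using NA[OF u] by (intro LI.I_r_closed)
        moreover have "(p \<odot>\<^bsub>Am\<^esub> l) \<otimes>\<^bsub>A\<^esub> u \<in> N" using u LI.Icarr[OF pl] by (intro NI.I_l_closed)
        ultimately have "(p \<odot>\<^bsub>Am\<^esub> l) \<otimes>\<^bsub>A\<^esub> u \<in> L \<inter> {x \<oplus>\<^bsub>A\<^esub> y | x y. x \<in> N \<and> y \<in> W}" using NW by (intro IntI)
        then show ?thesis unfolding L(2) by simp
      qed
      then show ?thesis using LI.Icarr[OF l] by (simp add: W_def)
    qed
    show "L \<subseteq> {\<zero>\<^bsub>Am\<^esub>}"
    proof
      fix l assume "l \<in> L"
      then have "l \<in> L \<inter> {x \<oplus>\<^bsub>A\<^esub> y | x y. x \<in> N \<and> y \<in> W}" using WW[OF LW] by (intro IntI)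
      then show "l \<in> {\<zero>\<^bsub>Am\<^esub>}" unfolding L(2) .
    qed
  qed
qed

lemma C_vanish_sum:
  assumes z: "z \<in> carrier C" and N: "submodule N S Am" and W: "submodule W S Am"
    and ess: "essential_submodule S Am {x \<oplus>\<^bsub>A\<^esub> y | x y. x \<in> N \<and> y \<in> W}"
    and zN: "\<And>x. x \<in> N \<Longrightarrow> z \<otimes>\<^bsub>A\<^esub> x = \<zero>\<^bsub>A\<^esub>" and zW: "\<And>x. x \<in> W \<Longrightarrow> z \<otimes>\<^bsub>A\<^esub> x = \<zero>\<^bsub>A\<^esub>"
  shows "z = \<zero>\<^bsub>A\<^esub>"
proof (rule C_vanish_essential[OF z ess])
  interpret M: lmodule S Am by (rule Am_lmodule)
  fix x assume "x \<in> {x \<oplus>\<^bsub>A\<^esub> y | x y. x \<in> N \<and> y \<in> W}"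
  then obtain u w where uw: "u \<in> N" "w \<in> W" "x = u \<oplus>\<^bsub>A\<^esub> w" by blast
  moreover have "u \<in> carrier A" "w \<in> carrier A"
    using M.submoduleD(1)[OF N uw(1)] M.submoduleD(1)[OF W uw(2)] by simp_all
  ultimately show "z \<otimes>\<^bsub>A\<^esub> x = \<zero>\<^bsub>A\<^esub>" using C_A[OF z] zN zW by (simp add: A.r_distr)
qed

end

end

section \<open>Central invariants of a semiprime self-injective algebra\<close>

locale semiprime_self_injective = hmodule_algebra K H A act
  for K :: "('k, 'm) ring_scheme" and H :: "('k, 'h) hopf" and A :: "('k, 'a) module"
    and act :: "'h \<Rightarrow> 'a \<Rightarrow> 'a" +
  assumes semiprime: "H_semiprime H A act"
    and self_injective: "self_injective (smash_algebra K H A act) (smash_module K H A act)"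
begin

sublocale M: lmodule S Am by (rule Am_lmodule)

sublocale Cr: cring C by (rule C_cring)

text \<open>Self-injectivity in ring terms: by \<open>endo_C\<close> the extension is multiplication
  by a central invariant.\<close>

lemma hom_extend_C:
  assumes "submodule N S Am" "f \<in> mod_hom S (Am\<lparr>carrier := N\<rparr>) Am"
  obtains c where "c \<in> carrier C" "\<And>x. x \<in> N \<Longrightarrow> c \<otimes>\<^bsub>A\<^esub> x = f x"
proof -
  obtain g where g: "g \<in> mod_hom S Am Am" "\<And>x. x \<in> N \<Longrightarrow> g x = f x"
    using self_injective assms unfolding self_injective_def by blast
  show ?thesis
  proof
    show "g \<one>\<^bsub>A\<^esub> \<in> carrier C" by (rule endo_C(1)[OF g(1)])
    show "g \<one>\<^bsub>A\<^esub> \<otimes>\<^bsub>A\<^esub> x = f x" if "x \<in> N" for x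
      using endo_C(2)[OF g(1), of x] g(2)[OF that] M.submoduleD(1)[OF assms(1) that] by simp
  qed
qed

text \<open>The projection of N + W onto N along W is well defined because two decompositions differ
  by an element of N \<inter> W = 0. The element e is the central invariant whose multiplication
  extends it.\<close>

lemma projection:
  assumes N: "submodule N S Am" and W: "submodule W S Am" and NW: "N \<inter> W = {\<zero>\<^bsub>A\<^esub>}"
  obtains e where "e \<in> carrier C" "\<And>x. x \<in> N \<Longrightarrow> e \<otimes>\<^bsub>A\<^esub> x = x" "\<And>x. x \<in> W \<Longrightarrow> e \<otimes>\<^bsub>A\<^esub> x = \<zero>\<^bsub>A\<^esub>"
proof -
  let ?D = "{x \<oplus>\<^bsub>A\<^esub> y | x y. x \<in> N \<and> y \<in> W}"
  have D: "submodule ?D S Am" using M.submodule_sum[OF N W] by simp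
  have NA: "u \<in> carrier A" if "u \<in> N" for u using M.submoduleD(1)[OF N that] by simp
  have WA: "u \<in> carrier A" if "u \<in> W" for u using M.submoduleD(1)[OF W that] by simp
  define f where "f x = (THE u. u \<in> N \<and> (\<exists>w\<in>W. x = u \<oplus>\<^bsub>A\<^esub> w))" for x
  have f: "f (u \<oplus>\<^bsub>A\<^esub> w) = u" if uw: "u \<in> N" "w \<in> W" for u w
    unfolding f_def
  proof (rule the_equality)
    show "u \<in> N \<and> (\<exists>w'\<in>W. u \<oplus>\<^bsub>A\<^esub> w = u \<oplus>\<^bsub>A\<^esub> w')" using uw by blast
    fix u' assume "u' \<in> N \<and> (\<exists>w'\<in>W. u \<oplus>\<^bsub>A\<^esub> w = u' \<oplus>\<^bsub>A\<^esub> w')"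
    then obtain w' where w': "u' \<in> N" "w' \<in> W" "u \<oplus>\<^bsub>A\<^esub> w = u' \<oplus>\<^bsub>A\<^esub> w'" by blast
    have c: "u \<in> carrier A" "u' \<in> carrier A" "w \<in> carrier A" "w' \<in> carrier A" using uw w' NA WA by auto
    have "u \<ominus>\<^bsub>A\<^esub> u' = w' \<ominus>\<^bsub>A\<^esub> w"
    proof -
      have "u = u' \<oplus>\<^bsub>A\<^esub> w' \<ominus>\<^bsub>A\<^esub> w" using c w'(3) by (metis A.add.inv_solve_right' A.minus_eq A.a_closed)
      then have "u \<ominus>\<^bsub>A\<^esub> u' = (u' \<oplus>\<^bsub>A\<^esub> w' \<ominus>\<^bsub>A\<^esub> w) \<ominus>\<^bsub>A\<^esub> u'" by simp
      also have "\<dots> = w' \<ominus>\<^bsub>A\<^esub> w" using c by algebra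
      finally show ?thesis .
    qed
    moreover have "u \<ominus>\<^bsub>Am\<^esub> u' \<in> N" by (rule M.submodule_diff[OF N uw(1) w'(1)])
    moreover have "w' \<ominus>\<^bsub>Am\<^esub> w \<in> W" by (rule M.submodule_diff[OF W w'(2) uw(2)])
    moreover have minus: "x \<ominus>\<^bsub>Am\<^esub> y = x \<ominus>\<^bsub>A\<^esub> y" for x y by (simp add: a_minus_def a_inv_def m_inv_def)
    ultimately have "u \<ominus>\<^bsub>A\<^esub> u' \<in> N \<inter> W" by simp
    then have "u \<ominus>\<^bsub>Am\<^esub> u' = \<zero>\<^bsub>Am\<^esub>" unfolding NW minus by simp
    then show "u' = u" using c M.diff_eq_zero[of u u'] by simp
  qed
  have "f \<in> mod_hom S (Am\<lparr>carrier := ?D\<rparr>) Am"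
  proof (rule mod_homI)
    fix x assume "x \<in> carrier (Am\<lparr>carrier := ?D\<rparr>)"
    then obtain u w where uw: "u \<in> N" "w \<in> W" "x = u \<oplus>\<^bsub>A\<^esub> w" by auto
    show "f x \<in> carrier Am" using uw f NA by simp
    show "f (p \<odot>\<^bsub>Am\<lparr>carrier := ?D\<rparr>\<^esub> x) = p \<odot>\<^bsub>Am\<^esub> f x" if "p \<in> carrier S" for p
    proof -
      have "p \<odot>\<^bsub>Am\<^esub> (u \<oplus>\<^bsub>A\<^esub> w) = p \<odot>\<^bsub>Am\<^esub> u \<oplus>\<^bsub>A\<^esub> p \<odot>\<^bsub>Am\<^esub> w"
        using M.lsmult_r_distr[OF that, of u w] NA[OF uw(1)] WA[OF uw(2)] by simp
      then show ?thesis
        using f[OF M.submoduleD(4)[OF N that uw(1)] M.submoduleD(4)[OF W that uw(2)]] f uw by simp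
    qed
    fix y assume "y \<in> carrier (Am\<lparr>carrier := ?D\<rparr>)"
    then obtain u' w' where uw': "u' \<in> N" "w' \<in> W" "y = u' \<oplus>\<^bsub>A\<^esub> w'" by auto
    have "x \<oplus>\<^bsub>A\<^esub> y = (u \<oplus>\<^bsub>A\<^esub> u') \<oplus>\<^bsub>A\<^esub> (w \<oplus>\<^bsub>A\<^esub> w')"
      using uw uw' NA WA by (simp add: A.a_ac)
    then show "f (x \<oplus>\<^bsub>Am\<lparr>carrier := ?D\<rparr>\<^esub> y) = f x \<oplus>\<^bsub>Am\<^esub> f y"
      using f[of "u \<oplus>\<^bsub>A\<^esub> u'" "w \<oplus>\<^bsub>A\<^esub> w'"] f uw uw' M.submoduleD(3)[OF N uw(1) uw'(1)]
        M.submoduleD(3)[OF W uw(2) uw'(2)] by simp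
  qed
  then obtain e where e: "e \<in> carrier C" "\<And>x. x \<in> ?D \<Longrightarrow> e \<otimes>\<^bsub>A\<^esub> x = f x"
    using hom_extend_C[OF D] by blast
  have z: "\<zero>\<^bsub>A\<^esub> \<in> N" "\<zero>\<^bsub>A\<^esub> \<in> W" using M.submoduleD(2)[OF N] M.submoduleD(2)[OF W] by simp_all
  show ?thesis
  proof
    show "e \<in> carrier C" by fact
    show "e \<otimes>\<^bsub>A\<^esub> x = x" if "x \<in> N" for x
    proof -
      have "x \<oplus>\<^bsub>A\<^esub> \<zero>\<^bsub>A\<^esub> \<in> ?D" using that z by blast
      then show ?thesis using e(2) f[OF that z(2)] NA[OF that] by simp
    qed
    show "e \<otimes>\<^bsub>A\<^esub> x = \<zero>\<^bsub>A\<^esub>" if "x \<in> W" for x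
    proof -
      have "\<zero>\<^bsub>A\<^esub> \<oplus>\<^bsub>A\<^esub> x \<in> ?D" using that z by blast
      then show ?thesis using e(2) f[OF z(1) that] WA[OF that] by simp
    qed
  qed
qed

text \<open>Let N be the annihilator of z and W a complement. Multiplication by z is injective on W,
  so its inverse from z W to W extends to multiplication by some y in C, and y z w = w on W. Then z
  y z - z kills both N and W.\<close>

theorem C_von_neumann_regular: "von_neumann_regular C"
  unfolding von_neumann_regular_def
proof (intro conjI ballI C_ring)
  fix z assume z: "z \<in> carrier C"
  have zA: "z \<in> carrier A" using C_A[OF z] .
  note hom = C_mult_hom[OF z]
  define N where "N = {x \<in> carrier A. z \<otimes>\<^bsub>A\<^esub> x = \<zero>\<^bsub>A\<^esub>}"
  have N: "submodule N S Am"
    using vimage_submodule[OF Am_lmodule Am_lmodule hom M.zero_submodule] by (simp add: N_def)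
  obtain W where W: "submodule W S Am" "N \<inter> W = {\<zero>\<^bsub>A\<^esub>}"
    "essential_submodule S Am {x \<oplus>\<^bsub>A\<^esub> y | x y. x \<in> N \<and> y \<in> W}"
    using ex_complement[OF semiprime N] .
  have WA: "u \<in> carrier A" if "u \<in> W" for u using M.submoduleD(1)[OF W(1) that] by simp
  define V where "V = (\<lambda>x. z \<otimes>\<^bsub>A\<^esub> x) ` W"
  have V: "submodule V S Am" unfolding V_def by (rule image_submodule[OF Am_lmodule Am_lmodule hom W(1)])
  define f where "f y = (THE w. w \<in> W \<and> z \<otimes>\<^bsub>A\<^esub> w = y)" for y
  have f: "f (z \<otimes>\<^bsub>A\<^esub> w) = w" if w: "w \<in> W" for w
    unfolding f_def
  proof (rule the_equality)
    show "w \<in> W \<and> z \<otimes>\<^bsub>A\<^esub> w = z \<otimes>\<^bsub>A\<^esub> w" using w by simp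
    fix w' assume w': "w' \<in> W \<and> z \<otimes>\<^bsub>A\<^esub> w' = z \<otimes>\<^bsub>A\<^esub> w"
    have "w' \<ominus>\<^bsub>Am\<^esub> w \<in> W" using M.submodule_diff[OF W(1)] w' w by blast
    moreover have "z \<otimes>\<^bsub>A\<^esub> (w' \<ominus>\<^bsub>Am\<^esub> w) = \<zero>\<^bsub>A\<^esub>"
      using mod_hom_minus[OF Am_lmodule Am_lmodule hom, of w' w] w' WA w M.diff_self[of "z \<otimes>\<^bsub>A\<^esub> w"] zA by simp
    ultimately have "w' \<ominus>\<^bsub>Am\<^esub> w \<in> N \<inter> W" using WA by (simp add: N_def)
    then have "w' \<ominus>\<^bsub>Am\<^esub> w = \<zero>\<^bsub>Am\<^esub>" unfolding W(2) by simp
    then show "w' = w" using M.diff_eq_zero[of w' w] WA w w' by simp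
  qed
  have "f \<in> mod_hom S (Am\<lparr>carrier := V\<rparr>) Am"
  proof (rule mod_homI)
    fix x assume "x \<in> carrier (Am\<lparr>carrier := V\<rparr>)"
    then obtain w where w: "w \<in> W" "x = z \<otimes>\<^bsub>A\<^esub> w" by (auto simp: V_def)
    show "f x \<in> carrier Am" using w f WA by simp
    show "f (p \<odot>\<^bsub>Am\<lparr>carrier := V\<rparr>\<^esub> x) = p \<odot>\<^bsub>Am\<^esub> f x" if "p \<in> carrier S" for p
      using mod_hom_smult[OF hom that, of w] f[OF M.submoduleD(4)[OF W(1) that w(1)]] f w WA by simp
    fix y assume "y \<in> carrier (Am\<lparr>carrier := V\<rparr>)"
    then obtain w' where w': "w' \<in> W" "y = z \<otimes>\<^bsub>A\<^esub> w'" by (auto simp: V_def)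
    show "f (x \<oplus>\<^bsub>Am\<lparr>carrier := V\<rparr>\<^esub> y) = f x \<oplus>\<^bsub>Am\<^esub> f y"
      using mod_hom_add[OF hom, of w w'] f[OF M.submoduleD(3)[OF W(1) w(1) w'(1)]] f w w' WA by simp
  qed
  then obtain y where y: "y \<in> carrier C" "\<And>x. x \<in> V \<Longrightarrow> y \<otimes>\<^bsub>A\<^esub> x = f x"
    using hom_extend_C[OF V] by blast
  have yA: "y \<in> carrier A" using C_A[OF y(1)] .
  have yz: "y \<otimes>\<^bsub>A\<^esub> (z \<otimes>\<^bsub>A\<^esub> w) = w" if "w \<in> W" for w
    using y(2)[of "z \<otimes>\<^bsub>A\<^esub> w"] f[OF that] that by (simp add: V_def)
  \<comment> \<open>The difference is formed in \<open>C\<close>, since the vanishing lemma concerns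
    central invariants; \<open>dz\<close> characterises it by addition, which avoids comparing the
    negations of \<open>C\<close> and A.\<close>
  let ?d = "z \<otimes>\<^bsub>A\<^esub> y \<otimes>\<^bsub>A\<^esub> z \<ominus>\<^bsub>C\<^esub> z"
  have dC: "?d \<in> carrier C" using Cr.minus_closed[of "z \<otimes>\<^bsub>A\<^esub> y \<otimes>\<^bsub>A\<^esub> z" z] z y(1) by (simp add: C_mult_closed)
  have dz: "?d \<oplus>\<^bsub>A\<^esub> z = z \<otimes>\<^bsub>A\<^esub> y \<otimes>\<^bsub>A\<^esub> z"
    using Cr.a_assoc[of "z \<otimes>\<^bsub>A\<^esub> y \<otimes>\<^bsub>A\<^esub> z" "\<ominus>\<^bsub>C\<^esub> z" z] Cr.l_neg[OF z] z y(1) yA zA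
    by (simp add: a_minus_def C_mult_closed)
  have dx: "?d \<otimes>\<^bsub>A\<^esub> x = \<zero>\<^bsub>A\<^esub>" if "x \<in> carrier A" "z \<otimes>\<^bsub>A\<^esub> y \<otimes>\<^bsub>A\<^esub> z \<otimes>\<^bsub>A\<^esub> x = z \<otimes>\<^bsub>A\<^esub> x" for x
  proof -
    from dz have "?d \<otimes>\<^bsub>A\<^esub> x \<oplus>\<^bsub>A\<^esub> z \<otimes>\<^bsub>A\<^esub> x = z \<otimes>\<^bsub>A\<^esub> x"
      using A.l_distr[OF C_A[OF dC] zA that(1)] that(2) by simp
    then show ?thesis using C_A[OF dC] zA that(1) A.add.r_cancel_one[of "z \<otimes>\<^bsub>A\<^esub> x" "?d \<otimes>\<^bsub>A\<^esub> x"]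
        A.add.l_cancel_one by simp
  qed
  have "?d = \<zero>\<^bsub>A\<^esub>"
  proof (rule C_vanish_sum[OF semiprime dC N W(1,3)])
    show "?d \<otimes>\<^bsub>A\<^esub> x = \<zero>\<^bsub>A\<^esub>" if "x \<in> N" for x
      using that zA yA by (intro dx) (simp_all add: N_def A.m_assoc)
    show "?d \<otimes>\<^bsub>A\<^esub> x = \<zero>\<^bsub>A\<^esub>" if "x \<in> W" for x
      using yz[OF that] WA[OF that] zA yA by (intro dx) (simp_all add: A.m_assoc)
  qed
  then have "z \<otimes>\<^bsub>A\<^esub> y \<otimes>\<^bsub>A\<^esub> z = z"
    using dz zA by simp
  then show "\<exists>x\<in>carrier C. z \<otimes>\<^bsub>C\<^esub> x \<otimes>\<^bsub>C\<^esub> z = z" using y(1) by auto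
qed

text \<open>Suppose x has an essential annihilator, and let e be the projection onto S x along a
  complement W. An element of C e that kills x kills both S x and W, so it is zero. Hence C e meets
  the annihilator trivially, e = 0 and x = e x = 0.\<close>

theorem C_nonsingular: "nonsingular_module C (regular_module A)"
proof (rule nonsingular_moduleI[OF regular_module_C_lmodule]; (unfold regular_module_simps central_invariants_simps)?)
  interpret Q: lmodule C "regular_module C" by (rule Cr.regular_lmodule)
  fix x assume x: "x \<in> carrier A" "essential_submodule C (regular_module C) {r \<in> carrier C. r \<otimes>\<^bsub>A\<^esub> x = \<zero>\<^bsub>A\<^esub>}"
  define N where "N = (\<lambda>p. p \<odot>\<^bsub>Am\<^esub> x) ` carrier S"
  have N: "submodule N S Am" "x \<in> N" unfolding N_def using M.cyclic_submodule[of x] x(1) by simp_all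
  obtain W where W: "submodule W S Am" "N \<inter> W = {\<zero>\<^bsub>A\<^esub>}"
    "essential_submodule S Am {x \<oplus>\<^bsub>A\<^esub> y | x y. x \<in> N \<and> y \<in> W}"
    using ex_complement[OF semiprime N(1)] .
  obtain e where e: "e \<in> carrier C" "\<And>y. y \<in> N \<Longrightarrow> e \<otimes>\<^bsub>A\<^esub> y = y" "\<And>y. y \<in> W \<Longrightarrow> e \<otimes>\<^bsub>A\<^esub> y = \<zero>\<^bsub>A\<^esub>"
    using projection[OF N(1) W(1,2)] by blast
  have WA: "u \<in> carrier A" if "u \<in> W" for u using M.submoduleD(1)[OF W(1) that] by simp
  define I where "I = (\<lambda>c. c \<otimes>\<^bsub>A\<^esub> e) ` carrier C"
  have I: "submodule I C (regular_module C)" "e \<in> I" unfolding I_def using Q.cyclic_submodule[of e] e(1) by simp_all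
  have "I \<inter> {r \<in> carrier C. r \<otimes>\<^bsub>A\<^esub> x = \<zero>\<^bsub>A\<^esub>} \<subseteq> {\<zero>\<^bsub>A\<^esub>}"
  proof
    fix r assume r: "r \<in> I \<inter> {r \<in> carrier C. r \<otimes>\<^bsub>A\<^esub> x = \<zero>\<^bsub>A\<^esub>}"
    then obtain c where c: "c \<in> carrier C" "r = c \<otimes>\<^bsub>A\<^esub> e" by (auto simp: I_def)
    have rC: "r \<in> carrier C" "r \<otimes>\<^bsub>A\<^esub> x = \<zero>\<^bsub>A\<^esub>" using r by auto
    have "r = \<zero>\<^bsub>A\<^esub>"
    proof (rule C_vanish_sum[OF semiprime rC(1) N(1) W(1,3)])
      fix y assume "y \<in> N"
      then obtain p where p: "p \<in> carrier S" "y = p \<odot>\<^bsub>Am\<^esub> x" by (auto simp: N_def)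
      then show "r \<otimes>\<^bsub>A\<^esub> y = \<zero>\<^bsub>A\<^esub>"
        using mod_hom_smult[OF C_mult_hom[OF rC(1)] p(1), of x] x(1) rC(2) M.smult_zero_right[OF p(1)] by simp
    next
      fix y assume y: "y \<in> W"
      then show "r \<otimes>\<^bsub>A\<^esub> y = \<zero>\<^bsub>A\<^esub>"
        using c C_A[OF c(1)] C_A[OF e(1)] WA[OF y] e(3) by (simp add: A.m_assoc)
    qed
    then show "r \<in> {\<zero>\<^bsub>A\<^esub>}" by simp
  qed
  moreover have "\<zero>\<^bsub>A\<^esub> \<in> I \<inter> {r \<in> carrier C. r \<otimes>\<^bsub>A\<^esub> x = \<zero>\<^bsub>A\<^esub>}"
    using Q.submoduleD(2)[OF I(1)] x(1) C_zero by simp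
  ultimately have "I \<inter> {r \<in> carrier C. r \<otimes>\<^bsub>A\<^esub> x = \<zero>\<^bsub>A\<^esub>} = {\<zero>\<^bsub>A\<^esub>}" by (intro equalityI) simp_all
  then have "I = {\<zero>\<^bsub>A\<^esub>}" using x(2) I(1) by (simp add: essential_submodule_def)
  then have "e = \<zero>\<^bsub>A\<^esub>" using I(2) by simp
  then show "x = \<zero>\<^bsub>A\<^esub>" using e(2)[OF N(2)] x(1) by simp
qed

text \<open>From the ideal I of C the homomorphism is carried to a submodule of A by x \<mapsto>
  f(e) x, where e in I fixes x. Extending this map over A yields an element c whose multiplication
  restricts to f on I.\<close>

theorem C_self_injective: "self_injective C (regular_module C)"
  unfolding self_injective_def
proof (intro conjI allI impI Cr.regular_lmodule)
  interpret Q: lmodule C "regular_module C" by (rule Cr.regular_lmodule)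
  fix I f assume I: "submodule I C (regular_module C)"
    and f: "f \<in> mod_hom C ((regular_module C)\<lparr>carrier := I\<rparr>) (regular_module C)"
  have IC: "i \<in> carrier C" if "i \<in> I" for i using Q.submoduleD(1)[OF I that] by simp
  have IA: "i \<in> carrier A" if "i \<in> I" for i using C_A[OF IC[OF that]] .
  have fC: "f i \<in> carrier C" if "i \<in> I" for i using mod_hom_closed[OF f, of i] that by simp
  have fA: "f i \<in> carrier A" if "i \<in> I" for i using C_A[OF fC[OF that]] .
  have Im: "c \<otimes>\<^bsub>A\<^esub> i \<in> I" if "c \<in> carrier C" "i \<in> I" for c i using Q.submoduleD(4)[OF I that] by simp
  have Ia: "i \<oplus>\<^bsub>A\<^esub> j \<in> I" if "i \<in> I" "j \<in> I" for i j using Q.submoduleD(3)[OF I that] by simp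
  have fm: "f (c \<otimes>\<^bsub>A\<^esub> i) = c \<otimes>\<^bsub>A\<^esub> f i" if "c \<in> carrier C" "i \<in> I" for c i
    using mod_hom_smult[OF f that(1), of i] that(2) by simp
  text \<open>By regularity \<open>IA\<close> consists of the elements fixed by some \<open>e \<in> I\<close>.\<close>
  define N where "N = {x \<in> carrier A. \<exists>e\<in>I. e \<otimes>\<^bsub>A\<^esub> x = x}"
  define g where "g x = f (SOME e. e \<in> I \<and> e \<otimes>\<^bsub>A\<^esub> x = x) \<otimes>\<^bsub>A\<^esub> x" for x
  \<comment> \<open>Both sides equal f(d e) x: f is linear over the commutative ring C, and d and e
    fix x.\<close>
  have indep: "f d \<otimes>\<^bsub>A\<^esub> x = f e \<otimes>\<^bsub>A\<^esub> x"
    if "d \<in> I" "e \<in> I" "d \<otimes>\<^bsub>A\<^esub> x = x" "e \<otimes>\<^bsub>A\<^esub> x = x" "x \<in> carrier A" for d e x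
  proof -
    have "f d \<otimes>\<^bsub>A\<^esub> x = (f d \<otimes>\<^bsub>A\<^esub> e) \<otimes>\<^bsub>A\<^esub> x" using that fA IA by (simp add: A.m_assoc)
    also have "f d \<otimes>\<^bsub>A\<^esub> e = e \<otimes>\<^bsub>A\<^esub> f d" using C_comm[OF fC IA] that by simp
    also have "\<dots> = f (e \<otimes>\<^bsub>A\<^esub> d)" using fm[OF IC] that by simp
    also have "e \<otimes>\<^bsub>A\<^esub> d = d \<otimes>\<^bsub>A\<^esub> e" using C_comm[OF IC IA] that by simp
    also have "f (d \<otimes>\<^bsub>A\<^esub> e) = d \<otimes>\<^bsub>A\<^esub> f e" using fm[OF IC] that by simp
    also have "\<dots> = f e \<otimes>\<^bsub>A\<^esub> d" using C_comm[OF IC fA] that by simp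
    also have "\<dots> \<otimes>\<^bsub>A\<^esub> x = f e \<otimes>\<^bsub>A\<^esub> x" using that fA IA by (simp add: A.m_assoc)
    finally show ?thesis .
  qed
  have g: "g x = f e \<otimes>\<^bsub>A\<^esub> x" if "e \<in> I" "e \<otimes>\<^bsub>A\<^esub> x = x" "x \<in> carrier A" for e x
  proof -
    have "(SOME e. e \<in> I \<and> e \<otimes>\<^bsub>A\<^esub> x = x) \<in> I \<and> (SOME e. e \<in> I \<and> e \<otimes>\<^bsub>A\<^esub> x = x) \<otimes>\<^bsub>A\<^esub> x = x"
      using that(1,2) by (rule someI2[where Q = "\<lambda>e. e \<in> I \<and> e \<otimes>\<^bsub>A\<^esub> x = x", OF conjI])
    then show ?thesis unfolding g_def using indep that by blast
  qed
  have common: "\<exists>e\<in>I. e \<otimes>\<^bsub>A\<^esub> x = x \<and> e \<otimes>\<^bsub>A\<^esub> y = y" if xy: "x \<in> N" "y \<in> N" for x y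
  proof -
    obtain d where d: "x \<in> carrier A" "d \<in> I" "d \<otimes>\<^bsub>A\<^esub> x = x" using xy(1) by (auto simp: N_def)
    obtain e where e: "y \<in> carrier A" "e \<in> I" "e \<otimes>\<^bsub>A\<^esub> y = y" using xy(2) by (auto simp: N_def)
    \<comment> \<open>Since 1 - u = (1 - d) (1 - e), the element u fixes whatever d or e
      fixes.\<close>
    let ?u = "d \<oplus>\<^bsub>A\<^esub> (e \<ominus>\<^bsub>A\<^esub> d \<otimes>\<^bsub>A\<^esub> e)"
    have c: "d \<in> carrier A" "e \<in> carrier A" using IA d e by auto
    have de: "d \<otimes>\<^bsub>A\<^esub> e = e \<otimes>\<^bsub>A\<^esub> d" using C_comm[OF IC IA] d e by simp
    have m: "(d \<otimes>\<^bsub>A\<^esub> e) \<otimes>\<^bsub>A\<^esub> x = e \<otimes>\<^bsub>A\<^esub> x" "(d \<otimes>\<^bsub>A\<^esub> e) \<otimes>\<^bsub>A\<^esub> y = d \<otimes>\<^bsub>A\<^esub> y"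
      unfolding de using c d e by (simp_all add: A.m_assoc) (simp flip: A.m_assoc add: de[symmetric], simp add: A.m_assoc)
    have "e \<ominus>\<^bsub>regular_module C\<^esub> d \<otimes>\<^bsub>A\<^esub> e \<in> I" using d e by (intro Q.submodule_diff[OF I] Im IC)
    \<comment> \<open>Negation in the record of C refers to the smaller carrier; by uniqueness of
      negatives it agrees with negation in A.\<close>
    moreover have "e \<ominus>\<^bsub>regular_module C\<^esub> d \<otimes>\<^bsub>A\<^esub> e = e \<ominus>\<^bsub>A\<^esub> d \<otimes>\<^bsub>A\<^esub> e"
    proof -
      have dd: "d \<otimes>\<^bsub>A\<^esub> e \<in> carrier C" using C_mult_closed IC d e by blast
      have "\<ominus>\<^bsub>regular_module C\<^esub> (d \<otimes>\<^bsub>A\<^esub> e) = \<ominus>\<^bsub>A\<^esub> (d \<otimes>\<^bsub>A\<^esub> e)"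
        using A.minus_equality[of "\<ominus>\<^bsub>regular_module C\<^esub> (d \<otimes>\<^bsub>A\<^esub> e)" "d \<otimes>\<^bsub>A\<^esub> e"] Q.M.l_neg[of "d \<otimes>\<^bsub>A\<^esub> e"]
          Q.M.a_inv_closed[of "d \<otimes>\<^bsub>A\<^esub> e"] dd C_A by simp
      then show ?thesis by (simp add: a_minus_def)
    qed
    ultimately have u: "?u \<in> I" using d by (intro Ia) simp_all
    have "?u \<otimes>\<^bsub>A\<^esub> x = x"
      using c d e m by (simp add: a_minus_def A.l_distr A.l_minus A.r_neg)
    moreover have "?u \<otimes>\<^bsub>A\<^esub> y = y"
      using c d e m by (simp add: a_minus_def A.l_distr A.l_minus A.r_neg A.r_neg2 A.a_ac)
    ultimately show ?thesis using u by blast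
  qed
  have N: "submodule N S Am"
    unfolding M.submodule_iff
  proof (intro conjI ballI)
    show "N \<subseteq> carrier Am" by (auto simp: N_def)
    have "\<zero>\<^bsub>A\<^esub> \<in> I" using Q.submoduleD(2)[OF I] by simp
    then show "\<zero>\<^bsub>Am\<^esub> \<in> N" using IA by (auto simp: N_def intro!: bexI[of _ "\<zero>\<^bsub>A\<^esub>"])
    show "x \<oplus>\<^bsub>Am\<^esub> y \<in> N" if xy: "x \<in> N" "y \<in> N" for x y
    proof -
      obtain e where e: "e \<in> I" "e \<otimes>\<^bsub>A\<^esub> x = x" "e \<otimes>\<^bsub>A\<^esub> y = y" using common[OF xy] by blast
      then have "e \<otimes>\<^bsub>A\<^esub> (x \<oplus>\<^bsub>A\<^esub> y) = x \<oplus>\<^bsub>A\<^esub> y" using xy IA by (simp add: N_def A.r_distr)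
      then show ?thesis using xy e(1) by (auto simp: N_def)
    qed
    show "p \<odot>\<^bsub>Am\<^esub> x \<in> N" if p: "p \<in> carrier S" "x \<in> N" for p x
    proof -
      obtain e where e: "x \<in> carrier A" "e \<in> I" "e \<otimes>\<^bsub>A\<^esub> x = x" using p(2) by (auto simp: N_def)
      have "e \<otimes>\<^bsub>A\<^esub> (p \<odot>\<^bsub>Am\<^esub> x) = p \<odot>\<^bsub>Am\<^esub> x"
        using mod_hom_smult[OF C_mult_hom[OF IC[OF e(2)]] p(1), of x] e by simp
      then show ?thesis using M.lsmult_closed[OF p(1), of x] e by (auto simp: N_def)
    qed
  qed
  have "g \<in> mod_hom S (Am\<lparr>carrier := N\<rparr>) Am"
  proof (rule mod_homI)
    fix x assume "x \<in> carrier (Am\<lparr>carrier := N\<rparr>)"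
    then have xN: "x \<in> N" by simp
    then obtain e where e: "x \<in> carrier A" "e \<in> I" "e \<otimes>\<^bsub>A\<^esub> x = x" by (auto simp: N_def)
    show "g x \<in> carrier Am" using g[OF e(2,3,1)] fA[OF e(2)] e(1) by simp
    show "g (p \<odot>\<^bsub>Am\<lparr>carrier := N\<rparr>\<^esub> x) = p \<odot>\<^bsub>Am\<^esub> g x" if p: "p \<in> carrier S" for p
    proof -
      have px: "e \<otimes>\<^bsub>A\<^esub> (p \<odot>\<^bsub>Am\<^esub> x) = p \<odot>\<^bsub>Am\<^esub> x"
        using mod_hom_smult[OF C_mult_hom[OF IC[OF e(2)]] p(1), of x] e by simp
      have "p \<odot>\<^bsub>Am\<^esub> x \<in> carrier A" using M.lsmult_closed[OF p(1), of x] e by simp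
      then show ?thesis using g[OF e(2) px] g[OF e(2,3,1)] mod_hom_smult[OF C_mult_hom[OF fC[OF e(2)]] p, of x] e(1)
        by simp
    qed
    fix y assume "y \<in> carrier (Am\<lparr>carrier := N\<rparr>)"
    then have yN: "y \<in> N" by simp
    then have yA: "y \<in> carrier A" by (simp add: N_def)
    obtain d where d: "d \<in> I" "d \<otimes>\<^bsub>A\<^esub> x = x" "d \<otimes>\<^bsub>A\<^esub> y = y" using common[OF xN yN] by blast
    have "d \<otimes>\<^bsub>A\<^esub> (x \<oplus>\<^bsub>A\<^esub> y) = x \<oplus>\<^bsub>A\<^esub> y" using d e(1) yA IA by (simp add: A.r_distr)
    then show "g (x \<oplus>\<^bsub>Am\<lparr>carrier := N\<rparr>\<^esub> y) = g x \<oplus>\<^bsub>Am\<^esub> g y"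
      using g[OF d(1), of "x \<oplus>\<^bsub>A\<^esub> y"] g[OF d(1,2) e(1)] g[OF d(1,3) yA] e(1) yA fA[OF d(1)]
      by (simp add: A.r_distr)
  qed
  then obtain c where c: "c \<in> carrier C" "\<And>x. x \<in> N \<Longrightarrow> c \<otimes>\<^bsub>A\<^esub> x = g x"
    using hom_extend_C[OF N] by blast
  have cA: "c \<in> carrier A" using C_A[OF c(1)] .
  show "\<exists>g\<in>mod_hom C (regular_module C) (regular_module C). \<forall>x\<in>I. g x = f x"
  proof (intro bexI[of _ "\<lambda>x. c \<otimes>\<^bsub>A\<^esub> x"] ballI)
    fix i assume i: "i \<in> I"
    \<comment> \<open>Regularity turns i into an element fixed by I: e = y i lies in I and e i = i.
      So i belongs to N and c i = f(e) i = f(i e) = f(i).\<close>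
    obtain y where y: "y \<in> carrier C" "i \<otimes>\<^bsub>A\<^esub> y \<otimes>\<^bsub>A\<^esub> i = i"
      using C_von_neumann_regular IC[OF i] by (auto simp: von_neumann_regular_def)
    let ?e = "y \<otimes>\<^bsub>A\<^esub> i"
    have e: "?e \<in> I" "?e \<otimes>\<^bsub>A\<^esub> i = i"
      using Im[OF y(1) i] y(2) C_comm[OF y(1) IA[OF i]] by simp_all
    then have "i \<in> N" using IA[OF i] by (auto simp: N_def)
    then have "c \<otimes>\<^bsub>A\<^esub> i = f ?e \<otimes>\<^bsub>A\<^esub> i" using c(2) g[OF e IA[OF i]] by simp
    also have "\<dots> = i \<otimes>\<^bsub>A\<^esub> f ?e" using C_comm[OF fC[OF e(1)] IA[OF i]] .
    also have "\<dots> = f (i \<otimes>\<^bsub>A\<^esub> ?e)" using fm[OF IC[OF i] e(1)] by simp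
    also have "i \<otimes>\<^bsub>A\<^esub> ?e = i" using C_comm[OF IC[OF i] IA[OF e(1)]] e(2) by simp
    finally show "c \<otimes>\<^bsub>A\<^esub> i = f i" .
  next
    show "(\<lambda>x. c \<otimes>\<^bsub>A\<^esub> x) \<in> mod_hom C (regular_module C) (regular_module C)"
    proof (rule mod_homI)
      show "c \<otimes>\<^bsub>A\<^esub> x \<in> carrier (regular_module C)" if "x \<in> carrier (regular_module C)" for x
        using that C_mult_closed[OF c(1)] by simp
      show "c \<otimes>\<^bsub>A\<^esub> (x \<oplus>\<^bsub>regular_module C\<^esub> y) = c \<otimes>\<^bsub>A\<^esub> x \<oplus>\<^bsub>regular_module C\<^esub> c \<otimes>\<^bsub>A\<^esub> y"
        if "x \<in> carrier (regular_module C)" "y \<in> carrier (regular_module C)" for x y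
        using that C_A cA by (simp add: A.r_distr)
      show "c \<otimes>\<^bsub>A\<^esub> (r \<odot>\<^bsub>regular_module C\<^esub> x) = r \<odot>\<^bsub>regular_module C\<^esub> (c \<otimes>\<^bsub>A\<^esub> x)"
        if "r \<in> carrier C" "x \<in> carrier (regular_module C)" for r x
        using that C_A cA C_comm[OF c(1), of r] by (simp flip: A.m_assoc)
    qed
  qed
qed

end

section \<open>The hull as a semiprime self-injective algebra\<close>

context semiprime_hull
begin

lemma Ahat_hmodule_algebra: "hmodule_algebra K H Ahat hact"
  by (intro hmodule_algebra.intro Ahat_module_algebra)

lemma lm_eq: "\<lbrakk>a \<in> carrier A; x \<in> X\<rbrakk> \<Longrightarrow> lm a x = \<iota> a \<star> x"
  using hmult_hom_left[OF \<T>_ident] by simp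

lemma rm_eq: "\<lbrakk>a \<in> carrier A; x \<in> X\<rbrakk> \<Longrightarrow> rm a x = x \<star> \<iota> a"
  using hmult_hom_right[OF _ \<T>_ident] by simp

text \<open>The given action of S is expressed by the constructed product and action of H. Through
  this formula stable ideals of the hull become S-submodules of E, and linearity over the two smash
  algebras can be compared.\<close>

lemma pure_smult_X:
  assumes "a \<in> carrier A" "b \<in> carrier A" "h \<in> carrier H" "x \<in> X"
  shows "pure a b h \<odot>\<^bsub>E\<^esub> x = \<iota> a \<star> hact h x \<star> \<iota> b"
proof -
  have "pure a b h \<odot>\<^bsub>E\<^esub> x = lm a (rm b (hact h x))"
    using assms X_E S_mult_closed unfolding pure_factor[OF assms(1-3)]
    by (simp add: lm_def rm_def hact_eq E.lsmult_assoc pure_closed)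
  then show ?thesis using assms by (simp add: lm_eq rm_eq hmult_closed hact_closed hmult_assoc \<iota>_X)
qed

lemma stable_ideal_submodule:
  assumes "H_stable_ideal H Ahat hact I" shows "submodule I S E"
proof -
  interpret I: ideal I Ahat using assms by (simp add: H_stable_ideal_def)
  have st: "\<And>h x. \<lbrakk>h \<in> carrier H; x \<in> I\<rbrakk> \<Longrightarrow> hact h x \<in> I" using assms by (simp add: H_stable_ideal_def)
  have IX: "x \<in> X" if "x \<in> I" for x using I.Icarr[OF that] by simp
  have Ia: "x \<oplus>\<^bsub>E\<^esub> y \<in> I" if "x \<in> I" "y \<in> I" for x y
    using additive_subgroup.a_closed[OF I.is_additive_subgroup that] by simp
  have "p \<odot>\<^bsub>E\<^esub> x \<in> I" if "p \<in> carrier S" "x \<in> I" for p x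
    using that(1)
  proof (induction rule: S_induct)
    case (pure a b h)
    then show ?case
      using I.I_r_closed[OF I.I_l_closed[OF st[OF pure(3) that(2)], of "\<iota> a"], of "\<iota> b"] IX[OF that(2)] \<iota>_X
      by (simp add: pure_smult_X)
  next
    case (add p q)
    then show ?case using E.lsmult_l_distr[of p q x] X_E[OF IX[OF that(2)]] Ia by simp
  qed
  moreover have "\<zero>\<^bsub>E\<^esub> \<in> I" using additive_subgroup.zero_closed[OF I.is_additive_subgroup] by simp
  ultimately show ?thesis using Ia IX X_E by (auto simp: E.submodule_iff)
qed

text \<open>The part of A inside I is a submodule of zero square, hence zero. As A is essential in E
  and I is a submodule of E, also I is zero.\<close>

theorem Ahat_H_semiprime: "H_semiprime H Ahat hact"
  unfolding H_semiprime_def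
proof (intro allI impI)
  fix I assume I: "H_stable_ideal H Ahat hact I" and sq: "ideal_prod Ahat I I = {\<zero>\<^bsub>Ahat\<^esub>}"
  have sub: "submodule I S E" by (rule stable_ideal_submodule[OF I])
  have J: "submodule {a \<in> carrier A. \<iota> a \<in> I} S Am"
    using vimage_submodule[OF Am_lmodule E.lmodule_axioms \<iota>_hom sub] by simp
  have J0: "{a \<in> carrier A. \<iota> a \<in> I} = {\<zero>\<^bsub>A\<^esub>}"
  proof (rule square_zero_submodule[OF semiprime J])
    fix a b assume ab: "a \<in> {a \<in> carrier A. \<iota> a \<in> I}" "b \<in> {a \<in> carrier A. \<iota> a \<in> I}"
    then have "\<iota> a \<otimes>\<^bsub>Ahat\<^esub> \<iota> b \<in> ideal_prod Ahat I I" by (intro ideal_prod.prod) auto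
    then have "\<iota> (a \<otimes>\<^bsub>A\<^esub> b) = \<zero>\<^bsub>E\<^esub>" unfolding sq using ab by (simp add: hmult_\<iota>)
    then show "a \<otimes>\<^bsub>A\<^esub> b = \<zero>\<^bsub>A\<^esub>" using ab by (intro \<iota>_eq_zero) auto
  qed
  have "I \<inter> \<iota> ` carrier A \<subseteq> {\<zero>\<^bsub>E\<^esub>}"
  proof
    fix y assume "y \<in> I \<inter> \<iota> ` carrier A"
    then obtain a where a: "a \<in> {a \<in> carrier A. \<iota> a \<in> I}" "y = \<iota> a" by auto
    then show "y \<in> {\<zero>\<^bsub>E\<^esub>}" unfolding J0 by simp
  qed
  moreover have "\<zero>\<^bsub>E\<^esub> \<in> I \<inter> \<iota> ` carrier A" using E.submoduleD(2)[OF sub] E.submoduleD(2)[OF \<iota>_submodule] by simp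
  ultimately have "I \<inter> \<iota> ` carrier A = {\<zero>\<^bsub>E\<^esub>}" by (intro equalityI) simp_all
  then show "I = {\<zero>\<^bsub>Ahat\<^esub>}" using \<iota>_essential sub by (simp add: essential_submodule_def)
qed

text \<open>F(x y) = F(x) y = x F(y) for x and y in the hull, and F commutes with H; so linearity
  for pure elements with entries in A extends to those with entries in the hull.\<close>

lemma \<T>_smash_linear:
  assumes F: "F \<in> \<T>"
  shows "F \<in> mod_hom (smash_algebra K H Ahat hact) (smash_module K H Ahat hact) (smash_module K H Ahat hact)"
proof -
  interpret Q: hmodule_algebra K H Ahat hact by (rule Ahat_hmodule_algebra)
  interpret QM: lmodule Q.S Q.Am by (rule Q.Am_lmodule)
  show ?thesis
  proof (rule mod_homI)
    show "F x \<in> carrier Q.Am" if "x \<in> carrier Q.Am" for x using that F by (simp add: \<T>_closed)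
    show "F (x \<oplus>\<^bsub>Q.Am\<^esub> y) = F x \<oplus>\<^bsub>Q.Am\<^esub> F y" if "x \<in> carrier Q.Am" "y \<in> carrier Q.Am" for x y
      using that F by (simp add: \<T>_add)
    show "F (p \<odot>\<^bsub>Q.Am\<^esub> z) = p \<odot>\<^bsub>Q.Am\<^esub> F z" if p: "p \<in> carrier Q.S" and "z \<in> carrier Q.Am" for p z
      using p
    proof (induction rule: Q.S_induct)
      case (pure x y h)
      have z: "z \<in> X" using that by simp
      have c: "F (hact h z) = hact h (F z)"
        using pure(3) z F \<T>_smult[OF F pure_closed_S z, of "\<one>\<^bsub>A\<^esub>" "\<one>\<^bsub>A\<^esub>" h] by (simp add: hact_eq \<T>_closed)
      have "F (x \<star> hact h z \<star> y) = x \<star> hact h (F z) \<star> y"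
        using pure z F c \<T>_hmult(1)[OF F, of "x \<star> hact h z" y] \<T>_hmult(2)[OF F, of x "hact h z"]
        by (simp add: hmult_closed hact_closed)
      then show ?case using pure z F by (simp add: Q.pure_smult_Am \<T>_closed)
    next
      case (add p q)
      have z: "z \<in> X" using that by simp
      have cl: "p \<odot>\<^bsub>Q.Am\<^esub> z \<in> X" "q \<odot>\<^bsub>Q.Am\<^esub> z \<in> X"
        using QM.lsmult_closed[OF add.hyps(1), of z] QM.lsmult_closed[OF add.hyps(2), of z] z by simp_all
      then show ?case
        using QM.lsmult_l_distr[OF add.hyps, of z] QM.lsmult_l_distr[OF add.hyps, of "F z"] add.IH z F
        by (simp add: \<T>_closed \<T>_add del: Q.S_simps)
    qed
  qed
qed

text \<open>A homomorphism over the hull's smash algebra is in particular one over S on a submodule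
  of E. It extends to an endomorphism F of the hull over S, and by \<open>\<T>_smash_linear\<close>
  this F is linear for the larger algebra too.\<close>

theorem Ahat_self_injective:
  "self_injective (smash_algebra K H Ahat hact) (smash_module K H Ahat hact)"
proof -
  interpret Q: hmodule_algebra K H Ahat hact by (rule Ahat_hmodule_algebra)
  interpret QM: lmodule Q.S Q.Am by (rule Q.Am_lmodule)
  have "\<exists>g\<in>mod_hom Q.S Q.Am Q.Am. \<forall>x\<in>N. g x = f x"
    if N: "submodule N Q.S Q.Am" and f: "f \<in> mod_hom Q.S (Q.Am\<lparr>carrier := N\<rparr>) Q.Am" for N f
  proof -
    have NI: "H_stable_ideal H Ahat hact N" using N by (simp add: Q.submodule_iff_H_stable_ideal)
    have NE: "submodule N S E" by (rule stable_ideal_submodule[OF NI])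
    have NX: "x \<in> X" if "x \<in> N" for x using QM.submoduleD(1)[OF N that] by simp
    have fX: "f x \<in> X" if "x \<in> N" for x using mod_hom_closed[OF f, of x] that by simp
    have "f \<in> mod_hom S (E\<lparr>carrier := N\<rparr>) E"
    proof (rule mod_homI)
      fix x assume "x \<in> carrier (E\<lparr>carrier := N\<rparr>)"
      then have x: "x \<in> N" by simp
      show "f x \<in> carrier E" using X_E[OF fX[OF x]] .
      show "f (x \<oplus>\<^bsub>E\<lparr>carrier := N\<rparr>\<^esub> y) = f x \<oplus>\<^bsub>E\<^esub> f y" if "y \<in> carrier (E\<lparr>carrier := N\<rparr>)" for y
        using mod_hom_add[OF f, of x y] x that by simp
      show "f (p \<odot>\<^bsub>E\<lparr>carrier := N\<rparr>\<^esub> x) = p \<odot>\<^bsub>E\<^esub> f x" if "p \<in> carrier S" for p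
        using that
      proof (induction rule: S_induct)
        case (pure a b h)
        then show ?case
          using mod_hom_smult[OF f Q.pure_closed_S, of "\<iota> a" "\<iota> b" h x] x NX[OF x] fX[OF x] \<iota>_X
          by (simp add: pure_smult_X Q.pure_smult_Am)
      next
        case (add p q)
        have "p \<odot>\<^bsub>E\<^esub> x \<in> N" "q \<odot>\<^bsub>E\<^esub> x \<in> N" using E.submoduleD(4)[OF NE _ x] add.hyps by blast+
        then show ?case
          using add.IH E.lsmult_l_distr[OF add.hyps X_E[OF NX[OF x]]] E.lsmult_l_distr[OF add.hyps X_E[OF fX[OF x]]]
            mod_hom_add[OF f, of "p \<odot>\<^bsub>E\<^esub> x" "q \<odot>\<^bsub>E\<^esub> x"] by simp
      qed
    qed
    then obtain F where F: "F \<in> \<T>" "\<And>x. x \<in> N \<Longrightarrow> F x = f x" using hom_extend[OF NE] by blast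
    then show ?thesis using \<T>_smash_linear by blast
  qed
  then show ?thesis using Q.Am_lmodule by (simp add: self_injective_def)
qed

lemma \<iota>_module_algebra_hom: "\<iota> \<in> module_algebra_hom K H A act Ahat hact"
proof -
  have "\<iota> \<in> ring_hom A Ahat"
    by (rule ring_hom_memI) (simp_all add: \<iota>_X hmult_\<iota> \<iota>_add)
  moreover have "\<iota> \<in> mod_hom K A Ahat" using \<T>_\<iota>_linear[OF \<T>_ident] by simp
  moreover have "\<iota> (act h x) = hact h (\<iota> x)" if "h \<in> carrier H" "x \<in> carrier A" for h x
    using hact_hom[OF that(1) \<T>_ident that(2)] by simp
  ultimately show ?thesis by (simp add: module_algebra_hom_def)
qed

end

section \<open>Subdirect products of \<open>H\<close>-prime algebras\<close>

text \<open>The rule for the action on products survives because \<pi> is linear and therefore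
  passes through Sweedler sums.\<close>

lemma (in module_algebra) module_algebra_surj:
  assumes carr: "carrier B = \<pi> ` carrier A" and z: "zero B = \<pi> (zero A)" and o: "one B = \<pi> (one A)"
    and a: "\<And>x y. \<lbrakk>x \<in> carrier A; y \<in> carrier A\<rbrakk> \<Longrightarrow> \<pi> x \<oplus>\<^bsub>B\<^esub> \<pi> y = \<pi> (x \<oplus>\<^bsub>A\<^esub> y)"
    and m: "\<And>x y. \<lbrakk>x \<in> carrier A; y \<in> carrier A\<rbrakk> \<Longrightarrow> \<pi> x \<otimes>\<^bsub>B\<^esub> \<pi> y = \<pi> (x \<otimes>\<^bsub>A\<^esub> y)"
    and s: "\<And>c x. \<lbrakk>c \<in> carrier K; x \<in> carrier A\<rbrakk> \<Longrightarrow> c \<odot>\<^bsub>B\<^esub> \<pi> x = \<pi> (c \<odot>\<^bsub>A\<^esub> x)"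
    and h: "\<And>h x. \<lbrakk>h \<in> carrier H; x \<in> carrier A\<rbrakk> \<Longrightarrow> act' h (\<pi> x) = \<pi> (act h x)"
  shows "module_algebra K H B act'"
proof -
  have M: "module K B" by (rule module_surj[OF A.is_module carr z a s])
  have R: "ring B" by (rule ring_surj[OF A.ring_axioms carr z o a m])
  have \<pi>: "\<pi> \<in> mod_hom K A B" by (rule mod_homI) (simp_all add: carr a s)
  have "assoc_algebra K B"
    by (intro assoc_algebra.intro M R assoc_algebra_axioms.intro)
      (auto simp: carr s m A.smult_mult_left A.smult_mult_right)
  moreover have "module_algebra_axioms K H B act'"
  proof
    fix g x y assume g: "g \<in> carrier H" and "x \<in> carrier B" "y \<in> carrier B"
    then obtain u v where uv: "u \<in> carrier A" "v \<in> carrier A" "x = \<pi> u" "y = \<pi> v" by (auto simp: carr)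
    have "act' g (x \<otimes>\<^bsub>B\<^esub> y) = \<pi> (H.Sw A (\<lambda>k k'. act k u \<otimes>\<^bsub>A\<^esub> act k' v) g)"
      using uv g by (simp add: m h act_on_mult)
    also have "\<dots> = H.Sw B (\<lambda>k k'. \<pi> (act k u \<otimes>\<^bsub>A\<^esub> act k' v)) g"
      using uv g by (intro H.hom_Sw[OF A.is_module M \<pi>]) (simp_all add: act_closed)
    also have "\<dots> = H.Sw B (\<lambda>k k'. act' k x \<otimes>\<^bsub>B\<^esub> act' k' y) g"
      using uv g by (intro H.Sw_cong[OF M]) (simp_all add: act_closed h m carr)
    finally show "act' g (x \<otimes>\<^bsub>B\<^esub> y) = H.Sw B (\<lambda>k k'. act' k x \<otimes>\<^bsub>B\<^esub> act' k' y) g" .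
  qed (auto simp: carr a m s h o act_closed act_add_left act_add_right act_smult_left act_smult_right
      act_assoc act_one act_on_one H.counit_closed)
  ultimately show ?thesis by (intro module_algebra.intro H.hopf_algebra_axioms)
qed

context hmodule_algebra
begin

definition rep :: "'a set \<Rightarrow> 'a set \<Rightarrow> 'a"
  where "rep P U = (SOME x. x \<in> carrier A \<and> P +>\<^bsub>A\<^esub> x = U)"

text \<open>The operations go through chosen representatives, and \<open>quotient_ops\<close> shows
  that the choice is immaterial. The elements are subsets of A, as
  \<open>subdirect_product_of_H_primes\<close> asks of its factors.\<close>

definition quotient_algebra :: "'a set \<Rightarrow> ('k, 'a set) module"
  where "quotient_algebra P =
    \<lparr>carrier = (\<lambda>x. P +>\<^bsub>A\<^esub> x) ` carrier A,
     mult = (\<lambda>U V. P +>\<^bsub>A\<^esub> (rep P U \<otimes>\<^bsub>A\<^esub> rep P V)),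
     one = P +>\<^bsub>A\<^esub> \<one>\<^bsub>A\<^esub>, zero = P +>\<^bsub>A\<^esub> \<zero>\<^bsub>A\<^esub>,
     add = (\<lambda>U V. P +>\<^bsub>A\<^esub> (rep P U \<oplus>\<^bsub>A\<^esub> rep P V)),
     smult = (\<lambda>c U. P +>\<^bsub>A\<^esub> (c \<odot>\<^bsub>A\<^esub> rep P U))\<rparr>"

definition quotient_act :: "'a set \<Rightarrow> 'h \<Rightarrow> 'a set \<Rightarrow> 'a set"
  where "quotient_act P h U = P +>\<^bsub>A\<^esub> (act h (rep P U))"

text \<open>Primeness is stated for I and J above P because these are the preimages of the stable
  ideals of the quotient by P; to equal P means to be zero there.\<close>

definition prime_submodule :: "'a set \<Rightarrow> bool"
  where "prime_submodule P \<longleftrightarrow> submodule P S Am \<and>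
    (\<forall>I J. submodule I S Am \<longrightarrow> submodule J S Am \<longrightarrow> P \<subseteq> I \<longrightarrow> P \<subseteq> J \<longrightarrow>
      (\<forall>x\<in>I. \<forall>y\<in>J. x \<otimes>\<^bsub>A\<^esub> y \<in> P) \<longrightarrow> I = P \<or> J = P)"

context
  fixes P assumes P: "submodule P S Am"
begin

lemma P_ideal: "ideal P A"
  using P by (simp add: submodule_iff_H_stable_ideal H_stable_ideal_def)

lemma P_coset_eq: "\<lbrakk>x \<in> carrier A; y \<in> carrier A\<rbrakk> \<Longrightarrow> P +>\<^bsub>A\<^esub> x = P +>\<^bsub>A\<^esub> y \<longleftrightarrow> x \<ominus>\<^bsub>A\<^esub> y \<in> P"
proof -
  interpret M: lmodule S Am by (rule Am_lmodule)
  have "P +>\<^bsub>Am\<^esub> x = P +>\<^bsub>A\<^esub> x" for x by (simp add: a_r_coset_def r_coset_def)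
  moreover have "x \<ominus>\<^bsub>Am\<^esub> y = x \<ominus>\<^bsub>A\<^esub> y" for x y by (simp add: a_minus_def a_inv_def m_inv_def)
  ultimately show "x \<in> carrier A \<Longrightarrow> y \<in> carrier A \<Longrightarrow> P +>\<^bsub>A\<^esub> x = P +>\<^bsub>A\<^esub> y \<longleftrightarrow> x \<ominus>\<^bsub>A\<^esub> y \<in> P"
    using M.coset_eq_iff[OF P, of x y] by simp
qed

lemma rep: assumes "x \<in> carrier A" shows "rep P (P +>\<^bsub>A\<^esub> x) \<in> carrier A" "rep P (P +>\<^bsub>A\<^esub> x) \<ominus>\<^bsub>A\<^esub> x \<in> P"
proof -
  have "rep P (P +>\<^bsub>A\<^esub> x) \<in> carrier A \<and> P +>\<^bsub>A\<^esub> rep P (P +>\<^bsub>A\<^esub> x) = P +>\<^bsub>A\<^esub> x"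
    unfolding rep_def by (rule someI[of _ x]) (use assms in simp)
  then show "rep P (P +>\<^bsub>A\<^esub> x) \<in> carrier A" "rep P (P +>\<^bsub>A\<^esub> x) \<ominus>\<^bsub>A\<^esub> x \<in> P"
    using P_coset_eq assms by auto
qed

lemma quotient_ops:
  "\<lbrakk>x \<in> carrier A; y \<in> carrier A\<rbrakk> \<Longrightarrow>
    (P +>\<^bsub>A\<^esub> x) \<oplus>\<^bsub>quotient_algebra P\<^esub> (P +>\<^bsub>A\<^esub> y) = P +>\<^bsub>A\<^esub> (x \<oplus>\<^bsub>A\<^esub> y)"
  "\<lbrakk>x \<in> carrier A; y \<in> carrier A\<rbrakk> \<Longrightarrow>
    (P +>\<^bsub>A\<^esub> x) \<otimes>\<^bsub>quotient_algebra P\<^esub> (P +>\<^bsub>A\<^esub> y) = P +>\<^bsub>A\<^esub> (x \<otimes>\<^bsub>A\<^esub> y)"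
  "\<lbrakk>c \<in> carrier K; x \<in> carrier A\<rbrakk> \<Longrightarrow> c \<odot>\<^bsub>quotient_algebra P\<^esub> (P +>\<^bsub>A\<^esub> x) = P +>\<^bsub>A\<^esub> (c \<odot>\<^bsub>A\<^esub> x)"
  "\<lbrakk>h \<in> carrier H; x \<in> carrier A\<rbrakk> \<Longrightarrow> quotient_act P h (P +>\<^bsub>A\<^esub> x) = P +>\<^bsub>A\<^esub> act h x"
proof -
  interpret I: ideal P A by (rule P_ideal)
  interpret M: lmodule S Am by (rule Am_lmodule)
  have st: "\<And>h x. \<lbrakk>h \<in> carrier H; x \<in> P\<rbrakk> \<Longrightarrow> act h x \<in> P"
    using P by (simp add: submodule_iff_H_stable_ideal H_stable_ideal_def)
  let ?r = "\<lambda>x. rep P (P +>\<^bsub>A\<^esub> x)"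
  have r: "?r x = (?r x \<ominus>\<^bsub>A\<^esub> x) \<oplus>\<^bsub>A\<^esub> x" if "x \<in> carrier A" for x
    using that rep[OF that] by (simp add: a_minus_def A.a_assoc A.l_neg)
  have eq: "P +>\<^bsub>A\<^esub> u = P +>\<^bsub>A\<^esub> v" if "u = p \<oplus>\<^bsub>A\<^esub> v" "p \<in> P" "v \<in> carrier A" for u v p
  proof -
    have p: "p \<in> carrier A" using I.Icarr[OF that(2)] .
    have "u \<ominus>\<^bsub>A\<^esub> v = p" unfolding that(1) using p that(3) by (simp add: a_minus_def A.a_assoc A.r_neg)
    then show ?thesis using P_coset_eq[of u v] that p by simp
  qed
  show "(P +>\<^bsub>A\<^esub> x) \<oplus>\<^bsub>quotient_algebra P\<^esub> (P +>\<^bsub>A\<^esub> y) = P +>\<^bsub>A\<^esub> (x \<oplus>\<^bsub>A\<^esub> y)"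
    if "x \<in> carrier A" "y \<in> carrier A" for x y
  proof -
    let ?p = "?r x \<ominus>\<^bsub>A\<^esub> x" and ?q = "?r y \<ominus>\<^bsub>A\<^esub> y"
    have pq: "?p \<in> P" "?q \<in> P" "?p \<in> carrier A" "?q \<in> carrier A" using rep that I.Icarr by auto
    have "?r x \<oplus>\<^bsub>A\<^esub> ?r y = (?p \<oplus>\<^bsub>A\<^esub> x) \<oplus>\<^bsub>A\<^esub> (?q \<oplus>\<^bsub>A\<^esub> y)" using r[OF that(1)] r[OF that(2)] by simp
    also have "\<dots> = (?p \<oplus>\<^bsub>A\<^esub> ?q) \<oplus>\<^bsub>A\<^esub> (x \<oplus>\<^bsub>A\<^esub> y)" using pq(3,4) that by (simp only: A.a_ac A.a_closed)
    finally show ?thesis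
      using eq[of "?r x \<oplus>\<^bsub>A\<^esub> ?r y" "?p \<oplus>\<^bsub>A\<^esub> ?q" "x \<oplus>\<^bsub>A\<^esub> y"] pq that I.a_closed by (simp add: quotient_algebra_def)
  qed
  show "(P +>\<^bsub>A\<^esub> x) \<otimes>\<^bsub>quotient_algebra P\<^esub> (P +>\<^bsub>A\<^esub> y) = P +>\<^bsub>A\<^esub> (x \<otimes>\<^bsub>A\<^esub> y)"
    if "x \<in> carrier A" "y \<in> carrier A" for x y
  proof -
    let ?p = "?r x \<ominus>\<^bsub>A\<^esub> x" and ?q = "?r y \<ominus>\<^bsub>A\<^esub> y"
    have pq: "?p \<in> P" "?q \<in> P" "?p \<in> carrier A" "?q \<in> carrier A" "?r y \<in> carrier A" using rep that I.Icarr by auto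
    have "?r x \<otimes>\<^bsub>A\<^esub> ?r y = (?p \<oplus>\<^bsub>A\<^esub> x) \<otimes>\<^bsub>A\<^esub> ?r y" using r[OF that(1)] by simp
    also have "\<dots> = ?p \<otimes>\<^bsub>A\<^esub> ?r y \<oplus>\<^bsub>A\<^esub> x \<otimes>\<^bsub>A\<^esub> ?r y" using pq that by (simp only: A.l_distr)
    also have "x \<otimes>\<^bsub>A\<^esub> ?r y = x \<otimes>\<^bsub>A\<^esub> (?q \<oplus>\<^bsub>A\<^esub> y)" using r[OF that(2)] by simp
    also have "\<dots> = x \<otimes>\<^bsub>A\<^esub> ?q \<oplus>\<^bsub>A\<^esub> x \<otimes>\<^bsub>A\<^esub> y" using pq that by (simp only: A.r_distr)
    also have "?p \<otimes>\<^bsub>A\<^esub> ?r y \<oplus>\<^bsub>A\<^esub> (x \<otimes>\<^bsub>A\<^esub> ?q \<oplus>\<^bsub>A\<^esub> x \<otimes>\<^bsub>A\<^esub> y) =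
      (?p \<otimes>\<^bsub>A\<^esub> ?r y \<oplus>\<^bsub>A\<^esub> x \<otimes>\<^bsub>A\<^esub> ?q) \<oplus>\<^bsub>A\<^esub> x \<otimes>\<^bsub>A\<^esub> y" using pq that by (simp only: A.a_assoc A.m_closed)
    finally show ?thesis
      using eq[of "?r x \<otimes>\<^bsub>A\<^esub> ?r y" "?p \<otimes>\<^bsub>A\<^esub> ?r y \<oplus>\<^bsub>A\<^esub> x \<otimes>\<^bsub>A\<^esub> ?q" "x \<otimes>\<^bsub>A\<^esub> y"] pq that
        I.a_closed[OF I.I_r_closed[OF pq(1,5)] I.I_l_closed[OF pq(2) that(1)]] by (simp add: quotient_algebra_def)
  qed
  show "c \<odot>\<^bsub>quotient_algebra P\<^esub> (P +>\<^bsub>A\<^esub> x) = P +>\<^bsub>A\<^esub> (c \<odot>\<^bsub>A\<^esub> x)" if "c \<in> carrier K" "x \<in> carrier A" for c x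
  proof -
    let ?p = "?r x \<ominus>\<^bsub>A\<^esub> x"
    have p: "?p \<in> P" "?p \<in> carrier A" using rep that I.Icarr by auto
    have "c \<odot>\<^bsub>A\<^esub> ?r x = c \<odot>\<^bsub>A\<^esub> (?p \<oplus>\<^bsub>A\<^esub> x)" using r[OF that(2)] by simp
    also have "\<dots> = c \<odot>\<^bsub>A\<^esub> ?p \<oplus>\<^bsub>A\<^esub> c \<odot>\<^bsub>A\<^esub> x" using p that by (simp only: A.smult_r_distr)
    finally have e: "c \<odot>\<^bsub>A\<^esub> ?r x = c \<odot>\<^bsub>A\<^esub> ?p \<oplus>\<^bsub>A\<^esub> c \<odot>\<^bsub>A\<^esub> x" .
    have "c \<odot>\<^bsub>A\<^esub> ?p = (c \<odot>\<^bsub>A\<^esub> \<one>\<^bsub>A\<^esub>) \<otimes>\<^bsub>A\<^esub> ?p" using p that by (simp add: A.smult_mult_left)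
    then have "c \<odot>\<^bsub>A\<^esub> ?p \<in> P" using I.I_l_closed[OF p(1), of "c \<odot>\<^bsub>A\<^esub> \<one>\<^bsub>A\<^esub>"] that by simp
    then show ?thesis using eq[OF e] that by (simp add: quotient_algebra_def)
  qed
  show "quotient_act P h (P +>\<^bsub>A\<^esub> x) = P +>\<^bsub>A\<^esub> act h x" if "h \<in> carrier H" "x \<in> carrier A" for h x
  proof -
    let ?p = "?r x \<ominus>\<^bsub>A\<^esub> x"
    have p: "?p \<in> P" "?p \<in> carrier A" using rep that I.Icarr by auto
    have "act h (?r x) = act h (?p \<oplus>\<^bsub>A\<^esub> x)" using r[OF that(2)] by simp
    also have "\<dots> = act h ?p \<oplus>\<^bsub>A\<^esub> act h x" using p that by (simp only: act_add_right)
    finally show ?thesis using eq[of "act h (?r x)" "act h ?p" "act h x"] st[OF that(1) p(1)] that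
      by (simp add: quotient_act_def act_closed)
  qed
qed

lemma quotient_simps:
  "carrier (quotient_algebra P) = (\<lambda>x. P +>\<^bsub>A\<^esub> x) ` carrier A"
  "one (quotient_algebra P) = P +>\<^bsub>A\<^esub> \<one>\<^bsub>A\<^esub>" "zero (quotient_algebra P) = P +>\<^bsub>A\<^esub> \<zero>\<^bsub>A\<^esub>"
  by (simp_all add: quotient_algebra_def)

lemma quotient_module_algebra: "module_algebra K H (quotient_algebra P) (quotient_act P)"
  by (rule module_algebra_surj[OF quotient_simps(1,3,2)]) (simp_all add: quotient_ops)

lemma quotient_module_algebra_hom:
  "(\<lambda>x. P +>\<^bsub>A\<^esub> x) \<in> module_algebra_hom K H A act (quotient_algebra P) (quotient_act P)"
  unfolding module_algebra_hom_def
  by (auto simp: quotient_simps quotient_ops intro!: ring_hom_memI mod_homI)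

lemma quotient_H_prime:
  assumes prime: "prime_submodule P"
  shows "H_prime H (quotient_algebra P) (quotient_act P)"
  unfolding H_prime_def
proof (intro allI impI)
  let ?B = "quotient_algebra P" and ?\<pi> = "\<lambda>x. P +>\<^bsub>A\<^esub> x"
  interpret PI: ideal P A by (rule P_ideal)
  have zeroP: "?\<pi> x = ?\<pi> \<zero>\<^bsub>A\<^esub> \<longleftrightarrow> x \<in> P" if "x \<in> carrier A" for x
    using P_coset_eq[OF that, of "\<zero>\<^bsub>A\<^esub>"] that by (simp add: a_minus_def)
  fix I J assume I: "H_stable_ideal H ?B (quotient_act P) I" and J: "H_stable_ideal H ?B (quotient_act P) J"
    and IJ: "ideal_prod ?B I J = {\<zero>\<^bsub>?B\<^esub>}"
  \<comment> \<open>Primeness is tested inside A, since a stable ideal of the quotient can be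
    recovered from its preimage.\<close>
  have pull: "submodule {x \<in> carrier A. ?\<pi> x \<in> L} S Am" "P \<subseteq> {x \<in> carrier A. ?\<pi> x \<in> L}"
    "{x \<in> carrier A. ?\<pi> x \<in> L} = P \<Longrightarrow> L = {\<zero>\<^bsub>?B\<^esub>}"
    if L: "H_stable_ideal H ?B (quotient_act P) L" for L
  proof -
    interpret LI: ideal L ?B using L by (simp add: H_stable_ideal_def)
    have "ideal {x \<in> carrier A. ?\<pi> x \<in> L} A"
      using ring_hom_ring.ideal_vimage[of A ?B ?\<pi> L] LI.ideal_axioms A.ring_axioms LI.ring_axioms
        quotient_module_algebra_hom
      by (auto simp: module_algebra_hom_def intro: ring_hom_ringI2)
    moreover have "?\<pi> (act h x) \<in> L" if "h \<in> carrier H" "x \<in> carrier A" "?\<pi> x \<in> L" for h x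
      using L that quotient_ops(4)[OF that(1,2)] unfolding H_stable_ideal_def by metis
    ultimately show "submodule {x \<in> carrier A. ?\<pi> x \<in> L} S Am"
      by (simp add: submodule_iff_H_stable_ideal H_stable_ideal_def act_closed)
    have z: "?\<pi> \<zero>\<^bsub>A\<^esub> \<in> L" using additive_subgroup.zero_closed[OF LI.is_additive_subgroup] by (simp add: quotient_simps)
    show "P \<subseteq> {x \<in> carrier A. ?\<pi> x \<in> L}"
    proof
      fix x assume "x \<in> P"
      then have "x \<in> carrier A" "?\<pi> x = ?\<pi> \<zero>\<^bsub>A\<^esub>" using zeroP[OF PI.Icarr] PI.Icarr by blast+
      then show "x \<in> {x \<in> carrier A. ?\<pi> x \<in> L}" using z by simp
    qed
    assume e: "{x \<in> carrier A. ?\<pi> x \<in> L} = P"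
    show "L = {\<zero>\<^bsub>?B\<^esub>}"
    proof (intro equalityI subsetI)
      fix U assume U: "U \<in> L"
      then have "U \<in> carrier ?B" by (rule LI.Icarr)
      then obtain x where x: "x \<in> carrier A" "U = ?\<pi> x" by (auto simp: quotient_simps)
      then have "x \<in> {x \<in> carrier A. ?\<pi> x \<in> L}" using U by simp
      then have "x \<in> P" unfolding e .
      then show "U \<in> {\<zero>\<^bsub>?B\<^esub>}" using zeroP[OF x(1)] x(2) by (simp add: quotient_simps)
    qed (use z in \<open>simp add: quotient_simps\<close>)
  qed
  have "x \<otimes>\<^bsub>A\<^esub> y \<in> P" if "x \<in> {x \<in> carrier A. ?\<pi> x \<in> I}" "y \<in> {x \<in> carrier A. ?\<pi> x \<in> J}" for x y
  proof -
    have "?\<pi> x \<otimes>\<^bsub>?B\<^esub> ?\<pi> y \<in> ideal_prod ?B I J" using that by (intro ideal_prod.prod) auto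
    then have "?\<pi> (x \<otimes>\<^bsub>A\<^esub> y) = ?\<pi> \<zero>\<^bsub>A\<^esub>" unfolding IJ using that by (simp add: quotient_ops quotient_simps)
    then show ?thesis using zeroP that by simp
  qed
  then have "{x \<in> carrier A. ?\<pi> x \<in> I} = P \<or> {x \<in> carrier A. ?\<pi> x \<in> J} = P"
    using prime pull(1,2)[OF I] pull(1,2)[OF J] unfolding prime_submodule_def by blast
  then show "I = {\<zero>\<^bsub>?B\<^esub>} \<or> J = {\<zero>\<^bsub>?B\<^esub>}" using pull(3)[OF I] pull(3)[OF J] by blast
qed

end

text \<open>A submodule maximal among those avoiding the sequence \<open>a\<^sub>0 = a\<close>, \<open>a\<^sub>n\<^sub>+\<^sub>1 \<in> (S a\<^sub>n)\<^sup>2 - {0}\<close>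
  is prime.\<close>

lemma ex_prime_submodule:
  assumes sp: "H_semiprime H A act" and a: "a \<in> carrier A" "a \<noteq> \<zero>\<^bsub>A\<^esub>"
  obtains P where "prime_submodule P" "a \<notin> P"
proof -
  interpret M: lmodule S Am by (rule Am_lmodule)
  define cyc where "cyc x = (\<lambda>p. p \<odot>\<^bsub>Am\<^esub> x) ` carrier S" for x
  have cyc: "submodule (cyc x) S Am" and self: "x \<in> cyc x" if "x \<in> carrier A" for x
    unfolding cyc_def using M.cyclic_submodule[of x] that by simp_all
  have least: "u \<in> L" if "submodule L S Am" "x \<in> L" "u \<in> cyc x" for L x u
    using that M.submoduleD(4) by (auto simp: cyc_def)
  have cA: "u \<in> carrier A" if "u \<in> cyc x" "x \<in> carrier A" for u x
    using M.submoduleD(1)[OF cyc[OF that(2)] that(1)] by simp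
  \<comment> \<open>Otherwise the submodule generated by x would have zero square, against
    semiprimeness.\<close>
  have ex: "\<exists>y. (\<exists>u\<in>cyc x. \<exists>v\<in>cyc x. y = u \<otimes>\<^bsub>A\<^esub> v) \<and> y \<noteq> \<zero>\<^bsub>A\<^esub>" if x: "x \<in> carrier A" "x \<noteq> \<zero>\<^bsub>A\<^esub>" for x
  proof (rule ccontr)
    assume "\<not> ?thesis"
    then have "u \<otimes>\<^bsub>A\<^esub> v = \<zero>\<^bsub>A\<^esub>" if "u \<in> cyc x" "v \<in> cyc x" for u v using that by blast
    then have "cyc x = {\<zero>\<^bsub>A\<^esub>}" by (rule square_zero_submodule[OF sp cyc[OF x(1)]])
    then show False using self[OF x(1)] x(2) by simp
  qed
  define step where "step x = (SOME y. (\<exists>u\<in>cyc x. \<exists>v\<in>cyc x. y = u \<otimes>\<^bsub>A\<^esub> v) \<and> y \<noteq> \<zero>\<^bsub>A\<^esub>)" for x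
  have step: "(\<exists>u\<in>cyc x. \<exists>v\<in>cyc x. step x = u \<otimes>\<^bsub>A\<^esub> v) \<and> step x \<noteq> \<zero>\<^bsub>A\<^esub>" if "x \<in> carrier A" "x \<noteq> \<zero>\<^bsub>A\<^esub>" for x
    unfolding step_def using ex[OF that] by (rule someI_ex)
  define s where "s n = (step ^^ n) a" for n
  have s: "s n \<in> carrier A \<and> s n \<noteq> \<zero>\<^bsub>A\<^esub>" for n
  proof (induction n)
    case (Suc n)
    obtain u v where "u \<in> cyc (s n)" "v \<in> cyc (s n)" "step (s n) = u \<otimes>\<^bsub>A\<^esub> v" using step Suc by blast
    then show ?case using step[of "s n"] Suc cA[of _ "s n"] by (auto simp: s_def)
  qed (use a in \<open>simp add: s_def\<close>)
  have sS: "\<exists>u\<in>cyc (s n). \<exists>v\<in>cyc (s n). s (Suc n) = u \<otimes>\<^bsub>A\<^esub> v" for n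
    using step[of "s n"] s[of n] by (simp add: s_def)
  \<comment> \<open>A submodule containing one term contains all later ones, since each is a product
    of two elements of the submodule generated by its predecessor.\<close>
  have mono: "s (n + k) \<in> L" if L: "submodule L S Am" "s n \<in> L" for L n k
  proof (induction k)
    case (Suc k)
    interpret LI: ideal L A using L(1) by (simp add: submodule_iff_H_stable_ideal H_stable_ideal_def)
    obtain u v where uv: "u \<in> cyc (s (n + k))" "v \<in> cyc (s (n + k))" "s (Suc (n + k)) = u \<otimes>\<^bsub>A\<^esub> v" using sS by blast
    have "u \<in> L" using least[OF L(1) Suc uv(1)] .
    then show ?case using uv LI.I_r_closed[of u v] cA s by simp
  qed (use L in simp)
  \<comment> \<open>Avoiding the whole sequence, rather than a alone, is what makes a maximal member
    prime. The zero submodule qualifies because no term is zero.\<close>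
  define F where "F = {P. submodule P S Am \<and> (\<forall>n. s n \<notin> P)}"
  have z: "{\<zero>\<^bsub>A\<^esub>} \<in> F" using M.zero_submodule s by (simp add: F_def)
  have "\<exists>U\<in>F. \<forall>X\<in>Ch. X \<subseteq> U" if Ch: "Ch \<in> chains F" for Ch
  proof (cases "Ch = {}")
    case True
    then show ?thesis using z by blast
  next
    case False
    have CF: "\<And>L. L \<in> Ch \<Longrightarrow> submodule L S Am \<and> (\<forall>n. s n \<notin> L)"
      and lin: "\<And>L L'. \<lbrakk>L \<in> Ch; L' \<in> Ch\<rbrakk> \<Longrightarrow> L \<subseteq> L' \<or> L' \<subseteq> L"
      using Ch by (auto simp: chains_def chain_subset_def F_def)
    have "submodule (\<Union>Ch) S Am"
      unfolding M.submodule_iff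
    proof (intro conjI ballI)
      show "\<Union>Ch \<subseteq> carrier Am" using CF M.submoduleD(1) by (intro Union_least subsetI) metis
      show "\<zero>\<^bsub>Am\<^esub> \<in> \<Union>Ch" using False CF M.submoduleD(2) by (metis UnionI ex_in_conv)
      show "x \<oplus>\<^bsub>Am\<^esub> y \<in> \<Union>Ch" if x: "x \<in> \<Union>Ch" and y: "y \<in> \<Union>Ch" for x y
      proof -
        obtain L1 L2 where "L1 \<in> Ch" "x \<in> L1" "L2 \<in> Ch" "y \<in> L2" using x y by blast
        then obtain L where L: "L \<in> Ch" "x \<in> L" "y \<in> L" using lin[of L1 L2] by (metis subsetD)
        then show ?thesis using M.submoduleD(3) CF by (metis UnionI)
      qed
      show "p \<odot>\<^bsub>Am\<^esub> x \<in> \<Union>Ch" if p: "p \<in> carrier S" and x: "x \<in> \<Union>Ch" for p x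
        using x M.submoduleD(4)[OF _ p] CF by (metis Union_iff)
    qed
    moreover have "\<forall>n. s n \<notin> \<Union>Ch" using CF by blast
    ultimately show ?thesis by (intro bexI[of _ "\<Union>Ch"]) (auto simp: F_def)
  qed
  then obtain P where P: "P \<in> F" "\<And>L. \<lbrakk>L \<in> F; P \<subseteq> L\<rbrakk> \<Longrightarrow> L = P"
    using Zorn_Lemma2[of F] by meson
  have Ps: "submodule P S Am" and Pn: "s n \<notin> P" for n using P(1) by (simp_all add: F_def)
  have "prime_submodule P"
    unfolding prime_submodule_def
  proof (intro conjI allI impI Ps)
    fix I J assume I: "submodule I S Am" "P \<subseteq> I" and J: "submodule J S Am" "P \<subseteq> J"
      and IJ: "\<forall>x\<in>I. \<forall>y\<in>J. x \<otimes>\<^bsub>A\<^esub> y \<in> P"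
    show "I = P \<or> J = P"
    proof (rule ccontr)
      assume "\<not> (I = P \<or> J = P)"
      then have "I \<notin> F" "J \<notin> F" using P(2) I(2) J(2) by metis+
      then obtain i j where ij: "s i \<in> I" "s j \<in> J" using I(1) J(1) by (auto simp: F_def)
      \<comment> \<open>Maximality puts a term of the sequence into I and one into J, and the index
        i + j is late enough for both. The next term is then a product of an element of I and one of
        J, hence in P, a contradiction.\<close>
      have si: "s (i + j) \<in> I" "s (i + j) \<in> J" using mono[OF I(1) ij(1), of j] mono[OF J(1) ij(2), of i] by (simp_all add: add.commute)
      obtain u v where uv: "u \<in> cyc (s (i + j))" "v \<in> cyc (s (i + j))" "s (Suc (i + j)) = u \<otimes>\<^bsub>A\<^esub> v" using sS by blast
      then have "s (Suc (i + j)) \<in> P" using IJ least[OF I(1) si(1)] least[OF J(1) si(2)] by simp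
      then show False using Pn by blast
    qed
  qed
  moreover have "a \<notin> P" using Pn[of 0] by (simp add: s_def)
  ultimately show ?thesis by (rule that)
qed

text \<open>The factors are the quotients by all prime submodules. They separate points because a
  nonzero difference lies outside some prime submodule.\<close>

theorem subdirect_product:
  assumes sp: "H_semiprime H A act"
  shows "subdirect_product_of_H_primes K H A act"
  unfolding subdirect_product_of_H_primes_def
proof (intro exI conjI ballI)
  let ?I = "Collect prime_submodule" and ?\<pi> = "\<lambda>P x. P +>\<^bsub>A\<^esub> x"
  fix P assume P: "P \<in> ?I"
  then have Ps: "submodule P S Am" by (simp add: prime_submodule_def)
  show "module_algebra K H (quotient_algebra P) (quotient_act P)" by (rule quotient_module_algebra[OF Ps])
  show "H_prime H (quotient_algebra P) (quotient_act P)" using quotient_H_prime[OF Ps] P by simp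
  show "?\<pi> P \<in> module_algebra_hom K H A act (quotient_algebra P) (quotient_act P)"
    by (rule quotient_module_algebra_hom[OF Ps])
  show "?\<pi> P ` carrier A = carrier (quotient_algebra P)" by (simp add: quotient_simps[OF Ps])
next
  let ?I = "Collect prime_submodule" and ?\<pi> = "\<lambda>P x. P +>\<^bsub>A\<^esub> x"
  interpret M: lmodule S Am by (rule Am_lmodule)
  show "inj_on (\<lambda>x. \<lambda>P\<in>?I. ?\<pi> P x) (carrier A)"
  proof (rule inj_onI, rule ccontr)
    fix x y assume xy: "x \<in> carrier A" "y \<in> carrier A" "(\<lambda>P\<in>?I. ?\<pi> P x) = (\<lambda>P\<in>?I. ?\<pi> P y)" "x \<noteq> y"
    have minus: "x \<ominus>\<^bsub>Am\<^esub> y = x \<ominus>\<^bsub>A\<^esub> y" by (simp add: a_minus_def a_inv_def m_inv_def)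
    have "x \<ominus>\<^bsub>A\<^esub> y \<noteq> \<zero>\<^bsub>A\<^esub>" using M.diff_eq_zero[of x y] xy minus by auto
    then obtain P where P: "prime_submodule P" "x \<ominus>\<^bsub>A\<^esub> y \<notin> P" using ex_prime_submodule[OF sp, of "x \<ominus>\<^bsub>A\<^esub> y"] xy by auto
    have "?\<pi> P x = ?\<pi> P y" using fun_cong[OF xy(3), of P] P(1) by simp
    then show False using P_coset_eq[of P x y] P xy by (simp add: prime_submodule_def)
  qed
qed

end

section \<open>Maximal quotient rings\<close>

context ring
begin

lemma dense_left_idealD:
  assumes "dense_left_ideal R D"
  shows "submodule D R (regular_module R)" "d \<in> D \<Longrightarrow> d \<in> carrier R"
    "\<lbrakk>x \<in> carrier R; y \<in> carrier R; x \<noteq> \<zero>\<rbrakk> \<Longrightarrow> \<exists>r\<in>carrier R. r \<otimes> y \<in> D \<and> r \<otimes> x \<noteq> \<zero>"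
    "\<lbrakk>r \<in> carrier R; d \<in> D\<rbrakk> \<Longrightarrow> r \<otimes> d \<in> D"
proof -
  interpret Q: lmodule R "regular_module R" by (rule regular_lmodule)
  show sub: "submodule D R (regular_module R)" using assms by (simp add: dense_left_ideal_def)
  show "d \<in> carrier R" if "d \<in> D" using Q.submoduleD(1)[OF sub that] by simp
  show "\<exists>r\<in>carrier R. r \<otimes> y \<in> D \<and> r \<otimes> x \<noteq> \<zero>" if "x \<in> carrier R" "y \<in> carrier R" "x \<noteq> \<zero>"
    using assms that by (simp add: dense_left_ideal_def)
  show "r \<otimes> d \<in> D" if "r \<in> carrier R" "d \<in> D" using Q.submoduleD(4)[OF sub that] by simp
qed

text \<open>Density is used twice: r brings y into D while r x \<noteq> 0, and then q brings f(r y)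
  into D' while q r x \<noteq> 0. The domain of a product of fractions is of this form.\<close>

lemma dense_left_ideal_vimage:
  assumes D: "dense_left_ideal R D" and f: "f \<in> mod_hom R ((regular_module R)\<lparr>carrier := D\<rparr>) (regular_module R)"
    and D': "dense_left_ideal R D'"
  shows "dense_left_ideal R {x \<in> D. f x \<in> D'}"
  unfolding dense_left_ideal_def
proof (intro conjI ballI impI)
  interpret Q: lmodule R "regular_module R" by (rule regular_lmodule)
  note sD = dense_left_idealD(1)[OF D]
  interpret QD: lmodule R "(regular_module R)\<lparr>carrier := D\<rparr>" by (rule Q.submodule_lmodule[OF sD])
  have sub: "submodule {x \<in> D. f x \<in> D'} R ((regular_module R)\<lparr>carrier := D\<rparr>)"
    using vimage_submodule[OF QD.lmodule_axioms Q.lmodule_axioms f dense_left_idealD(1)[OF D']] by simp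
  then show "submodule {x \<in> D. f x \<in> D'} R (regular_module R)"
    using submodule_restrict[OF Q.lmodule_axioms sD, of "{x \<in> D. f x \<in> D'}"] by blast
  fix x y assume xy: "x \<in> carrier R" "y \<in> carrier R" "x \<noteq> \<zero>"
  obtain r where r: "r \<in> carrier R" "r \<otimes> y \<in> D" "r \<otimes> x \<noteq> \<zero>" using dense_left_idealD(3)[OF D xy] by blast
  have fc: "f (r \<otimes> y) \<in> carrier R" using mod_hom_closed[OF f, of "r \<otimes> y"] r by simp
  obtain q where q: "q \<in> carrier R" "q \<otimes> f (r \<otimes> y) \<in> D'" "q \<otimes> (r \<otimes> x) \<noteq> \<zero>"
    using dense_left_idealD(3)[OF D' _ fc r(3)] r xy by auto
  have "f (q \<otimes> (r \<otimes> y)) = q \<otimes> f (r \<otimes> y)" using mod_hom_smult[OF f q(1), of "r \<otimes> y"] r by simp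
  moreover have "q \<otimes> (r \<otimes> y) \<in> D" using dense_left_idealD(4)[OF D q(1) r(2)] .
  ultimately show "\<exists>r\<in>carrier R. r \<otimes> y \<in> {x \<in> D. f x \<in> D'} \<and> r \<otimes> x \<noteq> \<zero>"
    using q r xy by (intro bexI[of _ "q \<otimes> r"]) (simp_all add: m_assoc)
qed

text \<open>The preimage of D' under the inclusion of D into the ring.\<close>

lemma dense_left_ideal_Int:
  assumes D: "dense_left_ideal R D" and D': "dense_left_ideal R D'"
  shows "dense_left_ideal R (D \<inter> D')"
proof -
  have "(\<lambda>x. x) \<in> mod_hom R ((regular_module R)\<lparr>carrier := D\<rparr>) (regular_module R)"
    using dense_left_idealD(2)[OF D] by (intro mod_homI) simp_all
  then have "dense_left_ideal R {x \<in> D. x \<in> D'}" using dense_left_ideal_vimage[OF D _ D', of "\<lambda>x. x"] by simp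
  then show ?thesis by (simp add: Int_def)
qed

lemma dense_left_ideal_carrier: "dense_left_ideal R (carrier R)"
proof -
  interpret Q: lmodule R "regular_module R" by (rule regular_lmodule)
  show ?thesis using Q.carrier_submodule by (auto simp: dense_left_ideal_def intro: bexI[of _ \<one>])
qed

end

section \<open>The central invariants of the hull as a maximal quotient ring\<close>

context semiprime_hull
begin

text \<open>From here on \<open>C\<close> is \<open>Z(A)^H\<close>, while \<open>Q.C\<close> is its
  analogue for the hull, to which the results on semiprime self-injective algebras apply.\<close>

sublocale Q: semiprime_self_injective K H Ahat hact
  by (intro semiprime_self_injective.intro Ahat_hmodule_algebra semiprime_self_injective_axioms.intro
      Ahat_H_semiprime Ahat_self_injective)

sublocale Cz: cring C by (rule C_cring)

text \<open>Multiplication by c is linear over the smash algebra of the hull; its pure elements with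
  entries from A give linearity over S.\<close>

lemma C_mult_\<T>: "c \<in> carrier Q.C \<Longrightarrow> (\<lambda>x. c \<star> x) \<in> \<T>"
proof (rule mod_homI)
  assume c: "c \<in> carrier Q.C"
  have cX: "c \<in> X" using Q.C_A[OF c] by simp
  show "c \<star> x \<in> X" if "x \<in> X" for x using cX that by (rule hmult_closed)
  show "c \<star> (x \<oplus>\<^bsub>Xm\<^esub> y) = c \<star> x \<oplus>\<^bsub>Xm\<^esub> c \<star> y" if "x \<in> X" "y \<in> X" for x y
    using cX that by (simp add: hmult_r_distr)
  show "c \<star> (p \<odot>\<^bsub>Xm\<^esub> x) = p \<odot>\<^bsub>Xm\<^esub> (c \<star> x)" if p: "p \<in> carrier S" and x: "x \<in> X" for p x
    using p
  proof (induction rule: S_induct)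
    case (pure a b h)
    have "c \<star> (Q.pure (\<iota> a) (\<iota> b) h \<odot>\<^bsub>Q.Am\<^esub> x) = Q.pure (\<iota> a) (\<iota> b) h \<odot>\<^bsub>Q.Am\<^esub> (c \<star> x)"
      using mod_hom_smult[OF Q.C_mult_hom[OF c] Q.pure_closed_S, of "\<iota> a" "\<iota> b" h x] pure x \<iota>_X by simp
    then show ?case using pure x cX \<iota>_X by (simp add: pure_smult_X Q.pure_smult_Am hmult_closed)
  next
    case (add p q)
    then show ?case using x cX E.lsmult_l_distr[OF add.hyps X_E[OF x]] E.lsmult_l_distr[OF add.hyps X_E, of "c \<star> x"]
      X_smult[OF add.hyps(1) x] X_smult[OF add.hyps(2) x] by (simp add: hmult_closed hmult_r_distr)
  qed
qed

lemma \<iota>_C: "z \<in> carrier C \<Longrightarrow> \<iota> z \<in> carrier Q.C"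
proof -
  assume z: "z \<in> carrier C"
  have zA: "z \<in> carrier A" using C_A[OF z] .
  have "\<iota> z \<star> x = x \<star> \<iota> z" if "x \<in> X" for x
    using that
  proof (induction rule: X_induct)
    case (hom f a)
    then show ?case using zA C_comm[OF z hom(2)] hmult_hom_hom[OF \<T>_ident zA hom] hmult_hom_hom[OF hom \<T>_ident zA] by simp
  next
    case (add x y)
    then show ?case using \<iota>_X[OF zA] by (simp add: hmult_l_distr hmult_r_distr)
  qed
  moreover have "hact h (\<iota> z) = counit H h \<odot>\<^bsub>Ahat\<^esub> \<iota> z" if "h \<in> carrier H" for h
    using hact_hom[OF that \<T>_ident zA] C_act[OF z that] Ahat_smult_hom[OF H.counit_closed[OF that] \<T>_ident zA] by simp
  ultimately show ?thesis using \<iota>_X[OF zA] by (simp add: Q.C_carrier)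
qed

text \<open>Together with \<open>\<iota>_C\<close> this describes \<open>Z(A)^H\<close> as the part
  of A lying in the central invariants of the hull. The defining equations descend because \<iota>
  is injective.\<close>

lemma C_\<iota>:
  assumes a: "a \<in> carrier A" and c: "\<iota> a \<in> carrier Q.C" shows "a \<in> carrier C"
  unfolding C_carrier
proof (intro conjI ballI a)
  fix x assume x: "x \<in> carrier A"
  have "\<iota> (a \<otimes>\<^bsub>A\<^esub> x) = \<iota> (x \<otimes>\<^bsub>A\<^esub> a)" using Q.C_comm[OF c, of "\<iota> x"] a x \<iota>_X by (simp add: hmult_\<iota>)
  then show "a \<otimes>\<^bsub>A\<^esub> x = x \<otimes>\<^bsub>A\<^esub> a" using inj_onD[OF \<iota>_inj] a x by simp
next
  fix h assume h: "h \<in> carrier H"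
  have "\<iota> (act h a) = \<iota> (counit H h \<odot>\<^bsub>A\<^esub> a)"
    using Q.C_act[OF c h] hact_hom[OF h \<T>_ident a] Ahat_smult_hom[OF H.counit_closed[OF h] \<T>_ident a] by simp
  then show "act h a = counit H h \<odot>\<^bsub>A\<^esub> a" using inj_onD[OF \<iota>_inj] a h by (simp add: act_closed H.counit_closed)
qed

context
  assumes large: "large_in (carrier C) H A act"
begin

lemma ex_C_nonzero:
  assumes "submodule V S Am" "v \<in> V" "v \<noteq> \<zero>\<^bsub>A\<^esub>"
  obtains w where "w \<in> carrier C" "w \<in> V" "w \<noteq> \<zero>\<^bsub>A\<^esub>"
proof -
  have "V \<noteq> {\<zero>\<^bsub>A\<^esub>}" using assms by auto
  then have "carrier C \<inter> V \<noteq> {\<zero>\<^bsub>A\<^esub>}"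
    using large assms(1) by (simp add: large_in_def submodule_iff_H_stable_ideal)
  moreover have "\<zero>\<^bsub>A\<^esub> \<in> carrier C \<inter> V" using C_zero Am.submoduleD(2)[OF assms(1)] by simp
  ultimately obtain w where "w \<in> carrier C \<inter> V" "w \<noteq> \<zero>\<^bsub>A\<^esub>" by blast
  then show ?thesis by (intro that[of w]) auto
qed

text \<open>Largeness puts a nonzero w of C into S x, and whatever in C kills x kills w. If r = c w
  kills x, then r^2 = c (r w) = 0, so r = 0. Thus for x \<noteq> 0 the nonzero ideal C w meets the
  annihilator of x trivially.\<close>

theorem nonsingular_over_C: "nonsingular_module C (regular_module A)"
proof (rule nonsingular_moduleI[OF regular_module_C_lmodule]; (unfold regular_module_simps central_invariants_simps)?)
  interpret R: lmodule C "regular_module C" by (rule Cz.regular_lmodule)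
  fix x assume x: "x \<in> carrier A" "essential_submodule C (regular_module C) {r \<in> carrier C. r \<otimes>\<^bsub>A\<^esub> x = \<zero>\<^bsub>A\<^esub>}"
  show "x = \<zero>\<^bsub>A\<^esub>"
  proof (rule ccontr)
    assume xn: "x \<noteq> \<zero>\<^bsub>A\<^esub>"
    have V: "submodule ((\<lambda>p. p \<odot>\<^bsub>Am\<^esub> x) ` carrier S) S Am" "x \<in> (\<lambda>p. p \<odot>\<^bsub>Am\<^esub> x) ` carrier S"
      using Am.cyclic_submodule[of x] x(1) by simp_all
    obtain w where w: "w \<in> carrier C" "w \<in> (\<lambda>p. p \<odot>\<^bsub>Am\<^esub> x) ` carrier S" "w \<noteq> \<zero>\<^bsub>A\<^esub>"
      using ex_C_nonzero[OF V xn] .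
    then obtain p where p: "p \<in> carrier S" "w = p \<odot>\<^bsub>Am\<^esub> x" by auto
    have kill: "r \<otimes>\<^bsub>A\<^esub> w = \<zero>\<^bsub>A\<^esub>" if "r \<in> carrier C" "r \<otimes>\<^bsub>A\<^esub> x = \<zero>\<^bsub>A\<^esub>" for r
      using mod_hom_smult[OF C_mult_hom[OF that(1)] p(1), of x] x(1) that(2) p(2) Am.smult_zero_right[OF p(1)] by simp
    define I where "I = (\<lambda>c. c \<otimes>\<^bsub>A\<^esub> w) ` carrier C"
    have I: "submodule I C (regular_module C)" "w \<in> I" unfolding I_def using R.cyclic_submodule[of w] w(1) by simp_all
    then have "I \<noteq> {\<zero>\<^bsub>regular_module C\<^esub>}" using w(3) by auto
    then obtain r where r: "r \<in> I" "r \<in> {r \<in> carrier C. r \<otimes>\<^bsub>A\<^esub> x = \<zero>\<^bsub>A\<^esub>}" "r \<noteq> \<zero>\<^bsub>regular_module C\<^esub>"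
      using essential_trivial[OF x(2) I(1)] by blast
    then obtain c where c: "c \<in> carrier C" "r = c \<otimes>\<^bsub>A\<^esub> w" by (auto simp: I_def)
    have rC: "r \<in> carrier C" "r \<otimes>\<^bsub>A\<^esub> x = \<zero>\<^bsub>A\<^esub>" using r(2) by auto
    have "r \<otimes>\<^bsub>A\<^esub> r = c \<otimes>\<^bsub>A\<^esub> (r \<otimes>\<^bsub>A\<^esub> w)"
    proof -
      have "r \<otimes>\<^bsub>A\<^esub> r = (r \<otimes>\<^bsub>A\<^esub> c) \<otimes>\<^bsub>A\<^esub> w" using c rC C_A w(1) by (simp add: A.m_assoc)
      also have "r \<otimes>\<^bsub>A\<^esub> c = c \<otimes>\<^bsub>A\<^esub> r" using C_comm[OF rC(1) C_A[OF c(1)]] .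
      finally show ?thesis using c(1) rC C_A w(1) by (simp add: A.m_assoc)
    qed
    then have "r \<otimes>\<^bsub>A\<^esub> r = \<zero>\<^bsub>A\<^esub>" using kill[OF rC] C_A[OF c(1)] by simp
    then show False using C_square_zero[OF semiprime rC(1)] r(3) by simp
  qed
qed

text \<open>If x \<noteq> 0, essentiality of A in E and largeness give a nonzero w = p x in C.
  Density yields r in D with r w \<noteq> 0, but multiplication by r commutes with p, so r w = p (r
  x) = 0.\<close>

lemma dense_faithful:
  assumes D: "dense_left_ideal C D" and x: "x \<in> X" and z: "\<And>d. d \<in> D \<Longrightarrow> \<iota> d \<star> x = \<zero>\<^bsub>E\<^esub>"
  shows "x = \<zero>\<^bsub>E\<^esub>"
proof (rule ccontr)
  assume xn: "x \<noteq> \<zero>\<^bsub>E\<^esub>"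
  let ?N = "(\<lambda>p. p \<odot>\<^bsub>E\<^esub> x) ` carrier S"
  have N: "submodule ?N S E" "x \<in> ?N" using E.cyclic_submodule[OF X_E[OF x]] .
  then have "?N \<noteq> {\<zero>\<^bsub>E\<^esub>}" using xn by auto
  then obtain y where y: "y \<in> ?N" "y \<in> \<iota> ` carrier A" "y \<noteq> \<zero>\<^bsub>E\<^esub>" using essential_trivial[OF \<iota>_essential N(1)] by blast
  then obtain v where v: "v \<in> carrier A" "y = \<iota> v" by auto
  have V: "submodule {a \<in> carrier A. \<iota> a \<in> ?N} S Am"
    using vimage_submodule[OF Am_lmodule E.lmodule_axioms \<iota>_hom N(1)] by simp
  obtain w where w: "w \<in> carrier C" "w \<in> {a \<in> carrier A. \<iota> a \<in> ?N}" "w \<noteq> \<zero>\<^bsub>A\<^esub>"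
    using ex_C_nonzero[OF V, of v] y v \<iota>_zero by (metis (no_types, lifting) mem_Collect_eq)
  then obtain p where p: "p \<in> carrier S" "\<iota> w = p \<odot>\<^bsub>E\<^esub> x" by auto
  \<comment> \<open>Density is applied to the pair (w, 1), so that r 1 = r itself lies in D.\<close>
  obtain r where r: "r \<in> carrier C" "r \<otimes>\<^bsub>A\<^esub> \<one>\<^bsub>A\<^esub> \<in> D" "r \<otimes>\<^bsub>A\<^esub> w \<noteq> \<zero>\<^bsub>A\<^esub>"
    using Cz.dense_left_idealD(3)[OF D w(1), of "\<one>\<^bsub>A\<^esub>"] C_one w(3) by auto
  have rA: "r \<in> carrier A" "w \<in> carrier A" using C_A r(1) w(1) by auto
  then have rD: "r \<in> D" using r(2) by simp
  have "\<iota> (r \<otimes>\<^bsub>A\<^esub> w) = \<iota> r \<star> (p \<odot>\<^bsub>E\<^esub> x)" using rA p(2) hmult_\<iota>[of r w] by simp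
  also have "\<dots> = p \<odot>\<^bsub>E\<^esub> (\<iota> r \<star> x)" by (rule \<T>_smult[OF C_mult_\<T>[OF \<iota>_C[OF r(1)]] p(1) x])
  also have "\<dots> = \<zero>\<^bsub>E\<^esub>" using z[OF rD] E.smult_zero_right[OF p(1)] by simp
  finally show False using \<iota>_eq_zero[of "r \<otimes>\<^bsub>A\<^esub> w"] rA r(3) by simp
qed

lemma dense_cancel:
  assumes D: "dense_left_ideal C D" and xy: "x \<in> X" "y \<in> X"
    and eq: "\<And>d. d \<in> D \<Longrightarrow> \<iota> d \<star> x = \<iota> d \<star> y"
  shows "x = y"
proof (rule Xm.diff_eq_zero)
  show "x \<in> X" "y \<in> X" by fact+
  have d: "x \<ominus>\<^bsub>Xm\<^esub> y \<in> X" using xy Xm.M.minus_closed by blast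
  have "x \<ominus>\<^bsub>Xm\<^esub> y = \<zero>\<^bsub>E\<^esub>"
  proof (rule dense_faithful[OF D d])
    fix e assume e: "e \<in> D"
    have f: "(\<lambda>x. \<iota> e \<star> x) \<in> \<T>" by (rule C_mult_\<T>[OF \<iota>_C[OF Cz.dense_left_idealD(2)[OF D e]]])
    show "\<iota> e \<star> (x \<ominus>\<^bsub>Xm\<^esub> y) = \<zero>\<^bsub>E\<^esub>"
      using mod_hom_minus[OF Xm.lmodule_axioms Xm.lmodule_axioms f xy] eq[OF e]
        Xm.diff_self[OF \<T>_closed[OF f xy(2)]] by simp
  qed
  then show "x \<ominus>\<^bsub>Xm\<^esub> y = \<zero>\<^bsub>Xm\<^esub>" by simp
qed

text \<open>The element \<open>c\<close> of the hull corresponds to the class of all fractions that are restrictions of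
  the multiplication by \<open>c\<close>.\<close>

definition frac :: "'e \<Rightarrow> 'a fraction set"
  where "frac c = {(D, f). (D, f) \<in> fractions C \<and> (\<forall>d\<in>D. \<iota> (f d) = c \<star> \<iota> d)}"

lemma fractionsD:
  assumes "(D, f) \<in> fractions C"
  shows "dense_left_ideal C D" "f \<in> mod_hom C ((regular_module C)\<lparr>carrier := D\<rparr>) (regular_module C)"
    "f \<in> extensional D" "d \<in> D \<Longrightarrow> d \<in> carrier C" "d \<in> D \<Longrightarrow> d \<in> carrier A" "d \<in> D \<Longrightarrow> f d \<in> carrier C"
    "d \<in> D \<Longrightarrow> f d \<in> carrier A" "\<lbrakk>z \<in> carrier C; d \<in> D\<rbrakk> \<Longrightarrow> f (z \<otimes>\<^bsub>A\<^esub> d) = z \<otimes>\<^bsub>A\<^esub> f d"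
    "\<lbrakk>d \<in> D; d' \<in> D\<rbrakk> \<Longrightarrow> f (d \<oplus>\<^bsub>A\<^esub> d') = f d \<oplus>\<^bsub>A\<^esub> f d'"
proof -
  show D: "dense_left_ideal C D" and f: "f \<in> mod_hom C ((regular_module C)\<lparr>carrier := D\<rparr>) (regular_module C)"
    and "f \<in> extensional D" using assms by (simp_all add: fractions_def)
  show 1: "d \<in> carrier C" if "d \<in> D" for d using Cz.dense_left_idealD(2)[OF D that] .
  then show "d \<in> carrier A" if "d \<in> D" for d using C_A that by blast
  show 2: "f d \<in> carrier C" if "d \<in> D" for d using mod_hom_closed[OF f, of d] that by simp
  then show "f d \<in> carrier A" if "d \<in> D" for d using C_A that by blast
  show "f (z \<otimes>\<^bsub>A\<^esub> d) = z \<otimes>\<^bsub>A\<^esub> f d" if "z \<in> carrier C" "d \<in> D" for z d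
    using mod_hom_smult[OF f that(1), of d] that(2) by simp
  show "f (d \<oplus>\<^bsub>A\<^esub> d') = f d \<oplus>\<^bsub>A\<^esub> f d'" if "d \<in> D" "d' \<in> D" for d d'
    using mod_hom_add[OF f, of d d'] that by simp
qed

text \<open>The domain is the largest possible: all z in C with c z in C. For its density let x
  \<noteq> 0. The elements of A that c maps into A form an essential submodule, which therefore
  meets x A, and largeness supplies a nonzero r of C in the intersection. Then c r lies in C, so r y
  is in the domain; and r x = 0 would give r^2 = 0, because r is a multiple of x.\<close>

lemma ex_frac:
  assumes c: "c \<in> carrier Q.C"
  shows "frac c \<noteq> {}"
proof -
  have cX: "c \<in> X" using Q.C_A[OF c] by simp
  define D where "D = {z \<in> carrier C. c \<star> \<iota> z \<in> \<iota> ` carrier C}"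
  define f where "f = (\<lambda>z\<in>D. the_inv_into (carrier A) \<iota> (c \<star> \<iota> z))"
  have f: "f z = w" if "z \<in> carrier C" "w \<in> carrier C" "c \<star> \<iota> z = \<iota> w" for z w
    using that the_inv_into_f_f[OF \<iota>_inj C_A[OF that(2)]] by (simp add: f_def D_def)
  have Dz: "\<exists>w\<in>carrier C. c \<star> \<iota> z = \<iota> w" if "z \<in> D" for z
    using that by (auto simp: D_def)
  have cm: "c \<star> \<iota> (r \<otimes>\<^bsub>A\<^esub> z) = \<iota> (r \<otimes>\<^bsub>A\<^esub> w)" if "r \<in> carrier C" "z \<in> carrier C" "w \<in> carrier C" "c \<star> \<iota> z = \<iota> w" for r z w
  proof -
    have "c \<star> \<iota> (r \<otimes>\<^bsub>A\<^esub> z) = c \<star> (\<iota> r \<star> \<iota> z)" using that C_A by (simp add: hmult_\<iota>)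
    also have "\<dots> = \<iota> r \<star> (c \<star> \<iota> z)"
      using \<T>_hmult(2)[OF C_mult_\<T>[OF c] \<iota>_X \<iota>_X, of r z] that C_A by simp
    finally show ?thesis using that C_A by (simp add: hmult_\<iota>)
  qed
  have ca: "c \<star> \<iota> (z \<oplus>\<^bsub>A\<^esub> z') = \<iota> (w \<oplus>\<^bsub>A\<^esub> w')"
    if "z \<in> carrier C" "w \<in> carrier C" "c \<star> \<iota> z = \<iota> w" "z' \<in> carrier C" "w' \<in> carrier C" "c \<star> \<iota> z' = \<iota> w'" for z w z' w'
    using that C_A cX \<iota>_X by (simp add: \<iota>_add hmult_r_distr)
  interpret R: lmodule C "regular_module C" by (rule Cz.regular_lmodule)
  have sub: "submodule D C (regular_module C)"
    unfolding R.submodule_iff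
  proof (intro conjI ballI)
    show "D \<subseteq> carrier (regular_module C)" by (auto simp: D_def)
    have "c \<star> \<iota> \<zero>\<^bsub>A\<^esub> = \<iota> \<zero>\<^bsub>A\<^esub>" using \<T>_zero[OF C_mult_\<T>[OF c]] by simp
    then show "\<zero>\<^bsub>regular_module C\<^esub> \<in> D" using C_zero unfolding D_def regular_module_simps central_invariants_simps
      by (intro CollectI conjI image_eqI[of _ _ "\<zero>\<^bsub>A\<^esub>"])
    show "x \<oplus>\<^bsub>regular_module C\<^esub> y \<in> D" if xy: "x \<in> D" "y \<in> D" for x y
    proof -
      obtain w w' where "w \<in> carrier C" "c \<star> \<iota> x = \<iota> w" "w' \<in> carrier C" "c \<star> \<iota> y = \<iota> w'" using Dz xy by blast
      then show ?thesis using ca[of x w y w'] xy C_add_closed[of w w'] C_add_closed[of x y] by (simp add: D_def)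
    qed
    show "r \<odot>\<^bsub>regular_module C\<^esub> x \<in> D" if rx: "r \<in> carrier C" "x \<in> D" for r x
    proof -
      obtain w where "w \<in> carrier C" "c \<star> \<iota> x = \<iota> w" using Dz rx by blast
      then show ?thesis using cm[of r x w] rx C_mult_closed[of r w] C_mult_closed[of r x] by (simp add: D_def)
    qed
  qed
  have "dense_left_ideal C D"
    unfolding dense_left_ideal_def
  proof (intro conjI ballI impI sub)
    fix x y assume xy: "x \<in> carrier C" "y \<in> carrier C" "x \<noteq> \<zero>\<^bsub>C\<^esub>"
    define N where "N = {a \<in> carrier A. c \<star> \<iota> a \<in> \<iota> ` carrier A}"
    have N: "essential_submodule S Am N" unfolding N_def by (rule \<iota>_vimage_essential[OF C_mult_\<T>[OF c]])
    let ?V = "(\<lambda>a. x \<otimes>\<^bsub>A\<^esub> a) ` carrier A"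
    have V: "submodule ?V S Am"
      using image_submodule[OF Am_lmodule Am_lmodule C_mult_hom[OF xy(1)] Am.carrier_submodule] by simp
    have "x \<in> ?V" using C_A[OF xy(1)] by (intro image_eqI[of _ _ "\<one>\<^bsub>A\<^esub>"]) simp_all
    then have "?V \<noteq> {\<zero>\<^bsub>Am\<^esub>}" using xy(3) by auto
    then obtain v where v: "v \<in> ?V" "v \<in> N" "v \<noteq> \<zero>\<^bsub>Am\<^esub>" using essential_trivial[OF N V] by blast
    have VN: "submodule (?V \<inter> N) S Am" using N by (intro Am.submodule_Int V) (simp add: essential_submodule_def)
    obtain r where r: "r \<in> carrier C" "r \<in> ?V \<inter> N" "r \<noteq> \<zero>\<^bsub>A\<^esub>"
      using ex_C_nonzero[OF VN, of v] v by auto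
    obtain b where b: "b \<in> carrier A" "c \<star> \<iota> r = \<iota> b" using r(2) by (auto simp: N_def)
    have "c \<star> \<iota> r \<in> carrier Q.C" using Q.C_mult_closed[OF c \<iota>_C[OF r(1)]] by simp
    then have bC: "b \<in> carrier C" using C_\<iota>[OF b(1)] b(2) by simp
    have "c \<star> \<iota> (y \<otimes>\<^bsub>A\<^esub> r) = \<iota> (y \<otimes>\<^bsub>A\<^esub> b)" by (rule cm[OF xy(2) r(1) bC b(2)])
    then have "y \<otimes>\<^bsub>A\<^esub> r \<in> D" using C_mult_closed[OF xy(2)] bC r(1) by (simp add: D_def)
    then have rD: "r \<otimes>\<^bsub>A\<^esub> y \<in> D" using C_comm[OF r(1) C_A[OF xy(2)]] by simp
    obtain a where a: "a \<in> carrier A" "r = x \<otimes>\<^bsub>A\<^esub> a" using r(2) by auto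
    have "r \<otimes>\<^bsub>A\<^esub> x \<noteq> \<zero>\<^bsub>A\<^esub>"
    proof
      assume z: "r \<otimes>\<^bsub>A\<^esub> x = \<zero>\<^bsub>A\<^esub>"
      have "r \<otimes>\<^bsub>A\<^esub> r = r \<otimes>\<^bsub>A\<^esub> (x \<otimes>\<^bsub>A\<^esub> a)" using a(2) by simp
      also have "\<dots> = (r \<otimes>\<^bsub>A\<^esub> x) \<otimes>\<^bsub>A\<^esub> a" using C_A r(1) xy(1) a(1) by (simp add: A.m_assoc)
      finally have "r \<otimes>\<^bsub>A\<^esub> r = \<zero>\<^bsub>A\<^esub>" using z a(1) by simp
      then show False using C_square_zero[OF semiprime r(1)] r(3) by simp
    qed
    then show "\<exists>r\<in>carrier C. r \<otimes>\<^bsub>C\<^esub> y \<in> D \<and> r \<otimes>\<^bsub>C\<^esub> x \<noteq> \<zero>\<^bsub>C\<^esub>" using r(1) rD by auto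
  qed
  moreover have "f \<in> mod_hom C ((regular_module C)\<lparr>carrier := D\<rparr>) (regular_module C)"
  proof (rule mod_homI)
    fix x assume "x \<in> carrier ((regular_module C)\<lparr>carrier := D\<rparr>)"
    then obtain w where w: "x \<in> carrier C" "w \<in> carrier C" "c \<star> \<iota> x = \<iota> w" by (auto simp: D_def)
    show "f x \<in> carrier (regular_module C)" using f[OF w] w by simp
    show "f (r \<odot>\<^bsub>(regular_module C)\<lparr>carrier := D\<rparr>\<^esub> x) = r \<odot>\<^bsub>regular_module C\<^esub> f x" if "r \<in> carrier C" for r
      using f[OF w] f[of "r \<otimes>\<^bsub>A\<^esub> x" "r \<otimes>\<^bsub>A\<^esub> w"] w that C_mult_closed cm by simp
    fix y assume "y \<in> carrier ((regular_module C)\<lparr>carrier := D\<rparr>)"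
    then obtain w' where w': "y \<in> carrier C" "w' \<in> carrier C" "c \<star> \<iota> y = \<iota> w'" by (auto simp: D_def)
    show "f (x \<oplus>\<^bsub>(regular_module C)\<lparr>carrier := D\<rparr>\<^esub> y) = f x \<oplus>\<^bsub>regular_module C\<^esub> f y"
      using f[OF w] f[OF w'] f[of "x \<oplus>\<^bsub>A\<^esub> y" "w \<oplus>\<^bsub>A\<^esub> w'"] w w' C_add_closed ca by simp
  qed
  ultimately have "(D, f) \<in> fractions C" by (simp add: fractions_def f_def)
  moreover have "\<iota> (f d) = c \<star> \<iota> d" if d: "d \<in> D" for d
  proof -
    obtain w where "w \<in> carrier C" "c \<star> \<iota> d = \<iota> w" using Dz[OF d] by blast
    then show ?thesis using f[of d w] d by (simp add: D_def)
  qed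
  ultimately have "(D, f) \<in> frac c" by (simp add: frac_def)
  then show ?thesis by blast
qed

text \<open>Two restrictions of multiplication by c agree on their common dense domain. Conversely,
  if g agrees with such a restriction on a dense ideal, then e g(d) = d g(e) = d c e = e (c d) for
  all e in that ideal, and density cancels e. So \<open>frac c\<close> is exactly one class.\<close>

lemma fraction_rel_frac:
  assumes c: "c \<in> carrier Q.C" and u: "u \<in> frac c"
  shows "fraction_rel C `` {u} = frac c"
proof -
  obtain D f where uf: "u = (D, f)" by (cases u)
  have cX: "c \<in> X" using Q.C_A[OF c] by simp
  have Df: "(D, f) \<in> fractions C" "\<And>d. d \<in> D \<Longrightarrow> \<iota> (f d) = c \<star> \<iota> d" using u by (auto simp: uf frac_def)
  note fD = fractionsD[OF Df(1)]
  have "(D', g) \<in> frac c \<longleftrightarrow> (u, (D', g)) \<in> fraction_rel C" for D' g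
  proof
    assume "(D', g) \<in> frac c"
    then have Dg: "(D', g) \<in> fractions C" "\<And>d. d \<in> D' \<Longrightarrow> \<iota> (g d) = c \<star> \<iota> d" by (auto simp: frac_def)
    note gD = fractionsD[OF Dg(1)]
    have "f d = g d" if "d \<in> D \<inter> D'" for d
      using inj_onD[OF \<iota>_inj, of "f d" "g d"] that Df(2) Dg(2) fD(7) gD(7) by simp
    then show "(u, (D', g)) \<in> fraction_rel C"
      using Df(1) Dg(1) Cz.dense_left_ideal_Int[OF fD(1) gD(1)] unfolding uf fraction_rel_def by blast
  next
    assume "(u, (D', g)) \<in> fraction_rel C"
    then obtain D'' where Dg: "(D', g) \<in> fractions C" and D'': "dense_left_ideal C D''" "D'' \<subseteq> D \<inter> D'"
      "\<And>x. x \<in> D'' \<Longrightarrow> f x = g x" by (auto simp: uf fraction_rel_def)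
    note gD = fractionsD[OF Dg]
    have "\<iota> (g d) = c \<star> \<iota> d" if d: "d \<in> D'" for d
    proof (rule dense_cancel[OF D''(1)])
      show "\<iota> (g d) \<in> X" "c \<star> \<iota> d \<in> X" using d gD(5,7) cX by (auto intro: \<iota>_X hmult_closed)
      fix e assume e: "e \<in> D''"
      then have e': "e \<in> D" "e \<in> D'" using D''(2) by auto
      note cl = gD(4,5)[OF d] gD(4,5)[OF e'(2)] gD(7)[OF d] gD(7)[OF e'(2)]
      have "\<iota> e \<star> \<iota> (g d) = \<iota> (g (e \<otimes>\<^bsub>A\<^esub> d))" using cl gD(8)[OF cl(3) d] by (simp add: hmult_\<iota>)
      also have "e \<otimes>\<^bsub>A\<^esub> d = d \<otimes>\<^bsub>A\<^esub> e" using C_comm cl by blast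
      also have "\<iota> (g (d \<otimes>\<^bsub>A\<^esub> e)) = \<iota> d \<star> \<iota> (g e)" using cl gD(8)[OF cl(1) e'(2)] by (simp add: hmult_\<iota>)
      also have "\<iota> (g e) = c \<star> \<iota> e" using D''(3)[OF e] Df(2)[OF e'(1)] by simp
      also have "\<iota> d \<star> (c \<star> \<iota> e) = c \<star> (\<iota> d \<star> \<iota> e)"
        using \<T>_hmult(2)[OF C_mult_\<T>[OF c] \<iota>_X \<iota>_X, of d e] cl by simp
      also have "\<iota> d \<star> \<iota> e = \<iota> e \<star> \<iota> d" using cl \<open>e \<otimes>\<^bsub>A\<^esub> d = d \<otimes>\<^bsub>A\<^esub> e\<close> by (simp add: hmult_\<iota>)
      also have "c \<star> (\<iota> e \<star> \<iota> d) = \<iota> e \<star> (c \<star> \<iota> d)"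
        using \<T>_hmult(2)[OF C_mult_\<T>[OF c] \<iota>_X \<iota>_X, of e d] cl by simp
      finally show "\<iota> e \<star> \<iota> (g d) = \<iota> e \<star> (c \<star> \<iota> d)" .
    qed
    then show "(D', g) \<in> frac c" using Dg by (simp add: frac_def)
  qed
  then show ?thesis by auto
qed

lemma frac_add:
  assumes c: "c \<in> carrier Q.C" "c' \<in> carrier Q.C" and u: "u \<in> frac c" "v \<in> frac c'"
  shows "fraction_add C u v \<in> frac (c \<oplus>\<^bsub>E\<^esub> c')"
proof -
  obtain D f where uf: "u = (D, f)" by (cases u)
  obtain D' g where vg: "v = (D', g)" by (cases v)
  have Df: "(D, f) \<in> fractions C" "\<And>d. d \<in> D \<Longrightarrow> \<iota> (f d) = c \<star> \<iota> d" using u by (auto simp: uf frac_def)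
  have Dg: "(D', g) \<in> fractions C" "\<And>d. d \<in> D' \<Longrightarrow> \<iota> (g d) = c' \<star> \<iota> d" using u by (auto simp: vg frac_def)
  note fD = fractionsD[OF Df(1)] and gD = fractionsD[OF Dg(1)]
  have cX: "c \<in> X" "c' \<in> X" using Q.C_A[OF c(1)] Q.C_A[OF c(2)] by simp_all
  have dI: "dense_left_ideal C (D \<inter> D')" by (rule Cz.dense_left_ideal_Int[OF fD(1) gD(1)])
  interpret R: lmodule C "regular_module C" by (rule Cz.regular_lmodule)
  note sub = Cz.dense_left_idealD(1)[OF dI]
  have "(\<lambda>x\<in>D \<inter> D'. f x \<oplus>\<^bsub>C\<^esub> g x) \<in> mod_hom C ((regular_module C)\<lparr>carrier := D \<inter> D'\<rparr>) (regular_module C)"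
  proof (rule mod_homI)
    fix x assume "x \<in> carrier ((regular_module C)\<lparr>carrier := D \<inter> D'\<rparr>)"
    then have x: "x \<in> D \<inter> D'" "x \<in> D" "x \<in> D'" by auto
    show "(\<lambda>x\<in>D \<inter> D'. f x \<oplus>\<^bsub>C\<^esub> g x) x \<in> carrier (regular_module C)"
      using x fD(6) gD(6) C_add_closed by simp
    show "(\<lambda>x\<in>D \<inter> D'. f x \<oplus>\<^bsub>C\<^esub> g x) (r \<odot>\<^bsub>(regular_module C)\<lparr>carrier := D \<inter> D'\<rparr>\<^esub> x) =
      r \<odot>\<^bsub>regular_module C\<^esub> (\<lambda>x\<in>D \<inter> D'. f x \<oplus>\<^bsub>C\<^esub> g x) x" if r: "r \<in> carrier C" for r
      using R.submoduleD(4)[OF sub r x(1)] x fD(8)[OF r] gD(8)[OF r] fD(7) gD(7) C_A[OF r] by (simp add: A.r_distr)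
    fix y assume "y \<in> carrier ((regular_module C)\<lparr>carrier := D \<inter> D'\<rparr>)"
    then have y: "y \<in> D \<inter> D'" "y \<in> D" "y \<in> D'" by auto
    show "(\<lambda>x\<in>D \<inter> D'. f x \<oplus>\<^bsub>C\<^esub> g x) (x \<oplus>\<^bsub>(regular_module C)\<lparr>carrier := D \<inter> D'\<rparr>\<^esub> y) =
      (\<lambda>x\<in>D \<inter> D'. f x \<oplus>\<^bsub>C\<^esub> g x) x \<oplus>\<^bsub>regular_module C\<^esub> (\<lambda>x\<in>D \<inter> D'. f x \<oplus>\<^bsub>C\<^esub> g x) y"
      using R.submoduleD(3)[OF sub x(1) y(1)] x y fD(9) gD(9) fD(7) gD(7) by (simp add: A.a_ac)
  qed
  then have "fraction_add C u v \<in> fractions C" using dI by (simp add: uf vg fraction_add_def fractions_def)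
  moreover have "\<iota> (f d \<oplus>\<^bsub>A\<^esub> g d) = (c \<oplus>\<^bsub>E\<^esub> c') \<star> \<iota> d" if "d \<in> D" "d \<in> D'" for d
    using that Df(2) Dg(2) fD(7,5) gD(7) cX by (simp add: \<iota>_add hmult_l_distr \<iota>_X)
  ultimately show ?thesis by (simp add: uf vg fraction_add_def frac_def)
qed

text \<open>The left factor is applied first, so d is sent to c' (c d); as c is central, this is (c
  c') d.\<close>

lemma frac_mult:
  assumes c: "c \<in> carrier Q.C" "c' \<in> carrier Q.C" and u: "u \<in> frac c" "v \<in> frac c'"
  shows "fraction_mult u v \<in> frac (c \<star> c')"
proof -
  obtain D f where uf: "u = (D, f)" by (cases u)
  obtain D' g where vg: "v = (D', g)" by (cases v)
  have Df: "(D, f) \<in> fractions C" "\<And>d. d \<in> D \<Longrightarrow> \<iota> (f d) = c \<star> \<iota> d" using u by (auto simp: uf frac_def)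
  have Dg: "(D', g) \<in> fractions C" "\<And>d. d \<in> D' \<Longrightarrow> \<iota> (g d) = c' \<star> \<iota> d" using u by (auto simp: vg frac_def)
  note fD = fractionsD[OF Df(1)] and gD = fractionsD[OF Dg(1)]
  have cX: "c \<in> X" "c' \<in> X" using Q.C_A[OF c(1)] Q.C_A[OF c(2)] by simp_all
  let ?D = "{x \<in> D. f x \<in> D'}"
  have dI: "dense_left_ideal C ?D" by (rule Cz.dense_left_ideal_vimage[OF fD(1,2) gD(1)])
  interpret R: lmodule C "regular_module C" by (rule Cz.regular_lmodule)
  note sub = Cz.dense_left_idealD(1)[OF dI]
  have "(\<lambda>x\<in>?D. g (f x)) \<in> mod_hom C ((regular_module C)\<lparr>carrier := ?D\<rparr>) (regular_module C)"
  proof (rule mod_homI)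
    fix x assume "x \<in> carrier ((regular_module C)\<lparr>carrier := ?D\<rparr>)"
    then have x: "x \<in> ?D" "x \<in> D" "f x \<in> D'" by auto
    show "(\<lambda>x\<in>?D. g (f x)) x \<in> carrier (regular_module C)" using x gD(6) by simp
    show "(\<lambda>x\<in>?D. g (f x)) (r \<odot>\<^bsub>(regular_module C)\<lparr>carrier := ?D\<rparr>\<^esub> x) =
      r \<odot>\<^bsub>regular_module C\<^esub> (\<lambda>x\<in>?D. g (f x)) x" if r: "r \<in> carrier C" for r
      using R.submoduleD(4)[OF sub r x(1)] x fD(8)[OF r] gD(8)[OF r] by simp
    fix y assume "y \<in> carrier ((regular_module C)\<lparr>carrier := ?D\<rparr>)"
    then have y: "y \<in> ?D" "y \<in> D" "f y \<in> D'" by auto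
    show "(\<lambda>x\<in>?D. g (f x)) (x \<oplus>\<^bsub>(regular_module C)\<lparr>carrier := ?D\<rparr>\<^esub> y) =
      (\<lambda>x\<in>?D. g (f x)) x \<oplus>\<^bsub>regular_module C\<^esub> (\<lambda>x\<in>?D. g (f x)) y"
      using R.submoduleD(3)[OF sub x(1) y(1)] x y fD(9) gD(9) by simp
  qed
  then have "fraction_mult u v \<in> fractions C" using dI by (simp add: uf vg fraction_mult_def fractions_def)
  moreover have "\<iota> (g (f d)) = (c \<star> c') \<star> \<iota> d" if "d \<in> D" "f d \<in> D'" for d
    using that Df(2) Dg(2) fD(5) cX Q.C_comm[OF c(1), of c'] by (simp add: hmult_assoc \<iota>_X)
  ultimately show ?thesis by (simp add: uf vg fraction_mult_def frac_def)
qed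

text \<open>Multiplication by z is itself a fraction, with all of C as its domain, and so determines
  the class.\<close>

lemma frac_embed:
  assumes z: "z \<in> carrier C" shows "Qmax_embed C z = frac (\<iota> z)"
proof -
  have zA: "z \<in> carrier A" using C_A[OF z] .
  have "(\<lambda>x\<in>carrier C. x \<otimes>\<^bsub>C\<^esub> z) \<in> mod_hom C ((regular_module C)\<lparr>carrier := carrier C\<rparr>) (regular_module C)"
    by (rule mod_homI) (use z zA C_A in \<open>simp_all add: C_mult_closed C_add_closed A.l_distr A.m_assoc\<close>)
  then have "(carrier C, \<lambda>x\<in>carrier C. x \<otimes>\<^bsub>C\<^esub> z) \<in> fractions C"
    using Cz.dense_left_ideal_carrier by (simp add: fractions_def)
  moreover have "\<iota> (d \<otimes>\<^bsub>A\<^esub> z) = \<iota> z \<star> \<iota> d" if "d \<in> carrier C" for d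
    using C_comm[OF that zA] zA C_A[OF that] by (simp add: hmult_\<iota>)
  ultimately have "(carrier C, \<lambda>x\<in>carrier C. x \<otimes>\<^bsub>C\<^esub> z) \<in> frac (\<iota> z)" by (simp add: frac_def)
  then show ?thesis unfolding Qmax_embed_def by (rule fraction_rel_frac[OF \<iota>_C[OF z]])
qed

text \<open>A fraction (D, f) is read as the partial endomorphism a \<mapsto> v of A given by d v =
  f(d) a for all d in D. Density makes it single-valued, and since D and f(D) consist of central
  invariants it is S-linear. It extends to an endomorphism of the hull, which is multiplication by
  its value c at 1.\<close>

lemma fraction_in_frac:
  assumes u: "u \<in> fractions C" obtains c where "c \<in> carrier Q.C" "u \<in> frac c"
proof -
  obtain D f where uf: "u = (D, f)" by (cases u)
  note fD = fractionsD[OF u[unfolded uf]]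
  define G where "G a v \<longleftrightarrow> v \<in> carrier A \<and> (\<forall>d\<in>D. d \<otimes>\<^bsub>A\<^esub> v = f d \<otimes>\<^bsub>A\<^esub> a)" for a v
  have G: "v = v'" if "G a v" "G a v'" for a v v'
  proof -
    have "\<iota> v = \<iota> v'"
      by (rule dense_cancel[OF fD(1)]) (use that fD(5) in \<open>auto simp: G_def \<iota>_X hmult_\<iota>\<close>)
    then show ?thesis using inj_onD[OF \<iota>_inj] that by (auto simp: G_def)
  qed
  define U where "U = {a \<in> carrier A. \<exists>v. G a v}"
  define k where "k a = (THE v. G a v)" for a
  have k: "k a = v" if "G a v" for a v unfolding k_def using that G by blast
  have Ga: "G (a \<oplus>\<^bsub>A\<^esub> b) (v \<oplus>\<^bsub>A\<^esub> w)" if "G a v" "G b w" "a \<in> carrier A" "b \<in> carrier A" for a b v w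
    using that fD(5,7) by (simp add: G_def A.r_distr)
  have Gs: "G (p \<odot>\<^bsub>Am\<^esub> a) (p \<odot>\<^bsub>Am\<^esub> v)" if "G a v" "a \<in> carrier A" "p \<in> carrier S" for a v p
    unfolding G_def
  proof (intro conjI ballI)
    have v: "v \<in> carrier A" using that by (simp add: G_def)
    then show "p \<odot>\<^bsub>Am\<^esub> v \<in> carrier A" using Am.lsmult_closed[OF that(3), of v] by simp
    fix d assume d: "d \<in> D"
    show "d \<otimes>\<^bsub>A\<^esub> (p \<odot>\<^bsub>Am\<^esub> v) = f d \<otimes>\<^bsub>A\<^esub> (p \<odot>\<^bsub>Am\<^esub> a)"
      using mod_hom_smult[OF C_mult_hom[OF fD(4)[OF d]] that(3), of v]
        mod_hom_smult[OF C_mult_hom[OF fD(6)[OF d]] that(3), of a] that d v by (simp add: G_def)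
  qed
  have U: "submodule U S Am"
    unfolding Am.submodule_iff
  proof (intro conjI ballI)
    have "G \<zero>\<^bsub>A\<^esub> \<zero>\<^bsub>A\<^esub>" using fD(5,7) by (simp add: G_def)
    then show "\<zero>\<^bsub>Am\<^esub> \<in> U" by (auto simp: U_def)
    show "x \<oplus>\<^bsub>Am\<^esub> y \<in> U" if "x \<in> U" "y \<in> U" for x y using that Ga[of x _ y] unfolding U_def by fastforce
    show "p \<odot>\<^bsub>Am\<^esub> x \<in> U" if p: "p \<in> carrier S" "x \<in> U" for p x
      using p(2) Gs[OF _ _ p(1)] Am.lsmult_closed[OF p(1), of x] by (auto simp: U_def)
  qed (auto simp: U_def)
  have "(\<lambda>a. \<iota> (k a)) \<in> mod_hom S (Am\<lparr>carrier := U\<rparr>) E"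
  proof (rule mod_homI)
    fix x assume "x \<in> carrier (Am\<lparr>carrier := U\<rparr>)"
    then obtain v where v: "x \<in> carrier A" "G x v" by (auto simp: U_def)
    have vA: "v \<in> carrier A" using v by (simp add: G_def)
    show "\<iota> (k x) \<in> carrier E" using k[OF v(2)] \<iota>_closed[OF vA] by simp
    show "\<iota> (k (p \<odot>\<^bsub>Am\<lparr>carrier := U\<rparr>\<^esub> x)) = p \<odot>\<^bsub>E\<^esub> \<iota> (k x)" if "p \<in> carrier S" for p
      using k[OF v(2)] k[OF Gs[OF v(2,1) that]] \<iota>_smult[OF that vA] by simp
    fix y assume "y \<in> carrier (Am\<lparr>carrier := U\<rparr>)"
    then obtain w where w: "y \<in> carrier A" "G y w" by (auto simp: U_def)
    have wA: "w \<in> carrier A" using w by (simp add: G_def)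
    show "\<iota> (k (x \<oplus>\<^bsub>Am\<lparr>carrier := U\<rparr>\<^esub> y)) = \<iota> (k x) \<oplus>\<^bsub>E\<^esub> \<iota> (k y)"
      using k[OF v(2)] k[OF w(2)] k[OF Ga[OF v(2) w(2) v(1) w(1)]] \<iota>_add[OF vA wA] by simp
  qed
  then obtain g where g: "g \<in> mod_hom S Am E" "\<And>a. a \<in> U \<Longrightarrow> g a = \<iota> (k a)"
    using injective_module_extension[OF E_injective Am_lmodule U] by blast
  obtain F where F: "F \<in> \<T>" "\<And>a. a \<in> carrier A \<Longrightarrow> F (\<iota> a) = g a" using hom_from_A_extend[OF g(1)] by blast
  let ?c = "F (\<iota> \<one>\<^bsub>A\<^esub>)"
  have c: "?c \<in> carrier Q.C" "\<And>x. x \<in> X \<Longrightarrow> F x = ?c \<star> x"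
    using Q.endo_C[OF \<T>_smash_linear[OF F(1)]] by simp_all
  have "\<iota> (f d) = ?c \<star> \<iota> d" if d: "d \<in> D" for d
  proof -
    \<comment> \<open>D lies in the domain of the partial endomorphism, which restricts to f there:
      e f(d) = f(e d) = f(d e) = d f(e) for e in D.\<close>
    have "G d (f d)"
      unfolding G_def
    proof (intro conjI ballI)
      show "f d \<in> carrier A" using fD(7)[OF d] .
      fix e assume e: "e \<in> D"
      have "e \<otimes>\<^bsub>A\<^esub> f d = f (e \<otimes>\<^bsub>A\<^esub> d)" using fD(8)[OF fD(4)[OF e] d] by simp
      also have "e \<otimes>\<^bsub>A\<^esub> d = d \<otimes>\<^bsub>A\<^esub> e" using C_comm[OF fD(4)[OF e] fD(5)[OF d]] .
      also have "f (d \<otimes>\<^bsub>A\<^esub> e) = d \<otimes>\<^bsub>A\<^esub> f e" using fD(8)[OF fD(4)[OF d] e] .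
      also have "\<dots> = f e \<otimes>\<^bsub>A\<^esub> d" using C_comm[OF fD(4)[OF d] fD(7)[OF e]] .
      finally show "e \<otimes>\<^bsub>A\<^esub> f d = f e \<otimes>\<^bsub>A\<^esub> d" .
    qed
    moreover from this have "d \<in> U" using fD(5)[OF d] by (auto simp: U_def)
    ultimately have "F (\<iota> d) = \<iota> (f d)" using F(2)[OF fD(5)[OF d]] g(2) k by simp
    then show ?thesis using c(2)[OF \<iota>_X[OF fD(5)[OF d]]] by simp
  qed
  then have "u \<in> frac ?c" using u by (simp add: uf frac_def)
  then show ?thesis using that c(1) by blast
qed

text \<open>A common fraction makes c and c' act alike on a dense ideal, and density cancels
  it.\<close>

lemma frac_inj:
  assumes c: "c \<in> carrier Q.C" "c' \<in> carrier Q.C" and eq: "frac c = frac c'"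
  shows "c = c'"
proof -
  obtain u where u: "u \<in> frac c" using ex_frac[OF c(1)] by blast
  obtain D f where uf: "u = (D, f)" by (cases u)
  have D: "(D, f) \<in> fractions C" "\<And>d. d \<in> D \<Longrightarrow> \<iota> (f d) = c \<star> \<iota> d" using u by (auto simp: uf frac_def)
  have "(D, f) \<in> frac c'" using u unfolding uf eq .
  then have D': "\<And>d. d \<in> D \<Longrightarrow> \<iota> (f d) = c' \<star> \<iota> d" by (auto simp: frac_def)
  note fD = fractionsD[OF D(1)]
  have cX: "c \<in> X" "c' \<in> X" using Q.C_A[OF c(1)] Q.C_A[OF c(2)] by simp_all
  show ?thesis
  proof (rule dense_cancel[OF fD(1) cX])
    fix d assume d: "d \<in> D"
    have dX: "\<iota> d \<in> X" using \<iota>_X[OF fD(5)[OF d]] .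
    show "\<iota> d \<star> c = \<iota> d \<star> c'" using D(2)[OF d] D'[OF d] Q.C_comm[OF c(1), of "\<iota> d"] Q.C_comm[OF c(2), of "\<iota> d"] dX by simp
  qed
qed

theorem Qmax_iso: "frac \<in> ring_iso Q.C (Qmax C)"
proof -
  have carr: "carrier (Qmax C) = frac ` carrier Q.C"
  proof (intro equalityI subsetI)
    fix U assume "U \<in> carrier (Qmax C)"
    then obtain u where u: "u \<in> fractions C" "U = fraction_rel C `` {u}" by (auto simp: Qmax_def quotient_def)
    obtain c where "c \<in> carrier Q.C" "u \<in> frac c" using fraction_in_frac[OF u(1)] .
    then show "U \<in> frac ` carrier Q.C" using u(2) fraction_rel_frac by simp
  next
    fix U assume "U \<in> frac ` carrier Q.C"
    then obtain c where c: "c \<in> carrier Q.C" "U = frac c" by auto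
    obtain u where u: "u \<in> frac c" using ex_frac[OF c(1)] by blast
    then have "u \<in> fractions C" by (auto simp: frac_def)
    then show "U \<in> carrier (Qmax C)"
      using fraction_rel_frac[OF c(1) u] c(2) by (auto simp: Qmax_def quotient_def)
  qed
  \<comment> \<open>The operations of \<open>Qmax\<close> are unions over all representatives. Every
    member of such a union is the class \<open>frac d\<close>, and the union is not empty because
    each \<open>frac\<close> class is inhabited.\<close>
  have UN: "(\<Union>u\<in>frac c. \<Union>v\<in>frac c'. fraction_rel C `` {op u v}) = frac d"
    if "c \<in> carrier Q.C" "c' \<in> carrier Q.C" "d \<in> carrier Q.C"
      "\<And>u v. \<lbrakk>u \<in> frac c; v \<in> frac c'\<rbrakk> \<Longrightarrow> op u v \<in> frac d" for c c' d op
    using ex_frac[OF that(1)] ex_frac[OF that(2)] fraction_rel_frac[OF that(3) that(4)] by simp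
  have "frac \<in> ring_hom Q.C (Qmax C)"
  proof (rule ring_hom_memI)
    fix c c' assume c: "c \<in> carrier Q.C" "c' \<in> carrier Q.C"
    show "frac (c \<otimes>\<^bsub>Q.C\<^esub> c') = frac c \<otimes>\<^bsub>Qmax C\<^esub> frac c'"
      using UN[OF c Q.C_mult_closed[OF c]] frac_mult[OF c] by (simp add: Qmax_def)
    show "frac (c \<oplus>\<^bsub>Q.C\<^esub> c') = frac c \<oplus>\<^bsub>Qmax C\<^esub> frac c'"
      using UN[OF c Q.C_add_closed[OF c]] frac_add[OF c] by (simp add: Qmax_def)
  qed (use carr frac_embed[OF C_one] in \<open>simp_all add: Qmax_def\<close>)
  moreover have "bij_betw frac (carrier Q.C) (carrier (Qmax C))"
    using frac_inj by (simp add: bij_betw_def carr inj_on_def)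
  ultimately show ?thesis by (simp add: ring_iso_def)
qed

end

end

theorem theorem5p5:
  fixes K :: "'k ring" and H :: "('k, 'h) hopf" and A :: "('k, 'a) module"
    and act :: "'h \<Rightarrow> 'a \<Rightarrow> 'a"
    and E :: "(('k, 'a, 'h) smash, 'e) module" and \<iota> :: "'a \<Rightarrow> 'e"
    and S M Ahat hact
  defines "S \<equiv> smash_algebra K H A act"
    and "M \<equiv> smash_module K H A act"
    and "Ahat \<equiv> hull_algebra K H A act E \<iota>"
    and "hact \<equiv> hull_act K H A act E \<iota>"
  assumes "cring K" and "hopf_algebra K H"
    and "module_algebra K H A act" and "H_semiprime H A act"
    and "injective_hull S M E \<iota>"
  shows "(polyform S M E \<and> subdirect_product_of_H_primes K H A act \<and>
            reduced_ring (central_invariants H A act)) \<and>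
         (module_algebra K H Ahat hact \<and> H_semiprime H Ahat hact \<and>
            \<iota> \<in> module_algebra_hom K H A act Ahat hact \<and> inj_on \<iota> (carrier A) \<and>
            self_injective (smash_algebra K H Ahat hact) (smash_module K H Ahat hact) \<and>
            nonsingular_module (central_invariants H Ahat hact) (regular_module Ahat) \<and>
            self_injective (central_invariants H Ahat hact)
              (regular_module (central_invariants H Ahat hact)) \<and>
            von_neumann_regular (central_invariants H Ahat hact)) \<and>
         (large_in (carrier (central_invariants H A act)) H A act \<longrightarrow>
            (\<exists>\<phi> \<in> ring_iso (central_invariants H Ahat hact) (Qmax (central_invariants H A act)).
               \<forall>z \<in> carrier (central_invariants H A act).
                 \<phi> (\<iota> z) = Qmax_embed (central_invariants H A act) z) \<and>
            nonsingular_module (central_invariants H A act) (regular_module A))"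
proof -
  interpret semiprime_hull K H A act E \<iota>
    using assms by (intro semiprime_hull.intro hmodule_algebra.intro semiprime_hull_axioms.intro) simp_all
  show ?thesis
    unfolding S_def M_def Ahat_def hact_def
    using polyform subdirect_product[OF semiprime] C_reduced[OF semiprime] Ahat_module_algebra
      Ahat_H_semiprime \<iota>_module_algebra_hom \<iota>_inj Ahat_self_injective Q.C_nonsingular
      Q.C_self_injective Q.C_von_neumann_regular Qmax_iso frac_embed nonsingular_over_C
    by (intro conjI impI) (blast | metis)+
qed

end
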